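(* Let $d\ge 1$, let $\mu$ be a Borel probability measure on $\mathbb R$, let $(\Omega,\mathcal F,\mathbb P)=(\mathbb R^{\mathbb Z^d},\mathcal B^{\mathbb Z^d},\mu^{\mathbb Z^d})$ with coordinate variables $\epsilon_i(\omega)=\omega_i$ (so $\{\epsilon_i\}_{i\in\mathbb Z^d}$ are i.i.d. with law $\mu$), let $\{T_i\}_{i\in\mathbb Z^d}$ be the shifts $[T_i(\omega)]_j=\omega_{i+j}$, and let $\mathcal F_i=\sigma\{\epsilon_j: j\in\mathbb Z^d, j\le i\}$. Let $f\in L^2(\Omega,\mathcal F,\mathbb P)$ with $\mathbb E f=0$, and let $X_i=f\circ T_i$, $i\in\mathbb Z^d$. Suppose that Hannan's condition holds: $$\sum_{i\in\mathbb Z^d}\|P_{\mathbf 0}X_i\|_2<\infty ,$$ where $P_{\mathbf 0}$ is the projection operator defined in the context. Let $D_{\mathbf 0}=\sum_{i\in\mathbb Z^d}P_{\mathbf 0}X_i$ (convergence in $L^2$) and, for $n\in\mathbb N^d$, $S_n(f)=\sum_{\mathbf 1\le i\le n}X_i$. Then $$\left\{\frac{S_{\lfloor n\cdot t\rfloor}(f)}{|n|^{1/2}}\right\}_{t\in[0,1]^d}\Rightarrow\{\sigma\mathbb B_t\}_{t\in[0,1]^d}$$ weakly in $D([0,1]^d)$ as $n\to\infty$, where $\{\mathbb B_t\}_{t\in[0,1]^d}$ is a standard Brownian sheet and $\sigma^2=\mathbb E D_{\mathbf 0}^2$.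
   Context: Order relations on $\mathbb Z^d$ are coordinatewise; $\mathbf 0=(0,\dots,0)$, $\mathbf 1=(1,\dots,1)$; $\mathbb N=\{1,2,\dots\}$. For $n\in\mathbb N^d$: $|n|=\prod_{q=1}^d n_q$, $n\cdot t=(n_1t_1,\dots,n_dt_d)$, $\lfloor\cdot\rfloor$ is the coordinatewise integer part, and $n\to\infty$ means $n_q\to\infty$ for every $q=1,\dots,d$. The partial sum is $0$ if some coordinate of its index is $0$. For $q=1,\dots,d$ and $\ell\in\mathbb Z$ let $\mathcal F^{(q)}_\ell=\bigvee_{i\in\mathbb Z^d,\, i_q\le\ell}\mathcal F_i$ and $P^{(q)}_\ell g=\mathbb E(g\mid\mathcal F^{(q)}_\ell)-\mathbb E(g\mid\mathcal F^{(q)}_{\ell-1})$ for $g\in L^1(\mathcal F)$. For $j\in\mathbb Z^d$, $P_j=\prod_{q=1}^dP^{(q)}_{j_q}$ (composition of operators, which commute). $\|\cdot\|_2$ is the $L^2(\mathbb P)$ norm. $D([0,1]^d)$ is the Skorohod space of functions on $[0,1]^d$ (the $d$-parameter analogue of càdlàg functions). A standard Brownian sheet is a centered Gaussian process on $[0,1]^d$ with continuous paths and covariance $\mathbb E(\mathbb B_s\mathbb B_t)=\prod_{q=1}^d\min(s_q,t_q)$. *)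

theory Defs
  imports "HOL-Probability.Probability"
begin

text \<open>The dimension \<open>d \<ge> 1\<close> is the cardinality of the finite type \<^typ>\<open>'d\<close>; the orders on
  \<open>int ^ 'd\<close> and \<open>real ^ 'd\<close> are the coordinatewise ones of the library.\<close>

section \<open>The i.i.d. field, its shifts and the projection operators\<close>

definition field_measure :: "real measure \<Rightarrow> (int ^ 'd::finite \<Rightarrow> real) measure" where
  "field_measure \<mu> = (\<Pi>\<^sub>M i\<in>UNIV. \<mu>)"

definition shift :: "int ^ 'd::finite \<Rightarrow> (int ^ 'd \<Rightarrow> real) \<Rightarrow> (int ^ 'd \<Rightarrow> real)" where
  "shift i \<omega> = (\<lambda>j. \<omega> (i + j))"

definition past :: "int ^ 'd::finite \<Rightarrow> (int ^ 'd \<Rightarrow> real) measure" where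
  "past i = sigma UNIV {(\<lambda>\<omega>. \<omega> j) -` A |j A. j \<le> i \<and> A \<in> sets borel}"

definition marginal_past :: "'d::finite \<Rightarrow> int \<Rightarrow> (int ^ 'd \<Rightarrow> real) measure" where
  "marginal_past q l = sigma UNIV (\<Union>i\<in>{i. i $ q \<le> l}. sets (past i))"

definition marginal_proj ::
    "real measure \<Rightarrow> 'd::finite \<Rightarrow> int \<Rightarrow> ((int ^ 'd \<Rightarrow> real) \<Rightarrow> real) \<Rightarrow> (int ^ 'd \<Rightarrow> real) \<Rightarrow> real" where
  "marginal_proj \<mu> q l g =
     (\<lambda>\<omega>. real_cond_exp (field_measure \<mu>) (marginal_past q l) g \<omega>
        - real_cond_exp (field_measure \<mu>) (marginal_past q (l - 1)) g \<omega>)"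

text \<open>The coordinates are composed along some enumeration of \<^typ>\<open>'d\<close>. The marginal projections
  commute up to null sets, so the choice affects the result only on a null set.\<close>

definition proj ::
    "real measure \<Rightarrow> int ^ 'd::finite \<Rightarrow> ((int ^ 'd \<Rightarrow> real) \<Rightarrow> real) \<Rightarrow> (int ^ 'd \<Rightarrow> real) \<Rightarrow> real" where
  "proj \<mu> j g =
     foldr (\<lambda>q. marginal_proj \<mu> q (j $ q)) (SOME qs. distinct qs \<and> set qs = UNIV) g"

definition partial_sum ::
    "((int ^ 'd::finite \<Rightarrow> real) \<Rightarrow> real) \<Rightarrow> int ^ 'd \<Rightarrow> (int ^ 'd \<Rightarrow> real) \<Rightarrow> real" where
  "partial_sum f n \<omega> = (\<Sum>i\<in>{1..n}. f (shift i \<omega>))"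

definition scaled_floor :: "nat ^ 'd::finite \<Rightarrow> real ^ 'd \<Rightarrow> int ^ 'd" where
  "scaled_floor n t = (\<chi> q. \<lfloor>real (n $ q) * t $ q\<rfloor>)"

definition all_coords_at_top :: "(nat ^ 'd::finite) filter" where
  "all_coords_at_top = (INF q. filtercomap (\<lambda>n. n $ q) at_top)"


section \<open>Square-integrable functions\<close>

definition square_integrable :: "'a measure \<Rightarrow> ('a \<Rightarrow> real) \<Rightarrow> bool" where
  "square_integrable M g \<longleftrightarrow> g \<in> borel_measurable M \<and> integrable M (\<lambda>x. (g x)\<^sup>2)"

definition L2_norm :: "'a measure \<Rightarrow> ('a \<Rightarrow> real) \<Rightarrow> real" where
  "L2_norm M g = sqrt (\<integral>x. (g x)\<^sup>2 \<partial>M)"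

definition has_L2_sum :: "'a measure \<Rightarrow> ('i \<Rightarrow> 'a \<Rightarrow> real) \<Rightarrow> ('a \<Rightarrow> real) \<Rightarrow> bool" where
  "has_L2_sum M u D \<longleftrightarrow>
     (\<forall>i. square_integrable M (u i)) \<and> square_integrable M D \<and>
     ((\<lambda>I. L2_norm M (\<lambda>x. (\<Sum>i\<in>I. u i x) - D x)) \<longlongrightarrow> 0) (finite_subsets_at_top UNIV)"


section \<open>The Skorohod space on the unit cube\<close>

definition unit_cube :: "(real ^ 'd::finite) set" where
  "unit_cube = {0..1}"

text \<open>The quadrant at \<open>t\<close> in which the coordinates in \<open>R\<close> are \<open>\<ge>\<close> and the other ones are \<open><\<close>.\<close>

definition quadrant :: "'d set \<Rightarrow> real ^ 'd::finite \<Rightarrow> (real ^ 'd) set" where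
  "quadrant R t = {s \<in> unit_cube. \<forall>q. if q \<in> R then t $ q \<le> s $ q else s $ q < t $ q}"

text \<open>Limits along all quadrants, and continuity along the quadrant of all larger points
  (Neuhaus; Bickel and Wichura). Limits along empty quadrants hold trivially.\<close>

definition skorohod_space :: "(real ^ 'd::finite \<Rightarrow> real) set" where
  "skorohod_space = {x \<in> extensional unit_cube. \<forall>t\<in>unit_cube.
     (\<forall>R. \<exists>l. (x \<longlongrightarrow> l) (at t within quadrant R t)) \<and>
     (x \<longlongrightarrow> x t) (at t within quadrant UNIV t)}"

definition time_changes :: "('d::finite \<Rightarrow> real \<Rightarrow> real) set" where
  "time_changes = {\<tau>. \<forall>q. continuous_on {0..1} (\<tau> q) \<and> strict_mono_on {0..1} (\<tau> q) \<and>
     \<tau> q 0 = 0 \<and> \<tau> q 1 = 1}"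

text \<open>The infimum over time changes of the larger of the two uniform distances. Elements of the
  space are bounded, so the set below is nonempty for them.\<close>

definition skorohod_dist :: "(real ^ 'd::finite \<Rightarrow> real) \<Rightarrow> (real ^ 'd \<Rightarrow> real) \<Rightarrow> real" where
  "skorohod_dist x y = Inf {e. 0 \<le> e \<and> (\<exists>\<tau>\<in>time_changes. \<forall>t\<in>unit_cube.
     (\<forall>q. \<bar>\<tau> q (t $ q) - t $ q\<bar> \<le> e) \<and> \<bar>x t - y (\<chi> q. \<tau> q (t $ q))\<bar> \<le> e)}"

definition skorohod_topology :: "(real ^ 'd::finite \<Rightarrow> real) topology" where
  "skorohod_topology = topology (\<lambda>U. U \<subseteq> skorohod_space \<and>
     (\<forall>x\<in>U. \<exists>r>0. \<forall>y\<in>skorohod_space. skorohod_dist x y < r \<longrightarrow> y \<in> U))"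

lemma openin_skorohod_topology:
  "openin skorohod_topology U \<longleftrightarrow> U \<subseteq> skorohod_space \<and>
     (\<forall>x\<in>U. \<exists>r>0. \<forall>y\<in>skorohod_space. skorohod_dist x y < r \<longrightarrow> y \<in> U)"
proof -
  let ?P = "\<lambda>U. U \<subseteq> skorohod_space \<and>
     (\<forall>x\<in>U. \<exists>r>0. \<forall>y\<in>skorohod_space. skorohod_dist x y < r \<longrightarrow> y \<in> U)"
  have "?P (S \<inter> T)" if S: "?P S" and T: "?P T" for S T
  proof (intro conjI ballI)
    show "S \<inter> T \<subseteq> skorohod_space" using S by blast
    fix x assume x: "x \<in> S \<inter> T"
    obtain r where r: "r > 0" "\<forall>y\<in>skorohod_space. skorohod_dist x y < r \<longrightarrow> y \<in> S"
      using S x by blast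
    obtain r' where r': "r' > 0" "\<forall>y\<in>skorohod_space. skorohod_dist x y < r' \<longrightarrow> y \<in> T"
      using T x by blast
    show "\<exists>r>0. \<forall>y\<in>skorohod_space. skorohod_dist x y < r \<longrightarrow> y \<in> S \<inter> T"
      using r r' by (intro exI[of _ "min r r'"]) auto
  qed
  moreover have "?P (\<Union>\<K>)" if "\<forall>K\<in>\<K>. ?P K" for \<K>
    using that by (intro conjI ballI) (blast, meson UnionE UnionI)
  ultimately have "istopology ?P"
    unfolding istopology_def by blast
  then show ?thesis
    unfolding skorohod_topology_def by (rule fun_cong[OF topology_inverse'])
qed

lemma topspace_skorohod_topology: "topspace skorohod_topology = skorohod_space"
proof
  show "topspace skorohod_topology \<subseteq> (skorohod_space :: (real ^ 'd \<Rightarrow> real) set)"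
    using openin_topspace[of skorohod_topology] unfolding openin_skorohod_topology by blast
  have "openin skorohod_topology (skorohod_space :: (real ^ 'd \<Rightarrow> real) set)"
    unfolding openin_skorohod_topology using zero_less_one by blast
  then show "(skorohod_space :: (real ^ 'd \<Rightarrow> real) set) \<subseteq> topspace skorohod_topology"
    by (rule openin_subset)
qed


section \<open>Convergence in distribution\<close>

definition borel_of_topology :: "'a topology \<Rightarrow> 'a measure" where
  "borel_of_topology T = sigma (topspace T) {U. openin T U}"

definition weakly_converges :: "'a topology \<Rightarrow> ('i \<Rightarrow> 'a measure) \<Rightarrow> 'a measure \<Rightarrow> 'i filter \<Rightarrow> bool" where
  "weakly_converges T \<nu>s \<nu> F \<longleftrightarrow>
     (\<forall>h. continuous_map T euclideanreal h \<and> bounded (h ` topspace T) \<longrightarrow>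
        ((\<lambda>n. \<integral>x. h x \<partial>\<nu>s n) \<longlongrightarrow> (\<integral>x. h x \<partial>\<nu>)) F)"

text \<open>Includes the claim that all \<open>X n\<close> and \<open>Y\<close> are random elements of the space.\<close>

definition converges_in_distribution ::
    "'x topology \<Rightarrow> 'a measure \<Rightarrow> ('i \<Rightarrow> 'a \<Rightarrow> 'x) \<Rightarrow> 'b measure \<Rightarrow> ('b \<Rightarrow> 'x) \<Rightarrow> 'i filter \<Rightarrow> bool" where
  "converges_in_distribution T M X N Y F \<longleftrightarrow>
     (\<forall>n. X n \<in> M \<rightarrow>\<^sub>M borel_of_topology T) \<and> Y \<in> N \<rightarrow>\<^sub>M borel_of_topology T \<and>
     weakly_converges T (\<lambda>n. distr M (borel_of_topology T) (X n)) (distr N (borel_of_topology T) Y) F"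


section \<open>The Brownian sheet\<close>

text \<open>Point masses count as Gaussian: the sheet vanishes on the lower faces of the cube.\<close>

definition gaussian_rv :: "'b measure \<Rightarrow> ('b \<Rightarrow> real) \<Rightarrow> bool" where
  "gaussian_rv N Y \<longleftrightarrow> Y \<in> borel_measurable N \<and>
     ((\<exists>m. AE \<omega> in N. Y \<omega> = m) \<or> (\<exists>m s. 0 < s \<and> distributed N lborel Y (normal_density m s)))"

definition gaussian_process :: "'b measure \<Rightarrow> 't set \<Rightarrow> ('t \<Rightarrow> 'b \<Rightarrow> real) \<Rightarrow> bool" where
  "gaussian_process N T B \<longleftrightarrow> (\<forall>t\<in>T. B t \<in> borel_measurable N) \<and>
     (\<forall>I c. finite I \<and> I \<subseteq> T \<longrightarrow> gaussian_rv N (\<lambda>\<omega>. \<Sum>t\<in>I. c t * B t \<omega>))"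

definition standard_brownian_sheet :: "'b measure \<Rightarrow> (real ^ 'd::finite \<Rightarrow> 'b \<Rightarrow> real) \<Rightarrow> bool" where
  "standard_brownian_sheet N B \<longleftrightarrow> prob_space N \<and> gaussian_process N unit_cube B \<and>
     (\<forall>t\<in>unit_cube. (\<integral>\<omega>. B t \<omega> \<partial>N) = 0) \<and>
     (\<forall>s\<in>unit_cube. \<forall>t\<in>unit_cube.
        (\<integral>\<omega>. B s \<omega> * B t \<omega> \<partial>N) = (\<Prod>q\<in>UNIV. min (s $ q) (t $ q))) \<and>
     (\<forall>\<omega>\<in>space N. continuous_on unit_cube (\<lambda>t. B t \<omega>))"

end

theory Submission
  imports Defs
begin

text \<open>The projections decompose \<open>f\<close> into \<open>\<Sum>\<^sub>j v\<^sub>j \<circ> T\<^sub>j\<close>, where \<open>v\<^sub>j\<close> is \<open>P\<^sub>0 X\<close> at the index \<open>- j\<close> and is a martingale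
  difference in every coordinate direction. Cairoli's maximal inequality gives
  \<open>\<parallel>max\<^sub>k \<bar>S\<^sub>k\<bar>\<parallel> \<le> 2\<^sup>d sqrt \<bar>n\<bar> \<Sum>\<^sub>j \<parallel>v\<^sub>j\<parallel>\<close>, so by Hannan's condition all but finitely many \<open>v\<^sub>j\<close> are negligible,
  uniformly in \<open>n\<close>, and the remaining ones may be replaced by bounded differences that depend on finitely many
  coordinates. Moving the shifts \<open>T\<^sub>j\<close> onto the boxes of summation changes the sums only near the boundary, which
  replaces \<open>f\<close> by such an approximation of \<open>D\<^sub>0\<close>. The finite-dimensional distributions then follow from a
  central limit theorem for locally dependent variables, and tightness from the maximal inequality for the fourth
  moment on thin slabs. As the limit has continuous paths, it suffices to test weak convergence on functions that
  are Lipschitz for the uniform distance and to compare each process with its discretization on a finite grid.\<close>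

section \<open>Square-integrable functions\<close>

text \<open>Conditioning on a set of coordinates is realized by integrating out the others, so
  \<open>cexp\<close> is one fixed function and dependence on coordinates is a pointwise property;
  the abstract conditional expectations are matched with it up to null sets. Tightness shapes the
  rest: for the maxima over about M slabs of relative thickness 1/M, second moments are of order 1/M
  each and their sum does not become small, whereas the sum of fourth moments of order 1/M^2 does.
  But \<open>f\<close> has only two moments. Hence fourth moments are taken of bounded approximants
  alone, and the errors are absorbed by the second-moment maximal inequality over the whole box.
  Projecting a bounded function of finitely many coordinates by \<open>P\<^sub>0\<close> keeps both
  properties, which yields approximants that are at once orthomartingale differences and locally
  dependent. As \<open>n\<close> runs along a filter on vectors, limits in \<open>n\<close> rest on
  explicit bounds, and dominated convergence is applied in sequential parameters.\<close>

lemma square_integrable_measurable: "square_integrable M f \<Longrightarrow> f \<in> borel_measurable M"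
  by (simp add: square_integrable_def)

lemma square_integrable_power2: "square_integrable M f \<Longrightarrow> integrable M (\<lambda>x. (f x)\<^sup>2)"
  by (simp add: square_integrable_def)

lemma square_integrable_mult:
  assumes "square_integrable M f" "square_integrable M g"
  shows "integrable M (\<lambda>x. f x * g x)"
proof (rule Bochner_Integration.integrable_bound)
  show "integrable M (\<lambda>x. (f x)\<^sup>2 + (g x)\<^sup>2)"
    using assms by (simp add: square_integrable_def)
  show "(\<lambda>x. f x * g x) \<in> borel_measurable M"
    by (intro borel_measurable_times square_integrable_measurable assms)
  have "\<bar>a * b\<bar> \<le> a\<^sup>2 + b\<^sup>2" for a b :: real
  proof -
    have "2 * \<bar>a\<bar> * \<bar>b\<bar> \<le> a\<^sup>2 + b\<^sup>2" "0 \<le> \<bar>a\<bar> * \<bar>b\<bar>"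
      using sum_squares_bound[of "\<bar>a\<bar>" "\<bar>b\<bar>"] by simp_all
    then show ?thesis unfolding abs_mult by linarith
  qed
  then show "AE x in M. norm (f x * g x) \<le> norm ((f x)\<^sup>2 + (g x)\<^sup>2)"
    by (simp add: AE_I2)
qed

lemma square_integrable_add:
  assumes "square_integrable M f" "square_integrable M g"
  shows "square_integrable M (\<lambda>x. f x + g x)"
  using assms square_integrable_mult[OF assms]
  by (auto simp: square_integrable_def power2_sum mult.assoc)

lemma square_integrable_cmult:
  "square_integrable M f \<Longrightarrow> square_integrable M (\<lambda>x. c * f x)"
  by (auto simp: square_integrable_def power_mult_distrib)

lemma square_integrable_minus:
  "square_integrable M f \<Longrightarrow> square_integrable M (\<lambda>x. - f x)"
  using square_integrable_cmult[of M f "-1"] by simp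

lemma square_integrable_diff:
  assumes "square_integrable M f" "square_integrable M g"
  shows "square_integrable M (\<lambda>x. f x - g x)"
  using square_integrable_add[OF assms(1) square_integrable_minus[OF assms(2)]] by simp

lemma square_integrable_zero: "square_integrable M (\<lambda>x. 0)"
  by (simp add: square_integrable_def)

lemma square_integrable_sum:
  "(\<And>i. i \<in> I \<Longrightarrow> square_integrable M (f i)) \<Longrightarrow> square_integrable M (\<lambda>x. \<Sum>i\<in>I. f i x)"
  by (induction I rule: infinite_finite_induct)
    (auto simp: square_integrable_zero square_integrable_add)

lemma square_integrable_bound:
  assumes "square_integrable M f" "g \<in> borel_measurable M" "AE x in M. \<bar>g x\<bar> \<le> \<bar>f x\<bar>"
  shows "square_integrable M g"
proof -
  have "integrable M (\<lambda>x. (g x)\<^sup>2)"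
  proof (rule Bochner_Integration.integrable_bound[OF square_integrable_power2[OF assms(1)]])
    show "(\<lambda>x. (g x)\<^sup>2) \<in> borel_measurable M" using assms by simp
    show "AE x in M. norm ((g x)\<^sup>2) \<le> norm ((f x)\<^sup>2)"
      using assms(3) by (auto simp: abs_le_square_iff)
  qed
  then show ?thesis using assms by (simp add: square_integrable_def)
qed

lemma square_integrable_abs: "square_integrable M f \<Longrightarrow> square_integrable M (\<lambda>x. \<bar>f x\<bar>)"
  by (auto simp: square_integrable_def)

lemma square_integrable_cong_AE:
  assumes "square_integrable M f" "g \<in> borel_measurable M" "AE x in M. g x = f x"
  shows "square_integrable M g"
  using assms by (intro square_integrable_bound[OF assms(1,2)]) auto

lemma (in finite_measure) square_integrable_const_bound:
  assumes "g \<in> borel_measurable M" "\<And>x. \<bar>g x\<bar> \<le> B"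
  shows "square_integrable M g"
proof (rule square_integrable_bound[where f = "\<lambda>_. B"])
  show "AE x in M. \<bar>g x\<bar> \<le> \<bar>B\<bar>"
    using assms(2) by (intro AE_I2) (meson abs_ge_self order_trans)
qed (use assms in \<open>auto simp: square_integrable_def\<close>)

lemma (in finite_measure) square_integrable_integrable:
  "square_integrable M f \<Longrightarrow> integrable M f"
  using square_integrable_mult[of M f "\<lambda>_. 1"] by (simp add: square_integrable_def)

lemma L2_norm_nonneg [simp]: "0 \<le> L2_norm M f"
  by (simp add: L2_norm_def)

lemma L2_norm_power2: "(L2_norm M f)\<^sup>2 = (\<integral>x. (f x)\<^sup>2 \<partial>M)"
  by (simp add: L2_norm_def)

lemma L2_norm_cong_AE:
  assumes "AE x in M. f x = g x" "f \<in> borel_measurable M" "g \<in> borel_measurable M"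
  shows "L2_norm M f = L2_norm M g"
  unfolding L2_norm_def using assms by (intro arg_cong[where f = sqrt] integral_cong_AE) auto

lemma L2_norm_mono:
  assumes "square_integrable M f" "AE x in M. \<bar>g x\<bar> \<le> \<bar>f x\<bar>"
  shows "L2_norm M g \<le> L2_norm M f"
  unfolding L2_norm_def
  using assms by (intro real_sqrt_le_mono integral_mono_AE') (auto simp: square_integrable_def abs_le_square_iff)

lemma L2_norm_cmult: "L2_norm M (\<lambda>x. c * f x) = \<bar>c\<bar> * L2_norm M f"
  by (simp add: L2_norm_def power_mult_distrib real_sqrt_mult)

lemma L2_norm_minus [simp]: "L2_norm M (\<lambda>x. - f x) = L2_norm M f"
  by (simp add: L2_norm_def)

lemma L2_norm_abs [simp]: "L2_norm M (\<lambda>x. \<bar>f x\<bar>) = L2_norm M f"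
  by (simp add: L2_norm_def)

lemma L2_norm_zero [simp]: "L2_norm M (\<lambda>x. 0) = 0"
  by (simp add: L2_norm_def)

lemma L2_norm_diff_commute: "L2_norm M (\<lambda>x. f x - g x) = L2_norm M (\<lambda>x. g x - f x)"
  by (simp add: L2_norm_def power2_commute)

lemma L2_norm_eq_zero:
  assumes "square_integrable M f" "L2_norm M f = 0"
  shows "AE x in M. f x = 0"
proof -
  have "(\<integral>x. (f x)\<^sup>2 \<partial>M) = 0" using assms(2) by (simp add: L2_norm_def)
  then have "AE x in M. (f x)\<^sup>2 = 0"
    using integral_nonneg_eq_0_iff_AE[of M "\<lambda>x. (f x)\<^sup>2"] assms(1)
    by (auto simp: square_integrable_def)
  then show ?thesis by auto
qed

lemma L2_Cauchy_Schwarz_abs: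
  assumes f: "square_integrable M f" and g: "square_integrable M g"
  shows "(\<integral>x. \<bar>f x * g x\<bar> \<partial>M) \<le> L2_norm M f * L2_norm M g"
proof (cases "L2_norm M f = 0 \<or> L2_norm M g = 0")
  case True
  then have "AE x in M. f x * g x = 0"
    using L2_norm_eq_zero[OF f] L2_norm_eq_zero[OF g] by auto
  then have "(\<integral>x. \<bar>f x * g x\<bar> \<partial>M) = (\<integral>x. 0 \<partial>M)"
    by (intro integral_cong_AE) (use f g in \<open>auto simp: square_integrable_def\<close>)
  then show ?thesis by simp
next
  case False
  define a where "a = L2_norm M f"
  define b where "b = L2_norm M g"
  have ab: "a > 0" "b > 0"
    using False L2_norm_nonneg[of M f] L2_norm_nonneg[of M g] unfolding a_def b_def by linarith+
  \<comment> \<open>The weights in this inequality between arithmetic and geometric mean are chosen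
    so that both terms integrate to \<open>a * b\<close>.\<close>
  have "(\<integral>x. 2 * \<bar>f x * g x\<bar> \<partial>M) \<le> (\<integral>x. b / a * (f x)\<^sup>2 + a / b * (g x)\<^sup>2 \<partial>M)"
  proof (rule integral_mono)
    show "integrable M (\<lambda>x. 2 * \<bar>f x * g x\<bar>)"
      using square_integrable_mult[OF f g] by auto
    show "integrable M (\<lambda>x. b / a * (f x)\<^sup>2 + a / b * (g x)\<^sup>2)"
      using f g by (auto simp: square_integrable_def)
    fix x
    have "b / a * (f x)\<^sup>2 + a / b * (g x)\<^sup>2 - 2 * \<bar>f x * g x\<bar> = (b * \<bar>f x\<bar> - a * \<bar>g x\<bar>)\<^sup>2 / (a * b)"
      using ab by (simp add: power2_eq_square field_simps abs_mult)
    also have "\<dots> \<ge> 0" using ab by simp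
    finally show "2 * \<bar>f x * g x\<bar> \<le> b / a * (f x)\<^sup>2 + a / b * (g x)\<^sup>2" by simp
  qed
  also have "\<dots> = b / a * a\<^sup>2 + a / b * b\<^sup>2"
    unfolding a_def b_def L2_norm_power2 using f g by (simp add: square_integrable_def)
  also have "\<dots> = 2 * (a * b)" using ab by (simp add: power2_eq_square)
  finally show ?thesis using ab by (simp add: a_def b_def)
qed

lemma L2_Cauchy_Schwarz:
  assumes "square_integrable M f" "square_integrable M g"
  shows "\<bar>\<integral>x. f x * g x \<partial>M\<bar> \<le> L2_norm M f * L2_norm M g"
  by (rule order_trans[OF integral_abs_bound L2_Cauchy_Schwarz_abs[OF assms]])

lemma L2_norm_triangle:
  assumes f: "square_integrable M f" and g: "square_integrable M g"
  shows "L2_norm M (\<lambda>x. f x + g x) \<le> L2_norm M f + L2_norm M g"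
proof (rule power2_le_imp_le)
  have "(L2_norm M (\<lambda>x. f x + g x))\<^sup>2 = (\<integral>x. (f x)\<^sup>2 + (g x)\<^sup>2 + 2 * (f x * g x) \<partial>M)"
    unfolding L2_norm_power2 by (simp add: power2_sum mult.assoc)
  also have "\<dots> = (L2_norm M f)\<^sup>2 + (L2_norm M g)\<^sup>2 + 2 * (\<integral>x. f x * g x \<partial>M)"
    unfolding L2_norm_power2
    using f g square_integrable_mult[OF f g] by (simp add: square_integrable_def)
  also have "\<dots> \<le> (L2_norm M f)\<^sup>2 + (L2_norm M g)\<^sup>2 + 2 * (L2_norm M f * L2_norm M g)"
    using L2_Cauchy_Schwarz[OF f g] by linarith
  finally show "(L2_norm M (\<lambda>x. f x + g x))\<^sup>2 \<le> (L2_norm M f + L2_norm M g)\<^sup>2"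
    by (simp add: power2_sum)
qed simp

lemma L2_norm_triangle_diff:
  assumes "square_integrable M f" "square_integrable M g"
  shows "L2_norm M (\<lambda>x. f x - g x) \<le> L2_norm M f + L2_norm M g"
  using L2_norm_triangle[OF assms(1) square_integrable_minus[OF assms(2)]] by simp

lemma L2_norm_sum:
  assumes "\<And>i. i \<in> I \<Longrightarrow> square_integrable M (f i)"
  shows "L2_norm M (\<lambda>x. \<Sum>i\<in>I. f i x) \<le> (\<Sum>i\<in>I. L2_norm M (f i))"
  using assms
proof (induction I rule: infinite_finite_induct)
  case (insert i I)
  have "L2_norm M (\<lambda>x. f i x + (\<Sum>i\<in>I. f i x)) \<le> L2_norm M (f i) + L2_norm M (\<lambda>x. \<Sum>i\<in>I. f i x)"
    using insert by (intro L2_norm_triangle square_integrable_sum) auto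
  then show ?case using insert by fastforce
qed auto

lemma L2_norm_diff_abs:
  assumes "square_integrable M u" "square_integrable M v"
  shows "\<bar>L2_norm M u - L2_norm M v\<bar> \<le> L2_norm M (\<lambda>x. u x - v x)"
proof -
  have "L2_norm M (\<lambda>x. (u x - v x) + v x) \<le> L2_norm M (\<lambda>x. u x - v x) + L2_norm M v"
    by (intro L2_norm_triangle square_integrable_diff assms)
  moreover have "L2_norm M (\<lambda>x. (v x - u x) + u x) \<le> L2_norm M (\<lambda>x. v x - u x) + L2_norm M u"
    by (intro L2_norm_triangle square_integrable_diff assms)
  ultimately show ?thesis using L2_norm_diff_commute[of M u v] by (simp add: abs_le_iff)
qed

lemma L2_norm_distr:
  assumes "T \<in> M \<rightarrow>\<^sub>M N" "distr M N T = N" "f \<in> borel_measurable N"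
  shows "L2_norm M (\<lambda>x. f (T x)) = L2_norm N f"
  unfolding L2_norm_def using integral_distr[OF assms(1), of "\<lambda>x. (f x)\<^sup>2"] assms by simp

lemma square_integrable_distr:
  assumes "T \<in> M \<rightarrow>\<^sub>M N" "distr M N T = N" "square_integrable N f"
  shows "square_integrable M (\<lambda>x. f (T x))"
  using assms integrable_distr[of T M N "\<lambda>x. (f x)\<^sup>2"] measurable_compose[OF assms(1)]
  by (auto simp: square_integrable_def)

context prob_space
begin

lemma L1_le_L2:
  assumes "square_integrable M f"
  shows "(\<integral>x. \<bar>f x\<bar> \<partial>M) \<le> L2_norm M f"
  using L2_Cauchy_Schwarz_abs[OF assms, of "\<lambda>_. 1"] prob_space
  by (simp add: square_integrable_def L2_norm_def)

lemma expectation_le_L2: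
  assumes "square_integrable M f"
  shows "\<bar>\<integral>x. f x \<partial>M\<bar> \<le> L2_norm M f"
  by (rule order_trans[OF integral_abs_bound L1_le_L2[OF assms]])

end

text \<open>A multiple of the limit itself is the dominating function; this fits simple functions
  bounded by twice the limit and increasing unions of sets.\<close>

lemma L2_tendsto_of_dominated:
  assumes "square_integrable M f" "\<And>n. g n \<in> borel_measurable M"
    and "\<And>x. x \<in> space M \<Longrightarrow> (\<lambda>n. g n x) \<longlonglongrightarrow> f x"
    and "\<And>n x. x \<in> space M \<Longrightarrow> \<bar>g n x - f x\<bar> \<le> C * \<bar>f x\<bar>"
  shows "(\<lambda>n. L2_norm M (\<lambda>x. g n x - f x)) \<longlonglongrightarrow> 0"
proof -
  have "(\<lambda>n. \<integral>x. (g n x - f x)\<^sup>2 \<partial>M) \<longlonglongrightarrow> (\<integral>x. 0 \<partial>M)"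
  proof (rule integral_dominated_convergence[where w = "\<lambda>x. C\<^sup>2 * (f x)\<^sup>2"])
    show "(\<lambda>x. (g n x - f x)\<^sup>2) \<in> borel_measurable M" for n
      using assms by (auto simp: square_integrable_def)
    show "integrable M (\<lambda>x. C\<^sup>2 * (f x)\<^sup>2)"
      using assms(1) by (auto simp: square_integrable_def)
    show "AE x in M. (\<lambda>n. (g n x - f x)\<^sup>2) \<longlonglongrightarrow> 0"
    proof (rule AE_I2)
      fix x assume "x \<in> space M"
      then have "(\<lambda>n. (g n x - f x)\<^sup>2) \<longlonglongrightarrow> (f x - f x)\<^sup>2"
        using assms(3) by (intro tendsto_intros) auto
      then show "(\<lambda>n. (g n x - f x)\<^sup>2) \<longlonglongrightarrow> 0" by simp
    qed
    show "AE x in M. norm ((g n x - f x)\<^sup>2) \<le> C\<^sup>2 * (f x)\<^sup>2" for n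
    proof (rule AE_I2)
      fix x assume "x \<in> space M"
      from power_mono[OF assms(4)[OF this, of n] abs_ge_zero, of 2]
      show "norm ((g n x - f x)\<^sup>2) \<le> C\<^sup>2 * (f x)\<^sup>2" by (simp add: power_mult_distrib)
    qed
  qed simp
  then have "(\<lambda>n. sqrt (\<integral>x. (g n x - f x)\<^sup>2 \<partial>M)) \<longlonglongrightarrow> sqrt 0"
    by (intro tendsto_intros) simp
  then show ?thesis by (simp add: L2_norm_def)
qed

text \<open>The square of the sum of the absolute values is integrated term by term through monotone
  convergence; this gives the pointwise sum, and Fatou's lemma the tail bounds.\<close>

lemma has_L2_sum_nat:
  fixes u :: "nat \<Rightarrow> 'a \<Rightarrow> real"
  assumes sq: "\<And>n. square_integrable M (u n)" and sm: "summable (\<lambda>n. L2_norm M (u n))"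
  shows "square_integrable M (\<lambda>x. \<Sum>n. u n x)"
    and "finite I \<Longrightarrow> L2_norm M (\<lambda>x. (\<Sum>i\<in>I. u i x) - (\<Sum>n. u n x)) \<le> (\<Sum>n. if n \<in> I then 0 else L2_norm M (u n))"
proof -
  \<comment> \<open>Used twice: for \<open>u\<close>, to obtain the pointwise sum, and for
    \<open>u\<close> with the terms in \<open>I\<close> set to zero, to obtain the tail.\<close>
  have key: "(\<integral>\<^sup>+x. ennreal ((\<Sum>n. v n x)\<^sup>2) \<partial>M) \<le> ennreal ((\<Sum>n. L2_norm M (v n))\<^sup>2)
      \<and> (AE x in M. summable (\<lambda>n. \<bar>v n x\<bar>))"
    if v: "\<And>n. square_integrable M (v n)" and smv: "summable (\<lambda>n. L2_norm M (v n))" for v :: "nat \<Rightarrow> 'a \<Rightarrow> real"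
  proof -
    define C where "C = (\<Sum>n. L2_norm M (v n))"
    have [measurable]: "v n \<in> borel_measurable M" for n using v by (simp add: square_integrable_def)
    have fin: "(\<integral>\<^sup>+x. ennreal ((\<Sum>n<N. \<bar>v n x\<bar>)\<^sup>2) \<partial>M) \<le> ennreal (C\<^sup>2)" for N
    proof -
      have s: "square_integrable M (\<lambda>x. \<Sum>n<N. \<bar>v n x\<bar>)"
        by (intro square_integrable_sum square_integrable_abs v)
      have "(\<integral>\<^sup>+x. ennreal ((\<Sum>n<N. \<bar>v n x\<bar>)\<^sup>2) \<partial>M) = ennreal ((L2_norm M (\<lambda>x. \<Sum>n<N. \<bar>v n x\<bar>))\<^sup>2)"
        unfolding L2_norm_power2 by (rule nn_integral_eq_integral) (use s in \<open>auto simp: square_integrable_def\<close>)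
      moreover have "L2_norm M (\<lambda>x. \<Sum>n<N. \<bar>v n x\<bar>) \<le> (\<Sum>n<N. L2_norm M (\<lambda>x. \<bar>v n x\<bar>))"
        by (intro L2_norm_sum square_integrable_abs v)
      moreover have "(\<Sum>n<N. L2_norm M (\<lambda>x. \<bar>v n x\<bar>)) \<le> C"
        unfolding C_def L2_norm_abs by (rule sum_le_suminf[OF smv]) auto
      ultimately show ?thesis
        by (auto intro!: ennreal_leI power_mono)
    qed
    let ?h = "\<lambda>x. (SUP N. ennreal ((\<Sum>n<N. \<bar>v n x\<bar>)\<^sup>2))"
    have inc: "incseq (\<lambda>N x. ennreal ((\<Sum>n<N. \<bar>v n x\<bar>)\<^sup>2))"
      unfolding incseq_def le_fun_def
      by (intro allI impI ennreal_leI power_mono sum_mono2 sum_nonneg) auto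
    have int: "(\<integral>\<^sup>+x. ?h x \<partial>M) \<le> ennreal (C\<^sup>2)"
      by (subst nn_integral_monotone_convergence_SUP[OF inc]) (auto intro!: SUP_least fin)
    have sup: "(\<integral>\<^sup>+x. ?h x \<partial>M) \<noteq> \<infinity>"
      using int by (auto simp: top_unique)
    have "AE x in M. ?h x \<noteq> \<infinity>"
      by (rule nn_integral_PInf_AE[OF _ sup]) measurable
    then have summ: "AE x in M. summable (\<lambda>n. \<bar>v n x\<bar>)"
    proof (rule AE_mp, intro AE_I2 impI)
      fix x assume "?h x \<noteq> \<infinity>"
      then obtain r where r: "?h x = ennreal r" "0 \<le> r" by (cases "?h x") auto
      have "(\<Sum>n<N. \<bar>v n x\<bar>) \<le> sqrt r" for N
      proof -
        have "ennreal ((\<Sum>n<N. \<bar>v n x\<bar>)\<^sup>2) \<le> ennreal r"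
          unfolding r(1)[symmetric] by (rule SUP_upper) simp
        then have "(\<Sum>n<N. \<bar>v n x\<bar>)\<^sup>2 \<le> r" using r(2) by simp
        then show ?thesis by (rule real_le_rsqrt)
      qed
      then show "summable (\<lambda>n. \<bar>v n x\<bar>)"
        by (intro summableI_nonneg_bounded[where x = "sqrt r"]) auto
    qed
    have "(\<integral>\<^sup>+x. ennreal ((\<Sum>n. v n x)\<^sup>2) \<partial>M) \<le> (\<integral>\<^sup>+x. ?h x \<partial>M)"
    proof (rule nn_integral_mono_AE, use summ in eventually_elim)
      case (elim x)
      have lim: "(\<lambda>N. ennreal ((\<Sum>n<N. v n x)\<^sup>2)) \<longlonglongrightarrow> ennreal ((\<Sum>n. v n x)\<^sup>2)"
        using summable_LIMSEQ[OF summable_rabs_cancel[OF elim]] by (intro tendsto_intros) auto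
      have "ennreal ((\<Sum>n<N. v n x)\<^sup>2) \<le> ?h x" for N
      proof -
        have "ennreal ((\<Sum>n<N. v n x)\<^sup>2) \<le> ennreal ((\<Sum>n<N. \<bar>v n x\<bar>)\<^sup>2)"
          using power_mono[OF sum_abs abs_ge_zero, of "\<lambda>n. v n x" "{..<N}" 2] by (intro ennreal_leI) simp
        also have "\<dots> \<le> ?h x" by (rule SUP_upper) simp
        finally show ?thesis .
      qed
      then show ?case by (intro LIMSEQ_le_const2[OF lim] exI[of _ 0] allI impI)
    qed
    with int summ show ?thesis unfolding C_def by auto
  qed
  have conv: "square_integrable M w \<and> L2_norm M w \<le> C"
    if "w \<in> borel_measurable M" "(\<integral>\<^sup>+x. ennreal ((w x)\<^sup>2) \<partial>M) \<le> ennreal (C\<^sup>2)" "0 \<le> C" for w :: "'a \<Rightarrow> real" and C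
  proof -
    have i: "integrable M (\<lambda>x. (w x)\<^sup>2)"
    proof (rule integrableI_bounded)
      show "(\<lambda>x. (w x)\<^sup>2) \<in> borel_measurable M" using that by simp
      show "(\<integral>\<^sup>+x. ennreal (norm ((w x)\<^sup>2)) \<partial>M) < \<infinity>"
        using that(2) by (auto intro: le_less_trans)
    qed
    have "ennreal ((L2_norm M w)\<^sup>2) = (\<integral>\<^sup>+x. ennreal ((w x)\<^sup>2) \<partial>M)"
      unfolding L2_norm_power2 using nn_integral_eq_integral[OF i] by simp
    then have "ennreal ((L2_norm M w)\<^sup>2) \<le> ennreal (C\<^sup>2)" using that(2) by simp
    then have "(L2_norm M w)\<^sup>2 \<le> C\<^sup>2" by (subst (asm) ennreal_le_iff) auto
    then have "L2_norm M w \<le> C" using that(3) by (metis power2_le_imp_le)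
    with i that(1) show ?thesis by (simp add: square_integrable_def)
  qed
  have [measurable]: "u n \<in> borel_measurable M" for n using sq by (simp add: square_integrable_def)
  show 1: "square_integrable M (\<lambda>x. \<Sum>n. u n x)"
    using key[OF sq sm] conv[of "\<lambda>x. \<Sum>n. u n x" "\<Sum>n. L2_norm M (u n)"] suminf_nonneg[OF sm] by auto
  assume I: "finite I"
  define v where "v n x = (if n \<in> I then 0 else u n x)" for n x
  have v: "square_integrable M (v n)" "L2_norm M (v n) = (if n \<in> I then 0 else L2_norm M (u n))" for n
  proof -
    have "v n = (if n \<in> I then (\<lambda>x. 0) else u n)" by (auto simp: v_def fun_eq_iff)
    then show "square_integrable M (v n)" "L2_norm M (v n) = (if n \<in> I then 0 else L2_norm M (u n))"
      using sq[of n] square_integrable_zero[of M] by auto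
  qed
  have smv: "summable (\<lambda>n. L2_norm M (v n))"
    by (rule summable_comparison_test'[OF sm, of 0]) (auto simp: v(2))
  have vm: "v n \<in> borel_measurable M" for n
    by (rule square_integrable_measurable[OF v(1)])
  have ae: "AE x in M. (\<Sum>n. u n x) - (\<Sum>i\<in>I. u i x) = (\<Sum>n. v n x)"
  proof (rule AE_mp[OF conjunct2[OF key[OF sq sm]]], intro AE_I2 impI)
    fix x assume elim: "summable (\<lambda>n. \<bar>u n x\<bar>)"
    have "(\<lambda>n. u n x - (if n \<in> I then u n x else 0)) sums ((\<Sum>n. u n x) - (\<Sum>i\<in>I. u i x))"
      by (rule sums_diff[OF summable_sums[OF summable_rabs_cancel[OF elim]] sums_If_finite_set[OF I]])
    moreover have "(\<lambda>n. u n x - (if n \<in> I then u n x else 0)) = (\<lambda>n. v n x)"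
      by (auto simp: v_def)
    ultimately show "(\<Sum>n. u n x) - (\<Sum>i\<in>I. u i x) = (\<Sum>n. v n x)" by (simp add: sums_iff)
  qed
  have m: "(\<lambda>x. (\<Sum>n. u n x) - (\<Sum>i\<in>I. u i x)) \<in> borel_measurable M"
    using sq by (intro borel_measurable_diff borel_measurable_suminf borel_measurable_sum)
      (simp_all add: square_integrable_def)
  have "L2_norm M (\<lambda>x. (\<Sum>i\<in>I. u i x) - (\<Sum>n. u n x)) = L2_norm M (\<lambda>x. \<Sum>n. v n x)"
    by (subst L2_norm_diff_commute, rule L2_norm_cong_AE[OF ae m borel_measurable_suminf[OF vm]])
  also have "\<dots> \<le> (\<Sum>n. L2_norm M (v n))"
    using key[OF v(1) smv] conv[of "\<lambda>x. \<Sum>n. v n x" "\<Sum>n. L2_norm M (v n)"] suminf_nonneg[OF smv]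
      borel_measurable_suminf[OF vm] by auto
  finally show "L2_norm M (\<lambda>x. (\<Sum>i\<in>I. u i x) - (\<Sum>n. u n x)) \<le> (\<Sum>n. if n \<in> I then 0 else L2_norm M (u n))"
    by (simp add: v(2))
qed

section \<open>Conditional expectations on a product space\<close>

text \<open>For independent arguments of law \<open>P\<close> this resamples the coordinates outside
  \<open>A\<close>; integrating over the second argument conditions on the coordinates in
  \<open>A\<close>.\<close>

definition glue :: "'i set \<Rightarrow> ('i \<Rightarrow> 'a) \<Rightarrow> ('i \<Rightarrow> 'a) \<Rightarrow> 'i \<Rightarrow> 'a" where
  "glue A \<omega> \<omega>' = (\<lambda>j. if j \<in> A then \<omega> j else \<omega>' j)"

text \<open>Pointwise counterpart of measurability with respect to the coordinates in
  \<open>A\<close>: a measurable \<open>g\<close> with this property is unchanged when the other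
  coordinates are frozen, hence measurable in those of \<open>A\<close>.\<close>

definition depends_on :: "'i set \<Rightarrow> (('i \<Rightarrow> 'a) \<Rightarrow> 'b) \<Rightarrow> bool" where
  "depends_on A g \<longleftrightarrow> (\<forall>\<omega> \<omega>'. (\<forall>j\<in>A. \<omega> j = \<omega>' j) \<longrightarrow> g \<omega> = g \<omega>')"

lemma depends_onD: "depends_on A g \<Longrightarrow> (\<And>j. j \<in> A \<Longrightarrow> \<omega> j = \<omega>' j) \<Longrightarrow> g \<omega> = g \<omega>'"
  by (auto simp: depends_on_def)

lemma depends_onI: "(\<And>\<omega> \<omega>'. (\<And>j. j \<in> A \<Longrightarrow> \<omega> j = \<omega>' j) \<Longrightarrow> g \<omega> = g \<omega>') \<Longrightarrow> depends_on A g"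
  unfolding depends_on_def by blast

lemma depends_on_mono: "depends_on A g \<Longrightarrow> A \<subseteq> B \<Longrightarrow> depends_on B g"
  by (auto simp: depends_on_def)

lemma depends_on_const: "depends_on A (\<lambda>_. c)"
  by (simp add: depends_on_def)

lemma depends_on_compose:
  assumes "depends_on A g"
  shows "depends_on A (\<lambda>\<omega>. h (g \<omega>))"
  by (intro depends_onI arg_cong[where f = h] depends_onD[OF assms])

lemma depends_on_compose2:
  assumes "depends_on A g" "depends_on A g'"
  shows "depends_on A (\<lambda>\<omega>. h (g \<omega>) (g' \<omega>))"
  by (intro depends_onI arg_cong2[where f = h] depends_onD[OF assms(1)] depends_onD[OF assms(2)])

lemma depends_on_sum:
  assumes "\<And>i. i \<in> I \<Longrightarrow> depends_on A (g i)"
  shows "depends_on A (\<lambda>\<omega>. \<Sum>i\<in>I. g i \<omega>)"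
  by (intro depends_onI sum.cong refl depends_onD[OF assms])

lemma depends_on_Max:
  assumes "\<And>i. i \<in> I \<Longrightarrow> depends_on A (g i)"
  shows "depends_on A (\<lambda>\<omega>. Max ((\<lambda>i. g i \<omega>) ` I))"
  by (intro depends_onI arg_cong[where f = Max] image_cong refl depends_onD[OF assms])

lemma depends_on_glue: "depends_on A g \<Longrightarrow> g (glue A \<omega> \<omega>') = g \<omega>"
  by (rule depends_onD) (auto simp: glue_def)

lemma depends_on_glue_compl: "depends_on B g \<Longrightarrow> A \<inter> B = {} \<Longrightarrow> g (glue A \<omega> \<omega>') = g \<omega>'"
  by (rule depends_onD) (auto simp: glue_def)

section \<open>The product measure under resampling of coordinates\<close>

locale real_iid =
  fixes \<mu> :: "real measure"
  assumes real_distribution: "real_distribution \<mu>"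
begin

lemma prob_space_mu: "prob_space \<mu>"
  using real_distribution by (rule real_distribution.axioms)

lemma space_mu [simp]: "space \<mu> = UNIV"
  by (rule real_distribution.space_eq_univ[OF real_distribution])

lemma sets_mu [simp, measurable_cong]: "sets \<mu> = sets borel"
  by (rule real_distribution.events_eq_borel[OF real_distribution])

abbreviation P :: "('i \<Rightarrow> real) measure" where
  "P \<equiv> (\<Pi>\<^sub>M i\<in>UNIV. \<mu>)"

lemma space_P [simp]: "space P = UNIV"
  by (simp add: space_PiM)

lemma prob_space_P: "prob_space (P :: ('i \<Rightarrow> real) measure)"
  by (intro prob_space_PiM prob_space_mu)

lemma product_prob_space_P: "product_prob_space (\<lambda>_::'i. \<mu>)"
  by (intro product_prob_spaceI prob_space_mu)

lemma pair_prob_space_P: "pair_prob_space (P :: ('i \<Rightarrow> real) measure) (P :: ('i \<Rightarrow> real) measure)"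
  by (intro pair_prob_space.intro pair_sigma_finite.intro prob_space_imp_sigma_finite prob_space_P)

lemmas pair_sigma_finite_P = pair_prob_space.axioms(1)[OF pair_prob_space_P]

lemma measurable_coordinate: "(\<lambda>\<omega>. \<omega> j) \<in> P \<rightarrow>\<^sub>M borel"
  using measurable_component_singleton[of j UNIV "\<lambda>_. \<mu>"] by (simp cong: measurable_cong_sets)

lemma measurable_into_P:
  assumes "\<And>j. (\<lambda>x. f x j) \<in> borel_measurable N"
  shows "f \<in> N \<rightarrow>\<^sub>M P"
proof -
  have "(\<lambda>x j. f x j) \<in> N \<rightarrow>\<^sub>M P"
    using assms by (intro measurable_PiM_single') (auto cong: measurable_cong_sets)
  then show ?thesis by simp
qed

lemma measurable_glue: "(\<lambda>(\<omega>, \<omega>'). glue A \<omega> \<omega>') \<in> P \<Otimes>\<^sub>M P \<rightarrow>\<^sub>M P"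
proof (rule measurable_into_P)
  fix j :: 'a
  show "(\<lambda>x. (case x of (\<omega>, \<omega>') \<Rightarrow> glue A \<omega> \<omega>') j) \<in> borel_measurable (P \<Otimes>\<^sub>M P)"
    using measurable_compose[OF measurable_fst measurable_coordinate[of j]]
      measurable_compose[OF measurable_snd measurable_coordinate[of j]]
    by (cases "j \<in> A") (simp_all add: glue_def case_prod_beta')
qed

lemma measurable_glue_snd: "(\<lambda>\<omega>'. glue A \<omega> \<omega>') \<in> P \<rightarrow>\<^sub>M P"
  using measurable_Pair2[OF measurable_glue[of A]] by simp

text \<open>The preimage of a finite-dimensional box is a product of two boxes, one carried by the
  indices in \<open>A\<close> and one by the others, and the measure of a box factors over its
  indices.\<close>

lemma distr_glue: "distr (P \<Otimes>\<^sub>M P) P (\<lambda>(\<omega>, \<omega>'). glue A \<omega> \<omega>') = (P :: ('i \<Rightarrow> real) measure)"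
proof (rule measure_eqI_PiM_infinite[symmetric, OF refl])
  show "finite_measure (P :: ('i \<Rightarrow> real) measure)"
    by (rule prob_space.axioms(1)[OF prob_space_P])
  fix F :: "'i \<Rightarrow> real set" and J assume J: "finite J" "J \<subseteq> UNIV" and F: "\<And>j. j \<in> J \<Longrightarrow> F j \<in> sets \<mu>"
  let ?X = "prod_emb UNIV (\<lambda>_. \<mu>) J (Pi\<^sub>E J F) :: ('i \<Rightarrow> real) set"
  let ?X1 = "prod_emb UNIV (\<lambda>_. \<mu>) (J \<inter> A) (Pi\<^sub>E (J \<inter> A) F) :: ('i \<Rightarrow> real) set"
  let ?X2 = "prod_emb UNIV (\<lambda>_. \<mu>) (J - A) (Pi\<^sub>E (J - A) F) :: ('i \<Rightarrow> real) set"
  have X: "?X \<in> sets P" "?X1 \<in> sets P" "?X2 \<in> sets P"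
    using J F by (auto intro!: sets_PiM_I)
  have "(\<lambda>(\<omega>, \<omega>'). glue A \<omega> \<omega>') -` ?X \<inter> space (P \<Otimes>\<^sub>M P) = ?X1 \<times> ?X2"
    by (auto simp: prod_emb_def glue_def space_pair_measure space_PiM PiE_def Pi_def extensional_def split: if_splits)
  then have "emeasure (distr (P \<Otimes>\<^sub>M P) P (\<lambda>(\<omega>, \<omega>'). glue A \<omega> \<omega>')) ?X = emeasure (P \<Otimes>\<^sub>M P) (?X1 \<times> ?X2)"
    using X measurable_glue by (subst emeasure_distr) auto
  also have "\<dots> = emeasure P ?X1 * emeasure P ?X2"
    using X
    by (intro sigma_finite_measure.emeasure_pair_measure_Times prob_space_imp_sigma_finite prob_space_P) auto
  also have "\<dots> = (\<Prod>j\<in>J \<inter> A. emeasure \<mu> (F j)) * (\<Prod>j\<in>J - A. emeasure \<mu> (F j))"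
    using J F by (subst (1 2) product_prob_space.emeasure_PiM_emb[OF product_prob_space_P]) auto
  also have "\<dots> = (\<Prod>j\<in>J. emeasure \<mu> (F j))"
    using prod.Int_Diff[OF J(1), of "\<lambda>j. emeasure \<mu> (F j)" A] by simp
  also have "\<dots> = emeasure P ?X"
    using J F by (subst product_prob_space.emeasure_PiM_emb[OF product_prob_space_P]) auto
  finally show "emeasure P ?X = emeasure (distr (P \<Otimes>\<^sub>M P) P (\<lambda>(\<omega>, \<omega>'). glue A \<omega> \<omega>')) ?X" ..
qed simp

lemma integrable_glue:
  assumes "integrable P g"
  shows "integrable (P \<Otimes>\<^sub>M P) (\<lambda>(\<omega>, \<omega>'). g (glue A \<omega> \<omega>') :: real)"
  using integrable_distr[OF measurable_glue[of A], of g] assms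
  unfolding distr_glue by (simp add: case_prod_unfold)

lemma integral_glue:
  assumes "g \<in> borel_measurable P"
  shows "(\<integral>z. g (glue A (fst z) (snd z)) \<partial>(P \<Otimes>\<^sub>M P)) = (\<integral>\<omega>. g \<omega> \<partial>P :: real)"
  using integral_distr[OF measurable_glue assms, of A]
  unfolding distr_glue by (simp add: case_prod_unfold)

section \<open>Conditional expectation by integrating out coordinates\<close>

text \<open>A version of the conditional expectation given the coordinates in \<open>A\<close> that
  is defined at every \<open>\<omega>\<close>; where the section is not integrable, its value is 0
  by convention.\<close>

definition cexp :: "'i set \<Rightarrow> (('i \<Rightarrow> real) \<Rightarrow> real) \<Rightarrow> ('i \<Rightarrow> real) \<Rightarrow> real" where
  "cexp A g \<omega> = (\<integral>\<omega>'. g (glue A \<omega> \<omega>') \<partial>P)"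

lemma borel_measurable_cexp [measurable]:
  assumes "g \<in> borel_measurable P"
  shows "cexp A g \<in> borel_measurable P"
proof -
  interpret prob_space P by (rule prob_space_P)
  have "(\<lambda>(\<omega>, \<omega>'). g (glue A \<omega> \<omega>')) \<in> borel_measurable (P \<Otimes>\<^sub>M P)"
    using measurable_compose[OF measurable_glue assms, of A] by (simp add: case_prod_unfold)
  then show ?thesis
    unfolding cexp_def[abs_def] by (intro borel_measurable_lebesgue_integral) simp
qed

lemma depends_on_cexp: "depends_on A (cexp A g)"
  unfolding cexp_def
  by (intro depends_onI Bochner_Integration.integral_cong refl arg_cong[where f = g]) (simp add: glue_def fun_eq_iff)

text \<open>Averaging creates no new dependence, so finite windows and half-spaces obtained earlier
  survive later projections.\<close>

lemma depends_on_cexp_inherit: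
  assumes "depends_on B g"
  shows "depends_on (A \<inter> B) (cexp A g)"
  unfolding cexp_def
  by (intro depends_onI Bochner_Integration.integral_cong refl depends_onD[OF assms]) (auto simp: glue_def)

lemma cexp_id: "depends_on A g \<Longrightarrow> cexp A g = g"
  using prob_space.prob_space[OF prob_space_P]
  by (auto simp: cexp_def fun_eq_iff depends_on_glue)

lemma cexp_disjoint: "depends_on B g \<Longrightarrow> A \<inter> B = {} \<Longrightarrow> cexp A g = (\<lambda>_. \<integral>\<omega>. g \<omega> \<partial>P)"
  by (simp add: cexp_def fun_eq_iff depends_on_glue_compl)

lemma cexp_bound:
  assumes "\<And>\<omega>. \<bar>g \<omega>\<bar> \<le> B"
  shows "\<bar>cexp A g \<omega>\<bar> \<le> B"
proof -
  interpret prob_space "P :: ('a \<Rightarrow> real) measure" by (rule prob_space_P)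
  have B: "0 \<le> B" using assms abs_ge_zero order_trans by blast
  show ?thesis
  proof (cases "integrable P (\<lambda>\<omega>'. g (glue A \<omega> \<omega>'))")
    case True
    have "\<bar>cexp A g \<omega>\<bar> \<le> (\<integral>\<omega>'. \<bar>g (glue A \<omega> \<omega>')\<bar> \<partial>P)"
      unfolding cexp_def by (rule integral_abs_bound)
    also have "\<dots> \<le> (\<integral>\<omega>'. B \<partial>(P :: ('a \<Rightarrow> real) measure))"
      using True assms by (intro integral_mono) auto
    finally show ?thesis using prob_space by simp
  next
    case False
    then show ?thesis using B by (simp add: cexp_def not_integrable_integral_eq)
  qed
qed

text \<open>Fubini's theorem gives integrable sections only almost everywhere; this is why linearity
  and monotonicity of \<open>cexp\<close> below are almost-everywhere statements.\<close>

lemma AE_integrable_glue: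
  assumes "integrable P g"
  shows "AE \<omega> in P. integrable P (\<lambda>\<omega>'. g (glue A \<omega> \<omega>') :: real)"
  using pair_sigma_finite.AE_integrable_fst'[OF pair_sigma_finite_P integrable_glue[OF assms, of A]] by simp

lemma integrable_cexp:
  assumes "integrable P g"
  shows "integrable P (cexp A g)"
  using pair_sigma_finite.integrable_fst'[OF pair_sigma_finite_P integrable_glue[OF assms, of A]] by (simp add: cexp_def[abs_def])

lemma integral_cexp:
  assumes "integrable P g"
  shows "(\<integral>\<omega>. cexp A g \<omega> \<partial>P) = (\<integral>\<omega>. g \<omega> \<partial>P)"
  using pair_sigma_finite.integral_fst'[OF pair_sigma_finite_P integrable_glue[OF assms, of A]] integral_glue[of g A] assms
  by (simp add: cexp_def[abs_def] case_prod_unfold)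

lemma cexp_mult:
  assumes "depends_on A w"
  shows "cexp A (\<lambda>\<omega>. w \<omega> * g \<omega>) = (\<lambda>\<omega>. w \<omega> * cexp A g \<omega>)"
  using assms by (simp add: cexp_def depends_on_glue fun_eq_iff)

lemma integral_mult_cexp:
  assumes "depends_on A w" "integrable P (\<lambda>\<omega>. w \<omega> * g \<omega>)"
  shows "(\<integral>\<omega>. w \<omega> * cexp A g \<omega> \<partial>P) = (\<integral>\<omega>. w \<omega> * g \<omega> \<partial>P)"
  using integral_cexp[OF assms(2), of A] by (simp add: cexp_mult[OF assms(1)])

text \<open>Conditioning on \<open>A\<close> replaces \<open>v\<close> by its mean, since
  \<open>v\<close> sees resampled coordinates only.\<close>

lemma integral_mult_indep:
  assumes "depends_on A u" "depends_on B v" "A \<inter> B = {}"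
    and "integrable P u" "integrable P v" "integrable P (\<lambda>\<omega>. u \<omega> * v \<omega> :: real)"
  shows "(\<integral>\<omega>. u \<omega> * v \<omega> \<partial>P) = (\<integral>\<omega>. u \<omega> \<partial>P) * (\<integral>\<omega>. v \<omega> \<partial>P)"
proof -
  have "(\<integral>\<omega>. u \<omega> * v \<omega> \<partial>P) = (\<integral>\<omega>. u \<omega> * cexp A v \<omega> \<partial>P)"
    using integral_mult_cexp[OF assms(1,6)] by simp
  then show ?thesis using cexp_disjoint[OF assms(2,3)] by simp
qed

text \<open>The exceptional null set is pulled back along \<open>glue\<close>, which preserves the
  measure, and almost all of its sections are null.\<close>

lemma cexp_cong_AE:
  assumes "AE \<omega> in P. g \<omega> = h \<omega>" "g \<in> borel_measurable P" "h \<in> borel_measurable P"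
  shows "AE \<omega> in P. cexp A g \<omega> = cexp A h \<omega>"
proof -
  have "AE \<omega> in distr (P \<Otimes>\<^sub>M P) P (\<lambda>(\<omega>, \<omega>'). glue A \<omega> \<omega>'). g \<omega> = h \<omega>"
    using assms(1) by (simp only: distr_glue)
  then have ae: "AE z in P \<Otimes>\<^sub>M P. g (glue A (fst z) (snd z)) = h (glue A (fst z) (snd z))"
    using AE_distrD[OF measurable_glue] by (simp add: case_prod_unfold)
  have "AE \<omega> in P. AE \<omega>' in P. g (glue A \<omega> \<omega>') = h (glue A \<omega> \<omega>')"
    using pair_sigma_finite.AE_pair[OF pair_sigma_finite_P ae] by simp
  then show ?thesis
  proof eventually_elim
    case (elim \<omega>)
    show ?case unfolding cexp_def
      by (rule integral_cong_AE[OF measurable_compose[OF measurable_glue_snd assms(2)]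
            measurable_compose[OF measurable_glue_snd assms(3)] elim])
  qed
qed

lemma cexp_diff_AE:
  assumes "integrable P g" "integrable P h"
  shows "AE \<omega> in P. cexp A (\<lambda>\<omega>. g \<omega> - h \<omega>) \<omega> = cexp A g \<omega> - cexp A h \<omega>"
  using AE_integrable_glue[OF assms(1), of A] AE_integrable_glue[OF assms(2), of A]
  by eventually_elim (simp add: cexp_def)

lemma cexp_sum_AE:
  assumes "\<And>i. i \<in> I \<Longrightarrow> integrable P (g i)" "finite I"
  shows "AE \<omega> in P. cexp A (\<lambda>\<omega>. \<Sum>i\<in>I. g i \<omega>) \<omega> = (\<Sum>i\<in>I. cexp A (g i) \<omega>)"
proof -
  have "AE \<omega> in P. \<forall>i\<in>I. integrable P (\<lambda>\<omega>'. g i (glue A \<omega> \<omega>'))"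
    using assms AE_integrable_glue by (intro AE_finite_allI) auto
  then show ?thesis
    by eventually_elim (unfold cexp_def, intro Bochner_Integration.integral_sum, auto)
qed

lemma cexp_mono_AE:
  assumes "integrable P g" "integrable P h" "\<And>\<omega>. g \<omega> \<le> h \<omega>"
  shows "AE \<omega> in P. cexp A g \<omega> \<le> cexp A h \<omega>"
  using AE_integrable_glue[OF assms(1), of A] AE_integrable_glue[OF assms(2), of A]
  by eventually_elim (unfold cexp_def, intro integral_mono assms(3))

lemma cexp_abs_le: "\<bar>cexp A g \<omega>\<bar> \<le> cexp A (\<lambda>\<omega>. \<bar>g \<omega>\<bar>) \<omega>"
  unfolding cexp_def by (rule integral_abs_bound)

text \<open>Jensen's inequality for the square, obtained by bounding the mean of each section by its
  \<open>L2_norm\<close>.\<close>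

lemma square_integrable_cexp:
  fixes g :: "('i \<Rightarrow> real) \<Rightarrow> real"
  assumes g: "square_integrable P g"
  shows "square_integrable P (cexp A g)" "L2_norm P (cexp A g) \<le> L2_norm P g"
proof -
  interpret prob_space "P :: ('i \<Rightarrow> real) measure" by (rule prob_space_P)
  have ig: "integrable P g" by (rule square_integrable_integrable[OF g])
  have ig2: "integrable P (\<lambda>\<omega>. (g \<omega>)\<^sup>2)" using g by (simp add: square_integrable_def)
  have le: "AE \<omega> in P. (cexp A g \<omega>)\<^sup>2 \<le> cexp A (\<lambda>\<omega>. (g \<omega>)\<^sup>2) \<omega>"
    using AE_integrable_glue[OF ig, of A] AE_integrable_glue[OF ig2, of A]
  proof eventually_elim
    case (elim \<omega>)
    have "square_integrable P (\<lambda>\<omega>'. g (glue A \<omega> \<omega>'))"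
      using elim by (simp add: square_integrable_def)
    then have "\<bar>cexp A g \<omega>\<bar>\<^sup>2 \<le> (L2_norm P (\<lambda>\<omega>'. g (glue A \<omega> \<omega>')))\<^sup>2"
      unfolding cexp_def by (intro power_mono expectation_le_L2) auto
    then show ?case by (simp add: L2_norm_power2 cexp_def)
  qed
  have m: "cexp A g \<in> borel_measurable P" using g by (auto simp: square_integrable_def)
  have i: "integrable P (\<lambda>\<omega>. (cexp A g \<omega>)\<^sup>2)"
  proof (rule Bochner_Integration.integrable_bound[OF integrable_cexp[OF ig2, of A]])
    show "AE x in P. norm ((cexp A g x)\<^sup>2) \<le> norm (cexp A (\<lambda>\<omega>. (g \<omega>)\<^sup>2) x)"
      using le by eventually_elim auto
  qed (use m in auto)
  with m show "square_integrable P (cexp A g)" by (simp add: square_integrable_def)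
  have "(\<integral>\<omega>. (cexp A g \<omega>)\<^sup>2 \<partial>P) \<le> (\<integral>\<omega>. cexp A (\<lambda>\<omega>. (g \<omega>)\<^sup>2) \<omega> \<partial>P)"
    by (rule integral_mono_AE[OF i integrable_cexp[OF ig2] le])
  also have "\<dots> = (\<integral>\<omega>. (g \<omega>)\<^sup>2 \<partial>P)" by (rule integral_cexp[OF ig2])
  finally show "L2_norm P (cexp A g) \<le> L2_norm P g" by (simp add: L2_norm_def)
qed

lemma integral_cexp_mult_cexp:
  assumes "square_integrable P g" "square_integrable P h"
  shows "(\<integral>\<omega>. h \<omega> * cexp A g \<omega> \<partial>P) = (\<integral>\<omega>. cexp A h \<omega> * cexp A g \<omega> \<partial>P)"
  using integral_mult_cexp[OF depends_on_cexp, of A g h]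
    square_integrable_mult[OF square_integrable_cexp(1)[OF assms(1)] assms(2)]
  by (simp add: mult.commute)

text \<open>Conditional expectation is an orthogonal projection, hence self-adjoint: both sides
  equal the inner product of the two projections.\<close>

lemma cexp_symmetric:
  assumes "square_integrable P g" "square_integrable P h"
  shows "(\<integral>\<omega>. h \<omega> * cexp A g \<omega> \<partial>P) = (\<integral>\<omega>. cexp A h \<omega> * g \<omega> \<partial>P)"
  using integral_cexp_mult_cexp[OF assms] integral_cexp_mult_cexp[OF assms(2,1)]
  by (simp add: mult.commute)

text \<open>Testing with the conditional expectation itself makes its squared norm vanish.\<close>

lemma cexp_eq_zero_AE:
  assumes g: "square_integrable P g"
    and "\<And>w. square_integrable P w \<Longrightarrow> depends_on A w \<Longrightarrow> (\<integral>\<omega>. w \<omega> * g \<omega> \<partial>P) = 0"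
  shows "AE \<omega> in P. cexp A g \<omega> = 0"
proof (rule L2_norm_eq_zero)
  note c = square_integrable_cexp(1)[OF g, of A]
  show "square_integrable P (cexp A g)" by (rule c)
  have "(\<integral>\<omega>. (cexp A g \<omega>)\<^sup>2 \<partial>P) = (\<integral>\<omega>. cexp A g \<omega> * g \<omega> \<partial>P)"
    using integral_mult_cexp[OF depends_on_cexp, of A g g] square_integrable_mult[OF c g]
    by (simp add: power2_eq_square)
  then show "L2_norm P (cexp A g) = 0"
    using assms(2)[OF c depends_on_cexp] by (simp add: L2_norm_def)
qed

end

section \<open>Shifts and orthomartingale differences\<close>

text \<open>The coordinates with these indices generate the sigma-algebra
  \<open>marginal_past q l\<close>.\<close>

definition halfspace_le :: "'d::finite \<Rightarrow> int \<Rightarrow> (int ^ 'd) set" where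
  "halfspace_le q l = {i. i $ q \<le> l}"

lemma halfspace_le_mono: "l \<le> l' \<Longrightarrow> halfspace_le q l \<subseteq> halfspace_le q l'"
  by (auto simp: halfspace_le_def)

lemma shift_shift: "shift i (shift j \<omega>) = shift (i + j) \<omega>"
  by (simp add: shift_def fun_eq_iff add.assoc add.left_commute)

lemma shift_0 [simp]: "shift 0 \<omega> = \<omega>"
  by (simp add: shift_def)

lemma depends_on_shift:
  assumes "depends_on A g"
  shows "depends_on ((+) i ` A) (\<lambda>\<omega>. g (shift i \<omega>))"
  by (rule depends_onI, rule depends_onD[OF assms]) (simp add: shift_def)

context real_iid
begin

lemma measurable_shift: "shift i \<in> P \<rightarrow>\<^sub>M P"
  by (rule measurable_into_P) (simp add: shift_def measurable_coordinate)

lemma distr_shift: "distr P P (shift i) = P"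
proof -
  have "distr P (\<Pi>\<^sub>M j\<in>UNIV. \<mu>) (\<lambda>\<omega>. \<lambda>n\<in>UNIV. \<omega> (i + n)) = (\<Pi>\<^sub>M j\<in>UNIV. \<mu>)"
    using distr_PiM_reindex[of UNIV "\<lambda>_. \<mu>" "\<lambda>n. i + n" UNIV] prob_space_mu by (simp add: inj_on_def)
  moreover have "(\<lambda>\<omega>. \<lambda>n\<in>UNIV. \<omega> (i + n)) = shift i" by (simp add: shift_def fun_eq_iff)
  ultimately show ?thesis by simp
qed

lemma integral_shift:
  assumes "g \<in> borel_measurable P"
  shows "(\<integral>\<omega>. g (shift i \<omega>) \<partial>P) = (\<integral>\<omega>. g \<omega> \<partial>P :: real)"
  using integral_distr[OF measurable_shift assms, of i] by (simp add: distr_shift)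

lemmas borel_measurable_shift = measurable_compose[OF measurable_shift]
lemmas square_integrable_shift = square_integrable_distr[OF measurable_shift distr_shift]
lemmas L2_norm_shift = L2_norm_distr[OF measurable_shift distr_shift]

lemma glue_shift: "shift i (glue A \<omega> \<omega>') = glue {j. i + j \<in> A} (shift i \<omega>) (shift i \<omega>')"
  by (auto simp: shift_def glue_def)

text \<open>Resampling commutes with shifts when the index set moves along, and the fresh copy keeps
  its law under the shift.\<close>

lemma cexp_shift:
  assumes "g \<in> borel_measurable P"
  shows "cexp A (\<lambda>\<omega>. g (shift i \<omega>)) \<omega> = cexp {j. i + j \<in> A} g (shift i \<omega>)"
  unfolding cexp_def glue_shift
  by (rule integral_shift) (rule measurable_compose[OF measurable_glue_snd assms])

section \<open>Marginal projections and their products\<close>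

definition mproj :: "'d::finite \<Rightarrow> int \<Rightarrow> ((int ^ 'd \<Rightarrow> real) \<Rightarrow> real) \<Rightarrow> (int ^ 'd \<Rightarrow> real) \<Rightarrow> real" where
  "mproj q l g = (\<lambda>\<omega>. cexp (halfspace_le q l) g \<omega> - cexp (halfspace_le q (l - 1)) g \<omega>)"

text \<open>The index is a function, not a vector, so that one coordinate at a time can be split off
  when summing over products of ranges.\<close>

definition cproj :: "'d::finite list \<Rightarrow> ('d \<Rightarrow> int) \<Rightarrow> ((int ^ 'd \<Rightarrow> real) \<Rightarrow> real) \<Rightarrow> (int ^ 'd \<Rightarrow> real) \<Rightarrow> real" where
  "cproj qs j = foldr (\<lambda>q. mproj q (j q)) qs"

lemma cproj_Nil [simp]: "cproj [] j g = g"
  by (simp add: cproj_def)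

lemma cproj_Cons [simp]: "cproj (q # qs) j g = mproj q (j q) (cproj qs j g)"
  by (simp add: cproj_def)

lemma borel_measurable_mproj: "g \<in> borel_measurable P \<Longrightarrow> mproj q l g \<in> borel_measurable P"
  unfolding mproj_def by (intro borel_measurable_diff borel_measurable_cexp)

lemma square_integrable_mproj:
  assumes "square_integrable P g"
  shows "square_integrable P (mproj q l g)" "L2_norm P (mproj q l g) \<le> 2 * L2_norm P g"
proof -
  note c = square_integrable_cexp(1)[OF assms] and n = square_integrable_cexp(2)[OF assms]
  show "square_integrable P (mproj q l g)"
    unfolding mproj_def by (intro square_integrable_diff c)
  show "L2_norm P (mproj q l g) \<le> 2 * L2_norm P g"
    unfolding mproj_def
    using L2_norm_triangle_diff[OF c[of "halfspace_le q l"] c[of "halfspace_le q (l - 1)"]]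
      n[of "halfspace_le q l"] n[of "halfspace_le q (l - 1)"] by linarith
qed

lemma square_integrable_cproj:
  assumes "square_integrable P g"
  shows "square_integrable P (cproj qs j g) \<and> L2_norm P (cproj qs j g) \<le> 2 ^ length qs * L2_norm P g"
proof (induction qs)
  case (Cons q qs)
  then show ?case
    using square_integrable_mproj[of "cproj qs j g" q "j q"] by auto
qed (simp add: assms)

lemma borel_measurable_cproj: "g \<in> borel_measurable P \<Longrightarrow> cproj qs j g \<in> borel_measurable P"
  by (induction qs) (auto intro: borel_measurable_mproj)

text \<open>The shift by \<open>i\<close> carries the half-space at level \<open>l\<close> to the
  one at level \<open>l - i $ q\<close>, in every direction.\<close>

lemma cproj_shift:
  assumes "g \<in> borel_measurable P"
  shows "cproj qs j (\<lambda>\<omega>. g (shift i \<omega>)) = (\<lambda>\<omega>. cproj qs (\<lambda>q. j q - i $ q) g (shift i \<omega>))"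
proof (induction qs)
  case (Cons q qs)
  have *: "{k. i + k \<in> halfspace_le q l} = halfspace_le q (l - i $ q)" for l
    by (auto simp: halfspace_le_def)
  have e: "j q - 1 - i $ q = j q - i $ q - 1" by simp
  show ?case
    using borel_measurable_cproj[OF assms, of qs "\<lambda>q. j q - i $ q"]
    by (simp only: cproj_Cons Cons mproj_def cexp_shift * e)
qed simp

text \<open>A difference of two averages at most doubles a uniform bound.\<close>

lemma cproj_bound: "(\<And>\<omega>. \<bar>g \<omega>\<bar> \<le> B) \<Longrightarrow> \<bar>cproj qs j g \<omega>\<bar> \<le> 2 ^ length qs * B"
proof (induction qs arbitrary: \<omega>)
  case (Cons q qs)
  have "\<bar>cexp A (cproj qs j g) \<omega>\<bar> \<le> 2 ^ length qs * B" for A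
    by (rule cexp_bound) (rule Cons.IH[OF Cons.prems])
  from this[of "halfspace_le q (j q)"] this[of "halfspace_le q (j q - 1)"]
  show ?case by (simp add: mproj_def)
qed simp

lemma depends_on_mproj: "depends_on A g \<Longrightarrow> depends_on A (mproj q l g)"
  unfolding mproj_def
  by (intro depends_on_compose2[where h = "(-)"] depends_on_mono[OF depends_on_cexp_inherit]) auto

lemma depends_on_cproj: "depends_on A g \<Longrightarrow> depends_on A (cproj qs j g)"
  by (induction qs) (auto intro: depends_on_mproj)

lemma depends_on_mproj_halfspace: "depends_on (halfspace_le q l) (mproj q l g)"
  unfolding mproj_def
  by (intro depends_on_compose2[where h = "(-)"] depends_on_cexp depends_on_mono[OF depends_on_cexp halfspace_le_mono]) simp

text \<open>The projection in direction \<open>q\<close> creates this dependence, and those applied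
  after it preserve it.\<close>

lemma depends_on_cproj_halfspace: "q \<in> set qs \<Longrightarrow> depends_on (halfspace_le q (j q)) (cproj qs j g)"
  by (induction qs) (auto intro: depends_on_mproj depends_on_mproj_halfspace)

text \<open>Two configurations that agree on the intersection are joined by a chain of glued ones,
  each step changing only coordinates outside one of the sets.\<close>

lemma depends_on_Inter:
  fixes g :: "('i \<Rightarrow> 'a) \<Rightarrow> 'b"
  assumes "finite Q" "\<And>q. q \<in> Q \<Longrightarrow> depends_on (A q) g"
  shows "depends_on (\<Inter>q\<in>Q. A q) g"
  using assms
proof (induction Q rule: finite_induct)
  case empty
  show ?case by (auto simp: depends_on_def intro!: arg_cong[where f = g])
next
  case (insert q Q)
  show ?case
  proof (rule depends_onI)
    fix \<omega> \<omega>' :: "'i \<Rightarrow> 'a" assume a: "\<And>j. j \<in> (\<Inter>q\<in>insert q Q. A q) \<Longrightarrow> \<omega> j = \<omega>' j"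
    have "g \<omega> = g (glue (A q) \<omega> \<omega>')"
      using insert.prems[of q] by (simp add: depends_on_glue)
    also have "\<dots> = g \<omega>'"
    proof -
      have "depends_on (\<Inter>q\<in>Q. A q) g" by (rule insert.IH) (rule insert.prems, simp)
      moreover have "glue (A q) \<omega> \<omega>' j = \<omega>' j" if "j \<in> (\<Inter>q\<in>Q. A q)" for j
        using that a[of j] by (simp add: glue_def)
      ultimately show ?thesis by (rule depends_onD)
    qed
    finally show "g \<omega> = g \<omega>'" .
  qed
qed

lemma mproj_symmetric:
  assumes "square_integrable P g" "square_integrable P h"
  shows "(\<integral>\<omega>. h \<omega> * mproj q l g \<omega> \<partial>P) = (\<integral>\<omega>. mproj q l h \<omega> * g \<omega> \<partial>P)"
proof -
  note c = square_integrable_mult[OF assms(2) square_integrable_cexp(1)[OF assms(1)]]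
    square_integrable_mult[OF square_integrable_cexp(1)[OF assms(2)] assms(1)]
  show ?thesis
    using c by (simp add: mproj_def right_diff_distrib left_diff_distrib cexp_symmetric[OF assms])
qed

text \<open>Both conditional expectations in \<open>mproj\<close> have the same inner product with
  \<open>w\<close>, namely that of \<open>g\<close>.\<close>

lemma integral_mult_mproj_eq_0:
  assumes g: "square_integrable P g" and w: "square_integrable P w" "depends_on (halfspace_le q (l - 1)) w"
  shows "(\<integral>\<omega>. w \<omega> * mproj q l g \<omega> \<partial>P) = 0"
proof -
  have d: "depends_on (halfspace_le q l) w"
    by (rule depends_on_mono[OF w(2) halfspace_le_mono]) simp
  note c = square_integrable_mult[OF w(1) square_integrable_cexp(1)[OF g]]
  note i = square_integrable_mult[OF w(1) g]
  show ?thesis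
    using c by (simp add: mproj_def right_diff_distrib integral_mult_cexp[OF d i] integral_mult_cexp[OF w(2) i])
qed

text \<open>Projections in other directions are moved onto \<open>w\<close> by symmetry and leave it
  in its half-space, until the projection in direction \<open>q\<close> meets it.\<close>

lemma integral_mult_cproj_eq_0:
  assumes g: "square_integrable P g" and "q \<in> set qs"
    and "square_integrable P w" "depends_on (halfspace_le q (j q - 1)) w"
  shows "(\<integral>\<omega>. w \<omega> * cproj qs j g \<omega> \<partial>P) = 0"
  using assms(2-)
proof (induction qs arbitrary: w)
  case (Cons p qs)
  note c = conjunct1[OF square_integrable_cproj[OF g, of qs j]]
  show ?case
  proof (cases "q = p")
    case True
    then show ?thesis using Cons.prems integral_mult_mproj_eq_0[OF c] by simp
  next
    case False
    then have "q \<in> set qs" using Cons.prems by simp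
    then have "(\<integral>\<omega>. mproj p (j p) w \<omega> * cproj qs j g \<omega> \<partial>P) = 0"
      using Cons.prems by (intro Cons.IH square_integrable_mproj depends_on_mproj)
    then show ?thesis using mproj_symmetric[OF c Cons.prems(2)] by simp
  qed
qed simp

lemma mproj_cong_AE:
  assumes "AE \<omega> in P. g \<omega> = h \<omega>" "g \<in> borel_measurable P" "h \<in> borel_measurable P"
  shows "AE \<omega> in P. mproj q l g \<omega> = mproj q l h \<omega>"
  using cexp_cong_AE[OF assms, of "halfspace_le q l"] cexp_cong_AE[OF assms, of "halfspace_le q (l - 1)"]
  by eventually_elim (simp add: mproj_def)

lemma mproj_diff_AE:
  assumes "integrable P g" "integrable P h"
  shows "AE \<omega> in P. mproj q l (\<lambda>\<omega>. g \<omega> - h \<omega>) \<omega> = mproj q l g \<omega> - mproj q l h \<omega>"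
  using cexp_diff_AE[OF assms, of "halfspace_le q l"] cexp_diff_AE[OF assms, of "halfspace_le q (l - 1)"]
  by eventually_elim (simp add: mproj_def)

lemma square_integrable_imp_integrable_P: "square_integrable P g \<Longrightarrow> integrable P g"
  by (rule finite_measure.square_integrable_integrable[OF prob_space.axioms(1)[OF prob_space_P]])

lemma cproj_diff_AE:
  assumes "square_integrable P g" "square_integrable P h"
  shows "AE \<omega> in P. cproj qs j (\<lambda>\<omega>. g \<omega> - h \<omega>) \<omega> = cproj qs j g \<omega> - cproj qs j h \<omega>"
proof (induction qs)
  case (Cons q qs)
  have s: "square_integrable P (cproj qs j g)" "square_integrable P (cproj qs j h)"
      "square_integrable P (cproj qs j (\<lambda>\<omega>. g \<omega> - h \<omega>))"
    using square_integrable_cproj assms square_integrable_diff[OF assms] by blast+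
  have "AE \<omega> in P. mproj q (j q) (cproj qs j (\<lambda>\<omega>. g \<omega> - h \<omega>)) \<omega> = mproj q (j q) (\<lambda>\<omega>. cproj qs j g \<omega> - cproj qs j h \<omega>) \<omega>"
    by (rule mproj_cong_AE[OF Cons square_integrable_measurable[OF s(3)]
          square_integrable_measurable[OF square_integrable_diff[OF s(1,2)]]])
  moreover have "AE \<omega> in P. mproj q (j q) (\<lambda>\<omega>. cproj qs j g \<omega> - cproj qs j h \<omega>) \<omega>
      = mproj q (j q) (cproj qs j g) \<omega> - mproj q (j q) (cproj qs j h) \<omega>"
    by (intro mproj_diff_AE square_integrable_imp_integrable_P s)
  ultimately show ?case by eventually_elim simp
qed simp

section \<open>Identification with the conditional expectations given the pasts\<close>

text \<open>The sets whose indicators depend on given coordinates form a sigma-algebra, so only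
  generators have to be inspected.\<close>

lemma depends_on_indicator_sigma_sets:
  fixes A :: "('i \<Rightarrow> 'a) set"
  assumes "A \<in> sigma_sets UNIV G" "\<And>B. B \<in> G \<Longrightarrow> depends_on H (indicator B :: _ \<Rightarrow> real)"
  shows "depends_on H (indicator A :: _ \<Rightarrow> real)"
proof (rule depends_onI)
  fix \<omega> \<omega>' :: "'i \<Rightarrow> 'a" assume eq: "\<And>j. j \<in> H \<Longrightarrow> \<omega> j = \<omega>' j"
  from assms(1) have "indicator A \<omega> = (indicator A \<omega>' :: real)"
  proof induction
    case (Basic a)
    show ?case by (rule depends_onD[OF assms(2)[OF Basic]]) (rule eq)
  next
    case (Union a)
    then have "\<omega> \<in> a i \<longleftrightarrow> \<omega>' \<in> a i" for i by (simp add: indicator_def of_bool_eq_iff)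
    then show ?case by (simp add: indicator_def)
  qed (simp_all add: indicator_def of_bool_eq_iff)
  then show "indicator A \<omega> = (indicator A \<omega>' :: real)" .
qed

lemma sets_marginal_past_depends:
  assumes "A \<in> sets (marginal_past q l)"
  shows "depends_on (halfspace_le q l) (indicator A :: _ \<Rightarrow> real)"
proof -
  have past: "depends_on {j. j \<le> i} (indicator A :: _ \<Rightarrow> real)" if "A \<in> sets (past i)" for A and i :: "int ^ 'a"
  proof -
    have "A \<in> sigma_sets UNIV {(\<lambda>\<omega>. \<omega> j) -` A |j A. j \<le> i \<and> A \<in> sets borel}"
      using that unfolding past_def by simp
    then show ?thesis
      by (rule depends_on_indicator_sigma_sets) (auto simp: depends_on_def indicator_def)
  qed
  have "A \<in> sigma_sets UNIV (\<Union>i\<in>{i. i $ q \<le> l}. sets (past i))"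
    using assms unfolding marginal_past_def by simp
  then show ?thesis
  proof (rule depends_on_indicator_sigma_sets)
    fix B assume "B \<in> (\<Union>i\<in>{i. i $ q \<le> l}. sets (past i))"
    then obtain i where i: "i $ q \<le> l" "B \<in> sets (past i)" by auto
    have "{j. j \<le> i} \<subseteq> halfspace_le q l"
      using i(1) by (auto simp: halfspace_le_def less_eq_vec_def intro: order_trans)
    then show "depends_on (halfspace_le q l) (indicator B :: _ \<Rightarrow> real)"
      by (rule depends_on_mono[OF past[OF i(2)]])
  qed
qed

lemma marginal_past_coordinate:
  assumes "j $ q \<le> l"
  shows "(\<lambda>\<omega>. \<omega> j) \<in> borel_measurable (marginal_past q l)"
proof (rule measurableI)
  fix B :: "real set" assume B: "B \<in> sets borel"
  have "(\<lambda>\<omega>. \<omega> j) -` B \<in> sets (past j)" unfolding past_def using B by (auto intro!: sigma_sets.Basic)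
  then have "(\<lambda>\<omega>. \<omega> j) -` B \<in> sets (marginal_past q l)"
    unfolding marginal_past_def using assms by (auto intro!: sigma_sets.Basic)
  moreover have "space (marginal_past q l) = UNIV" by (simp add: marginal_past_def)
  ultimately show "(\<lambda>\<omega>. \<omega> j) -` B \<inter> space (marginal_past q l) \<in> sets (marginal_past q l)" by simp
qed simp

lemma subalgebra_marginal_past: "subalgebra P (marginal_past q l)"
proof -
  have past: "sets (past i) \<subseteq> sets P" for i :: "int ^ 'a"
  proof -
    have "(\<lambda>\<omega>. \<omega> j) -` A \<in> sets P" if "A \<in> sets borel" for j :: "int ^ 'a" and A
      using measurable_sets[OF measurable_coordinate[of j] that] by simp
    then show ?thesis unfolding past_def
      using sets.sigma_sets_subset[of "{(\<lambda>\<omega>. \<omega> j) -` A |j A. j \<le> i \<and> A \<in> sets borel}" P] by auto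
  qed
  then show ?thesis unfolding subalgebra_def marginal_past_def
    using sets.sigma_sets_subset[of "\<Union>i\<in>{i. i $ q \<le> l}. sets (past i)" P] by auto
qed

text \<open>By uniqueness it suffices to test \<open>cexp\<close> on events of the past and to see
  that it is measurable there.\<close>

lemma real_cond_exp_marginal_past:
  assumes g: "integrable P g"
  shows "AE \<omega> in P. real_cond_exp P (marginal_past q l) g \<omega> = cexp (halfspace_le q l) g \<omega>"
proof -
  interpret finite_measure_subalgebra P "marginal_past q l"
    by (intro finite_measure_subalgebra.intro finite_measure_subalgebra_axioms.intro subalgebra_marginal_past
        prob_space.axioms(1)[OF prob_space_P])
  show ?thesis
  proof (rule real_cond_exp_charact)
    fix A assume A: "A \<in> sets (marginal_past q l)"
    have AP: "A \<in> sets P" using A subalgebra_marginal_past by (auto simp: subalgebra_def)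
    have i: "integrable P (\<lambda>x. indicator A x * g x)"
      using integrable_mult_indicator[OF AP g] by simp
    show "(\<integral>x\<in>A. g x \<partial>P) = (\<integral>x\<in>A. cexp (halfspace_le q l) g x \<partial>P)"
      unfolding set_lebesgue_integral_def
      using integral_mult_cexp[OF sets_marginal_past_depends[OF A] i] by simp
  next
    \<comment> \<open>Freezing the coordinates outside the half-space at 0 does not change a
      function that depends on the half-space only, and exhibits it as measurable in the
      past.\<close>
    have "(\<lambda>\<omega>. glue (halfspace_le q l) \<omega> (\<lambda>_. 0)) \<in> marginal_past q l \<rightarrow>\<^sub>M P"
    proof (rule measurable_into_P)
      fix j :: "int ^ 'a"
      show "(\<lambda>x. glue (halfspace_le q l) x (\<lambda>_. 0) j) \<in> borel_measurable (marginal_past q l)"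
        using marginal_past_coordinate[of j q l]
        by (cases "j \<in> halfspace_le q l") (simp_all add: glue_def halfspace_le_def)
    qed
    from measurable_compose[OF this borel_measurable_cexp[OF borel_measurable_integrable[OF g], of "halfspace_le q l"]]
    show "cexp (halfspace_le q l) g \<in> borel_measurable (marginal_past q l)"
      by (simp add: depends_on_glue[OF depends_on_cexp])
    show "integrable P g" by (rule g)
    show "integrable P (cexp (halfspace_le q l) g)" by (rule integrable_cexp[OF g])
  qed
qed

lemma marginal_proj_AE:
  assumes g: "integrable P g"
  shows "AE \<omega> in P. marginal_proj \<mu> q l g \<omega> = mproj q l g \<omega>"
  using real_cond_exp_marginal_past[OF g, of q l] real_cond_exp_marginal_past[OF g, of q "l - 1"]
  by eventually_elim (simp add: marginal_proj_def mproj_def field_measure_def)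

lemma marginal_proj_cong_AE:
  assumes "AE \<omega> in P. g \<omega> = h \<omega>" "g \<in> borel_measurable P" "h \<in> borel_measurable P"
  shows "AE \<omega> in P. marginal_proj \<mu> q l g \<omega> = marginal_proj \<mu> q l h \<omega>"
proof -
  have *: "AE \<omega> in P. real_cond_exp P (marginal_past q l) g \<omega> = real_cond_exp P (marginal_past q l) h \<omega>" for l
  proof -
    interpret finite_measure_subalgebra P "marginal_past q l"
      by (intro finite_measure_subalgebra.intro finite_measure_subalgebra_axioms.intro subalgebra_marginal_past
          prob_space.axioms(1)[OF prob_space_P])
    show ?thesis by (rule real_cond_exp_cong[OF assms])
  qed
  show ?thesis
    using *[of l] *[of "l - 1"]
    by eventually_elim (simp add: marginal_proj_def field_measure_def)
qed

lemma borel_measurable_marginal_proj: "marginal_proj \<mu> q l g \<in> borel_measurable P"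
  unfolding marginal_proj_def field_measure_def
  by (intro borel_measurable_diff borel_measurable_cond_exp2)

text \<open>The same choice as in the definition of \<open>proj\<close>, so that both compose the
  directions in the same order.\<close>

definition coords :: "'d::finite list" where
  "coords = (SOME qs. distinct qs \<and> set qs = UNIV)"

lemma coords [simp]: "distinct (coords :: 'd::finite list)" "set (coords :: 'd list) = UNIV"
  using someI_ex[OF finite_distinct_list[OF finite[of "UNIV :: 'd set"]]] unfolding coords_def
  by (auto simp: conj_commute)

lemma proj_AE:
  fixes g :: "(int ^ 'd::finite \<Rightarrow> real) \<Rightarrow> real"
  assumes g: "square_integrable P g"
  shows "AE \<omega> in P. proj \<mu> j g \<omega> = cproj coords (($) j) g \<omega>" "proj \<mu> j g \<in> borel_measurable P"
proof -
  have "foldr (\<lambda>q. marginal_proj \<mu> q (j $ q)) qs g \<in> borel_measurable P \<and>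
      (AE \<omega> in P. foldr (\<lambda>q. marginal_proj \<mu> q (j $ q)) qs g \<omega> = cproj qs (($) j) g \<omega>)" for qs
  proof (induction qs)
    case (Cons q qs)
    note s = conjunct1[OF square_integrable_cproj[OF g, of qs "($) j"]]
    from marginal_proj_cong_AE[OF conjunct2[OF Cons] conjunct1[OF Cons] square_integrable_measurable[OF s], of q "j $ q"]
      marginal_proj_AE[OF square_integrable_imp_integrable_P[OF s], of q "j $ q"]
    have "AE \<omega> in P. marginal_proj \<mu> q (j $ q) (foldr (\<lambda>q. marginal_proj \<mu> q (j $ q)) qs g) \<omega> = mproj q (j $ q) (cproj qs (($) j) g) \<omega>"
      by eventually_elim simp
    then show ?case by (simp add: borel_measurable_marginal_proj)
  qed (use g in \<open>simp add: square_integrable_def\<close>)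
  from this[of coords]
  show "AE \<omega> in P. proj \<mu> j g \<omega> = cproj coords (($) j) g \<omega>" "proj \<mu> j g \<in> borel_measurable P"
    by (simp_all add: proj_def coords_def)
qed

section \<open>Orthomartingale differences\<close>

text \<open>A martingale difference in all directions at once, located at the index 0. The vanishing
  of its conditional expectations is expressed by orthogonality to the square-integrable functions
  of each strict past, without an almost-everywhere clause.\<close>

definition orthodiff :: "((int ^ 'd::finite \<Rightarrow> real) \<Rightarrow> real) \<Rightarrow> bool" where
  "orthodiff e \<longleftrightarrow> square_integrable P e \<and> depends_on {..0} e \<and>
     (\<forall>q w. square_integrable P w \<longrightarrow> depends_on (halfspace_le q (-1)) w \<longrightarrow> (\<integral>\<omega>. w \<omega> * e \<omega> \<partial>P) = 0)"

lemma orthodiff_square_integrable: "orthodiff e \<Longrightarrow> square_integrable P e"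
  by (simp add: orthodiff_def)

lemma orthodiff_cproj:
  fixes g :: "(int ^ 'd::finite \<Rightarrow> real) \<Rightarrow> real"
  assumes g: "square_integrable P g"
  shows "orthodiff (cproj coords (\<lambda>_. 0) g)"
proof -
  have "depends_on (\<Inter>q\<in>UNIV. halfspace_le q 0) (cproj coords (\<lambda>_. 0) g)"
    using depends_on_cproj_halfspace[of _ coords "\<lambda>_. 0" g] coords(2) by (intro depends_on_Inter) auto
  moreover have "(\<Inter>q\<in>UNIV. halfspace_le q 0) = {..0 :: int ^ 'd}"
    by (auto simp: halfspace_le_def less_eq_vec_def)
  ultimately show ?thesis
    using square_integrable_cproj[OF g] integral_mult_cproj_eq_0[OF g, of _ coords _ "\<lambda>_. 0"]
    by (simp add: orthodiff_def)
qed

lemma orthodiff_diff: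
  assumes "orthodiff u" "orthodiff v"
  shows "orthodiff (\<lambda>\<omega>. u \<omega> - v \<omega>)"
  using assms unfolding orthodiff_def
  by (auto simp: right_diff_distrib square_integrable_diff square_integrable_mult
      intro: depends_on_compose2[where h = "(-)"])

lemma orthodiff_halfspace:
  assumes "orthodiff e"
  shows "depends_on (halfspace_le q 0) e"
  using assms unfolding orthodiff_def
  by (auto intro!: depends_on_mono[of "{..0}"] simp: halfspace_le_def less_eq_vec_def)

text \<open>In each direction the conditional expectation at level 0 is the identity on
  \<open>e\<close>, and the one at level -1 vanishes.\<close>

lemma cproj_orthodiff:
  assumes e: "orthodiff e"
  shows "AE \<omega> in P. cproj qs (\<lambda>_. 0) e \<omega> = e \<omega>"
proof (induction qs)
  case (Cons q qs)
  note s = orthodiff_square_integrable[OF e]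
  have z: "AE \<omega> in P. cexp (halfspace_le q (-1)) e \<omega> = 0"
    using e by (intro cexp_eq_zero_AE[OF s]) (auto simp: orthodiff_def)
  have "AE \<omega> in P. mproj q 0 (cproj qs (\<lambda>_. 0) e) \<omega> = mproj q 0 e \<omega>"
    by (rule mproj_cong_AE[OF Cons])
      (auto intro: square_integrable_measurable s conjunct1[OF square_integrable_cproj])
  with z show ?case
    by eventually_elim (simp add: mproj_def cexp_id[OF orthodiff_halfspace[OF e]])
qed simp

lemma integral_mult_orthodiff_shift:
  assumes e: "orthodiff e" and w: "square_integrable P w" "depends_on (halfspace_le q (i $ q - 1)) w"
  shows "(\<integral>\<omega>. w \<omega> * e (shift i \<omega>) \<partial>P) = 0"
proof -
  let ?w = "\<lambda>\<omega>. w (shift (- i) \<omega>)"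
  have s: "square_integrable P ?w" by (rule square_integrable_shift[OF w(1)])
  have "depends_on (halfspace_le q (-1)) ?w"
    by (rule depends_on_mono[OF depends_on_shift[OF w(2)]]) (auto simp: halfspace_le_def)
  then have "(\<integral>\<omega>. ?w \<omega> * e \<omega> \<partial>P) = 0" using e s by (auto simp: orthodiff_def)
  moreover have "(\<integral>\<omega>. ?w \<omega> * e \<omega> \<partial>P) = (\<integral>\<omega>. w (shift (- i) (shift i \<omega>)) * e (shift i \<omega>) \<partial>P)"
    by (rule integral_shift[symmetric])
      (intro borel_measurable_times square_integrable_measurable s orthodiff_square_integrable e)
  ultimately show ?thesis by (simp add: shift_shift)
qed

text \<open>Some coordinate separates \<open>i\<close> and \<open>j\<close>; the factor with the
  smaller one lies in the strict past of the other in that direction.\<close>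

lemma orthodiff_shift_orthogonal:
  assumes u: "orthodiff u" and v: "orthodiff v" and ij: "i \<noteq> j"
  shows "(\<integral>\<omega>. u (shift i \<omega>) * v (shift j \<omega>) \<partial>P) = 0"
proof -
  have *: "(\<integral>\<omega>. u (shift i \<omega>) * v (shift j \<omega>) \<partial>P) = 0"
    if u: "orthodiff u" and v: "orthodiff v" and q: "i $ q < j $ q" for u v :: "(int ^ 'a \<Rightarrow> real) \<Rightarrow> real" and i j q
  proof (rule integral_mult_orthodiff_shift[OF v, where q = q])
    show "square_integrable P (\<lambda>\<omega>. u (shift i \<omega>))"
      by (rule square_integrable_shift[OF orthodiff_square_integrable[OF u]])
    have dep: "depends_on {..0} u" using u by (simp add: orthodiff_def)
    have sub: "(+) i ` {..0} \<subseteq> halfspace_le q (j $ q - 1)"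
    proof (rule image_subsetI)
      fix k :: "int ^ 'a" assume "k \<in> {..0}"
      then have "k $ q \<le> 0" by (simp add: less_eq_vec_def)
      then show "i + k \<in> halfspace_le q (j $ q - 1)" using q by (simp add: halfspace_le_def)
    qed
    show "depends_on (halfspace_le q (j $ q - 1)) (\<lambda>\<omega>. u (shift i \<omega>))"
      by (rule depends_on_mono[OF depends_on_shift[OF dep] sub])
  qed
  obtain q where "i $ q \<noteq> j $ q" using ij by (auto simp: vec_eq_iff)
  then consider "i $ q < j $ q" | "j $ q < i $ q" by linarith
  then show ?thesis
    using *[OF u v, of i q j] *[OF v u, of j q i] by cases (simp_all add: mult.commute)
qed

section \<open>Second moments of sums over index sets\<close>

definition field_sum :: "((int ^ 'd::finite \<Rightarrow> real) \<Rightarrow> real) \<Rightarrow> (int ^ 'd) set \<Rightarrow> (int ^ 'd \<Rightarrow> real) \<Rightarrow> real" where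
  "field_sum g A \<omega> = (\<Sum>i\<in>A. g (shift i \<omega>))"

lemma square_integrable_field_sum: "square_integrable P g \<Longrightarrow> square_integrable P (field_sum g A)"
  unfolding field_sum_def by (intro square_integrable_sum square_integrable_shift)

text \<open>Only the diagonal terms survive, one for each common index.\<close>

lemma integral_field_sum_mult:
  assumes u: "orthodiff u" and v: "orthodiff v" and fin: "finite A" "finite B"
  shows "(\<integral>\<omega>. field_sum u A \<omega> * field_sum v B \<omega> \<partial>P) = real (card (A \<inter> B)) * (\<integral>\<omega>. u \<omega> * v \<omega> \<partial>P)"
proof -
  have s: "square_integrable P u" "square_integrable P v"
    using u v by (auto intro: orthodiff_square_integrable)
  have i: "integrable P (\<lambda>\<omega>. u (shift i \<omega>) * v (shift j \<omega>))" for i j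
    by (intro square_integrable_mult square_integrable_shift s)
  have "(\<integral>\<omega>. field_sum u A \<omega> * field_sum v B \<omega> \<partial>P) = (\<Sum>i\<in>A. \<Sum>j\<in>B. \<integral>\<omega>. u (shift i \<omega>) * v (shift j \<omega>) \<partial>P)"
    unfolding field_sum_def sum_product using i by simp
  also have "\<dots> = (\<Sum>i\<in>A. \<Sum>j\<in>B. if i = j then \<integral>\<omega>. u \<omega> * v \<omega> \<partial>P else 0)"
  proof (intro sum.cong refl)
    fix i j
    have "(\<integral>\<omega>. u (shift j \<omega>) * v (shift j \<omega>) \<partial>P) = (\<integral>\<omega>. u \<omega> * v \<omega> \<partial>P)"
      using s by (intro integral_shift) (auto simp: square_integrable_def)
    then show "(\<integral>\<omega>. u (shift i \<omega>) * v (shift j \<omega>) \<partial>P) = (if i = j then \<integral>\<omega>. u \<omega> * v \<omega> \<partial>P else 0)"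
      using orthodiff_shift_orthogonal[OF u v, of i j] by (cases "i = j") simp_all
  qed
  also have "\<dots> = (\<Sum>i\<in>A. if i \<in> B then \<integral>\<omega>. u \<omega> * v \<omega> \<partial>P else 0)"
    using fin by (simp add: sum.delta)
  also have "\<dots> = real (card (A \<inter> B)) * (\<integral>\<omega>. u \<omega> * v \<omega> \<partial>P)"
    using fin by (simp add: sum.If_cases)
  finally show ?thesis .
qed

lemma L2_norm_field_sum:
  assumes e: "orthodiff e" and fin: "finite A"
  shows "L2_norm P (field_sum e A) = sqrt (card A) * L2_norm P e"
  using integral_field_sum_mult[OF e e fin fin]
  by (simp add: L2_norm_def power2_eq_square real_sqrt_mult)

text \<open>The factor counts the symmetric difference of \<open>A\<close> and \<open>B\<close>, so
  translating a large box costs only its boundary.\<close>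

lemma L2_norm_field_sum_diff:
  assumes e: "orthodiff e" and fin: "finite A" "finite B"
  shows "(L2_norm P (\<lambda>\<omega>. field_sum e A \<omega> - field_sum e B \<omega>))\<^sup>2
    = (real (card A) + real (card B) - 2 * real (card (A \<inter> B))) * (L2_norm P e)\<^sup>2"
proof -
  have s: "square_integrable P (field_sum e A)" for A
    by (intro square_integrable_field_sum orthodiff_square_integrable e)
  have "(L2_norm P (\<lambda>\<omega>. field_sum e A \<omega> - field_sum e B \<omega>))\<^sup>2 =
      (\<integral>\<omega>. field_sum e A \<omega> * field_sum e A \<omega> + field_sum e B \<omega> * field_sum e B \<omega>
        - 2 * (field_sum e A \<omega> * field_sum e B \<omega>) \<partial>P)"
    unfolding L2_norm_power2 by (simp add: power2_eq_square algebra_simps)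
  also have "\<dots> = (\<integral>\<omega>. field_sum e A \<omega> * field_sum e A \<omega> \<partial>P) + (\<integral>\<omega>. field_sum e B \<omega> * field_sum e B \<omega> \<partial>P)
      - 2 * (\<integral>\<omega>. field_sum e A \<omega> * field_sum e B \<omega> \<partial>P)"
    using square_integrable_mult[OF s s] by simp
  moreover have "(L2_norm P e)\<^sup>2 = (\<integral>\<omega>. e \<omega> * e \<omega> \<partial>P)"
    unfolding L2_norm_power2 by (simp add: power2_eq_square)
  ultimately show ?thesis
    unfolding integral_field_sum_mult[OF e e fin(1) fin(1)] integral_field_sum_mult[OF e e fin(2) fin(2)]
      integral_field_sum_mult[OF e e fin]
    by (simp add: algebra_simps)
qed

end

section \<open>Maximal inequalities\<close>

definition running_max :: "(nat \<Rightarrow> real) \<Rightarrow> nat \<Rightarrow> real" where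
  "running_max z n = Max (z ` {..n})"

lemma running_max_0 [simp]: "running_max z 0 = z 0"
  by (simp add: running_max_def)

lemma running_max_Suc: "running_max z (Suc n) = max (running_max z n) (z (Suc n))"
  by (simp add: running_max_def atMost_Suc max.commute)

lemma running_max_ge: "z n \<le> running_max z n"
  by (simp add: running_max_def)

text \<open>A pathwise form of Doob's inequality: the sum is a discrete stochastic integral of the
  running maximum, whose mean is nonnegative for a nonnegative submartingale; taking means leaves
  the constant 4.\<close>

lemma doob_pathwise:
  "(running_max z N)\<^sup>2 + 4 * (\<Sum>i<N. running_max z i * (z (Suc i) - z i)) \<le> 4 * (z N)\<^sup>2"
proof -
  \<comment> \<open>The induction carries this stronger bound: equality while the maximum stays, a
    square to spare when it jumps. The square of \<open>2 * z N - running_max z N\<close> then gives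
    the claim.\<close>
  have "4 * (\<Sum>i<N. running_max z i * (z (Suc i) - z i)) \<le> 4 * (running_max z N * z N) - 2 * (running_max z N)\<^sup>2"
  proof (induction N)
    case (Suc N)
    have "4 * (running_max z N * (z (Suc N) - z N)) + (4 * (running_max z N * z N) - 2 * (running_max z N)\<^sup>2)
        \<le> 4 * (running_max z (Suc N) * z (Suc N)) - 2 * (running_max z (Suc N))\<^sup>2"
    proof (cases "z (Suc N) \<le> running_max z N")
      case True
      then show ?thesis by (simp add: running_max_Suc algebra_simps)
    next
      case False
      have "0 \<le> (z (Suc N) - running_max z N)\<^sup>2" by simp
      with False show ?thesis by (simp add: running_max_Suc algebra_simps power2_eq_square)
    qed
    with Suc show ?case by simp
  qed (simp add: power2_eq_square)
  moreover have "0 \<le> (2 * z N - running_max z N)\<^sup>2" by simp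
  ultimately show ?thesis by (simp add: power2_eq_square algebra_simps)
qed

lemma square_integrable_running_max:
  assumes "\<And>i. i \<le> N \<Longrightarrow> square_integrable M (Z i)"
  shows "square_integrable M (\<lambda>x. running_max (\<lambda>i. Z i x) N)"
  using assms
proof (induction N)
  case (Suc N)
  let ?m = "\<lambda>x. running_max (\<lambda>i. Z i x) N"
  have m: "square_integrable M ?m" "square_integrable M (Z (Suc N))" using Suc by auto
  show ?case unfolding running_max_Suc
  proof (rule square_integrable_bound[OF square_integrable_add[OF m[THEN square_integrable_abs]]])
    show "(\<lambda>x. max (?m x) (Z (Suc N) x)) \<in> borel_measurable M"
      using m by (intro borel_measurable_max) (auto simp: square_integrable_def)
    show "AE x in M. \<bar>max (?m x) (Z (Suc N) x)\<bar> \<le> \<bar>\<bar>?m x\<bar> + \<bar>Z (Suc N) x\<bar>\<bar>" by (intro AE_I2) linarith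
  qed
qed simp

text \<open>The submartingale property is asked for only against the running maximum, which is the
  weight in the pathwise inequality.\<close>

lemma doob_L2:
  assumes Z: "\<And>i. i \<le> N \<Longrightarrow> square_integrable M (Z i)"
    and sub: "\<And>i. i < N \<Longrightarrow> (\<integral>x. running_max (\<lambda>i. Z i x) i * Z i x \<partial>M) \<le> (\<integral>x. running_max (\<lambda>i. Z i x) i * Z (Suc i) x \<partial>M)"
  shows "L2_norm M (\<lambda>x. running_max (\<lambda>i. Z i x) N) \<le> 2 * L2_norm M (Z N)"
proof -
  let ?R = "\<lambda>i x. running_max (\<lambda>i. Z i x) i"
  have R: "square_integrable M (?R i)" if "i \<le> N" for i
    using that by (intro square_integrable_running_max Z) auto
  have prod: "integrable M (\<lambda>x. ?R i x * Z i x)" "integrable M (\<lambda>x. ?R i x * Z (Suc i) x)" if "i < N" for i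
    using that by (auto intro!: square_integrable_mult R Z)
  have int: "integrable M (\<lambda>x. \<Sum>i<N. ?R i x * (Z (Suc i) x - Z i x))"
    unfolding right_diff_distrib using prod by auto
  have "0 \<le> (\<Sum>i<N. (\<integral>x. ?R i x * Z (Suc i) x \<partial>M) - (\<integral>x. ?R i x * Z i x \<partial>M))"
    using sub by (intro sum_nonneg) simp
  also have "\<dots> = (\<integral>x. (\<Sum>i<N. ?R i x * (Z (Suc i) x - Z i x)) \<partial>M)"
    unfolding right_diff_distrib using prod by (subst Bochner_Integration.integral_sum) auto
  finally have nn: "0 \<le> (\<integral>x. (\<Sum>i<N. ?R i x * (Z (Suc i) x - Z i x)) \<partial>M)" .
  have "(\<integral>x. (?R N x)\<^sup>2 + 4 * (\<Sum>i<N. ?R i x * (Z (Suc i) x - Z i x)) \<partial>M) \<le> (\<integral>x. 4 * (Z N x)\<^sup>2 \<partial>M)"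
    using int R[of N] Z[of N] doob_pathwise[of "\<lambda>i. Z i _" N]
    by (intro integral_mono) (auto simp: square_integrable_def)
  then have "(\<integral>x. (?R N x)\<^sup>2 \<partial>M) + 4 * (\<integral>x. (\<Sum>i<N. ?R i x * (Z (Suc i) x - Z i x)) \<partial>M) \<le> 4 * (\<integral>x. (Z N x)\<^sup>2 \<partial>M)"
    using int R[of N] by (simp add: square_integrable_def)
  with nn have "(L2_norm M (?R N))\<^sup>2 \<le> (2 * L2_norm M (Z N))\<^sup>2"
    by (simp add: L2_norm_power2 power_mult_distrib)
  then show ?thesis by (rule power2_le_imp_le) simp
qed

text \<open>Orthogonality removes the cubic cross term; the remaining terms let the square root of
  the fourth moment grow at most linearly in \<open>N\<close>.\<close>

lemma fourth_moment_sum: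
  assumes "finite_measure M" and meas: "\<And>k. d k \<in> borel_measurable M" and bdd: "\<And>k x. \<bar>d k x\<bar> \<le> (b k :: real)"
    and orth: "\<And>k. k < N \<Longrightarrow> (\<integral>x. (\<Sum>l<k. d l x) ^ 3 * d k x \<partial>M) = 0"
    and fourth: "\<And>k. k < N \<Longrightarrow> (\<integral>x. d k x ^ 4 \<partial>M) \<le> \<kappa>\<^sup>2" and "0 \<le> \<kappa>"
  shows "(\<integral>x. (\<Sum>l<N. d l x) ^ 4 \<partial>M) \<le> (4 * real N * \<kappa>)\<^sup>2"
  using orth fourth
proof (induction N)
  case (Suc N)
  interpret finite_measure M by fact
  let ?S = "\<lambda>x. \<Sum>l<N. d l x"
  have [measurable]: "d k \<in> borel_measurable M" for k by (rule meas)
  have Sb: "\<bar>?S x\<bar> \<le> (\<Sum>l<N. b l)" for x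
    by (rule order_trans[OF sum_abs sum_mono]) (rule bdd)
  have int: "integrable M (\<lambda>x. ?S x ^ m * d N x ^ k)" for m k
  proof (rule integrable_const_bound[where B = "(\<Sum>l<N. b l) ^ m * b N ^ k"])
    show "AE x in M. norm (?S x ^ m * d N x ^ k) \<le> (\<Sum>l<N. b l) ^ m * b N ^ k"
    proof (rule AE_I2)
      fix x
      have "\<bar>?S x\<bar> ^ m * \<bar>d N x\<bar> ^ k \<le> (\<Sum>l<N. b l) ^ m * b N ^ k"
        by (intro mult_mono power_mono Sb bdd zero_le_power order_trans[OF abs_ge_zero Sb[of x]]) simp_all
      then show "norm (?S x ^ m * d N x ^ k) \<le> (\<Sum>l<N. b l) ^ m * b N ^ k"
        by (simp add: abs_mult power_abs)
    qed
  qed (intro borel_measurable_times borel_measurable_power borel_measurable_sum meas)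
  have sq: "square_integrable M (\<lambda>x. (?S x)\<^sup>2)" "square_integrable M (\<lambda>x. (d N x)\<^sup>2)"
    using int[of 4 0] int[of 0 4] by (simp_all add: square_integrable_def flip: power_mult)
  define a where "a = L2_norm M (\<lambda>x. (?S x)\<^sup>2)"
  have a2: "a\<^sup>2 = (\<integral>x. ?S x ^ 4 \<partial>M)" unfolding a_def L2_norm_power2 by (simp flip: power_mult)
  have a: "0 \<le> a" "a \<le> 4 * real N * \<kappa>"
    using Suc a2 \<open>0 \<le> \<kappa>\<close> power2_le_imp_le[of a "4 * real N * \<kappa>"] by (simp_all add: a_def)
  have "(L2_norm M (\<lambda>x. (d N x)\<^sup>2))\<^sup>2 \<le> \<kappa>\<^sup>2"
    using Suc.prems(2)[of N] unfolding L2_norm_power2 by (simp flip: power_mult)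
  then have dk: "L2_norm M (\<lambda>x. (d N x)\<^sup>2) \<le> \<kappa>" using \<open>0 \<le> \<kappa>\<close> by (rule power2_le_imp_le)
  have cross: "(\<integral>x. (?S x)\<^sup>2 * (d N x)\<^sup>2 \<partial>M) \<le> a * \<kappa>"
    using L2_Cauchy_Schwarz[OF sq] mult_left_mono[OF dk a(1)] unfolding a_def by linarith
  \<comment> \<open>The term \<open>4 * s * t ^ 3\<close> is split into
    \<open>2 * s\<^sup>2 * t\<^sup>2\<close> and \<open>2 * t ^ 4\<close>, so that every cross term
    left is either orthogonal or covered by the Cauchy-Schwarz inequality.\<close>
  have pt: "(s + t) ^ 4 \<le> s ^ 4 + 4 * (s ^ 3 * t) + 8 * (s\<^sup>2 * t\<^sup>2) + 3 * t ^ 4" for s t :: real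
  proof -
    have "0 \<le> 2 * t\<^sup>2 * (s - t)\<^sup>2" by simp
    then show ?thesis by (simp add: power2_eq_square power4_eq_xxxx power3_eq_cube algebra_simps)
  qed
  have "(\<integral>x. (\<Sum>l<Suc N. d l x) ^ 4 \<partial>M) \<le> (\<integral>x. ?S x ^ 4 + 4 * (?S x ^ 3 * d N x) + 8 * ((?S x)\<^sup>2 * (d N x)\<^sup>2) + 3 * d N x ^ 4 \<partial>M)"
  proof (rule integral_mono_AE')
    show "integrable M (\<lambda>x. ?S x ^ 4 + 4 * (?S x ^ 3 * d N x) + 8 * ((?S x)\<^sup>2 * (d N x)\<^sup>2) + 3 * d N x ^ 4)"
      using int[of 4 0] int[of 3 1] int[of 2 2] int[of 0 4] by simp
    show "AE x in M. (\<Sum>l<Suc N. d l x) ^ 4 \<le> ?S x ^ 4 + 4 * (?S x ^ 3 * d N x) + 8 * ((?S x)\<^sup>2 * (d N x)\<^sup>2) + 3 * d N x ^ 4"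
      using pt by (simp add: AE_I2)
    have "0 \<le> s ^ 4 + 4 * (s ^ 3 * t) + 8 * (s\<^sup>2 * t\<^sup>2) + 3 * t ^ 4" for s t :: real
      by (rule order_trans[OF zero_le_even_power pt]) simp
    then show "AE x in M. 0 \<le> ?S x ^ 4 + 4 * (?S x ^ 3 * d N x) + 8 * ((?S x)\<^sup>2 * (d N x)\<^sup>2) + 3 * d N x ^ 4"
      by (intro AE_I2)
  qed
  also have "\<dots> = a\<^sup>2 + 4 * (\<integral>x. ?S x ^ 3 * d N x \<partial>M) + 8 * (\<integral>x. (?S x)\<^sup>2 * (d N x)\<^sup>2 \<partial>M) + 3 * (\<integral>x. d N x ^ 4 \<partial>M)"
    unfolding a2 using int[of 4 0] int[of 3 1] int[of 2 2] int[of 0 4] by simp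
  also have "\<dots> \<le> a\<^sup>2 + 8 * (a * \<kappa>) + 3 * \<kappa>\<^sup>2"
    using Suc.prems(1)[of N] Suc.prems(2)[of N] cross by simp
  \<comment> \<open>The 8 in front of the cross term is twice 4: this is the source of the 4 per
    summand.\<close>
  also have "\<dots> \<le> (a + 4 * \<kappa>)\<^sup>2"
    by (simp add: power2_eq_square algebra_simps)
  also have "\<dots> \<le> (4 * real (Suc N) * \<kappa>)\<^sup>2"
    using a \<open>0 \<le> \<kappa>\<close> by (intro power_mono) (auto simp: algebra_simps)
  finally show ?case .
qed simp

subsection \<open>Boxes\<close>

lemma vec_interval_eq_image: "{a..b :: int ^ 'd::finite} = (\<lambda>f. \<chi> q. f q) ` (\<Pi>\<^sub>E q\<in>UNIV. {a $ q..b $ q})"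
proof (intro equalityI subsetI)
  fix x assume "x \<in> {a..b}"
  then have "x = (\<chi> q. (\<lambda>q. x $ q) q)" "(\<lambda>q. x $ q) \<in> (\<Pi>\<^sub>E q\<in>UNIV. {a $ q..b $ q})"
    by (auto simp: less_eq_vec_def vec_eq_iff)
  then show "x \<in> (\<lambda>f. \<chi> q. f q) ` (\<Pi>\<^sub>E q\<in>UNIV. {a $ q..b $ q})" by (rule image_eqI)
qed (auto simp: less_eq_vec_def PiE_iff)

lemma finite_vec_interval [simp]: "finite {a..b :: int ^ 'd::finite}"
  unfolding vec_interval_eq_image by (intro finite_imageI finite_PiE) auto

lemma card_vec_interval: "card {a..b :: int ^ 'd::finite} = (\<Prod>q\<in>UNIV. nat (b $ q - a $ q + 1))"
proof -
  have "inj_on (\<lambda>f. \<chi> q. f q) (\<Pi>\<^sub>E q\<in>UNIV. {a $ q..b $ q})"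
    by (auto simp: inj_on_def vec_eq_iff fun_eq_iff)
  then show ?thesis
    unfolding vec_interval_eq_image by (subst card_image) (auto simp: card_PiE algebra_simps)
qed

definition vec_upd :: "'a ^ 'd::finite \<Rightarrow> 'd \<Rightarrow> 'a \<Rightarrow> 'a ^ 'd" where
  "vec_upd k r v = (\<chi> q. if q = r then v else k $ q)"

lemma vec_upd_nth [simp]: "vec_upd k r v $ q = (if q = r then v else k $ q)"
  by (simp add: vec_upd_def)

lemma le_vec_upd_iff: "i \<le> vec_upd k r v \<longleftrightarrow> (\<forall>q. q \<noteq> r \<longrightarrow> i $ q \<le> k $ q) \<and> i $ r \<le> v"
  by (auto simp: less_eq_vec_def)

text \<open>A signed product, which counts the lattice points of \<open>{1..n}\<close> as soon as
  \<open>0 \<le> n\<close>.\<close>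

definition box_volume :: "int ^ 'd::finite \<Rightarrow> real" where
  "box_volume n = (\<Prod>q\<in>UNIV. real_of_int (n $ q))"

lemma box_volume_nonneg: "0 \<le> n \<Longrightarrow> 0 \<le> box_volume n"
  unfolding box_volume_def by (intro prod_nonneg) (auto simp: less_eq_vec_def)

lemma card_box: "0 \<le> n \<Longrightarrow> real (card {1..n :: int ^ 'd::finite}) = box_volume n"
  unfolding box_volume_def card_vec_interval by (auto simp: less_eq_vec_def intro!: prod.cong)

context real_iid
begin

section \<open>Layers of the field and maxima over boxes\<close>

lemma depends_on_field_sum:
  assumes "orthodiff e" "\<And>i. i \<in> A \<Longrightarrow> i $ q \<le> l"
  shows "depends_on (halfspace_le q l) (field_sum e A)"
  unfolding field_sum_def
proof (rule depends_on_sum)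
  fix i assume i: "i \<in> A"
  have "(+) i ` halfspace_le q 0 \<subseteq> halfspace_le q l"
    using assms(2)[OF i] by (auto simp: halfspace_le_def)
  then show "depends_on (halfspace_le q l) (\<lambda>\<omega>. e (shift i \<omega>))"
    by (rule depends_on_mono[OF depends_on_shift[OF orthodiff_halfspace[OF assms(1)]]])
qed

lemma integral_mult_field_sum_eq_0:
  assumes e: "orthodiff e" and w: "square_integrable P w" "depends_on (halfspace_le q l) w"
    and A: "\<And>i. i \<in> A \<Longrightarrow> i $ q = l + 1"
  shows "(\<integral>\<omega>. w \<omega> * field_sum e A \<omega> \<partial>P) = 0"
proof -
  have "(\<integral>\<omega>. w \<omega> * field_sum e A \<omega> \<partial>P) = (\<Sum>i\<in>A. \<integral>\<omega>. w \<omega> * e (shift i \<omega>) \<partial>P)"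
    unfolding field_sum_def sum_distrib_left
    by (intro Bochner_Integration.integral_sum square_integrable_mult w square_integrable_shift orthodiff_square_integrable e)
  also have "\<dots> = 0"
  proof (rule sum.neutral, rule ballI)
    fix i assume "i \<in> A"
    from A[OF this] show "(\<integral>\<omega>. w \<omega> * e (shift i \<omega>) \<partial>P) = 0"
      using w by (intro integral_mult_orthodiff_shift[OF e, where q = q]) auto
  qed
  finally show ?thesis .
qed

text \<open>The martingale property in one direction: the layer at level \<open>l + 1\<close>
  averages to zero, and the other layers are already determined.\<close>

lemma cexp_field_sum_AE:
  assumes e: "orthodiff e" and fin: "finite A" and A: "\<And>i. i \<in> A \<Longrightarrow> i $ q \<le> l + 1"
  shows "AE \<omega> in P. cexp (halfspace_le q l) (field_sum e A) \<omega> = field_sum e {i\<in>A. i $ q \<le> l} \<omega>"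
proof -
  let ?A = "{i\<in>A. i $ q \<le> l}" and ?B = "{i\<in>A. i $ q = l + 1}"
  have s: "square_integrable P (field_sum e C)" for C
    by (intro square_integrable_field_sum orthodiff_square_integrable e)
  have "A = ?A \<union> ?B" using A by force
  then have split: "field_sum e A \<omega> - field_sum e ?A \<omega> = field_sum e ?B \<omega>" for \<omega>
    unfolding field_sum_def using fin by (subst \<open>A = ?A \<union> ?B\<close>, subst sum.union_disjoint) auto
  have z: "AE \<omega> in P. cexp (halfspace_le q l) (field_sum e ?B) \<omega> = 0"
    by (rule cexp_eq_zero_AE[OF s integral_mult_field_sum_eq_0[OF e]]) auto
  have dep: "depends_on (halfspace_le q l) (field_sum e ?A)"
    by (rule depends_on_field_sum[OF e]) auto
  have "AE \<omega> in P. cexp (halfspace_le q l) (\<lambda>\<omega>. field_sum e A \<omega> - field_sum e ?A \<omega>) \<omega>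
      = cexp (halfspace_le q l) (field_sum e A) \<omega> - cexp (halfspace_le q l) (field_sum e ?A) \<omega>"
    by (intro cexp_diff_AE square_integrable_imp_integrable_P s)
  with z show ?thesis
    unfolding split by eventually_elim (simp add: cexp_id[OF dep])
qed

definition max_field_sum :: "((int ^ 'd::finite \<Rightarrow> real) \<Rightarrow> real) \<Rightarrow> (int ^ 'd) set \<Rightarrow> (int ^ 'd \<Rightarrow> real) \<Rightarrow> real" where
  "max_field_sum g K \<omega> = Max ((\<lambda>k. \<bar>field_sum g {1..k} \<omega>\<bar>) ` K)"

lemma max_field_sum_ge: "finite K \<Longrightarrow> k \<in> K \<Longrightarrow> \<bar>field_sum g {1..k} \<omega>\<bar> \<le> max_field_sum g K \<omega>"
  unfolding max_field_sum_def by (intro Max_ge) auto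

lemma max_field_sum_le:
  "finite K \<Longrightarrow> K \<noteq> {} \<Longrightarrow> (\<And>k. k \<in> K \<Longrightarrow> \<bar>field_sum g {1..k} \<omega>\<bar> \<le> c) \<Longrightarrow> max_field_sum g K \<omega> \<le> c"
  unfolding max_field_sum_def by (intro Max.boundedI) auto

lemma max_field_sum_nonneg: "finite K \<Longrightarrow> K \<noteq> {} \<Longrightarrow> 0 \<le> max_field_sum g K \<omega>"
  using max_field_sum_ge[of K _ g \<omega>] by (meson abs_ge_zero all_not_in_conv order_trans)

lemma borel_measurable_field_sum: "g \<in> borel_measurable P \<Longrightarrow> field_sum g A \<in> borel_measurable P"
  unfolding field_sum_def[abs_def] by (intro borel_measurable_sum borel_measurable_shift)

lemma borel_measurable_max_field_sum:
  assumes "g \<in> borel_measurable P" "finite K"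
  shows "max_field_sum g K \<in> borel_measurable P"
  unfolding max_field_sum_def[abs_def]
  by (intro borel_measurable_Max assms borel_measurable_abs borel_measurable_field_sum)

text \<open>The maximum is attained at some \<open>k\<close>, so its power is bounded by the sum of
  all powers.\<close>

lemma square_integrable_max_field_sum_power:
  assumes "g \<in> borel_measurable P" "finite K" "K \<noteq> {}"
    and sq: "\<And>A. finite A \<Longrightarrow> square_integrable P (\<lambda>\<omega>. \<bar>field_sum g A \<omega>\<bar> ^ p)"
  shows "square_integrable P (\<lambda>\<omega>. max_field_sum g K \<omega> ^ p)"
proof (rule square_integrable_bound)
  show "square_integrable P (\<lambda>\<omega>. \<Sum>k\<in>K. \<bar>field_sum g {1..k} \<omega>\<bar> ^ p)"
    by (intro square_integrable_sum sq) simp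
  show "(\<lambda>\<omega>. max_field_sum g K \<omega> ^ p) \<in> borel_measurable P"
    by (intro borel_measurable_power borel_measurable_max_field_sum assms)
  show "AE \<omega> in P. \<bar>max_field_sum g K \<omega> ^ p\<bar> \<le> \<bar>\<Sum>k\<in>K. \<bar>field_sum g {1..k} \<omega>\<bar> ^ p\<bar>"
  proof (rule AE_I2)
    fix \<omega> :: "int ^ 'a \<Rightarrow> real"
    have "max_field_sum g K \<omega> \<in> (\<lambda>k. \<bar>field_sum g {1..k} \<omega>\<bar>) ` K"
      unfolding max_field_sum_def using assms by (intro Max_in) auto
    then obtain k where k: "k \<in> K" "max_field_sum g K \<omega> = \<bar>field_sum g {1..k} \<omega>\<bar>" by auto
    have "\<bar>field_sum g {1..k} \<omega>\<bar> ^ p \<le> (\<Sum>k\<in>K. \<bar>field_sum g {1..k} \<omega>\<bar> ^ p)"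
      using assms k(1) by (intro member_le_sum) auto
    then show "\<bar>max_field_sum g K \<omega> ^ p\<bar> \<le> \<bar>\<Sum>k\<in>K. \<bar>field_sum g {1..k} \<omega>\<bar> ^ p\<bar>"
      unfolding k(2) by (simp add: power_abs)
  qed
qed

text \<open>For \<open>p = 2\<close> the submartingale property of \<open>V\<^sup>2\<close> is tested through
  \<open>V'\<^sup>2 \<ge> 2 V V' - V\<^sup>2\<close>, with \<open>w V\<close> as a new weight.\<close>

lemma submartingale_power:
  assumes V: "square_integrable P V" "square_integrable P V'" "depends_on A V" "\<And>\<omega>. 0 \<le> V \<omega>"
    and le: "AE \<omega> in P. V \<omega> \<le> cexp A V' \<omega>"
    and w: "square_integrable P w" "depends_on A w" "\<And>\<omega>. 0 \<le> w \<omega>"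
    and p: "p \<in> {1, 2 :: nat}" "square_integrable P (\<lambda>\<omega>. V \<omega> ^ p)" "square_integrable P (\<lambda>\<omega>. V' \<omega> ^ p)"
  shows "(\<integral>\<omega>. w \<omega> * V \<omega> ^ p \<partial>P) \<le> (\<integral>\<omega>. w \<omega> * V' \<omega> ^ p \<partial>P)"
proof -
  have test: "(\<integral>\<omega>. v \<omega> * V \<omega> \<partial>P) \<le> (\<integral>\<omega>. v \<omega> * V' \<omega> \<partial>P)"
    if v: "depends_on A v" "\<And>\<omega>. 0 \<le> v \<omega>" "integrable P (\<lambda>\<omega>. v \<omega> * V \<omega>)" "integrable P (\<lambda>\<omega>. v \<omega> * V' \<omega>)" for v
  proof -
    have "(\<integral>\<omega>. v \<omega> * V \<omega> \<partial>P) \<le> (\<integral>\<omega>. v \<omega> * cexp A V' \<omega> \<partial>P)"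
    proof (rule integral_mono_AE[OF v(3)])
      show "integrable P (\<lambda>\<omega>. v \<omega> * cexp A V' \<omega>)"
        using integrable_cexp[OF v(4), of A] by (simp add: cexp_mult[OF v(1)])
      show "AE \<omega> in P. v \<omega> * V \<omega> \<le> v \<omega> * cexp A V' \<omega>"
        using le by eventually_elim (intro mult_left_mono v(2))
    qed
    also have "\<dots> = (\<integral>\<omega>. v \<omega> * V' \<omega> \<partial>P)" by (rule integral_mult_cexp[OF v(1,4)])
    finally show ?thesis .
  qed
  show ?thesis
  proof (cases "p = 1")
    case True
    then show ?thesis using test[OF w(2,3)] square_integrable_mult[OF w(1) V(1)] square_integrable_mult[OF w(1) V(2)] by simp
  next
    case False
    with p have p2: "p = 2" by simp
    have i1: "integrable P (\<lambda>\<omega>. w \<omega> * (V \<omega>)\<^sup>2)" and i2: "integrable P (\<lambda>\<omega>. w \<omega> * (V' \<omega>)\<^sup>2)"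
      using p unfolding p2 by (auto intro!: square_integrable_mult w)
    have i3: "integrable P (\<lambda>\<omega>. w \<omega> * V \<omega> * V' \<omega>)"
    proof (rule Bochner_Integration.integrable_bound[OF Bochner_Integration.integrable_add[OF i1 i2]])
      show "(\<lambda>\<omega>. w \<omega> * V \<omega> * V' \<omega>) \<in> borel_measurable P"
        using V w by (intro borel_measurable_times) (auto simp: square_integrable_def)
      show "AE \<omega> in P. norm (w \<omega> * V \<omega> * V' \<omega>) \<le> norm (w \<omega> * (V \<omega>)\<^sup>2 + w \<omega> * (V' \<omega>)\<^sup>2)"
      proof (rule AE_I2)
        fix \<omega>
        have "2 * (\<bar>V \<omega>\<bar> * \<bar>V' \<omega>\<bar>) \<le> (V \<omega>)\<^sup>2 + (V' \<omega>)\<^sup>2" "0 \<le> \<bar>V \<omega>\<bar> * \<bar>V' \<omega>\<bar>"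
          using sum_squares_bound[of "\<bar>V \<omega>\<bar>" "\<bar>V' \<omega>\<bar>"] by simp_all
        then have "\<bar>V \<omega>\<bar> * \<bar>V' \<omega>\<bar> \<le> (V \<omega>)\<^sup>2 + (V' \<omega>)\<^sup>2" by linarith
        from mult_left_mono[OF this w(3)[of \<omega>]]
        show "norm (w \<omega> * V \<omega> * V' \<omega>) \<le> norm (w \<omega> * (V \<omega>)\<^sup>2 + w \<omega> * (V' \<omega>)\<^sup>2)"
          using w(3)[of \<omega>] by (simp add: abs_mult distrib_left mult.assoc)
      qed
    qed
    have "(\<integral>\<omega>. (w \<omega> * V \<omega>) * V \<omega> \<partial>P) \<le> (\<integral>\<omega>. (w \<omega> * V \<omega>) * V' \<omega> \<partial>P)"
      using i1 i3 V(4) w(3)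
      by (intro test depends_on_compose2[where h = "(*)"] w V(3)) (auto simp: power2_eq_square mult.assoc)
    then have "(\<integral>\<omega>. w \<omega> * (V \<omega>)\<^sup>2 \<partial>P) \<le> (\<integral>\<omega>. 2 * (w \<omega> * V \<omega> * V' \<omega>) - w \<omega> * (V \<omega>)\<^sup>2 \<partial>P)"
      using i1 i3 by (simp add: power2_eq_square mult.assoc)
    also have "\<dots> \<le> (\<integral>\<omega>. w \<omega> * (V' \<omega>)\<^sup>2 \<partial>P)"
    proof (rule integral_mono)
      fix \<omega>
      have "0 \<le> w \<omega> * (V' \<omega> - V \<omega>)\<^sup>2" using w(3) by simp
      then show "2 * (w \<omega> * V \<omega> * V' \<omega>) - w \<omega> * (V \<omega>)\<^sup>2 \<le> w \<omega> * (V' \<omega>)\<^sup>2"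
        by (simp add: power2_eq_square algebra_simps)
    qed (use i1 i2 i3 in auto)
    finally show ?thesis by (simp add: p2)
  qed
qed

text \<open>Doob's inequality is applied in one coordinate after the other.\<close>

lemma cairoli:
  fixes e :: "(int ^ 'd::finite \<Rightarrow> real) \<Rightarrow> real" and n :: "int ^ 'd"
  assumes e: "orthodiff e" and n: "0 \<le> n" and p: "p \<in> {1, 2 :: nat}"
    and sq: "\<And>A. finite A \<Longrightarrow> square_integrable P (\<lambda>\<omega>. \<bar>field_sum e A \<omega>\<bar> ^ p)"
  shows "L2_norm P (\<lambda>\<omega>. max_field_sum e {0..n} \<omega> ^ p) \<le> 2 ^ CARD('d) * L2_norm P (\<lambda>\<omega>. \<bar>field_sum e {1..n} \<omega>\<bar> ^ p)"
proof -
  \<comment> \<open>Upper corners that vary in the directions of \<open>Q\<close> and are frozen at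
    \<open>n\<close> in the others. Induction on \<open>Q\<close> frees one direction after another,
    at the cost of a factor 2 each.\<close>
  define K where "K Q = {k. (\<forall>q. 0 \<le> k $ q \<and> k $ q \<le> n $ q) \<and> (\<forall>q. q \<notin> Q \<longrightarrow> k $ q = n $ q)}" for Q
  have finK: "finite (K Q)" for Q
    by (rule finite_subset[of _ "{0..n}"]) (auto simp: K_def less_eq_vec_def)
  have nK: "n \<in> K Q" for Q using n by (auto simp: K_def less_eq_vec_def)
  have em: "e \<in> borel_measurable P" and es: "square_integrable P e"
    using e by (auto simp: orthodiff_def square_integrable_def)
  have step: "L2_norm P (\<lambda>\<omega>. max_field_sum e (K Q) \<omega> ^ p) \<le> 2 ^ card Q * L2_norm P (\<lambda>\<omega>. \<bar>field_sum e {1..n} \<omega>\<bar> ^ p)"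
    if "finite Q" for Q using that
  proof (induction Q rule: finite_induct)
    case empty
    have "K {} = {n}" using n by (auto simp: K_def vec_eq_iff less_eq_vec_def)
    then show ?case by (simp add: max_field_sum_def)
  next
    case (insert r Q)
    define N where "N = nat (n $ r)"
    have N: "int N = n $ r" using n by (simp add: N_def less_eq_vec_def)
    \<comment> \<open>The slices of the next corner set along direction \<open>r\<close>; the maxima
      over the slices form the process to which Doob's inequality is applied.\<close>
    define L where "L l = (\<lambda>k. vec_upd k r (int l)) ` K Q" for l
    have finL: "finite (L l)" "L l \<noteq> {}" for l using finK[of Q] nK[of Q] by (auto simp: L_def)
    have Lr: "k $ r = int l" if "k \<in> L l" for k l using that by (auto simp: L_def)
    \<comment> \<open>The last slice is the previous corner set, to which the induction hypothesis
      applies.\<close>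
    have LN: "L N = K Q"
    proof -
      have "vec_upd k r (int N) = k" if "k \<in> K Q" for k
        using that insert.hyps(2) N by (auto simp: K_def vec_eq_iff)
      then show ?thesis by (auto simp: L_def image_iff)
    qed
    have KL: "K (insert r Q) = (\<Union>l\<le>N. L l)"
    proof (intro equalityI subsetI)
      fix k assume k: "k \<in> K (insert r Q)"
      then have kr: "0 \<le> k $ r" "k $ r \<le> n $ r" by (auto simp: K_def)
      define k' where "k' = vec_upd k r (n $ r)"
      have "k' \<in> K Q" using k n insert.hyps(2) by (auto simp: K_def k'_def less_eq_vec_def)
      moreover have "k = vec_upd k' r (int (nat (k $ r)))" using kr by (auto simp: k'_def vec_eq_iff)
      moreover have "nat (k $ r) \<le> N" using kr by (simp add: N_def)
      ultimately show "k \<in> (\<Union>l\<le>N. L l)" unfolding L_def by blast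
    next
      fix k assume "k \<in> (\<Union>l\<le>N. L l)"
      then obtain l k' where "l \<le> N" "k' \<in> K Q" "k = vec_upd k' r (int l)" by (auto simp: L_def)
      then show "k \<in> K (insert r Q)" using N by (auto simp: K_def)
    qed
    let ?V = "\<lambda>l. max_field_sum e (L l)"
    let ?Z = "\<lambda>l \<omega>. ?V l \<omega> ^ p"
    have V0: "0 \<le> ?V l \<omega>" for l \<omega> by (rule max_field_sum_nonneg[OF finL])
    have sqV: "square_integrable P (?V l)" for l
      using square_integrable_max_field_sum_power[OF em finL, of 1]
      by (simp add: square_integrable_abs square_integrable_field_sum[OF es])
    have sqZ: "square_integrable P (?Z l)" for l
      by (rule square_integrable_max_field_sum_power[OF em finL sq])
    \<comment> \<open>Powers are monotone on nonnegative numbers, so the running maximum of the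
      powers is the power of the maximum over all slices reached so far.\<close>
    have rm: "running_max (\<lambda>l. ?Z l \<omega>) m = max_field_sum e (\<Union>l\<le>m. L l) \<omega> ^ p" for m \<omega>
    proof -
      have "max_field_sum e (\<Union>l\<le>m. L l) \<omega> = Max (\<Union>l\<le>m. (\<lambda>k. \<bar>field_sum e {1..k} \<omega>\<bar>) ` L l)"
        by (simp add: max_field_sum_def image_UN)
      also have "\<dots> = Max ((\<lambda>l. ?V l \<omega>) ` {..m})"
      proof (induction m)
        case (Suc m)
        have "Max (\<Union>l\<le>Suc m. (\<lambda>k. \<bar>field_sum e {1..k} \<omega>\<bar>) ` L l)
            = max (Max ((\<lambda>k. \<bar>field_sum e {1..k} \<omega>\<bar>) ` L (Suc m))) (Max (\<Union>l\<le>m. (\<lambda>k. \<bar>field_sum e {1..k} \<omega>\<bar>) ` L l))"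
          unfolding atMost_Suc UN_insert using finL by (intro Max_Un) auto
        then show ?case unfolding Suc by (simp add: atMost_Suc max_field_sum_def)
      qed (simp add: max_field_sum_def)
      also have "\<dots> ^ p = Max ((\<lambda>x. x ^ p) ` ((\<lambda>l. ?V l \<omega>) ` {..m}))"
      proof -
        have mono: "max x y ^ p = max (x ^ p) (y ^ p)" if "0 \<le> x" "0 \<le> y" for x y :: real
          using that power_mono[of x y p] power_mono[of y x p] by (auto simp: max_def intro: antisym)
        show ?thesis
        proof (induction m)
          case (Suc m)
          have "0 \<le> Max ((\<lambda>l. ?V l \<omega>) ` {..m})"
            by (rule order_trans[OF V0[of 0 \<omega>] Max_ge]) auto
          then show ?case using Suc V0[of "Suc m" \<omega>] by (simp add: atMost_Suc mono)
        qed simp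
      qed
      finally show ?thesis by (simp add: running_max_def image_image)
    qed
    have sub: "(\<integral>\<omega>. running_max (\<lambda>l. ?Z l \<omega>) l * ?Z l \<omega> \<partial>P) \<le> (\<integral>\<omega>. running_max (\<lambda>l. ?Z l \<omega>) l * ?Z (Suc l) \<omega> \<partial>P)" for l
    \<comment> \<open>The weight is the running maximum of the powers; it involves only slices up to
      \<open>l\<close> and therefore lies in the past.\<close>
    proof (rule submartingale_power[where A = "halfspace_le r (int l)", OF sqV sqV _ V0 _ _ _ _ p sqZ sqZ])
      have dep: "depends_on (halfspace_le r (int l)) (?V m)" if "m \<le> l" for m
        unfolding max_field_sum_def[abs_def]
      proof (intro depends_on_Max depends_on_compose[where h = abs] depends_on_field_sum[OF e])
        fix k i assume k: "k \<in> L m" and "i \<in> {1..k}"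
        then have "i $ r \<le> k $ r" by (simp add: less_eq_vec_def)
        with Lr[OF k] show "i $ r \<le> int l" using that by simp
      qed
      show "depends_on (halfspace_le r (int l)) (?V l)" by (rule dep) simp
      show "square_integrable P (\<lambda>\<omega>. running_max (\<lambda>l. ?Z l \<omega>) l)"
        by (rule square_integrable_running_max) (rule sqZ)
      show "depends_on (halfspace_le r (int l)) (\<lambda>\<omega>. running_max (\<lambda>l. ?Z l \<omega>) l)"
        unfolding running_max_def
        by (intro depends_on_Max depends_on_compose[where h = "\<lambda>x. x ^ p"] dep) simp
      show "0 \<le> running_max (\<lambda>l. ?Z l \<omega>) l" for \<omega>
        using running_max_ge[of "\<lambda>l. ?Z l \<omega>" l] V0[of l \<omega>] by (meson order_trans zero_le_power)
      \<comment> \<open>Conditioning in direction \<open>r\<close> turns the sum up to level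
        \<open>l + 1\<close> into the sum up to level \<open>l\<close>; absolute values are then
        taken inside, and the maximum over the next slice dominates them.\<close>
      have "AE \<omega> in P. \<forall>k\<in>K Q. \<bar>field_sum e {1..vec_upd k r (int l)} \<omega>\<bar> \<le> cexp (halfspace_le r (int l)) (?V (Suc l)) \<omega>"
      proof (intro AE_finite_allI finK)
        fix k assume k: "k \<in> K Q"
        let ?S = "field_sum e {1..vec_upd k r (int (Suc l))}"
        have eq: "{i\<in>{1..vec_upd k r (int (Suc l))}. i $ r \<le> int l} = {1..vec_upd k r (int l)}"
          by (auto simp: le_vec_upd_iff)
        have kL: "vec_upd k r (int (Suc l)) \<in> L (Suc l)" unfolding L_def using k by blast
        have s: "square_integrable P ?S" by (rule square_integrable_field_sum[OF es])
        have 1: "AE \<omega> in P. cexp (halfspace_le r (int l)) ?S \<omega> = field_sum e {1..vec_upd k r (int l)} \<omega>"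
        proof -
          have "i $ r \<le> int l + 1" if "i \<in> {1..vec_upd k r (int (Suc l))}" for i
          proof -
            have "i $ r \<le> vec_upd k r (int (Suc l)) $ r" using that by (simp add: less_eq_vec_def del: vec_upd_nth)
            then show ?thesis by simp
          qed
          from cexp_field_sum_AE[OF e finite_vec_interval, of "1" "vec_upd k r (int (Suc l))" r "int l", OF this] show ?thesis unfolding eq .
        qed
        have 2: "AE \<omega> in P. cexp (halfspace_le r (int l)) (\<lambda>\<omega>. \<bar>?S \<omega>\<bar>) \<omega> \<le> cexp (halfspace_le r (int l)) (?V (Suc l)) \<omega>"
          using max_field_sum_ge[OF finL(1) kL]
          by (intro cexp_mono_AE square_integrable_imp_integrable_P sqV square_integrable_abs s) auto
        show "AE \<omega> in P. \<bar>field_sum e {1..vec_upd k r (int l)} \<omega>\<bar> \<le> cexp (halfspace_le r (int l)) (?V (Suc l)) \<omega>"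
          using 1 2
        proof eventually_elim
          case (elim \<omega>)
          then show ?case using cexp_abs_le[of "halfspace_le r (int l)" ?S \<omega>] by simp
        qed
      qed
      then show "AE \<omega> in P. ?V l \<omega> \<le> cexp (halfspace_le r (int l)) (?V (Suc l)) \<omega>"
      proof eventually_elim
        case (elim \<omega>)
        then show ?case by (intro max_field_sum_le finL) (auto simp: L_def)
      qed
    qed
    have "L2_norm P (\<lambda>\<omega>. max_field_sum e (K (insert r Q)) \<omega> ^ p) \<le> 2 * L2_norm P (?Z N)"
      using doob_L2[of N P ?Z, OF sqZ sub] unfolding rm KL by simp
    also have "\<dots> \<le> 2 * (2 ^ card Q * L2_norm P (\<lambda>\<omega>. \<bar>field_sum e {1..n} \<omega>\<bar> ^ p))"
      unfolding LN using insert.IH by simp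
    finally show ?case using insert.hyps by simp
  qed
  have "K UNIV = {0..n}" by (auto simp: K_def less_eq_vec_def)
  with step[of UNIV] show ?thesis by simp
qed

lemma square_integrable_max_field_sum:
  assumes "square_integrable P g" "finite K" "K \<noteq> {}"
  shows "square_integrable P (max_field_sum g K)"
  using square_integrable_max_field_sum_power[of g K 1] assms
  by (simp add: square_integrable_abs square_integrable_field_sum square_integrable_def[of P g])

text \<open>The case \<open>p = 1\<close> of Cairoli's inequality, where orthogonality evaluates the
  norm of the full sum exactly.\<close>

lemma maximal_inequality_L2:
  fixes e :: "(int ^ 'd::finite \<Rightarrow> real) \<Rightarrow> real"
  assumes e: "orthodiff e" and n: "0 \<le> n"
  shows "L2_norm P (max_field_sum e {0..n}) \<le> 2 ^ CARD('d) * sqrt (box_volume n) * L2_norm P e"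
  using cairoli[OF e n, of 1] L2_norm_field_sum[OF e, of "{1..n}"] n
  by (simp add: square_integrable_abs square_integrable_field_sum orthodiff_square_integrable[OF e] card_box mult.assoc)

text \<open>\<open>fourth_moment_sum\<close> is applied to the layers of one direction after the
  other. Each direction contributes a factor 4, and the base case is a single bounded term.\<close>

lemma fourth_moment_field_sum:
  fixes e :: "(int ^ 'd::finite \<Rightarrow> real) \<Rightarrow> real"
  assumes e: "orthodiff e" and bdd: "\<And>\<omega>. \<bar>e \<omega>\<bar> \<le> b" and n: "0 \<le> n"
  shows "(\<integral>\<omega>. field_sum e {1..n} \<omega> ^ 4 \<partial>P) \<le> (4 ^ CARD('d) * box_volume n * b\<^sup>2)\<^sup>2"
proof -
  have fm: "finite_measure (P :: (int ^ 'd \<Rightarrow> real) measure)" by (rule prob_space.axioms(1)[OF prob_space_P])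
  have em: "e \<in> borel_measurable P" using e by (auto simp: orthodiff_def square_integrable_def)
  have b: "0 \<le> b" using bdd abs_ge_zero order_trans by blast
  have fb: "\<bar>field_sum e A \<omega>\<bar> \<le> real (card A) * b" for A \<omega>
    unfolding field_sum_def by (rule order_trans[OF sum_abs sum_bounded_above]) (rule bdd)
  \<comment> \<open>Boxes that are full in the directions of \<open>Q\<close> and reduced to the
    coordinate of \<open>c\<close> elsewhere. The point \<open>c\<close> varies in the induction
    because the layers of the next direction are such boxes at different levels.\<close>
  define B where "B Q c = {i. (\<forall>q. q \<in> Q \<longrightarrow> 1 \<le> i $ q \<and> i $ q \<le> n $ q) \<and> (\<forall>q. q \<notin> Q \<longrightarrow> i $ q = c $ q)}" for Q c
  have finB: "finite (B Q c)" for Q c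
  proof (rule finite_subset)
    have "min 1 (c $ q) \<le> i $ q \<and> i $ q \<le> max (n $ q) (c $ q)" if "i \<in> B Q c" for i q
      using that unfolding B_def by (cases "q \<in> Q") auto
    then show "B Q c \<subseteq> {(\<chi> q. min 1 (c $ q))..(\<chi> q. max (n $ q) (c $ q))}" by (auto simp: less_eq_vec_def)
  qed simp
  have "(\<integral>\<omega>. field_sum e (B Q c) \<omega> ^ 4 \<partial>P) \<le> ((\<Prod>q\<in>Q. 4 * real_of_int (n $ q)) * b\<^sup>2)\<^sup>2" if "finite Q" for Q c
    using that
  proof (induction Q arbitrary: c rule: finite_induct)
    case empty
    have "B {} c = {c}" by (auto simp: B_def vec_eq_iff)
    then have "(\<integral>\<omega>. field_sum e (B {} c) \<omega> ^ 4 \<partial>P) = (\<integral>\<omega>. e (shift c \<omega>) ^ 4 \<partial>P)" by (simp add: field_sum_def)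
    also have "\<dots> \<le> (\<integral>\<omega>. b ^ 4 \<partial>(P :: (int ^ 'd \<Rightarrow> real) measure))"
    proof (rule integral_mono_AE')
      show "integrable P (\<lambda>\<omega> :: int ^ 'd \<Rightarrow> real. b ^ 4)" by (simp add: finite_measure.integrable_const[OF fm])
      show "AE \<omega> in P. e (shift c \<omega>) ^ 4 \<le> b ^ 4"
        using power_mono[OF bdd abs_ge_zero, of _ 4] by (intro AE_I2) simp
    qed (simp add: b)
    also have "\<dots> = b ^ 4" using prob_space.prob_space[OF prob_space_P[where 'i = "int ^ 'd"]] by simp
    finally show ?case by (simp flip: power_mult)
  next
    case (insert r Q)
    define N where "N = nat (n $ r)"
    have N: "int N = n $ r" using n by (simp add: N_def less_eq_vec_def)
    \<comment> \<open>Layers are numbered from 0 while the box starts at coordinate 1, hence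
      \<open>int l + 1\<close>.\<close>
    define D where "D l = B Q (vec_upd c r (int l + 1))" for l :: nat
    have Dr: "i $ r = int l + 1" if "i \<in> D l" for i l
      using that insert.hyps(2) by (auto simp: D_def B_def)
    have BD: "B (insert r Q) c = (\<Union>l<N. D l)"
    proof (intro equalityI subsetI)
      fix i assume i: "i \<in> B (insert r Q) c"
      then have ir: "1 \<le> i $ r" "i $ r \<le> n $ r" by (auto simp: B_def)
      have "i \<in> D (nat (i $ r - 1))" using i ir by (auto simp: D_def B_def)
      moreover have "nat (i $ r - 1) < N" using ir by (simp add: N_def)
      ultimately show "i \<in> (\<Union>l<N. D l)" by blast
    next
      fix i assume "i \<in> (\<Union>l<N. D l)"
      then obtain l where l: "l < N" "i \<in> D l" by blast
      from Dr[OF l(2)] l N show "i \<in> B (insert r Q) c" by (auto simp: D_def B_def)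
    qed
    have finD: "finite (D l)" for l unfolding D_def by (rule finB)
    have part: "field_sum e (\<Union>l<m. D l) \<omega> = (\<Sum>l<m. field_sum e (D l) \<omega>)" for m \<omega>
    proof -
      have "D i \<inter> D j = {}" if "i \<noteq> j" for i j
      proof -
        have False if "x \<in> D i" "x \<in> D j" for x
          using Dr[OF that(1)] Dr[OF that(2)] \<open>i \<noteq> j\<close> by simp
        then show ?thesis by blast
      qed
      then show ?thesis
        unfolding field_sum_def using finD by (intro sum.UNION_disjoint) auto
    qed
    have "(\<integral>\<omega>. (\<Sum>l<N. field_sum e (D l) \<omega>) ^ 4 \<partial>P) \<le> (4 * real N * ((\<Prod>q\<in>Q. 4 * real_of_int (n $ q)) * b\<^sup>2))\<^sup>2"
    proof (rule fourth_moment_sum[OF fm, where d = "\<lambda>l. field_sum e (D l)" and b = "\<lambda>l. real (card (D l)) * b"])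
      show "field_sum e (D l) \<in> borel_measurable P" for l by (rule borel_measurable_field_sum[OF em])
      show "\<bar>field_sum e (D l) \<omega>\<bar> \<le> real (card (D l)) * b" for l \<omega> by (rule fb)
      show "(\<integral>\<omega>. (\<Sum>l<k. field_sum e (D l) \<omega>) ^ 3 * field_sum e (D k) \<omega> \<partial>P) = 0" for k
        unfolding part[symmetric]
      proof (rule integral_mult_field_sum_eq_0[OF e, where q = r and l = "int k"])
        show "square_integrable P (\<lambda>\<omega>. field_sum e (\<Union>l<k. D l) \<omega> ^ 3)"
        proof (rule finite_measure.square_integrable_const_bound[OF fm])
          show "(\<lambda>\<omega>. field_sum e (\<Union>l<k. D l) \<omega> ^ 3) \<in> borel_measurable P"
            by (intro borel_measurable_power borel_measurable_field_sum em)
          show "\<bar>field_sum e (\<Union>l<k. D l) \<omega> ^ 3\<bar> \<le> (real (card (\<Union>l<k. D l)) * b) ^ 3" for \<omega>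
            using power_mono[OF fb abs_ge_zero, of _ \<omega> 3] by (simp add: power_abs)
        qed
        show "depends_on (halfspace_le r (int k)) (\<lambda>\<omega>. field_sum e (\<Union>l<k. D l) \<omega> ^ 3)"
        proof (intro depends_on_compose[where h = "\<lambda>x. x ^ 3"] depends_on_field_sum[OF e])
          fix i assume "i \<in> (\<Union>l<k. D l)"
          then obtain l where "l < k" "i \<in> D l" by blast
          with Dr[of i l] show "i $ r \<le> int k" by simp
        qed
      qed (rule Dr)
      show "(\<integral>\<omega>. field_sum e (D k) \<omega> ^ 4 \<partial>P) \<le> ((\<Prod>q\<in>Q. 4 * real_of_int (n $ q)) * b\<^sup>2)\<^sup>2" for k
        unfolding D_def by (rule insert.IH)
      show "0 \<le> (\<Prod>q\<in>Q. 4 * real_of_int (n $ q)) * b\<^sup>2"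
        using n by (intro mult_nonneg_nonneg prod_nonneg) (auto simp: less_eq_vec_def)
    qed
    then have *: "(\<integral>\<omega>. field_sum e (B (insert r Q) c) \<omega> ^ 4 \<partial>P) \<le> (4 * real N * ((\<Prod>q\<in>Q. 4 * real_of_int (n $ q)) * b\<^sup>2))\<^sup>2"
      by (simp add: BD part)
    have "real N = real_of_int (n $ r)" using N by (metis of_int_of_nat_eq)
    then show ?case using * insert.hyps by (simp add: mult.assoc)
  qed
  from this[of UNIV 0] have "(\<integral>\<omega>. field_sum e (B UNIV 0) \<omega> ^ 4 \<partial>P) \<le> ((\<Prod>q\<in>UNIV. 4 * real_of_int (n $ q)) * b\<^sup>2)\<^sup>2" by simp
  moreover have "B UNIV 0 = {1..n}" by (auto simp: B_def less_eq_vec_def)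
  ultimately show ?thesis by (simp add: box_volume_def prod.distrib)
qed

text \<open>Cairoli's inequality for squares; the 8 per direction is the 2 from Doob's inequality
  times the 4 from the fourth-moment bound.\<close>

lemma maximal_inequality_L4:
  fixes e :: "(int ^ 'd::finite \<Rightarrow> real) \<Rightarrow> real"
  assumes e: "orthodiff e" and bdd: "\<And>\<omega>. \<bar>e \<omega>\<bar> \<le> b" and n: "0 \<le> n"
  shows "(\<integral>\<omega>. max_field_sum e {0..n} \<omega> ^ 4 \<partial>P) \<le> (8 ^ CARD('d) * box_volume n * b\<^sup>2)\<^sup>2"
proof -
  have fm: "finite_measure (P :: (int ^ 'd \<Rightarrow> real) measure)" by (rule prob_space.axioms(1)[OF prob_space_P])
  have em: "e \<in> borel_measurable P" using e by (auto simp: orthodiff_def square_integrable_def)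
  have fb: "\<bar>field_sum e A \<omega>\<bar> \<le> real (card A) * b" for A \<omega>
    unfolding field_sum_def by (rule order_trans[OF sum_abs sum_bounded_above]) (rule bdd)
  have sq: "square_integrable P (\<lambda>\<omega>. \<bar>field_sum e A \<omega>\<bar> ^ 2)" for A
  proof (rule finite_measure.square_integrable_const_bound[OF fm])
    show "(\<lambda>\<omega>. \<bar>field_sum e A \<omega>\<bar> ^ 2) \<in> borel_measurable P"
      by (intro borel_measurable_power borel_measurable_abs borel_measurable_field_sum em)
    show "\<bar>\<bar>field_sum e A \<omega>\<bar> ^ 2\<bar> \<le> (real (card A) * b) ^ 2" for \<omega>
      using power_mono[OF fb abs_ge_zero, of A \<omega> 2] by simp
  qed
  have "L2_norm P (\<lambda>\<omega>. (max_field_sum e {0..n} \<omega>)\<^sup>2) \<le> 2 ^ CARD('d) * L2_norm P (\<lambda>\<omega>. \<bar>field_sum e {1..n} \<omega>\<bar>\<^sup>2)"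
    using cairoli[OF e n, of 2] sq by simp
  also have "L2_norm P (\<lambda>\<omega>. \<bar>field_sum e {1..n} \<omega>\<bar>\<^sup>2) \<le> 4 ^ CARD('d) * box_volume n * b\<^sup>2"
  proof (rule power2_le_imp_le)
    show "(L2_norm P (\<lambda>\<omega>. \<bar>field_sum e {1..n} \<omega>\<bar>\<^sup>2))\<^sup>2 \<le> (4 ^ CARD('d) * box_volume n * b\<^sup>2)\<^sup>2"
      using fourth_moment_field_sum[OF e bdd n] unfolding L2_norm_power2 by (simp flip: power_mult)
    show "0 \<le> 4 ^ CARD('d) * box_volume n * b\<^sup>2" using box_volume_nonneg[OF n] by simp
  qed
  finally have "L2_norm P (\<lambda>\<omega>. (max_field_sum e {0..n} \<omega>)\<^sup>2) \<le> 2 ^ CARD('d) * (4 ^ CARD('d) * box_volume n * b\<^sup>2)"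
    by simp
  also have "\<dots> = 8 ^ CARD('d) * box_volume n * b\<^sup>2"
    by (simp add: mult.assoc flip: power_mult_distrib)
  finally have "(L2_norm P (\<lambda>\<omega>. (max_field_sum e {0..n} \<omega>)\<^sup>2))\<^sup>2 \<le> (8 ^ CARD('d) * box_volume n * b\<^sup>2)\<^sup>2"
    by (intro power_mono) auto
  then show ?thesis unfolding L2_norm_power2 by (simp flip: power_mult)
qed

end

section \<open>Approximation and decomposition\<close>

context real_iid
begin

section \<open>Density of the bounded functions of finitely many coordinates\<close>

definition cylindrical :: "(('i \<Rightarrow> real) \<Rightarrow> real) \<Rightarrow> bool" where
  "cylindrical \<phi> \<longleftrightarrow> \<phi> \<in> borel_measurable P \<and> (\<exists>K. finite K \<and> depends_on K \<phi>) \<and> (\<exists>B. \<forall>\<omega>. \<bar>\<phi> \<omega>\<bar> \<le> B)"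

lemma cylindricalI:
  "\<phi> \<in> borel_measurable P \<Longrightarrow> finite K \<Longrightarrow> depends_on K \<phi> \<Longrightarrow> (\<And>\<omega>. \<bar>\<phi> \<omega>\<bar> \<le> B) \<Longrightarrow> cylindrical \<phi>"
  unfolding cylindrical_def by blast

lemma cylindricalE:
  assumes "cylindrical \<phi>"
  obtains K B where "finite K" "depends_on K \<phi>" "\<forall>\<omega>. \<bar>\<phi> \<omega>\<bar> \<le> B"
proof -
  note a = assms[unfolded cylindrical_def]
  from a[THEN conjunct2, THEN conjunct1] obtain K where K: "finite K \<and> depends_on K \<phi>" by (rule exE)
  from a[THEN conjunct2, THEN conjunct2] obtain B where B: "\<forall>\<omega>. \<bar>\<phi> \<omega>\<bar> \<le> B" by (rule exE)
  show ?thesis by (rule that[OF conjunct1[OF K] conjunct2[OF K] B])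
qed

lemma cylindrical_measurable:
  assumes "cylindrical \<phi>"
  shows "\<phi> \<in> borel_measurable P"
  by (rule assms[unfolded cylindrical_def, THEN conjunct1])

lemma cylindrical_const: "cylindrical (\<lambda>_. c)"
  by (rule cylindricalI[of _ "{}" "\<bar>c\<bar>"]) (simp_all add: depends_on_const)

lemma cylindrical_cmult:
  assumes "cylindrical \<phi>"
  shows "cylindrical (\<lambda>\<omega>. c * \<phi> \<omega>)"
proof -
  obtain K B where K: "finite K" "depends_on K \<phi>" and B: "\<forall>\<omega>. \<bar>\<phi> \<omega>\<bar> \<le> B"
    by (rule cylindricalE[OF assms(1)])
  have "\<bar>c * \<phi> \<omega>\<bar> \<le> \<bar>c\<bar> * B" for \<omega>
    unfolding abs_mult by (rule mult_left_mono[OF B[rule_format]]) simp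
  moreover have "depends_on K (\<lambda>\<omega>. c * \<phi> \<omega>)" by (rule depends_on_compose[OF K(2)])
  ultimately show ?thesis
    using cylindrical_measurable[OF assms] by (intro cylindricalI[OF _ K(1)] borel_measurable_times borel_measurable_const)
qed

lemma cylindrical_add:
  assumes "cylindrical \<phi>" "cylindrical \<psi>"
  shows "cylindrical (\<lambda>\<omega>. \<phi> \<omega> + \<psi> \<omega>)"
proof -
  obtain K B where K: "finite K" "depends_on K \<phi>" and B: "\<forall>\<omega>. \<bar>\<phi> \<omega>\<bar> \<le> B"
    by (rule cylindricalE[OF assms(1)])
  obtain K' B' where K': "finite K'" "depends_on K' \<psi>" and B': "\<forall>\<omega>. \<bar>\<psi> \<omega>\<bar> \<le> B'"
    by (rule cylindricalE[OF assms(2)])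
  have "\<bar>\<phi> \<omega> + \<psi> \<omega>\<bar> \<le> B + B'" for \<omega>
    using B[rule_format, of \<omega>] B'[rule_format, of \<omega>] by linarith
  moreover have "depends_on (K \<union> K') (\<lambda>\<omega>. \<phi> \<omega> + \<psi> \<omega>)"
    by (rule depends_on_compose2[OF depends_on_mono[OF K(2) Un_upper1] depends_on_mono[OF K'(2) Un_upper2]])
  ultimately show ?thesis
    using assms[THEN cylindrical_measurable] K(1) K'(1)
    by (intro cylindricalI[of _ "K \<union> K'"] borel_measurable_add finite_UnI)
qed

lemma cylindrical_square_integrable:
  assumes "cylindrical \<phi>"
  shows "square_integrable P \<phi>"
proof -
  obtain K B where "finite K" "depends_on K \<phi>" and B: "\<forall>\<omega>. \<bar>\<phi> \<omega>\<bar> \<le> B" by (rule cylindricalE[OF assms])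
  show ?thesis
    by (rule finite_measure.square_integrable_const_bound[OF prob_space.axioms(1)[OF prob_space_P]
          cylindrical_measurable[OF assms] B[rule_format]])
qed

text \<open>The closure of the cylindrical functions in square mean, shown below to contain every
  square-integrable function.\<close>

definition cyl_approx :: "(('i \<Rightarrow> real) \<Rightarrow> real) \<Rightarrow> bool" where
  "cyl_approx g \<longleftrightarrow> square_integrable P g \<and> (\<forall>\<epsilon>>0. \<exists>\<phi>. cylindrical \<phi> \<and> L2_norm P (\<lambda>\<omega>. g \<omega> - \<phi> \<omega>) < \<epsilon>)"

lemma cyl_approxD: "cyl_approx g \<Longrightarrow> square_integrable P g" by (simp add: cyl_approx_def)

lemma cylindrical_cyl_approx: "cylindrical \<phi> \<Longrightarrow> cyl_approx \<phi>"
  unfolding cyl_approx_def using cylindrical_square_integrable by (intro conjI allI impI exI[of _ \<phi>]) simp_all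

lemma cyl_approx_cmult:
  assumes "cyl_approx g"
  shows "cyl_approx (\<lambda>\<omega>. c * g \<omega>)"
  unfolding cyl_approx_def
proof (intro conjI allI impI)
  show "square_integrable P (\<lambda>\<omega>. c * g \<omega>)" by (rule square_integrable_cmult[OF cyl_approxD[OF assms]])
  fix \<epsilon> :: real assume e: "\<epsilon> > 0"
  have pos: "0 < \<epsilon> / (\<bar>c\<bar> + 1)" using e by simp
  obtain \<phi> where p: "cylindrical \<phi>" "L2_norm P (\<lambda>\<omega>. g \<omega> - \<phi> \<omega>) < \<epsilon> / (\<bar>c\<bar> + 1)"
    using assms pos unfolding cyl_approx_def by blast
  have "L2_norm P (\<lambda>\<omega>. c * g \<omega> - c * \<phi> \<omega>) = \<bar>c\<bar> * L2_norm P (\<lambda>\<omega>. g \<omega> - \<phi> \<omega>)"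
    by (simp add: L2_norm_cmult flip: right_diff_distrib)
  also have "\<dots> \<le> \<bar>c\<bar> * (\<epsilon> / (\<bar>c\<bar> + 1))" using p(2) by (intro mult_left_mono) auto
  also have "\<dots> < \<epsilon>" using e by (simp add: field_simps)
  finally show "\<exists>\<phi>. cylindrical \<phi> \<and> L2_norm P (\<lambda>\<omega>. c * g \<omega> - \<phi> \<omega>) < \<epsilon>"
    using cylindrical_cmult[OF p(1), of c] by blast
qed

lemma cyl_approx_add:
  assumes "cyl_approx g" "cyl_approx h"
  shows "cyl_approx (\<lambda>\<omega>. g \<omega> + h \<omega>)"
  unfolding cyl_approx_def
proof (intro conjI allI impI)
  note s = assms[THEN cyl_approxD]
  show "square_integrable P (\<lambda>\<omega>. g \<omega> + h \<omega>)" by (rule square_integrable_add[OF s])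
  fix \<epsilon> :: real assume e: "\<epsilon> > 0"
  then have e2: "\<epsilon> / 2 > 0" by simp
  obtain \<phi> where p: "cylindrical \<phi>" "L2_norm P (\<lambda>\<omega>. g \<omega> - \<phi> \<omega>) < \<epsilon> / 2"
    using assms(1) e2 unfolding cyl_approx_def by blast
  obtain \<psi> where q: "cylindrical \<psi>" "L2_norm P (\<lambda>\<omega>. h \<omega> - \<psi> \<omega>) < \<epsilon> / 2"
    using assms(2) e2 unfolding cyl_approx_def by blast
  have "L2_norm P (\<lambda>\<omega>. (g \<omega> - \<phi> \<omega>) + (h \<omega> - \<psi> \<omega>)) < \<epsilon>"
    using L2_norm_triangle[OF square_integrable_diff[OF s(1) cylindrical_square_integrable[OF p(1)]]
        square_integrable_diff[OF s(2) cylindrical_square_integrable[OF q(1)]]] p(2) q(2) by simp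
  then have "L2_norm P (\<lambda>\<omega>. g \<omega> + h \<omega> - (\<phi> \<omega> + \<psi> \<omega>)) < \<epsilon>" by (simp add: algebra_simps)
  then show "\<exists>\<phi>. cylindrical \<phi> \<and> L2_norm P (\<lambda>\<omega>. g \<omega> + h \<omega> - \<phi> \<omega>) < \<epsilon>"
    using cylindrical_add[OF p(1) q(1)] by (intro exI[of _ "\<lambda>\<omega>. \<phi> \<omega> + \<psi> \<omega>"]) simp
qed

lemma cyl_approx_sum:
  "finite I \<Longrightarrow> (\<And>i. i \<in> I \<Longrightarrow> cyl_approx (g i)) \<Longrightarrow> cyl_approx (\<lambda>\<omega>. \<Sum>i\<in>I. g i \<omega>)"
proof (induction I rule: finite_induct)
  case empty
  show ?case using cylindrical_cyl_approx[OF cylindrical_const[of 0]] by simp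
next
  case (insert i I)
  have "cyl_approx (\<lambda>\<omega>. g i \<omega> + (\<Sum>i\<in>I. g i \<omega>))"
    by (rule cyl_approx_add) (use insert in auto)
  then show ?case using insert.hyps by simp
qed

lemma cyl_approx_limit:
  assumes g: "square_integrable P g" and F: "\<And>n. cyl_approx (F n)"
    and lim: "(\<lambda>n. L2_norm P (\<lambda>\<omega>. F n \<omega> - g \<omega>)) \<longlonglongrightarrow> 0"
  shows "cyl_approx g"
  unfolding cyl_approx_def
proof (intro conjI allI impI g)
  fix \<epsilon> :: real assume e: "\<epsilon> > 0"
  then have e2: "\<epsilon> / 2 > 0" by simp
  obtain n where n: "L2_norm P (\<lambda>\<omega>. F n \<omega> - g \<omega>) < \<epsilon> / 2"
    using order_tendstoD(2)[OF lim e2] by (auto simp: eventually_sequentially)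
  obtain \<phi> where p: "cylindrical \<phi>" "L2_norm P (\<lambda>\<omega>. F n \<omega> - \<phi> \<omega>) < \<epsilon> / 2"
    using F[of n] e2 unfolding cyl_approx_def by blast
  have "L2_norm P (\<lambda>\<omega>. (F n \<omega> - \<phi> \<omega>) - (F n \<omega> - g \<omega>)) < \<epsilon>"
    using L2_norm_triangle_diff[OF square_integrable_diff[OF cyl_approxD[OF F[of n]] cylindrical_square_integrable[OF p(1)]]
        square_integrable_diff[OF cyl_approxD[OF F[of n]] g]] p(2) n by simp
  then show "\<exists>\<phi>. cylindrical \<phi> \<and> L2_norm P (\<lambda>\<omega>. g \<omega> - \<phi> \<omega>) < \<epsilon>"
    using p(1) by (intro exI[of _ \<phi>]) simp
qed

text \<open>Dynkin's argument: the cylinder sets are an intersection-stable generator, and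
  complements and countable disjoint unions stay in the closure.\<close>

lemma cyl_approx_indicator:
  assumes "S \<in> sets (P :: ('i \<Rightarrow> real) measure)"
  shows "cyl_approx (indicator S :: ('i \<Rightarrow> real) \<Rightarrow> real)"
proof -
  have fm: "finite_measure (P :: ('i \<Rightarrow> real) measure)" by (rule prob_space.axioms(1)[OF prob_space_P])
  let ?G = "prod_algebra UNIV (\<lambda>_::'i. \<mu>)"
  have sets_eq: "sets (P :: ('i \<Rightarrow> real) measure) = sigma_sets UNIV ?G"
    by (simp add: sets_PiM PiE_def extensional_def)
  have sqi: "square_integrable P (indicator A :: ('i \<Rightarrow> real) \<Rightarrow> real)" if "A \<in> sigma_sets UNIV ?G" for A
  proof (rule finite_measure.square_integrable_const_bound[OF fm, where B = 1])
    have "A \<in> sets P" using that by (simp only: sets_eq)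
    then show "(indicator A :: ('i \<Rightarrow> real) \<Rightarrow> real) \<in> borel_measurable P" by (rule borel_measurable_indicator)
  qed (simp add: indicator_def)
  have G: "?G \<subseteq> Pow UNIV" by simp
  have "S \<in> sigma_sets UNIV ?G" using assms by (simp add: sets_eq)
  from G this show ?thesis
  proof (induction rule: sigma_sets_induct_disjoint[OF Int_stable_prod_algebra, consumes 2, case_names basic empty compl union])
    case (basic A)
    then obtain J E where A: "A = prod_emb UNIV (\<lambda>_. \<mu>) J (Pi\<^sub>E J E)" "finite J"
      by (auto elim!: prod_algebraE)
    have "depends_on J (indicator A :: _ \<Rightarrow> real)"
      by (auto simp: depends_on_def A(1) indicator_def prod_emb_def PiE_iff)
    moreover have "(indicator A :: _ \<Rightarrow> real) \<in> borel_measurable P"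
      by (rule square_integrable_measurable[OF sqi]) (use basic in blast)
    ultimately have "cylindrical (indicator A)"
      using A(2) by (intro cylindricalI[of _ J 1]) (simp_all add: indicator_def)
    then show ?case by (rule cylindrical_cyl_approx)
  next
    case empty
    show ?case using cylindrical_cyl_approx[OF cylindrical_const[of 0]] by simp
  next
    case (compl A)
    have "cyl_approx (\<lambda>\<omega>. 1 + (-1) * indicator A \<omega>)"
      by (rule cyl_approx_add[OF cylindrical_cyl_approx[OF cylindrical_const] cyl_approx_cmult[OF compl(2)]])
    moreover have "(\<lambda>\<omega>. 1 + (-1) * indicator A \<omega>) = (indicator (UNIV - A) :: _ \<Rightarrow> real)"
      by (auto simp: indicator_def fun_eq_iff)
    ultimately show ?case by simp
  next
    case (union A)
    have U: "(\<Union>i. A i) \<in> sigma_sets UNIV ?G" using union by (intro sigma_sets.Union) auto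
    show ?case
    proof (rule cyl_approx_limit[where F = "\<lambda>n \<omega>. \<Sum>i<n. indicator (A i) \<omega>"])
      show "square_integrable P (indicator (\<Union>i. A i) :: ('i \<Rightarrow> real) \<Rightarrow> real)" by (rule sqi[OF U])
      show "cyl_approx (\<lambda>\<omega>. \<Sum>i<n. indicator (A i) \<omega>)" for n
        by (rule cyl_approx_sum[OF finite_lessThan union(3)])
      have part: "(\<Sum>i<n. indicator (A i) \<omega>) = (indicator (\<Union>i<n. A i) \<omega> :: real)" for n \<omega>
        using union(1) by (subst indicator_UN_disjoint) (auto simp: disjoint_family_on_def)
      show "(\<lambda>n. L2_norm P (\<lambda>\<omega>. (\<Sum>i<n. indicator (A i) \<omega>) - indicator (\<Union>i. A i) \<omega>)) \<longlonglongrightarrow> 0"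
        unfolding part
      proof (rule L2_tendsto_of_dominated[where C = 1])
        show "square_integrable P (indicator (\<Union>i. A i) :: ('i \<Rightarrow> real) \<Rightarrow> real)" by (rule sqi[OF U])
        show "(indicator (\<Union>i<n. A i) :: ('i \<Rightarrow> real) \<Rightarrow> real) \<in> borel_measurable P" for n
        proof (rule borel_measurable_indicator, rule sets.finite_UN)
          show "A i \<in> sets P" if "i \<in> {..<n}" for i unfolding sets_eq using union(2) by blast
        qed simp
        show "(\<lambda>n. indicator (\<Union>i<n. A i) \<omega> :: real) \<longlonglongrightarrow> indicator (\<Union>i. A i) \<omega>" for \<omega>
          by (rule LIMSEQ_indicator_UN)
        show "\<bar>indicator (\<Union>i<n. A i) \<omega> - indicator (\<Union>i. A i) \<omega>\<bar> \<le> 1 * \<bar>indicator (\<Union>i. A i) \<omega> :: real\<bar>" for n \<omega>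
          by (auto simp: indicator_def)
      qed
    qed
  qed
qed

lemma cyl_approx_square_integrable:
  assumes f: "square_integrable P f"
  shows "cyl_approx f"
proof -
  have fm: "f \<in> borel_measurable P" using f by (simp add: square_integrable_def)
  obtain F where F: "\<And>i. simple_function P (F i)" "\<And>x. (\<lambda>i. F i x) \<longlonglongrightarrow> f x"
    "\<And>i x. dist (F i x) 0 \<le> 2 * dist (f x) 0"
    using borel_measurable_implies_sequence_metric[OF fm, of 0] by auto
  show ?thesis
  proof (rule cyl_approx_limit[OF f, where F = F])
    fix n
    have "F n = (\<lambda>x. \<Sum>y\<in>F n ` space P. y * indicator (F n -` {y} \<inter> space P) x)"
    proof
      fix x
      have fin: "finite (F n ` space P)" by (rule simple_functionD(1)[OF F(1)])
      have "(\<Sum>y\<in>F n ` space P. y * indicator (F n -` {y} \<inter> space P) x) = (\<Sum>y\<in>F n ` space P. if y = F n x then y else 0)"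
        by (rule sum.cong) (simp_all add: indicator_def)
      also have "\<dots> = F n x" using fin by (subst sum.delta) simp_all
      finally show "F n x = (\<Sum>y\<in>F n ` space P. y * indicator (F n -` {y} \<inter> space P) x)" ..
    qed
    moreover have "cyl_approx (\<lambda>x. \<Sum>y\<in>F n ` space P. y * indicator (F n -` {y} \<inter> space P) x)"
      by (rule cyl_approx_sum[OF simple_functionD(1)[OF F(1)] cyl_approx_cmult[OF cyl_approx_indicator[OF simple_functionD(2)[OF F(1)]]]])
    ultimately show "cyl_approx (F n)" by simp
  next
    show "(\<lambda>n. L2_norm P (\<lambda>\<omega>. F n \<omega> - f \<omega>)) \<longlonglongrightarrow> 0"
    proof (rule L2_tendsto_of_dominated[OF f, where C = 3])
      show "F n \<in> borel_measurable P" for n by (rule borel_measurable_simple_function[OF F(1)])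
      show "\<bar>F n x - f x\<bar> \<le> 3 * \<bar>f x\<bar>" for n x using F(3)[of n x] by (simp add: dist_real_def)
    qed (rule F(2))
  qed
qed

text \<open>A cylindrical approximation is projected by \<open>P\<^sub>0\<close>, which reproduces
  \<open>e\<close> almost everywhere, is bounded in square mean, and keeps both boundedness and the
  finite window of coordinates.\<close>

lemma orthodiff_approx:
  fixes e :: "(int ^ 'd::finite \<Rightarrow> real) \<Rightarrow> real"
  assumes e: "orthodiff e" and \<epsilon>: "0 < \<epsilon>"
  obtains u where "orthodiff u" "cylindrical u" "L2_norm P (\<lambda>\<omega>. e \<omega> - u \<omega>) < \<epsilon>"
proof -
  let ?c = "coords :: 'd list"
  note es = orthodiff_square_integrable[OF e]
  \<comment> \<open>The projection enlarges square-mean norms at most by the factor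
    \<open>2 ^ length ?c\<close>, so the tolerance is divided by it.\<close>
  have "0 < \<epsilon> / 2 ^ length ?c" using \<epsilon> by simp
  then obtain \<phi> where p: "cylindrical \<phi>" "L2_norm P (\<lambda>\<omega>. e \<omega> - \<phi> \<omega>) < \<epsilon> / 2 ^ length ?c"
    using cyl_approx_square_integrable[OF es] unfolding cyl_approx_def by blast
  note ps = cylindrical_square_integrable[OF p(1)]
  note ds = square_integrable_diff[OF es ps]
  let ?u = "cproj ?c (\<lambda>_. 0) \<phi>"
  have u: "orthodiff ?u" by (rule orthodiff_cproj[OF ps])
  obtain K B where K: "finite K" "depends_on K \<phi>" and B: "\<forall>\<omega>. \<bar>\<phi> \<omega>\<bar> \<le> B"
    by (rule cylindricalE[OF p(1)])
  have "cylindrical ?u"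
    by (rule cylindricalI[OF square_integrable_measurable[OF orthodiff_square_integrable[OF u]] K(1)
          depends_on_cproj[OF K(2)] cproj_bound[OF B[rule_format]]])
  moreover have "L2_norm P (\<lambda>\<omega>. e \<omega> - ?u \<omega>) < \<epsilon>"
  proof -
    have "L2_norm P (\<lambda>\<omega>. e \<omega> - ?u \<omega>) = L2_norm P (cproj ?c (\<lambda>_. 0) (\<lambda>\<omega>. e \<omega> - \<phi> \<omega>))"
    proof (rule L2_norm_cong_AE)
      show "AE \<omega> in P. e \<omega> - ?u \<omega> = cproj ?c (\<lambda>_. 0) (\<lambda>\<omega>. e \<omega> - \<phi> \<omega>) \<omega>"
        using cproj_orthodiff[OF e, of ?c] cproj_diff_AE[OF es ps, of ?c "\<lambda>_. 0"] by eventually_elim simp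
      show "(\<lambda>\<omega>. e \<omega> - ?u \<omega>) \<in> borel_measurable P"
        by (rule square_integrable_measurable[OF square_integrable_diff[OF es orthodiff_square_integrable[OF u]]])
      show "cproj ?c (\<lambda>_. 0) (\<lambda>\<omega>. e \<omega> - \<phi> \<omega>) \<in> borel_measurable P"
        by (rule borel_measurable_cproj[OF square_integrable_measurable[OF ds]])
    qed
    also have "\<dots> \<le> 2 ^ length ?c * L2_norm P (\<lambda>\<omega>. e \<omega> - \<phi> \<omega>)"
      using square_integrable_cproj[OF ds] by blast
    also have "\<dots> < \<epsilon>" using p(2) by (simp add: field_simps)
    finally show ?thesis .
  qed
  ultimately show ?thesis using u that by blast
qed

section \<open>The telescoping sum of the projections\<close>

text \<open>In each direction the marginal projections at the levels from \<open>- N\<close> to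
  \<open>N\<close> add up to this difference of two conditional expectations.\<close>

definition tele :: "'d::finite list \<Rightarrow> nat \<Rightarrow> ((int ^ 'd \<Rightarrow> real) \<Rightarrow> real) \<Rightarrow> (int ^ 'd \<Rightarrow> real) \<Rightarrow> real" where
  "tele qs N = foldr (\<lambda>q g \<omega>. cexp (halfspace_le q (int N)) g \<omega> - cexp (halfspace_le q (- int N - 1)) g \<omega>) qs"

lemma tele_Nil [simp]: "tele [] N g = g" by (simp add: tele_def)

lemma tele_Cons [simp]: "tele (q # qs) N g =
    (\<lambda>\<omega>. cexp (halfspace_le q (int N)) (tele qs N g) \<omega> - cexp (halfspace_le q (- int N - 1)) (tele qs N g) \<omega>)"
  by (simp add: tele_def)

lemma square_integrable_tele:
  assumes "square_integrable P g"
  shows "square_integrable P (tele qs N g) \<and> L2_norm P (tele qs N g) \<le> 2 ^ length qs * L2_norm P g"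
proof (induction qs)
  case (Cons q qs)
  note c = square_integrable_cexp(1)[OF conjunct1[OF Cons]] and n = square_integrable_cexp(2)[OF conjunct1[OF Cons]]
  have "L2_norm P (tele (q # qs) N g) \<le> 2 * L2_norm P (tele qs N g)"
    using L2_norm_triangle_diff[OF c c, of "halfspace_le q (int N)" "halfspace_le q (- int N - 1)"]
      n[of "halfspace_le q (int N)"] n[of "halfspace_le q (- int N - 1)"] by simp
  then show ?case using Cons c by (auto intro: square_integrable_diff)
qed (simp add: assms)

lemma tele_diff_AE:
  assumes "square_integrable P g" "square_integrable P h"
  shows "AE \<omega> in P. tele qs N (\<lambda>\<omega>. g \<omega> - h \<omega>) \<omega> = tele qs N g \<omega> - tele qs N h \<omega>"
proof (induction qs)
  case (Cons q qs)
  have s: "square_integrable P (tele qs N g)" "square_integrable P (tele qs N h)"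
      "square_integrable P (tele qs N (\<lambda>\<omega>. g \<omega> - h \<omega>))"
    using square_integrable_tele assms square_integrable_diff[OF assms] by blast+
  have *: "AE \<omega> in P. cexp A (tele qs N (\<lambda>\<omega>. g \<omega> - h \<omega>)) \<omega> = cexp A (tele qs N g) \<omega> - cexp A (tele qs N h) \<omega>" for A
    using cexp_cong_AE[OF Cons square_integrable_measurable[OF s(3)]
          square_integrable_measurable[OF square_integrable_diff[OF s(1,2)]], of A]
      cexp_diff_AE[OF s(1,2)[THEN square_integrable_imp_integrable_P], of A]
    by eventually_elim simp
  show ?case
    using *[of "halfspace_le q (int N)"] *[of "halfspace_le q (- int N - 1)"] by eventually_elim simp
qed simp

definition cube :: "nat \<Rightarrow> (int ^ 'd::finite) set" where
  "cube N = {(\<chi> q. - int N)..(\<chi> q. int N)}"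

lemma finite_cube [simp]: "finite (cube N)" by (simp add: cube_def)

lemma mem_cube: "i \<in> cube N \<longleftrightarrow> (\<forall>q. \<bar>i $ q\<bar> \<le> int N)"
  by (auto simp: cube_def less_eq_vec_def abs_le_iff) (metis minus_le_iff)+

lemma finite_subset_cube:
  assumes "finite K"
  obtains N where "K \<subseteq> cube N"
proof -
  define N where "N = Max (insert 0 ((\<lambda>(i, q). nat \<bar>i $ q\<bar>) ` (K \<times> UNIV)))"
  have "\<bar>i $ q\<bar> \<le> int N" if "i \<in> K" for i q
  proof -
    have "nat \<bar>i $ q\<bar> \<le> N"
      unfolding N_def using assms that by (intro Max_ge) (auto intro!: image_eqI[where x = "(i, q)"])
    then show ?thesis by simp
  qed
  then have "K \<subseteq> cube N" unfolding subset_iff mem_cube by blast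
  then show ?thesis by (rule that)
qed

text \<open>In the innermost direction the level \<open>N\<close> sees all of \<open>K\<close> and
  the level \<open>- N - 1\<close> nothing of it, which subtracts the mean; the other directions
  then fix a centered function.\<close>

lemma tele_cylindrical:
  assumes K: "K \<subseteq> cube N" "depends_on K \<phi>" and i: "integrable P \<phi>"
  shows "tele (q # qs) N \<phi> = (\<lambda>\<omega>. \<phi> \<omega> - (\<integral>\<omega>. \<phi> \<omega> \<partial>P))"
proof -
  have c1: "cexp (halfspace_le q (int N)) g = g" if "depends_on K g" for g q
    by (rule cexp_id[OF depends_on_mono[OF that]]) (use K(1) in \<open>auto simp: mem_cube halfspace_le_def abs_le_iff\<close>)
  have c2: "cexp (halfspace_le q (- int N - 1)) g = (\<lambda>_. \<integral>\<omega>. g \<omega> \<partial>P)" if "depends_on K g" for g q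
  proof (rule cexp_disjoint[OF that])
    have "- int N - 1 < i $ q" if "i \<in> K" for i
    proof -
      have "\<bar>i $ q\<bar> \<le> int N" using K(1) that by (auto simp: mem_cube)
      then show ?thesis by linarith
    qed
    then show "halfspace_le q (- int N - 1) \<inter> K = {}" by (force simp: halfspace_le_def)
  qed
  have dep: "depends_on K (\<lambda>\<omega>. \<phi> \<omega> - (\<integral>\<omega>. \<phi> \<omega> \<partial>P))"
    by (rule depends_on_compose[OF K(2)])
  have zero: "(\<integral>\<omega>. \<phi> \<omega> - (\<integral>\<omega>. \<phi> \<omega> \<partial>P) \<partial>P) = 0"
    using i prob_space.prob_space[OF prob_space_P[where 'i = "int ^ 'a"]] 
    by (subst Bochner_Integration.integral_diff)
      (auto simp: finite_measure.integrable_const[OF prob_space.axioms(1)[OF prob_space_P]])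
  show ?thesis
  proof (induction qs arbitrary: q)
    case Nil
    show ?case by (simp add: c1[OF K(2)] c2[OF K(2)])
  next
    case (Cons p qs)
    show ?case
      unfolding tele_Cons[of q "p # qs"] Cons c1[OF dep] c2[OF dep] zero by simp
  qed
qed

text \<open>On a cylindrical function \<open>tele\<close> subtracts just the mean once the cube
  covers its window. The general case follows by approximation, since \<open>tele\<close> is bounded
  in square mean uniformly in \<open>N\<close>.\<close>

lemma tele_tendsto:
  fixes f :: "(int ^ 'd::finite \<Rightarrow> real) \<Rightarrow> real"
  assumes f: "square_integrable P f" and mean: "(\<integral>\<omega>. f \<omega> \<partial>P) = 0" and qs: "qs \<noteq> []"
  shows "(\<lambda>N. L2_norm P (\<lambda>\<omega>. f \<omega> - tele qs N f \<omega>)) \<longlonglongrightarrow> 0"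
proof (rule LIMSEQ_I)
  fix r :: real assume "0 < r"
  \<comment> \<open>One share is for \<open>f - \<phi>\<close>, one for the mean of
    \<open>\<phi>\<close>, which is small because \<open>f\<close> is centered, and
    \<open>2 ^ length qs\<close> shares are for \<open>tele\<close> of the difference.\<close>
  then have "0 < r / (2 + 2 ^ length qs)" by (intro divide_pos_pos) (auto intro: add_pos_pos)
  then obtain \<phi> where p: "cylindrical \<phi>" "L2_norm P (\<lambda>\<omega>. f \<omega> - \<phi> \<omega>) < r / (2 + 2 ^ length qs)"
    using cyl_approx_square_integrable[OF f] unfolding cyl_approx_def by blast
  let ?\<delta> = "L2_norm P (\<lambda>\<omega>. f \<omega> - \<phi> \<omega>)"
  note ps = cylindrical_square_integrable[OF p(1)]
  note ds = square_integrable_diff[OF f ps]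
  obtain K B where K: "finite K" "depends_on K \<phi>" and "\<forall>\<omega>. \<bar>\<phi> \<omega>\<bar> \<le> B"
    by (rule cylindricalE[OF p(1)])
  obtain N0 where N0: "K \<subseteq> cube N0" by (rule finite_subset_cube[OF K(1)])
  have "norm (L2_norm P (\<lambda>\<omega>. f \<omega> - tele qs N f \<omega>) - 0) < r" if "N0 \<le> N" for N
  proof -
    have "cube N0 \<subseteq> (cube N :: (int ^ 'd) set)"
    proof (rule subsetI)
      fix i :: "int ^ 'd" assume "i \<in> cube N0"
      then have "\<bar>i $ q\<bar> \<le> int N" for q using that order_trans[of "\<bar>i $ q\<bar>" "int N0" "int N"] by (simp add: mem_cube)
      then show "i \<in> cube N" by (simp add: mem_cube)
    qed
    with N0 have "K \<subseteq> cube N" by simp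
    moreover obtain q qs' where "qs = q # qs'" using qs by (cases qs) auto
    ultimately have t: "tele qs N \<phi> = (\<lambda>\<omega>. \<phi> \<omega> - (\<integral>\<omega>. \<phi> \<omega> \<partial>P))"
      using tele_cylindrical[OF _ K(2) square_integrable_imp_integrable_P[OF ps]] by blast
    let ?m = "\<integral>\<omega>. \<phi> \<omega> \<partial>P"
    note ts = conjunct1[OF square_integrable_tele[OF ds, of qs N]]
    have cs: "square_integrable P (\<lambda>_::int ^ 'd \<Rightarrow> real. c)" for c
      by (intro cylindrical_square_integrable cylindrical_const)
    have "L2_norm P (\<lambda>\<omega>. f \<omega> - tele qs N f \<omega>)
        = L2_norm P (\<lambda>\<omega>. ((f \<omega> - \<phi> \<omega>) + ?m) - tele qs N (\<lambda>\<omega>. f \<omega> - \<phi> \<omega>) \<omega>)"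
    proof (rule L2_norm_cong_AE)
      show "AE \<omega> in P. f \<omega> - tele qs N f \<omega> = ((f \<omega> - \<phi> \<omega>) + ?m) - tele qs N (\<lambda>\<omega>. f \<omega> - \<phi> \<omega>) \<omega>"
        using tele_diff_AE[OF f ps, of qs N] by eventually_elim (simp add: t)
    next
      show "(\<lambda>\<omega>. f \<omega> - tele qs N f \<omega>) \<in> borel_measurable P"
        by (rule square_integrable_measurable[OF square_integrable_diff[OF f conjunct1[OF square_integrable_tele[OF f]]]])
      show "(\<lambda>\<omega>. ((f \<omega> - \<phi> \<omega>) + ?m) - tele qs N (\<lambda>\<omega>. f \<omega> - \<phi> \<omega>) \<omega>) \<in> borel_measurable P"
        by (rule square_integrable_measurable[OF square_integrable_diff[OF square_integrable_add[OF ds cs] ts]])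
    qed
    also have "\<dots> \<le> L2_norm P (\<lambda>\<omega>. (f \<omega> - \<phi> \<omega>) + ?m) + L2_norm P (tele qs N (\<lambda>\<omega>. f \<omega> - \<phi> \<omega>))"
      by (rule L2_norm_triangle_diff[OF square_integrable_add[OF ds cs] ts])
    also have "L2_norm P (\<lambda>\<omega>. (f \<omega> - \<phi> \<omega>) + ?m) \<le> ?\<delta> + L2_norm P (\<lambda>_ :: int ^ 'd \<Rightarrow> real. ?m)"
      by (rule L2_norm_triangle[OF ds cs])
    also have "L2_norm P (\<lambda>_ :: int ^ 'd \<Rightarrow> real. ?m) = \<bar>?m\<bar>"
      using prob_space.prob_space[OF prob_space_P[where 'i = "int ^ 'd"]] by (simp add: L2_norm_def)
    also have "\<bar>?m\<bar> \<le> ?\<delta>"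
    proof -
      have "(\<integral>\<omega>. f \<omega> - \<phi> \<omega> \<partial>P) = - ?m"
        using mean f ps by (simp add: square_integrable_imp_integrable_P)
      then show ?thesis using prob_space.expectation_le_L2[OF prob_space_P ds] by simp
    qed
    also have "L2_norm P (tele qs N (\<lambda>\<omega>. f \<omega> - \<phi> \<omega>)) \<le> 2 ^ length qs * ?\<delta>"
      using square_integrable_tele[OF ds] by blast
    also have "?\<delta> + ?\<delta> + 2 ^ length qs * ?\<delta> = (2 + 2 ^ length qs) * ?\<delta>" by (simp add: algebra_simps)
    also have "\<dots> < r"
    proof -
      have "(0::real) < 2 + 2 ^ length qs" by (intro add_pos_pos) auto
      then show ?thesis using p(2) by (simp add: pos_less_divide_eq mult.commute)
    qed
    finally show ?thesis by simp
  qed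
  then show "\<exists>N0. \<forall>N\<ge>N0. norm (L2_norm P (\<lambda>\<omega>. f \<omega> - tele qs N f \<omega>) - 0) < r" by blast
qed

lemma sum_telescope_int: "(\<Sum>l\<in>{- int n..int n}. a l - a (l - 1)) = a (int n) - (a (- int n - 1) :: 'a::ab_group_add)"
proof (induction n)
  case (Suc n)
  have "{- int (Suc n)..int (Suc n)} = insert (- int (Suc n)) (insert (int (Suc n)) {- int n..int n})" by auto
  then have "(\<Sum>l\<in>{- int (Suc n)..int (Suc n)}. a l - a (l - 1))
      = (a (- int (Suc n)) - a (- int (Suc n) - 1)) + ((a (int (Suc n)) - a (int (Suc n) - 1)) + (\<Sum>l\<in>{- int n..int n}. a l - a (l - 1)))"
    by simp
  also have "\<dots> = a (int (Suc n)) - a (- int (Suc n) - 1)"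
  proof -
    have "a (- int (Suc n)) = a (- int n - 1)" "a (int (Suc n) - 1) = a (int n)"
      by (rule arg_cong[where f = a], simp)+
    then show ?thesis unfolding Suc by simp
  qed
  finally show ?case .
qed simp

lemma cproj_cong: "(\<And>q. q \<in> set qs \<Longrightarrow> j q = j' q) \<Longrightarrow> cproj qs j g = cproj qs j' g"
  by (induction qs) auto

text \<open>The directions are telescoped one at a time: the inner directions are already replaced
  by \<open>tele\<close> when the levels of the outermost one are summed.\<close>

lemma sum_cproj_AE:
  fixes f :: "(int ^ 'd::finite \<Rightarrow> real) \<Rightarrow> real"
  assumes f: "square_integrable P f"
  shows "distinct qs \<Longrightarrow> AE \<omega> in P. (\<Sum>j\<in>(\<Pi>\<^sub>E q\<in>set qs. {- int N..int N}). cproj qs j f \<omega>) = tele qs N f \<omega>"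
proof (induction qs)
  case (Cons q qs)
  let ?I = "{- int N..int N}"
  let ?J = "\<Pi>\<^sub>E q\<in>set qs. ?I"
  have q: "q \<notin> set qs" using Cons.prems by simp
  have finJ: "finite ?J" by (intro finite_PiE) auto
  note s = conjunct1[OF square_integrable_cproj[OF f]]
  note ts = conjunct1[OF square_integrable_tele[OF f]]
  have expand: "(\<Sum>j\<in>(\<Pi>\<^sub>E q\<in>set (q # qs). ?I). cproj (q # qs) j f \<omega>) = (\<Sum>l\<in>?I. \<Sum>j\<in>?J. mproj q l (cproj qs j f) \<omega>)" for \<omega>
  proof -
    have "(\<Sum>j\<in>(\<Pi>\<^sub>E q\<in>set (q # qs). ?I). cproj (q # qs) j f \<omega>)
        = (\<Sum>(l, j)\<in>?I \<times> ?J. cproj (q # qs) (j(q := l)) f \<omega>)"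
      unfolding list.set PiE_insert_eq
      using inj_combinator[OF q, of "\<lambda>_. ?I"]
      by (subst sum.reindex) (simp_all add: case_prod_unfold comp_def del: cproj_Cons)
    also have "\<dots> = (\<Sum>(l, j)\<in>?I \<times> ?J. mproj q l (cproj qs j f) \<omega>)"
    proof (intro sum.cong refl, clarify)
      fix l j
      have "cproj qs (j(q := l)) f = cproj qs j f" using q by (intro cproj_cong) auto
      then show "cproj (q # qs) (j(q := l)) f \<omega> = mproj q l (cproj qs j f) \<omega>" by simp
    qed
    finally show ?thesis by (simp add: sum.cartesian_product)
  qed
  have lin: "AE \<omega> in P. (\<Sum>j\<in>?J. mproj q l (cproj qs j f) \<omega>) = mproj q l (tele qs N f) \<omega>" for l
  proof -
    have c: "AE \<omega> in P. (\<Sum>j\<in>?J. cexp A (cproj qs j f) \<omega>) = cexp A (tele qs N f) \<omega>" for A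
    proof -
      have IH: "AE \<omega> in P. (\<Sum>j\<in>?J. cproj qs j f \<omega>) = tele qs N f \<omega>"
        using Cons.IH Cons.prems by simp
      have "AE \<omega> in P. cexp A (\<lambda>\<omega>. \<Sum>j\<in>?J. cproj qs j f \<omega>) \<omega> = cexp A (tele qs N f) \<omega>"
        by (rule cexp_cong_AE[OF IH square_integrable_measurable[OF square_integrable_sum[OF s]]
              square_integrable_measurable[OF ts]])
      moreover have "AE \<omega> in P. cexp A (\<lambda>\<omega>. \<Sum>j\<in>?J. cproj qs j f \<omega>) \<omega> = (\<Sum>j\<in>?J. cexp A (cproj qs j f) \<omega>)"
        by (rule cexp_sum_AE[OF square_integrable_imp_integrable_P[OF s] finJ])
      ultimately show ?thesis by eventually_elim simp
    qed
    show ?thesis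
      using c[of "halfspace_le q l"] c[of "halfspace_le q (l - 1)"]
      by eventually_elim (simp add: mproj_def sum_subtractf)
  qed
  have "AE \<omega> in P. \<forall>l\<in>?I. (\<Sum>j\<in>?J. mproj q l (cproj qs j f) \<omega>) = mproj q l (tele qs N f) \<omega>"
    by (intro AE_finite_allI lin) simp
  then show ?case
  proof eventually_elim
    case (elim \<omega>)
    then show ?case
      unfolding expand using sum_telescope_int[of "\<lambda>l. cexp (halfspace_le q l) (tele qs N f) \<omega>" N]
      by (simp add: mproj_def)
  qed
qed simp

text \<open>This is \<open>P\<^sub>0 X\<close> at the index \<open>- j\<close>; composed with the shift by \<open>j\<close> it is \<open>P\<^sub>j f\<close>.\<close>

definition hannan_diff :: "((int ^ 'd::finite \<Rightarrow> real) \<Rightarrow> real) \<Rightarrow> int ^ 'd \<Rightarrow> (int ^ 'd \<Rightarrow> real) \<Rightarrow> real" where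
  "hannan_diff f j = cproj coords (\<lambda>_. 0) (\<lambda>\<omega>. f (shift (- j) \<omega>))"

lemma orthodiff_hannan_diff: "square_integrable P f \<Longrightarrow> orthodiff (hannan_diff f j)"
  unfolding hannan_diff_def by (intro orthodiff_cproj square_integrable_shift)

lemma hannan_diff_shift:
  assumes "f \<in> borel_measurable P"
  shows "hannan_diff f j (shift j \<omega>) = cproj coords (($) j) f \<omega>"
  unfolding hannan_diff_def cproj_shift[OF assms] shift_shift by simp

lemma hannan_decomposition:
  fixes f :: "(int ^ 'd::finite \<Rightarrow> real) \<Rightarrow> real"
  assumes f: "square_integrable P f" and mean: "(\<integral>\<omega>. f \<omega> \<partial>P) = 0"
  shows "(\<lambda>N. L2_norm P (\<lambda>\<omega>. f \<omega> - (\<Sum>j\<in>cube N. hannan_diff f j (shift j \<omega>)))) \<longlonglongrightarrow> 0"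
proof -
  let ?c = "coords :: 'd list"
  have c: "?c \<noteq> []" using coords(2)[where 'd = 'd] by (metis UNIV_not_empty empty_set)
  have fm: "f \<in> borel_measurable P" using f by (simp add: square_integrable_def)
  have eq: "L2_norm P (\<lambda>\<omega>. f \<omega> - (\<Sum>j\<in>cube N. hannan_diff f j (shift j \<omega>))) = L2_norm P (\<lambda>\<omega>. f \<omega> - tele ?c N f \<omega>)" for N
  proof (rule L2_norm_cong_AE)
    have "(\<Sum>j\<in>cube N. hannan_diff f j (shift j \<omega>)) = (\<Sum>j\<in>(\<Pi>\<^sub>E q\<in>set ?c. {- int N..int N}). cproj ?c j f \<omega>)" for \<omega>
      unfolding hannan_diff_shift[OF fm] cube_def vec_interval_eq_image
    proof (subst sum.reindex)
      have eq: "($) (\<chi> q. x q) = x" for x :: "'d \<Rightarrow> int" by (simp add: fun_eq_iff)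
      show "inj_on (\<lambda>f. \<chi> q. f q) (\<Pi>\<^sub>E q\<in>UNIV. {(\<chi> q. - int N) $ q..(\<chi> q. int N) $ q})"
        by (auto simp: inj_on_def vec_eq_iff fun_eq_iff)
      show "(\<Sum>j\<in>(\<Pi>\<^sub>E q\<in>UNIV. {(\<chi> q. - int N) $ q..(\<chi> q. int N) $ q}). ((\<lambda>j. cproj ?c (($) j) f \<omega>) \<circ> (\<lambda>f. \<chi> q. f q)) j)
          = (\<Sum>j\<in>(\<Pi>\<^sub>E q\<in>set ?c. {- int N..int N}). cproj ?c j f \<omega>)"
        by (simp add: eq)
    qed
    then show "AE \<omega> in P. f \<omega> - (\<Sum>j\<in>cube N. hannan_diff f j (shift j \<omega>)) = f \<omega> - tele ?c N f \<omega>"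
      using sum_cproj_AE[OF f, of ?c N] by simp
    show "(\<lambda>\<omega>. f \<omega> - (\<Sum>j\<in>cube N. hannan_diff f j (shift j \<omega>))) \<in> borel_measurable P"
      by (intro square_integrable_measurable square_integrable_diff f square_integrable_sum square_integrable_shift
          orthodiff_square_integrable orthodiff_hannan_diff)
    show "(\<lambda>\<omega>. f \<omega> - tele ?c N f \<omega>) \<in> borel_measurable P"
      by (rule square_integrable_measurable[OF square_integrable_diff[OF f conjunct1[OF square_integrable_tele[OF f]]]])
  qed
  show ?thesis unfolding eq by (rule tele_tendsto[OF f mean c])
qed

section \<open>A maximal inequality for series of shifted differences\<close>

lemma field_sum_shift: "field_sum (\<lambda>\<omega>. v (shift j \<omega>)) A \<omega> = field_sum v A (shift j \<omega>)"
  by (simp add: field_sum_def shift_shift add.commute)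

text \<open>The maximum for a shifted difference has the law of the unshifted one, so the bounds add
  up over \<open>j\<close>. The remainder of the series is multiplied by the number of points of the
  box, which is harmless because \<open>n\<close> stays fixed while \<open>N\<close> grows.\<close>

lemma maximal_inequality_series:
  fixes h :: "(int ^ 'd::finite \<Rightarrow> real) \<Rightarrow> real"
  assumes h: "square_integrable P h" and v: "\<And>j. orthodiff (v j)"
    and lim: "(\<lambda>N. L2_norm P (\<lambda>\<omega>. h \<omega> - (\<Sum>j\<in>cube N. v j (shift j \<omega>)))) \<longlonglongrightarrow> 0"
    and C: "\<And>N. (\<Sum>j\<in>cube N. L2_norm P (v j)) \<le> C" and n: "0 \<le> n"
  shows "L2_norm P (max_field_sum h {0..n}) \<le> 2 ^ CARD('d) * sqrt (box_volume n) * C"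
proof -
  let ?r = "\<lambda>N \<omega>. h \<omega> - (\<Sum>j\<in>cube N. v j (shift j \<omega>))"
  let ?k = "2 ^ CARD('d) * sqrt (box_volume n)"
  have K: "finite {0..n}" "{0..n} \<noteq> {}" using n by auto
  note vs = orthodiff_square_integrable[OF v]
  have rs: "square_integrable P (?r N)" for N
    by (intro square_integrable_diff h square_integrable_sum square_integrable_shift vs)
  note ms = square_integrable_max_field_sum[OF vs K]
  have bound: "L2_norm P (max_field_sum h {0..n}) \<le> ?k * C + real (card {1..n}) * L2_norm P (?r N)" for N
  proof -
    let ?A = "\<lambda>\<omega>. \<Sum>j\<in>cube N. max_field_sum (v j) {0..n} (shift j \<omega>)"
    let ?B = "\<lambda>\<omega>. \<Sum>i\<in>{1..n}. \<bar>?r N (shift i \<omega>)\<bar>"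
    have As: "square_integrable P ?A"
      by (intro square_integrable_sum square_integrable_shift ms)
    have Bs: "square_integrable P ?B"
      by (intro square_integrable_sum square_integrable_abs square_integrable_shift[OF rs])
    have le: "max_field_sum h {0..n} \<omega> \<le> ?A \<omega> + ?B \<omega>" for \<omega>
    proof (rule max_field_sum_le[OF K])
      fix k assume k: "k \<in> {0..n}"
      have "field_sum h {1..k} \<omega> = field_sum (\<lambda>\<omega>. (\<Sum>j\<in>cube N. v j (shift j \<omega>)) + ?r N \<omega>) {1..k} \<omega>" by simp
      also have "\<dots> = (\<Sum>j\<in>cube N. field_sum (v j) {1..k} (shift j \<omega>)) + (\<Sum>i\<in>{1..k}. ?r N (shift i \<omega>))"
        unfolding field_sum_shift[symmetric] unfolding field_sum_def sum.distrib
        by (subst sum.swap) simp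
      finally have "\<bar>field_sum h {1..k} \<omega>\<bar> \<le> (\<Sum>j\<in>cube N. \<bar>field_sum (v j) {1..k} (shift j \<omega>)\<bar>) + (\<Sum>i\<in>{1..k}. \<bar>?r N (shift i \<omega>)\<bar>)"
        using sum_abs[of "\<lambda>j. field_sum (v j) {1..k} (shift j \<omega>)" "cube N"] sum_abs[of "\<lambda>i. ?r N (shift i \<omega>)" "{1..k}"] by linarith
      moreover have "(\<Sum>j\<in>cube N. \<bar>field_sum (v j) {1..k} (shift j \<omega>)\<bar>) \<le> ?A \<omega>"
        by (intro sum_mono max_field_sum_ge K k)
      moreover have "(\<Sum>i\<in>{1..k}. \<bar>?r N (shift i \<omega>)\<bar>) \<le> ?B \<omega>"
        using k by (intro sum_mono2) auto
      ultimately show "\<bar>field_sum h {1..k} \<omega>\<bar> \<le> ?A \<omega> + ?B \<omega>" by linarith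
    qed
    have "L2_norm P (max_field_sum h {0..n}) \<le> L2_norm P (\<lambda>\<omega>. ?A \<omega> + ?B \<omega>)"
    proof (rule L2_norm_mono[OF square_integrable_add[OF As Bs]], rule AE_I2)
      fix \<omega>
      show "\<bar>max_field_sum h {0..n} \<omega>\<bar> \<le> \<bar>?A \<omega> + ?B \<omega>\<bar>"
        using le[of \<omega>] max_field_sum_nonneg[OF K, of h \<omega>] by linarith
    qed
    also have "\<dots> \<le> L2_norm P ?A + L2_norm P ?B" by (rule L2_norm_triangle[OF As Bs])
    also have "L2_norm P ?A \<le> ?k * C"
    proof -
      have "L2_norm P ?A \<le> (\<Sum>j\<in>cube N. L2_norm P (\<lambda>\<omega>. max_field_sum (v j) {0..n} (shift j \<omega>)))"
        by (intro L2_norm_sum square_integrable_shift ms)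
      also have "\<dots> = (\<Sum>j\<in>cube N. L2_norm P (max_field_sum (v j) {0..n}))"
        by (rule sum.cong[OF refl L2_norm_shift[OF square_integrable_measurable[OF ms]]])
      also have "\<dots> \<le> (\<Sum>j\<in>cube N. ?k * L2_norm P (v j))"
        by (intro sum_mono maximal_inequality_L2[OF v n])
      also have "\<dots> \<le> ?k * C"
        unfolding sum_distrib_left[symmetric] using box_volume_nonneg[OF n] by (intro mult_left_mono C) auto
      finally show ?thesis .
    qed
    also have "L2_norm P ?B \<le> real (card {1..n}) * L2_norm P (?r N)"
    proof -
      have "L2_norm P ?B \<le> (\<Sum>i\<in>{1..n}. L2_norm P (\<lambda>\<omega>. \<bar>?r N (shift i \<omega>)\<bar>))"
        by (intro L2_norm_sum square_integrable_abs square_integrable_shift[OF rs])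
      also have "\<dots> = (\<Sum>i\<in>{1..n}. L2_norm P (?r N))"
        using L2_norm_shift[OF square_integrable_measurable[OF rs[of N]]] by simp
      finally show ?thesis by simp
    qed
    finally show ?thesis by simp
  qed
  have "(\<lambda>N. ?k * C + real (card {1..n}) * L2_norm P (?r N)) \<longlonglongrightarrow> ?k * C + real (card {1..n}) * 0"
    by (intro tendsto_intros lim)
  then show ?thesis using bound by (intro LIMSEQ_le_const) auto
qed

end

section \<open>A central limit theorem for locally dependent fields\<close>

lemma abs_cos_diff_le: "\<bar>cos x - cos y\<bar> \<le> \<bar>x - y :: real\<bar>"
proof -
  have "norm (cos x - cos y) \<le> 1 * norm (x - y)"
    by (rule field_differentiable_bound[of UNIV cos "\<lambda>x. - sin x"])
      (auto intro!: derivative_eq_intros)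
  then show ?thesis by simp
qed

lemma abs_sin_diff_le: "\<bar>sin x - sin y\<bar> \<le> \<bar>x - y :: real\<bar>"
proof -
  have "norm (sin x - sin y) \<le> 1 * norm (x - y)"
    by (rule field_differentiable_bound[of UNIV sin cos])
      (auto intro!: derivative_eq_intros)
  then show ?thesis by simp
qed

text \<open>The derivative of the remainder is a difference of cosines, at most
  \<open>\<bar>h\<bar>\<close> on the segment.\<close>

lemma sin_taylor_bound: "\<bar>sin (x + h) - sin x - h * cos x\<bar> \<le> h\<^sup>2" for x h :: real
proof -
  let ?g = "\<lambda>t. sin (x + t) - t * cos x"
  have "norm (?g h - ?g 0) \<le> \<bar>h\<bar> * norm (h - 0)"
  proof (rule field_differentiable_bound[of "closed_segment 0 h" ?g "\<lambda>t. cos (x + t) - cos x"])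
    fix t assume "t \<in> closed_segment 0 h"
    then have "\<bar>t\<bar> \<le> \<bar>h\<bar>" by (auto simp: closed_segment_eq_real_ivl split: if_splits)
    then show "norm (cos (x + t) - cos x) \<le> \<bar>h\<bar>" using abs_cos_diff_le[of "x + t" x] by simp
  qed (auto intro!: derivative_eq_intros)
  then show ?thesis by (simp add: power2_eq_square algebra_simps)
qed

lemma cos_taylor_bound: "\<bar>cos (x + h) - cos x + h * sin x\<bar> \<le> h\<^sup>2" for x h :: real
proof -
  let ?g = "\<lambda>t. cos (x + t) + t * sin x"
  have "norm (?g h - ?g 0) \<le> \<bar>h\<bar> * norm (h - 0)"
  proof (rule field_differentiable_bound[of "closed_segment 0 h" ?g "\<lambda>t. sin x - sin (x + t)"])
    fix t assume "t \<in> closed_segment 0 h"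
    then have "\<bar>t\<bar> \<le> \<bar>h\<bar>" by (auto simp: closed_segment_eq_real_ivl split: if_splits)
    then show "norm (sin x - sin (x + t)) \<le> \<bar>h\<bar>" using abs_sin_diff_le[of x "x + t"] by simp
  qed (auto intro!: derivative_eq_intros)
  then show ?thesis by (simp add: power2_eq_square algebra_simps)
qed

text \<open>Tikhomirov's method: for \<open>\<phi>(u) = E cos (u W + \<theta>)\<close>, splitting off from \<open>W\<close> the neighbourhood of each
  summand gives \<open>\<phi>' = - u s\<^sup>2 \<phi>\<close> up to a small error, where \<open>s\<^sup>2\<close> is the variance of \<open>W\<close>. The phase
  \<open>\<theta>\<close> keeps everything real.\<close>

lemma (in prob_space) local_dependence_clt:
  fixes \<xi> :: "'i \<Rightarrow> 'a \<Rightarrow> real"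
  assumes fin: "finite I" and meas: "\<And>i. \<xi> i \<in> borel_measurable M" and bdd: "\<And>i x. \<bar>\<xi> i x\<bar> \<le> b"
    and N: "\<And>i. N i \<subseteq> Nb i" "\<And>i. Nb i \<subseteq> I" "\<And>i. real (card (Nb i)) \<le> K"
    and ind1: "\<And>i h. i \<in> I \<Longrightarrow> continuous_on UNIV h \<Longrightarrow> (\<integral>x. \<xi> i x * h (\<Sum>j\<in>I - N i. \<xi> j x) \<partial>M) = 0"
    and ind2: "\<And>i h. i \<in> I \<Longrightarrow> continuous_on UNIV h \<Longrightarrow>
      (\<integral>x. \<xi> i x * (\<Sum>j\<in>N i. \<xi> j x) * h (\<Sum>j\<in>I - Nb i. \<xi> j x) \<partial>M)
      = (\<integral>x. \<xi> i x * (\<Sum>j\<in>N i. \<xi> j x) \<partial>M) * (\<integral>x. h (\<Sum>j\<in>I - Nb i. \<xi> j x) \<partial>M)"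
  shows "\<bar>(\<integral>x. cos ((\<Sum>i\<in>I. \<xi> i x) + \<theta>) \<partial>M) - cos \<theta> * exp (- (\<integral>x. (\<Sum>i\<in>I. \<xi> i x)\<^sup>2 \<partial>M) / 2)\<bar>
    \<le> 4 * real (card I) * K\<^sup>2 * b ^ 3"
proof -
  define W where "W x = (\<Sum>i\<in>I. \<xi> i x)" for x
  define V where "V i x = (\<Sum>j\<in>N i. \<xi> j x)" for i x
  define V2 where "V2 i x = (\<Sum>j\<in>Nb i. \<xi> j x)" for i x
  define U where "U i x = (\<Sum>j\<in>I - N i. \<xi> j x)" for i x
  define U2 where "U2 i x = (\<Sum>j\<in>I - Nb i. \<xi> j x)" for i x
  define s2 where "s2 = (\<integral>x. (W x)\<^sup>2 \<partial>M)"
  define \<phi> where "\<phi> u = (\<integral>x. cos (u * W x + \<theta>) \<partial>M)" for u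
  have b: "0 \<le> b" using bdd abs_ge_zero order_trans by blast
  have K: "0 \<le> K" using N(3) of_nat_0_le_iff order_trans by blast
  have [measurable]: "\<xi> i \<in> borel_measurable M" for i by (rule meas)
  have mW[measurable]: "W \<in> borel_measurable M" "V i \<in> borel_measurable M" "V2 i \<in> borel_measurable M"
    "U i \<in> borel_measurable M" "U2 i \<in> borel_measurable M" for i
    unfolding W_def[abs_def] V_def[abs_def] V2_def[abs_def] U_def[abs_def] U2_def[abs_def]
    by (intro borel_measurable_sum meas)+
  have finN: "finite (N i)" "finite (Nb i)" for i
    using N fin by (meson finite_subset)+
  have sumb: "\<bar>\<Sum>j\<in>A. \<xi> j x\<bar> \<le> real (card A) * b" for A x
    by (rule order_trans[OF sum_abs sum_bounded_above]) (rule bdd)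
  have Wb: "\<bar>W x\<bar> \<le> real (card I) * b" for x unfolding W_def by (rule sumb)
  have V2b: "\<bar>V2 i x\<bar> \<le> K * b" for i x
    unfolding V2_def using sumb[of x "Nb i"] mult_right_mono[OF N(3)[of i] b] by linarith
  have Vb: "\<bar>V i x\<bar> \<le> K * b" for i x
  proof -
    have "real (card (N i)) \<le> K" using card_mono[OF finN(2) N(1), of i] N(3)[of i] by linarith
    from mult_right_mono[OF this b] show ?thesis unfolding V_def using sumb[of x "N i"] by linarith
  qed
  have WU: "W x = U i x + V i x" "W x = U2 i x + V2 i x" for i x
    unfolding W_def U_def V_def U2_def V2_def
    using sum.subset_diff[of "N i" I "\<lambda>j. \<xi> j x"] sum.subset_diff[of "Nb i" I "\<lambda>j. \<xi> j x"] N fin by (auto simp: subset_trans)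
  have intb: "integrable M g" if "g \<in> borel_measurable M" "\<And>x. \<bar>g x\<bar> \<le> c" for g :: "'a \<Rightarrow> real" and c
    using that by (intro integrable_const_bound[where B = c]) auto
  have cosb: "\<bar>cos y\<bar> \<le> 1" "\<bar>sin y\<bar> \<le> 1" for y :: real by simp_all
  have ic: "integrable M (\<lambda>x. cos (u * Y x + \<theta>))" "integrable M (\<lambda>x. sin (u * Y x + \<theta>))"
    if [measurable]: "Y \<in> borel_measurable M" for u Y
    by (rule intb[of _ 1]; simp)+
  have ixi: "integrable M (\<lambda>x. \<xi> i x * g x)" if "g \<in> borel_measurable M" "\<And>x. \<bar>g x\<bar> \<le> c" for i g c
  proof (rule intb[of _ "b * c"])
    show "\<bar>\<xi> i x * g x\<bar> \<le> b * c" for x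
      unfolding abs_mult using b by (intro mult_mono bdd that) auto
  qed (use that in measurable)
  \<comment> \<open>The variance sees only neighbouring pairs: each summand is orthogonal to the sum
    outside \<open>N i\<close>.\<close>
  have s2: "s2 = (\<Sum>i\<in>I. \<integral>x. \<xi> i x * V i x \<partial>M)"
  proof -
    have "(\<integral>x. \<xi> i x * W x \<partial>M) = (\<integral>x. \<xi> i x * V i x \<partial>M)" if "i \<in> I" for i
    proof -
      have "(\<integral>x. \<xi> i x * U i x \<partial>M) = 0" unfolding U_def using ind1[OF that, of "\<lambda>x. x"] by simp
      moreover have "(\<integral>x. \<xi> i x * W x \<partial>M) = (\<integral>x. \<xi> i x * U i x + \<xi> i x * V i x \<partial>M)"
        unfolding WU(1)[of _ i] by (simp add: distrib_left)
      moreover have "integrable M (\<lambda>x. \<xi> i x * U i x)" "integrable M (\<lambda>x. \<xi> i x * V i x)"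
        using sumb Vb by (auto intro!: ixi simp: U_def)
      ultimately show ?thesis by simp
    qed
    moreover have "s2 = (\<Sum>i\<in>I. \<integral>x. \<xi> i x * W x \<partial>M)"
    proof -
      have "s2 = (\<integral>x. (\<Sum>i\<in>I. \<xi> i x * W x) \<partial>M)"
        unfolding s2_def by (simp add: power2_eq_square W_def sum_distrib_right)
      also have "\<dots> = (\<Sum>i\<in>I. \<integral>x. \<xi> i x * W x \<partial>M)"
        by (rule Bochner_Integration.integral_sum) (rule ixi[OF mW(1) Wb])
      finally show ?thesis .
    qed
    ultimately show ?thesis by simp
  qed
  \<comment> \<open>The 4 collects 1 from the Taylor expansion around \<open>U i\<close>, 2 from
    replacing \<open>U i\<close> by \<open>U2 i\<close>, against which the mean of
    \<open>\<xi> i * V i\<close> factors out, and 1 from returning to \<open>W\<close>.\<close>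
  have key: "\<bar>(\<integral>x. \<xi> i x * sin (u * W x + \<theta>) \<partial>M) - u * (\<integral>x. \<xi> i x * V i x \<partial>M) * \<phi> u\<bar> \<le> 4 * (u\<^sup>2 * K\<^sup>2 * b ^ 3)"
    if i: "i \<in> I" for i u
  proof -
    let ?E = "\<lambda>g. \<integral>x. g x \<partial>M"
    have 0: "?E (\<lambda>x. \<xi> i x * sin (u * U i x + \<theta>)) = 0"
      unfolding U_def by (rule ind1[OF i]) (intro continuous_intros)
    have Vxi: "\<bar>\<xi> i x * V i x\<bar> \<le> b * (K * b)" for x
      unfolding abs_mult using b by (intro mult_mono bdd Vb) auto
    have 1: "\<bar>\<xi> i x * sin (u * W x + \<theta>) - \<xi> i x * sin (u * U i x + \<theta>) - u * (\<xi> i x * V i x * cos (u * U i x + \<theta>))\<bar> \<le> u\<^sup>2 * K\<^sup>2 * b ^ 3" for x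
    proof -
      have "\<bar>sin (u * U i x + \<theta> + u * V i x) - sin (u * U i x + \<theta>) - u * V i x * cos (u * U i x + \<theta>)\<bar> \<le> (u * V i x)\<^sup>2"
        by (rule sin_taylor_bound)
      also have "\<dots> \<le> u\<^sup>2 * (K * b)\<^sup>2"
        unfolding power_mult_distrib[of u] using power_mono[OF Vb abs_ge_zero, of i x 2] by (intro mult_left_mono) auto
      finally have "\<bar>\<xi> i x\<bar> * \<bar>sin (u * W x + \<theta>) - sin (u * U i x + \<theta>) - u * V i x * cos (u * U i x + \<theta>)\<bar> \<le> b * (u\<^sup>2 * (K * b)\<^sup>2)"
        using b by (intro mult_mono bdd) (auto simp: WU(1)[of x i] algebra_simps)
      also have "\<dots> = u\<^sup>2 * K\<^sup>2 * b ^ 3" by (simp add: power2_eq_square power3_eq_cube)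
      finally show ?thesis by (simp add: abs_mult[symmetric] algebra_simps)
    qed
    have 2: "\<bar>\<xi> i x * V i x * cos (u * U i x + \<theta>) - \<xi> i x * V i x * cos (u * U2 i x + \<theta>)\<bar> \<le> 2 * \<bar>u\<bar> * K\<^sup>2 * b ^ 3" for x
    proof -
      have "\<bar>cos (u * U i x + \<theta>) - cos (u * U2 i x + \<theta>)\<bar> \<le> \<bar>u * U i x + \<theta> - (u * U2 i x + \<theta>)\<bar>"
        by (rule abs_cos_diff_le)
      also have "\<dots> = \<bar>u\<bar> * \<bar>V2 i x - V i x\<bar>"
      proof -
        have "U i x - U2 i x = V2 i x - V i x" using WU[of x i] by linarith
        then show ?thesis by (simp add: abs_mult[symmetric] right_diff_distrib[symmetric])
      qed
      also have "\<dots> \<le> \<bar>u\<bar> * (2 * (K * b))" using Vb[of i x] V2b[of i x] by (intro mult_left_mono) linarith+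
      finally have "\<bar>\<xi> i x * V i x\<bar> * \<bar>cos (u * U i x + \<theta>) - cos (u * U2 i x + \<theta>)\<bar> \<le> (b * (K * b)) * (\<bar>u\<bar> * (2 * (K * b)))"
        using b K by (intro mult_mono Vxi) auto
      also have "\<dots> = 2 * \<bar>u\<bar> * K\<^sup>2 * b ^ 3" by (simp add: power2_eq_square power3_eq_cube)
      finally show ?thesis by (simp add: abs_mult[symmetric] algebra_simps)
    qed
    have 3: "\<bar>cos (u * U2 i x + \<theta>) - cos (u * W x + \<theta>)\<bar> \<le> \<bar>u\<bar> * (K * b)" for x
    proof -
      have "\<bar>cos (u * U2 i x + \<theta>) - cos (u * W x + \<theta>)\<bar> \<le> \<bar>u * U2 i x + \<theta> - (u * W x + \<theta>)\<bar>" by (rule abs_cos_diff_le)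
      also have "\<dots> = \<bar>u\<bar> * \<bar>V2 i x\<bar>" using WU(2)[of x i] by (simp add: abs_mult algebra_simps)
      also have "\<dots> \<le> \<bar>u\<bar> * (K * b)" by (intro mult_left_mono V2b) simp
      finally show ?thesis .
    qed
    have iVc: "integrable M (\<lambda>x. \<xi> i x * V i x * cos (u * Y x + \<theta>))" if [measurable]: "Y \<in> borel_measurable M" for Y
    proof (rule intb[of _ "b * (K * b) * 1"])
      show "\<bar>\<xi> i x * V i x * cos (u * Y x + \<theta>)\<bar> \<le> b * (K * b) * 1" for x
        unfolding abs_mult[of "\<xi> i x * V i x"] using b K by (intro mult_mono Vxi cosb) auto
    qed measurable
    have iS: "integrable M (\<lambda>x. \<xi> i x * sin (u * Y x + \<theta>))" if [measurable]: "Y \<in> borel_measurable M" for Y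
      by (rule ixi[of _ 1]) (simp_all)
    have b1: "\<bar>?E g\<bar> \<le> c" if "\<And>x. \<bar>g x\<bar> \<le> c" for g :: "'a \<Rightarrow> real" and c
    proof -
      have "\<bar>?E g\<bar> \<le> ?E (\<lambda>x. \<bar>g x\<bar>)" by (rule integral_abs_bound)
      also have "\<dots> \<le> ?E (\<lambda>x. c)"
      proof (rule integral_mono_AE')
        show "AE x in M. 0 \<le> c" using that by (intro AE_I2) (rule order_trans[OF abs_ge_zero])
      qed (use that in auto)
      finally show ?thesis by (simp add: prob_space)
    qed
    have e1: "\<bar>?E (\<lambda>x. \<xi> i x * sin (u * W x + \<theta>)) - u * ?E (\<lambda>x. \<xi> i x * V i x * cos (u * U i x + \<theta>))\<bar> \<le> u\<^sup>2 * K\<^sup>2 * b ^ 3"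
    proof -
      have "\<bar>?E (\<lambda>x. \<xi> i x * sin (u * W x + \<theta>) - \<xi> i x * sin (u * U i x + \<theta>) - u * (\<xi> i x * V i x * cos (u * U i x + \<theta>)))\<bar> \<le> u\<^sup>2 * K\<^sup>2 * b ^ 3"
        by (rule b1) (rule 1)
      then show ?thesis using iS[OF mW(1)] iS[OF mW(4)[of i]] iVc[OF mW(4)[of i]] 0 by simp
    qed
    have e2: "\<bar>?E (\<lambda>x. \<xi> i x * V i x * cos (u * U i x + \<theta>)) - ?E (\<lambda>x. \<xi> i x * V i x * cos (u * U2 i x + \<theta>))\<bar> \<le> 2 * \<bar>u\<bar> * K\<^sup>2 * b ^ 3"
    proof -
      have "\<bar>?E (\<lambda>x. \<xi> i x * V i x * cos (u * U i x + \<theta>) - \<xi> i x * V i x * cos (u * U2 i x + \<theta>))\<bar> \<le> 2 * \<bar>u\<bar> * K\<^sup>2 * b ^ 3"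
        by (rule b1) (rule 2)
      then show ?thesis using iVc[OF mW(4)[of i]] iVc[OF mW(5)[of i]] by simp
    qed
    have e3: "?E (\<lambda>x. \<xi> i x * V i x * cos (u * U2 i x + \<theta>)) = ?E (\<lambda>x. \<xi> i x * V i x) * ?E (\<lambda>x. cos (u * U2 i x + \<theta>))"
      unfolding U2_def V_def by (rule ind2[OF i]) (intro continuous_intros)
    have "\<bar>?E (\<lambda>x. cos (u * U2 i x + \<theta>)) - \<phi> u\<bar> \<le> \<bar>u\<bar> * (K * b)"
    proof -
      have "\<bar>?E (\<lambda>x. cos (u * U2 i x + \<theta>) - cos (u * W x + \<theta>))\<bar> \<le> \<bar>u\<bar> * (K * b)"
        by (rule b1) (rule 3)
      then show ?thesis unfolding \<phi>_def using ic(1)[OF mW(5)[of i], of u] ic(1)[OF mW(1), of u] by simp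
    qed
    then have "\<bar>?E (\<lambda>x. \<xi> i x * V i x)\<bar> * \<bar>?E (\<lambda>x. cos (u * U2 i x + \<theta>)) - \<phi> u\<bar> \<le> (b * (K * b)) * (\<bar>u\<bar> * (K * b))"
      using b K by (intro mult_mono b1 Vxi) auto
    then have e4: "\<bar>?E (\<lambda>x. \<xi> i x * V i x) * ?E (\<lambda>x. cos (u * U2 i x + \<theta>)) - ?E (\<lambda>x. \<xi> i x * V i x) * \<phi> u\<bar> \<le> \<bar>u\<bar> * K\<^sup>2 * b ^ 3"
      by (simp add: abs_mult[symmetric] right_diff_distrib power2_eq_square power3_eq_cube algebra_simps)
    have "\<bar>?E (\<lambda>x. \<xi> i x * V i x * cos (u * U i x + \<theta>)) - ?E (\<lambda>x. \<xi> i x * V i x) * \<phi> u\<bar> \<le> 3 * \<bar>u\<bar> * K\<^sup>2 * b ^ 3"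
      using e2 e4 unfolding e3 by linarith
    then have "\<bar>u\<bar> * \<bar>?E (\<lambda>x. \<xi> i x * V i x * cos (u * U i x + \<theta>)) - ?E (\<lambda>x. \<xi> i x * V i x) * \<phi> u\<bar> \<le> \<bar>u\<bar> * (3 * \<bar>u\<bar> * K\<^sup>2 * b ^ 3)"
      by (intro mult_left_mono) auto
    then have "\<bar>u * ?E (\<lambda>x. \<xi> i x * V i x * cos (u * U i x + \<theta>)) - u * ?E (\<lambda>x. \<xi> i x * V i x) * \<phi> u\<bar> \<le> 3 * (\<bar>u\<bar> * \<bar>u\<bar>) * K\<^sup>2 * b ^ 3"
      by (simp add: abs_mult[symmetric] right_diff_distrib algebra_simps)
    then have "\<bar>u * ?E (\<lambda>x. \<xi> i x * V i x * cos (u * U i x + \<theta>)) - u * ?E (\<lambda>x. \<xi> i x * V i x) * \<phi> u\<bar> \<le> 3 * (u\<^sup>2 * K\<^sup>2 * b ^ 3)"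
      by (simp add: power2_eq_square)
    with e1 show ?thesis by linarith
  qed
  define \<phi>' where "\<phi>' u = - (\<integral>x. W x * sin (u * W x + \<theta>) \<partial>M)" for u
  have iWs: "integrable M (\<lambda>x. W x * sin (u * W x + \<theta>))" for u
  proof (rule intb[of _ "real (card I) * b * 1"])
    show "\<bar>W x * sin (u * W x + \<theta>)\<bar> \<le> real (card I) * b * 1" for x
      unfolding abs_mult using b by (intro mult_mono Wb cosb) auto
  qed measurable
  have iW2: "integrable M (\<lambda>x. (W x)\<^sup>2)"
  proof (rule intb[of _ "(real (card I) * b)\<^sup>2"])
    show "\<bar>(W x)\<^sup>2\<bar> \<le> (real (card I) * b)\<^sup>2" for x
      using power_mono[OF Wb abs_ge_zero, of x 2] by simp
  qed measurable
  \<comment> \<open>Differentiation under the integral, with a Taylor error that is quadratic in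
    \<open>h\<close> and integrable because \<open>W\<close> is bounded.\<close>
  have deriv: "(\<phi> has_real_derivative \<phi>' u) (at u)" for u
    unfolding DERIV_def
  proof (rule Lim_transform[OF tendsto_const])
    have bound: "\<bar>(\<phi> (u + h) - \<phi> u) / h - \<phi>' u\<bar> \<le> \<bar>h\<bar> * s2" if h: "h \<noteq> 0" for h
    proof -
      have eq: "\<phi> (u + h) - \<phi> u - h * \<phi>' u
          = (\<integral>x. cos ((u + h) * W x + \<theta>) - cos (u * W x + \<theta>) + h * (W x * sin (u * W x + \<theta>)) \<partial>M)"
        unfolding \<phi>_def \<phi>'_def using ic(1)[OF mW(1), of u] ic(1)[OF mW(1), of "u + h"] iWs[of u] by simp
      have "\<bar>\<phi> (u + h) - \<phi> u - h * \<phi>' u\<bar> \<le> (\<integral>x. \<bar>cos ((u + h) * W x + \<theta>) - cos (u * W x + \<theta>) + h * (W x * sin (u * W x + \<theta>))\<bar> \<partial>M)"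
        unfolding eq by (rule integral_abs_bound)
      also have "\<dots> \<le> (\<integral>x. h\<^sup>2 * (W x)\<^sup>2 \<partial>M)"
      proof (rule integral_mono_AE')
        show "AE x in M. \<bar>cos ((u + h) * W x + \<theta>) - cos (u * W x + \<theta>) + h * (W x * sin (u * W x + \<theta>))\<bar> \<le> h\<^sup>2 * (W x)\<^sup>2"
        proof (rule AE_I2)
          fix x
          show "\<bar>cos ((u + h) * W x + \<theta>) - cos (u * W x + \<theta>) + h * (W x * sin (u * W x + \<theta>))\<bar> \<le> h\<^sup>2 * (W x)\<^sup>2"
            using cos_taylor_bound[of "u * W x + \<theta>" "h * W x"] by (simp add: algebra_simps power_mult_distrib)
        qed
      qed (use iW2 in auto)
      also have "\<dots> = h\<^sup>2 * s2" using iW2 by (simp add: s2_def)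
      finally have "\<bar>\<phi> (u + h) - \<phi> u - h * \<phi>' u\<bar> / \<bar>h\<bar> \<le> h\<^sup>2 * s2 / \<bar>h\<bar>" by (rule divide_right_mono) simp
      moreover have "(\<phi> (u + h) - \<phi> u) / h - \<phi>' u = (\<phi> (u + h) - \<phi> u - h * \<phi>' u) / h"
        using h by (simp add: field_simps)
      moreover have "h\<^sup>2 * s2 / \<bar>h\<bar> = \<bar>h\<bar> * s2" using h by (simp add: field_simps power2_eq_square abs_mult[symmetric])
      ultimately show ?thesis by (simp add: abs_divide)
    qed
    show "((\<lambda>h. (\<phi> (u + h) - \<phi> u) / h - \<phi>' u) \<longlongrightarrow> 0) (at 0)"
    proof (rule Lim_null_comparison)
      show "\<forall>\<^sub>F h in at 0. norm ((\<phi> (u + h) - \<phi> u) / h - \<phi>' u) \<le> \<bar>h\<bar> * s2"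
        unfolding eventually_at_filter by (rule always_eventually) (simp add: bound)
      show "((\<lambda>h. \<bar>h\<bar> * s2) \<longlongrightarrow> 0) (at 0)"
        by (auto intro!: tendsto_eq_intros)
    qed
  qed
  let ?B = "4 * real (card I) * K\<^sup>2 * b ^ 3"
  have B0: "0 \<le> ?B" using b by simp
  have ode: "\<bar>\<phi>' u + u * s2 * \<phi> u\<bar> \<le> u\<^sup>2 * ?B" for u
  proof -
    have "\<phi>' u = - (\<Sum>i\<in>I. \<integral>x. \<xi> i x * sin (u * W x + \<theta>) \<partial>M)"
    proof -
      have "(\<integral>x. W x * sin (u * W x + \<theta>) \<partial>M) = (\<integral>x. (\<Sum>i\<in>I. \<xi> i x * sin (u * W x + \<theta>)) \<partial>M)"
        by (simp add: W_def sum_distrib_right)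
      also have "\<dots> = (\<Sum>i\<in>I. \<integral>x. \<xi> i x * sin (u * W x + \<theta>) \<partial>M)"
        by (rule Bochner_Integration.integral_sum) (rule ixi[of _ 1], simp_all)
      finally show ?thesis by (simp add: \<phi>'_def)
    qed
    then have "\<phi>' u + u * s2 * \<phi> u = - (\<Sum>i\<in>I. (\<integral>x. \<xi> i x * sin (u * W x + \<theta>) \<partial>M) - u * (\<integral>x. \<xi> i x * V i x \<partial>M) * \<phi> u)"
      by (simp add: s2 sum_subtractf sum_distrib_left sum_distrib_right)
    then have "\<bar>\<phi>' u + u * s2 * \<phi> u\<bar> \<le> (\<Sum>i\<in>I. \<bar>(\<integral>x. \<xi> i x * sin (u * W x + \<theta>) \<partial>M) - u * (\<integral>x. \<xi> i x * V i x \<partial>M) * \<phi> u\<bar>)"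
      by simp
    also have "\<dots> \<le> (\<Sum>i\<in>I. 4 * (u\<^sup>2 * K\<^sup>2 * b ^ 3))" by (rule sum_mono) (rule key)
    finally show ?thesis by (simp add: algebra_simps)
  qed
  have s20: "0 \<le> s2" unfolding s2_def by simp
  \<comment> \<open>The integrating factor \<open>exp (u\<^sup>2 * s2 / 2)\<close> turns the
    approximate differential equation into a function with small derivative between 0 and 1.\<close>
  have "\<exists>z::real>0. z < 1 \<and> \<phi> 1 * exp (1\<^sup>2 * s2 / 2) - \<phi> 0 * exp (0\<^sup>2 * s2 / 2) = (1 - 0) * ((\<phi>' z + z * s2 * \<phi> z) * exp (z\<^sup>2 * s2 / 2))"
  proof (rule MVT2)
    fix z :: real
    show "((\<lambda>u. \<phi> u * exp (u\<^sup>2 * s2 / 2)) has_real_derivative (\<phi>' z + z * s2 * \<phi> z) * exp (z\<^sup>2 * s2 / 2)) (at z)"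
      by (auto intro!: derivative_eq_intros deriv simp: algebra_simps)
  qed simp
  then obtain z :: real where z: "0 < z" "z < 1"
    "\<phi> 1 * exp (s2 / 2) - \<phi> 0 = (\<phi>' z + z * s2 * \<phi> z) * exp (z\<^sup>2 * s2 / 2)" by auto
  have "\<phi> 0 = cos \<theta>" by (simp add: \<phi>_def prob_space)
  with z have "\<bar>\<phi> 1 * exp (s2 / 2) - cos \<theta>\<bar> = \<bar>\<phi>' z + z * s2 * \<phi> z\<bar> * exp (z\<^sup>2 * s2 / 2)"
    by (simp add: abs_mult)
  also have "\<dots> \<le> ?B * exp (s2 / 2)"
  proof (rule mult_mono)
    have "z\<^sup>2 \<le> 1" using z by (simp add: power_le_one)
    then show "\<bar>\<phi>' z + z * s2 * \<phi> z\<bar> \<le> ?B"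
      using ode[of z] mult_right_mono[OF \<open>z\<^sup>2 \<le> 1\<close> B0] by linarith
    show "exp (z\<^sup>2 * s2 / 2) \<le> exp (s2 / 2)"
      using mult_right_mono[OF \<open>z\<^sup>2 \<le> 1\<close> s20] by simp
  qed (use B0 in auto)
  finally have f1: "\<bar>\<phi> 1 * exp (s2 / 2) - cos \<theta>\<bar> * exp (- (s2 / 2)) \<le> ?B * exp (s2 / 2) * exp (- (s2 / 2))"
    by (rule mult_right_mono) simp
  have eq1: "\<bar>\<phi> 1 * exp (s2 / 2) - cos \<theta>\<bar> * exp (- (s2 / 2)) = \<bar>(\<phi> 1 * exp (s2 / 2) - cos \<theta>) * exp (- (s2 / 2))\<bar>"
    by (simp add: abs_mult)
  have eq2: "(\<phi> 1 * exp (s2 / 2) - cos \<theta>) * exp (- (s2 / 2)) = \<phi> 1 - cos \<theta> * exp (- s2 / 2)"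
    by (simp add: left_diff_distrib mult.assoc flip: exp_add)
  have eq3: "?B * exp (s2 / 2) * exp (- (s2 / 2)) = ?B"
    by (simp add: mult.assoc flip: exp_add)
  from f1 have "\<bar>\<phi> 1 - cos \<theta> * exp (- s2 / 2)\<bar> \<le> ?B" unfolding eq1 eq2 eq3 .
  then show ?thesis unfolding \<phi>_def s2_def W_def by simp
qed

context real_iid
begin

section \<open>Application to cylindrical differences\<close>

text \<open>The constant 1 is a test function of every strict past.\<close>

lemma orthodiff_mean:
  assumes "orthodiff e"
  shows "(\<integral>\<omega>. e \<omega> \<partial>P) = 0"
proof -
  have "square_integrable P (\<lambda>_. 1)" by (rule cylindrical_square_integrable[OF cylindrical_const])
  from assms[unfolded orthodiff_def, THEN conjunct2, THEN conjunct2, rule_format, OF this depends_on_const]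
  show ?thesis by simp
qed

text \<open>\<open>j\<close> is a neighbour of \<open>i\<close> when the windows \<open>i + K\<^sub>0\<close> and \<open>j + K\<^sub>0\<close> of coordinates meet.\<close>

lemma clt_cylindrical:
  fixes e :: "(int ^ 'd::finite \<Rightarrow> real) \<Rightarrow> real"
  assumes e: "orthodiff e" and c: "cylindrical e"
  obtains C where "0 \<le> C" "\<And>I w wm \<theta>. finite I \<Longrightarrow> (\<And>i. \<bar>w i\<bar> \<le> wm) \<Longrightarrow>
    \<bar>(\<integral>\<omega>. cos ((\<Sum>i\<in>I. w i * e (shift i \<omega>)) + \<theta>) \<partial>P) - cos \<theta> * exp (- (\<integral>\<omega>. (\<Sum>i\<in>I. w i * e (shift i \<omega>))\<^sup>2 \<partial>P) / 2)\<bar>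
      \<le> C * real (card I) * wm ^ 3"
proof -
  obtain K0 B where K0: "finite K0" "depends_on K0 e" and B: "\<forall>\<omega>. \<bar>e \<omega>\<bar> \<le> B"
    by (rule cylindricalE[OF c])
  \<comment> \<open>The windows of \<open>i\<close> and \<open>j\<close> meet only if
    \<open>j - i\<close> is a difference of two elements of \<open>K0\<close>.\<close>
  define k where "k = (card K0)\<^sup>2"
  \<comment> \<open>Counts the neighbours of an index together with the neighbours of these.\<close>
  define K where "K = real (k + k * k)"
  have B0: "0 \<le> B" using B abs_ge_zero order_trans by blast
  have em: "e \<in> borel_measurable P" by (rule cylindrical_measurable[OF c])
  have fm: "finite_measure (P :: (int ^ 'd \<Rightarrow> real) measure)" by (rule prob_space.axioms(1)[OF prob_space_P])
  define win where "win i = (+) i ` K0" for i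
  define nbr where "nbr i = (\<lambda>(a, b). i + a - b) ` (K0 \<times> K0)" for i
  have nbr: "j \<in> nbr i" if m: "win i \<inter> win j \<noteq> {}" for i j
  proof -
    obtain x where x: "x \<in> win i" "x \<in> win j" using m by blast
    obtain a where a: "a \<in> K0" "x = i + a" using x(1) unfolding win_def by blast
    obtain b where b: "b \<in> K0" "x = j + b" using x(2) unfolding win_def by blast
    have ab: "a \<in> K0" "b \<in> K0" "i + a = j + b" using a b by simp_all
    then have "j = i + a - b" by (simp add: algebra_simps)
    then show ?thesis using ab unfolding nbr_def by (intro image_eqI[where x = "(a, b)"]) auto
  qed
  have disj: "win i \<inter> win j = {}" if "j \<notin> nbr i" for i j using nbr that by blast
  have fn: "finite (nbr i)" for i unfolding nbr_def using K0 by simp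
  have cn: "card (nbr i) \<le> k" for i
    unfolding nbr_def k_def power2_eq_square using card_image_le[of "K0 \<times> K0"] K0(1) by (simp add: card_cartesian_product)
  have main: "\<bar>(\<integral>\<omega>. cos ((\<Sum>i\<in>I. w i * e (shift i \<omega>)) + \<theta>) \<partial>P) - cos \<theta> * exp (- (\<integral>\<omega>. (\<Sum>i\<in>I. w i * e (shift i \<omega>))\<^sup>2 \<partial>P) / 2)\<bar>
      \<le> (4 * K\<^sup>2 * B ^ 3) * real (card I) * wm ^ 3"
    if I: "finite I" and w: "\<And>i. \<bar>w i\<bar> \<le> wm" for I w wm \<theta>
  proof -
    define N where "N i = nbr i \<inter> I" for i
    define N2 where "N2 i = (nbr i \<union> (\<Union>j\<in>nbr i. nbr j)) \<inter> I" for i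
    define \<xi> where "\<xi> i \<omega> = w i * e (shift i \<omega>)" for i \<omega>
    have m: "\<xi> i \<in> borel_measurable P" for i
      unfolding \<xi>_def[abs_def] by (intro borel_measurable_times borel_measurable_const borel_measurable_shift em)
    have bd: "\<bar>\<xi> i \<omega>\<bar> \<le> wm * B" for i \<omega>
      unfolding \<xi>_def abs_mult using w[of i] B by (intro mult_mono) auto
    have dep: "depends_on (win i) (\<xi> i)" for i
      unfolding \<xi>_def[abs_def] win_def
      by (rule depends_on_compose[where h = "\<lambda>y. w i * y", OF depends_on_shift[OF K0(2)]])
    have depS: "depends_on (\<Union>j\<in>A. win j) (\<lambda>\<omega>. \<Sum>j\<in>A. \<xi> j \<omega>)" for A
      by (rule depends_on_sum, rule depends_on_mono[OF dep]) auto
    have depS': "depends_on (\<Union>j\<in>A. win j) (\<lambda>\<omega>. h (\<Sum>j\<in>A. \<xi> j \<omega>))" for A and h :: "real \<Rightarrow> real"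
      by (rule depends_on_compose[where h = h, OF depS])
    have mS: "(\<lambda>\<omega>. \<Sum>j\<in>A. \<xi> j \<omega>) \<in> borel_measurable P" for A by (intro borel_measurable_sum m)
    have sumb: "\<bar>\<Sum>j\<in>A. \<xi> j \<omega>\<bar> \<le> real (card A) * (wm * B)" for A \<omega>
      by (rule order_trans[OF sum_abs sum_bounded_above]) (rule bd)
    have intb: "integrable P g" if "g \<in> borel_measurable P" "\<And>\<omega>. \<bar>g \<omega>\<bar> \<le> c" for g :: "(int ^ 'd \<Rightarrow> real) \<Rightarrow> real" and c
      using that by (intro finite_measure.integrable_const_bound[OF fm, where B = c]) auto
    \<comment> \<open>A continuous \<open>h\<close> is bounded on the bounded range of the sums,
      which makes all products integrable.\<close>
    have hb: "\<exists>c. \<forall>\<omega>. \<bar>h (\<Sum>j\<in>A. \<xi> j \<omega>)\<bar> \<le> c" if h: "continuous_on UNIV h" for A and h :: "real \<Rightarrow> real"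
    proof -
      have "compact (h ` {- (real (card A) * (wm * B))..real (card A) * (wm * B)})"
        by (intro compact_continuous_image continuous_on_subset[OF h]) auto
      then obtain c where c: "\<forall>y\<in>h ` {- (real (card A) * (wm * B))..real (card A) * (wm * B)}. norm y \<le> c"
        using compact_imp_bounded bounded_iff by blast
      have "\<bar>h (\<Sum>j\<in>A. \<xi> j \<omega>)\<bar> \<le> c" for \<omega>
        using c sumb[of \<omega> A] by (force simp: abs_le_iff)
      then show ?thesis by blast
    qed
    have mh: "(\<lambda>\<omega>. h (\<Sum>j\<in>A. \<xi> j \<omega>)) \<in> borel_measurable P" if "continuous_on UNIV h" for A and h :: "real \<Rightarrow> real"
      by (rule measurable_compose[OF mS borel_measurable_continuous_onI[OF that]])
    have prodb: "integrable P (\<lambda>\<omega>. u \<omega> * v \<omega>)"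
      if "u \<in> borel_measurable P" "v \<in> borel_measurable P" "\<And>\<omega>. \<bar>u \<omega>\<bar> \<le> c" "\<And>\<omega>. \<bar>v \<omega>\<bar> \<le> c'" for u v :: "(int ^ 'd \<Rightarrow> real) \<Rightarrow> real" and c c'
    proof (rule intb[of _ "c * c'"])
      have "0 \<le> c" using that(3)[of undefined] by linarith
      then show "\<bar>u \<omega> * v \<omega>\<bar> \<le> c * c'" for \<omega> unfolding abs_mult by (intro mult_mono that) auto
    qed (intro borel_measurable_times that)
    have "\<bar>(\<integral>\<omega>. cos ((\<Sum>i\<in>I. \<xi> i \<omega>) + \<theta>) \<partial>P) - cos \<theta> * exp (- (\<integral>\<omega>. (\<Sum>i\<in>I. \<xi> i \<omega>)\<^sup>2 \<partial>P) / 2)\<bar>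
      \<le> 4 * real (card I) * K\<^sup>2 * (wm * B) ^ 3"
    proof (rule prob_space.local_dependence_clt[OF prob_space_P I m bd, where N = N and Nb = N2])
      show "N i \<subseteq> N2 i" "N2 i \<subseteq> I" for i by (auto simp: N_def N2_def)
      show "real (card (N2 i)) \<le> K" for i
      proof -
        have "card (N2 i) \<le> card (nbr i \<union> (\<Union>j\<in>nbr i. nbr j))"
          unfolding N2_def using fn by (intro card_mono) auto
        also have "\<dots> \<le> card (nbr i) + card (\<Union>j\<in>nbr i. nbr j)" by (rule card_Un_le)
        also have "\<dots> \<le> k + (\<Sum>j\<in>nbr i. card (nbr j))" by (intro add_mono cn card_UN_le fn)
        also have "(\<Sum>j\<in>nbr i. card (nbr j)) \<le> card (nbr i) * k" using sum_bounded_above[of "nbr i" "\<lambda>j. card (nbr j)" k] cn by simp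
        also have "card (nbr i) * k \<le> k * k" by (intro mult_right_mono cn) simp
        finally show ?thesis unfolding K_def by (simp only: of_nat_le_iff)
      qed
    next
      fix i and h :: "real \<Rightarrow> real" assume i: "i \<in> I" and h: "continuous_on UNIV h"
      obtain c where cb: "\<forall>\<omega>. \<bar>h (\<Sum>j\<in>I - N i. \<xi> j \<omega>)\<bar> \<le> c" using hb[OF h] by blast
      have "(\<integral>\<omega>. \<xi> i \<omega> * h (\<Sum>j\<in>I - N i. \<xi> j \<omega>) \<partial>P) = (\<integral>\<omega>. \<xi> i \<omega> \<partial>P) * (\<integral>\<omega>. h (\<Sum>j\<in>I - N i. \<xi> j \<omega>) \<partial>P)"
      proof (rule integral_mult_indep[OF dep depS'])
        show "win i \<inter> (\<Union>j\<in>I - N i. win j) = {}" unfolding N_def using disj by blast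
        show "integrable P (\<xi> i)" by (rule intb[OF m bd])
        show "integrable P (\<lambda>\<omega>. h (\<Sum>j\<in>I - N i. \<xi> j \<omega>))" by (rule intb[OF mh[OF h] cb[rule_format]])
        show "integrable P (\<lambda>\<omega>. \<xi> i \<omega> * h (\<Sum>j\<in>I - N i. \<xi> j \<omega>))" by (rule prodb[OF m mh[OF h] bd cb[rule_format]])
      qed
      also have "(\<integral>\<omega>. \<xi> i \<omega> \<partial>P) = 0"
        using integral_shift[OF em, of i] orthodiff_mean[OF e] by (simp add: \<xi>_def)
      finally show "(\<integral>\<omega>. \<xi> i \<omega> * h (\<Sum>j\<in>I - N i. \<xi> j \<omega>) \<partial>P) = 0" by simp
    next
      fix i and h :: "real \<Rightarrow> real" assume i: "i \<in> I" and h: "continuous_on UNIV h"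
      obtain c where cb: "\<forall>\<omega>. \<bar>h (\<Sum>j\<in>I - N2 i. \<xi> j \<omega>)\<bar> \<le> c" using hb[OF h] by blast
      let ?u = "\<lambda>\<omega>. \<xi> i \<omega> * (\<Sum>j\<in>N i. \<xi> j \<omega>)"
      have um: "?u \<in> borel_measurable P" by (intro borel_measurable_times m mS)
      have ub: "\<bar>?u \<omega>\<bar> \<le> (wm * B) * (real (card (N i)) * (wm * B))" for \<omega>
        unfolding abs_mult[of "\<xi> i \<omega>"] using order_trans[OF abs_ge_zero bd[of i \<omega>]] by (intro mult_mono bd sumb) auto
      show "(\<integral>\<omega>. ?u \<omega> * h (\<Sum>j\<in>I - N2 i. \<xi> j \<omega>) \<partial>P) = (\<integral>\<omega>. ?u \<omega> \<partial>P) * (\<integral>\<omega>. h (\<Sum>j\<in>I - N2 i. \<xi> j \<omega>) \<partial>P)"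
      proof (rule integral_mult_indep[OF _ depS'])
        show "depends_on (win i \<union> (\<Union>j\<in>N i. win j)) ?u"
          by (rule depends_on_compose2[where h = "(*)", OF depends_on_mono[OF dep Un_upper1] depends_on_mono[OF depS Un_upper2]])
        \<comment> \<open>An index of \<open>I\<close> outside \<open>N2 i\<close> is a neighbour
          neither of \<open>i\<close> nor of any neighbour of \<open>i\<close>.\<close>
        show "(win i \<union> (\<Union>j\<in>N i. win j)) \<inter> (\<Union>j\<in>I - N2 i. win j) = {}"
        proof -
          have "win i \<inter> win k = {} \<and> (\<forall>j\<in>N i. win j \<inter> win k = {})" if "k \<in> I - N2 i" for k
            using that disj[of k] unfolding N_def N2_def by blast
          then show ?thesis by blast
        qed
        show "integrable P ?u" by (rule intb[OF um ub])
        show "integrable P (\<lambda>\<omega>. h (\<Sum>j\<in>I - N2 i. \<xi> j \<omega>))" by (rule intb[OF mh[OF h] cb[rule_format]])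
        show "integrable P (\<lambda>\<omega>. ?u \<omega> * h (\<Sum>j\<in>I - N2 i. \<xi> j \<omega>))" by (rule prodb[OF um mh[OF h] ub cb[rule_format]])
      qed
    qed
    then show ?thesis by (simp add: \<xi>_def power_mult_distrib algebra_simps)
  qed
  show ?thesis
  proof (rule that[OF _ main])
    show "0 \<le> 4 * K\<^sup>2 * B ^ 3" using B0 by simp
  qed
qed

end

section \<open>The Cramer-Wold device\<close>

text \<open>The phases make sums of cosines contain the sines as well and be closed under products,
  by the product-to-sum formula.\<close>

inductive trig_poly :: "'t set \<Rightarrow> (('t \<Rightarrow> real) \<Rightarrow> real) \<Rightarrow> bool" for I where
  cos: "trig_poly I (\<lambda>x. c * cos ((\<Sum>t\<in>I. \<theta> t * x t) + s))"
| add: "trig_poly I F \<Longrightarrow> trig_poly I G \<Longrightarrow> trig_poly I (\<lambda>x. F x + G x)"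

lemma trig_poly_const: "trig_poly I (\<lambda>x. c)"
  using trig_poly.cos[of I c "\<lambda>_. 0" 0] by simp

lemma trig_poly_mult_cos:
  assumes "trig_poly I G"
  shows "trig_poly I (\<lambda>x. (c * cos ((\<Sum>t\<in>I. \<theta> t * x t) + s)) * G x)"
  using assms
proof induction
  case (cos c' \<theta>' s')
  have "trig_poly I (\<lambda>x. (c * c' / 2) * cos ((\<Sum>t\<in>I. (\<theta> t - \<theta>' t) * x t) + (s - s'))
      + (c * c' / 2) * cos ((\<Sum>t\<in>I. (\<theta> t + \<theta>' t) * x t) + (s + s')))"
    by (intro trig_poly.intros)
  moreover have "(c * c' / 2) * cos ((\<Sum>t\<in>I. (\<theta> t - \<theta>' t) * x t) + (s - s'))
      + (c * c' / 2) * cos ((\<Sum>t\<in>I. (\<theta> t + \<theta>' t) * x t) + (s + s'))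
    = (c * cos ((\<Sum>t\<in>I. \<theta> t * x t) + s)) * (c' * cos ((\<Sum>t\<in>I. \<theta>' t * x t) + s'))" for x
  proof -
    have 1: "(\<Sum>t\<in>I. (\<theta> t - \<theta>' t) * x t) + (s - s') = ((\<Sum>t\<in>I. \<theta> t * x t) + s) - ((\<Sum>t\<in>I. \<theta>' t * x t) + s')"
      and 2: "(\<Sum>t\<in>I. (\<theta> t + \<theta>' t) * x t) + (s + s') = ((\<Sum>t\<in>I. \<theta> t * x t) + s) + ((\<Sum>t\<in>I. \<theta>' t * x t) + s')"
      by (simp_all add: left_diff_distrib distrib_right sum_subtractf sum.distrib)
    have "c * c' / 2 * cos (a - b) + c * c' / 2 * cos (a + b) = (c * cos a) * (c' * cos b)" for a b
    proof -
      have "(c * cos a) * (c' * cos b) = c * c' * (cos a * cos b)" by simp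
      also have "\<dots> = c * c' / 2 * cos (a - b) + c * c' / 2 * cos (a + b)"
        unfolding cos_times_cos by algebra
      finally show ?thesis by simp
    qed
    then show ?thesis unfolding 1 2 .
  qed
  ultimately show ?case by simp
next
  case (add F G)
  from trig_poly.add[OF add.IH] show ?case by (simp add: distrib_left)
qed

lemma trig_poly_mult:
  assumes "trig_poly I F" "trig_poly I G"
  shows "trig_poly I (\<lambda>x. F x * G x)"
  using assms(1)
proof induction
  case (cos c \<theta> s)
  show ?case by (rule trig_poly_mult_cos[OF assms(2)])
next
  case (add F F')
  from trig_poly.add[OF add.IH] show ?case by (simp add: distrib_right)
qed

text \<open>A cosine with phase \<open>- (pi / 2)\<close> and frequencies concentrated at
  \<open>t\<close>.\<close>

lemma trig_poly_sin:
  assumes "finite I" "t \<in> I"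
  shows "trig_poly I (\<lambda>x. sin (a * x t))"
proof -
  have "trig_poly I (\<lambda>x. 1 * cos ((\<Sum>u\<in>I. (if u = t then a else 0) * x u) + (- (pi / 2))))"
    by (rule trig_poly.cos)
  moreover have "(\<Sum>u\<in>I. (if u = t then a else 0) * x u) = a * x t" for x
  proof -
    have "(\<Sum>u\<in>I. (if u = t then a else 0) * x u) = (\<Sum>u\<in>I. if u = t then a * x t else 0)"
      by (rule sum.cong) auto
    then show ?thesis using assms by simp
  qed
  moreover have "cos (y + (- (pi / 2))) = sin y" for y :: real
    by (simp add: cos_diff)
  ultimately show ?thesis by simp
qed

lemma continuous_on_lipschitz_coordinates:
  fixes H :: "('t \<Rightarrow> real) \<Rightarrow> real"
  assumes "\<And>x y. \<bar>H x - H y\<bar> \<le> L * (\<Sum>t\<in>I. \<bar>x t - y t\<bar>)"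
  shows "continuous_on UNIV H"
  unfolding continuous_on_def
proof
  fix x :: "'t \<Rightarrow> real"
  have c: "((\<lambda>y. y t) \<longlongrightarrow> x t) (at x)" for t
    by (rule continuous_on_product_coordinates[of t, unfolded continuous_on_def, rule_format]) simp
  have "((\<lambda>y. L * (\<Sum>t\<in>I. \<bar>y t - x t\<bar>)) \<longlongrightarrow> L * (\<Sum>t\<in>I. \<bar>x t - x t\<bar>)) (at x)"
    by (intro tendsto_intros c)
  then have "((\<lambda>y. L * (\<Sum>t\<in>I. \<bar>y t - x t\<bar>)) \<longlongrightarrow> 0) (at x)" by simp
  then have "((\<lambda>y. H y - H x) \<longlongrightarrow> 0) (at x)"
    by (rule Lim_null_comparison[rotated]) (simp add: assms)
  then show "(H \<longlongrightarrow> H x) (at x)" by (rule LIM_zero_cancel)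
qed

text \<open>The Lipschitz bound makes \<open>H\<close> blind to the coordinates outside
  \<open>I\<close>, so these can be set to 0 where nothing is known about \<open>Z\<close>.
  Countability of the index type identifies the product sigma-algebra with the Borel sets.\<close>

lemma borel_measurable_lipschitz_coordinates:
  fixes H :: "('t::countable \<Rightarrow> real) \<Rightarrow> real"
  assumes "\<And>x y. \<bar>H x - H y\<bar> \<le> L * (\<Sum>t\<in>I. \<bar>x t - y t\<bar>)"
    and Z: "\<And>t. t \<in> I \<Longrightarrow> Z t \<in> borel_measurable M"
  shows "(\<lambda>x. H (\<lambda>t. Z t x)) \<in> borel_measurable M"
proof -
  let ?Z = "\<lambda>x t. if t \<in> I then Z t x else 0"
  have "(\<lambda>x t. ?Z x t) \<in> M \<rightarrow>\<^sub>M (\<Pi>\<^sub>M t\<in>UNIV. borel)"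
  proof (rule measurable_PiM_single')
    show "(\<lambda>x. if t \<in> I then Z t x else 0) \<in> borel_measurable M" for t using Z by (cases "t \<in> I") auto
  qed auto
  then have "?Z \<in> borel_measurable M"
    using measurable_cong_sets[OF refl sets_PiM_equal_borel] by blast
  from measurable_compose[OF this borel_measurable_continuous_onI[OF continuous_on_lipschitz_coordinates[OF assms(1)]]]
  have "(\<lambda>x. H (?Z x)) \<in> borel_measurable M" .
  moreover have "H (?Z x) = H (\<lambda>t. Z t x)" for x
  proof -
    have "(\<Sum>t\<in>I. \<bar>?Z x t - Z t x\<bar>) = 0" by (rule sum.neutral) simp
    with assms(1)[of "?Z x" "\<lambda>t. Z t x"] show ?thesis by simp
  qed
  ultimately show ?thesis by simp
qed

text \<open>The triangular wave \<open>(1 / a) arcsin (sin (a x))\<close> is the identity on \<open>[-\<pi> / (2 a), \<pi> / (2 a)]\<close>; replacing the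
  coordinates by their waves makes \<open>H\<close> a continuous function of finitely many sines, to which the
  Stone-Weierstrass theorem applies on a cube, uniformly in all \<open>x\<close>.\<close>

lemma trig_poly_approximation:
  fixes H :: "('t::countable \<Rightarrow> real) \<Rightarrow> real"
  assumes I: "finite I" and lip: "\<And>x y. \<bar>H x - H y\<bar> \<le> L * (\<Sum>t\<in>I. \<bar>x t - y t\<bar>)"
    and bdd: "\<And>x. \<bar>H x\<bar> \<le> B" and K: "0 < K" and \<epsilon>: "0 < \<epsilon>"
  shows "\<exists>F. trig_poly I F \<and> (\<forall>x. \<bar>F x\<bar> \<le> B + \<epsilon>) \<and> (\<forall>x. (\<forall>t\<in>I. \<bar>x t\<bar> \<le> K) \<longrightarrow> \<bar>F x - H x\<bar> \<le> \<epsilon>)"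
proof -
  \<comment> \<open>With this frequency, \<open>\<bar>x t\<bar> \<le> K\<close> means that
    \<open>a * x t\<close> lies in the interval on which arcsin inverts sin.\<close>
  define a where "a = pi / (2 * K)"
  have a: "0 < a" "a * K = pi / 2" using K by (simp_all add: a_def)
  \<comment> \<open>Coordinates outside \<open>I\<close> are pinned to 0, so that the sines with
    index in \<open>I\<close> separate the points of the compact set \<open>S\<close>.\<close>
  define X where "X t = (if t \<in> I then {-1..1} else {0 :: real})" for t
  define S where "S = (\<Pi>\<^sub>E t\<in>UNIV. X t)"
  define \<sigma> where "\<sigma> x = (\<lambda>t. if t \<in> I then sin (a * x t) else 0)" for x :: "'t \<Rightarrow> real"
  have \<sigma>S: "\<sigma> x \<in> S" for x by (auto simp: S_def X_def \<sigma>_def)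
  have "compactin (product_topology (\<lambda>_. euclidean) UNIV) S"
    unfolding S_def compactin_PiE by (auto simp: X_def)
  then have compS: "compact S" by (simp add: euclidean_product_topology)
  define G where "G y = H (\<lambda>t. arcsin (y t) / a)" for y
  have contG: "continuous_on S G"
  proof -
    have "continuous_on S (\<lambda>y. \<lambda>t. if t \<in> I then arcsin (y t) / a else 0)"
    proof (rule continuous_on_coordinatewise_then_product)
      fix t
      have "continuous_on S (\<lambda>y. y t)"
        by (rule continuous_on_subset[OF continuous_on_product_coordinates]) simp
      moreover have "\<forall>y\<in>S. - 1 \<le> y t \<and> y t \<le> 1"
      proof
        fix y assume "y \<in> S"
        then have "y t \<in> X t" unfolding S_def by (rule PiE_mem) simp
        then show "- 1 \<le> y t \<and> y t \<le> 1" by (cases "t \<in> I") (simp_all add: X_def)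
      qed
      ultimately have "continuous_on S (\<lambda>y. arcsin (y t) / a)"
        using a by (intro continuous_intros continuous_on_arcsin) auto
      then show "continuous_on S (\<lambda>y. if t \<in> I then arcsin (y t) / a else 0)" by (cases "t \<in> I") auto
    qed
    from continuous_on_compose2[OF continuous_on_lipschitz_coordinates[OF lip] this]
    have "continuous_on S (\<lambda>y. H (\<lambda>t. if t \<in> I then arcsin (y t) / a else 0))" by simp
    moreover have "H (\<lambda>t. if t \<in> I then arcsin (y t) / a else 0) = G y" for y
    proof -
      have "(\<Sum>t\<in>I. \<bar>(if t \<in> I then arcsin (y t) / a else 0) - arcsin (y t) / a\<bar>) = 0" by (rule sum.neutral) simp
      with lip[of "\<lambda>t. if t \<in> I then arcsin (y t) / a else 0" "\<lambda>t. arcsin (y t) / a"]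
      show ?thesis by (simp add: G_def)
    qed
    ultimately show ?thesis by simp
  qed
  \<comment> \<open>The algebra consists of the continuous \<open>g\<close> whose composition with
    \<open>\<sigma>\<close> is a trigonometric polynomial.\<close>
  have "\<exists>g. (continuous_on S g \<and> trig_poly I (\<lambda>x. g (\<sigma> x))) \<and> (\<forall>y\<in>S. \<bar>G y - g y\<bar> < \<epsilon>)"
  proof (rule Stone_Weierstrass_HOL[where P = "\<lambda>g. continuous_on S g \<and> trig_poly I (\<lambda>x. g (\<sigma> x))", OF compS])
    show "continuous_on S (\<lambda>x. c) \<and> trig_poly I (\<lambda>x. c)" for c :: real
      by (simp add: trig_poly_const)
    show "continuous_on S (\<lambda>x. f x + g x) \<and> trig_poly I (\<lambda>x. f (\<sigma> x) + g (\<sigma> x))"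
      if "(continuous_on S f \<and> trig_poly I (\<lambda>x. f (\<sigma> x))) \<and> (continuous_on S g \<and> trig_poly I (\<lambda>x. g (\<sigma> x)))"
      for f g :: "('t \<Rightarrow> real) \<Rightarrow> real"
      using that by (simp add: continuous_on_add trig_poly.add)
    show "continuous_on S (\<lambda>x. f x * g x) \<and> trig_poly I (\<lambda>x. f (\<sigma> x) * g (\<sigma> x))"
      if "(continuous_on S f \<and> trig_poly I (\<lambda>x. f (\<sigma> x))) \<and> (continuous_on S g \<and> trig_poly I (\<lambda>x. g (\<sigma> x)))"
      for f g :: "('t \<Rightarrow> real) \<Rightarrow> real"
      using that by (simp add: continuous_on_mult trig_poly_mult)
    show "\<exists>f. (continuous_on S f \<and> trig_poly I (\<lambda>x. f (\<sigma> x))) \<and> f x \<noteq> f y"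
      if xy: "x \<in> S \<and> y \<in> S \<and> x \<noteq> y" for x y
    proof -
      obtain t where t: "x t \<noteq> y t" using xy by auto
      have "t \<in> I"
      proof (rule ccontr)
        assume "t \<notin> I"
        then have "x t = 0" "y t = 0" using xy by (auto simp: S_def X_def PiE_iff split: if_splits)
        with t show False by simp
      qed
      then have "trig_poly I (\<lambda>x. \<sigma> x t)" using trig_poly_sin[OF I, of t a] by (simp add: \<sigma>_def)
      moreover have "continuous_on S (\<lambda>y. y t)"
        by (rule continuous_on_subset[OF continuous_on_product_coordinates]) simp
      ultimately show ?thesis using t by (intro exI[of _ "\<lambda>y. y t"]) simp
    qed
  qed (use contG \<epsilon> in auto)
  then obtain g where g: "trig_poly I (\<lambda>x. g (\<sigma> x))" "\<And>y. y \<in> S \<Longrightarrow> \<bar>G y - g y\<bar> < \<epsilon>" by blast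
  show ?thesis
  proof (intro exI[of _ "\<lambda>x. g (\<sigma> x)"] conjI allI impI)
    show "trig_poly I (\<lambda>x. g (\<sigma> x))" by (rule g(1))
    show "\<bar>g (\<sigma> x)\<bar> \<le> B + \<epsilon>" for x
      using g(2)[OF \<sigma>S[of x]] bdd[of "\<lambda>t. arcsin (\<sigma> x t) / a"] unfolding G_def by linarith
    fix x :: "'t \<Rightarrow> real" assume x: "\<forall>t\<in>I. \<bar>x t\<bar> \<le> K"
    have "arcsin (\<sigma> x t) / a = x t" if "t \<in> I" for t
    proof -
      have "\<bar>a * x t\<bar> \<le> pi / 2"
        using mult_left_mono[OF x[rule_format, OF that], of a] a by (simp add: abs_mult)
      then have "arcsin (sin (a * x t)) = a * x t" by (intro arcsin_sin) auto
      then show ?thesis using a(1) that by (simp add: \<sigma>_def)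
    qed
    then have "(\<Sum>t\<in>I. \<bar>arcsin (\<sigma> x t) / a - x t\<bar>) = 0" by (intro sum.neutral) simp
    with lip[of "\<lambda>t. arcsin (\<sigma> x t) / a" x] have "G (\<sigma> x) = H x" by (simp add: G_def)
    then show "\<bar>g (\<sigma> x) - H x\<bar> \<le> \<epsilon>" using g(2)[OF \<sigma>S[of x]] by linarith
  qed
qed

lemma trig_poly_measurable:
  assumes "trig_poly I F" "\<And>t. t \<in> I \<Longrightarrow> Z t \<in> borel_measurable M"
  shows "(\<lambda>x. F (\<lambda>t. Z t x)) \<in> borel_measurable M"
  using assms(1)
proof induction
  case (cos c \<theta> s)
  have "(\<lambda>x. (\<Sum>t\<in>I. \<theta> t * Z t x) + s) \<in> borel_measurable M"
    by (intro borel_measurable_add borel_measurable_sum borel_measurable_times borel_measurable_const assms(2))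
  from measurable_compose[OF this borel_measurable_continuous_onI[of cos]]
  have "(\<lambda>x. cos ((\<Sum>t\<in>I. \<theta> t * Z t x) + s)) \<in> borel_measurable M" by (simp add: continuous_on_cos)
  then show ?case by simp
qed (auto intro: borel_measurable_add)

lemma trig_poly_bounded: "trig_poly I F \<Longrightarrow> \<exists>B. \<forall>x. \<bar>F x\<bar> \<le> B"
proof (induction rule: trig_poly.induct)
  case (cos c \<theta> s)
  have "\<bar>c * cos ((\<Sum>t\<in>I. \<theta> t * x t) + s)\<bar> \<le> \<bar>c\<bar>" for x
    unfolding abs_mult by (rule mult_left_le) auto
  then show ?case by blast
next
  case (add F G)
  then obtain B B' where "\<forall>x. \<bar>F x\<bar> \<le> B" "\<forall>x. \<bar>G x\<bar> \<le> B'" by blast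
  then have "\<bar>F x + G x\<bar> \<le> B + B'" for x by (meson abs_triangle_ineq add_mono order_trans)
  then show ?case by blast
qed

lemma trig_poly_tendsto:
  fixes M :: "'a measure" and N :: "'b measure"
  assumes F: "trig_poly I F" and M: "prob_space M" and N: "prob_space N"
    and Z: "\<And>n t. t \<in> I \<Longrightarrow> Z n t \<in> borel_measurable M" and Y: "\<And>t. t \<in> I \<Longrightarrow> Y t \<in> borel_measurable N"
    and char: "\<And>\<theta> s. ((\<lambda>n. \<integral>x. cos ((\<Sum>t\<in>I. \<theta> t * Z n t x) + s) \<partial>M) \<longlongrightarrow> (\<integral>x. cos ((\<Sum>t\<in>I. \<theta> t * Y t x) + s) \<partial>N)) \<F>"
  shows "((\<lambda>n. \<integral>x. F (\<lambda>t. Z n t x) \<partial>M) \<longlongrightarrow> (\<integral>x. F (\<lambda>t. Y t x) \<partial>N)) \<F>"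
  using F
proof induction
  case (cos c \<theta> s)
  show ?case using tendsto_mult_left[OF char[of \<theta> s], of c] by simp
next
  case (add F G)
  have i: "integrable M (\<lambda>x. F (\<lambda>t. Z n t x))" if F: "trig_poly I F" for F n
  proof -
    obtain B where "\<forall>x. \<bar>F x\<bar> \<le> B" using trig_poly_bounded[OF F] by blast
    then show ?thesis
      by (intro finite_measure.integrable_const_bound[OF prob_space.axioms(1)[OF M], where B = B] trig_poly_measurable[OF F] Z) auto
  qed
  have j: "integrable N (\<lambda>x. F (\<lambda>t. Y t x))" if F: "trig_poly I F" for F
  proof -
    obtain B where "\<forall>x. \<bar>F x\<bar> \<le> B" using trig_poly_bounded[OF F] by blast
    then show ?thesis
      by (intro finite_measure.integrable_const_bound[OF prob_space.axioms(1)[OF N], where B = B] trig_poly_measurable[OF F] Y) auto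
  qed
  show ?case
    using tendsto_add[OF add.IH] i[OF add.hyps(1)] i[OF add.hyps(2)] j[OF add.hyps(1)] j[OF add.hyps(2)] by simp
qed

section \<open>Truncation by second moments\<close>

text \<open>The error may grow quadratically: this is Chebyshev's bound for leaving a cube,
  integrated by means of the second moments.\<close>

lemma integral_close:
  fixes Q :: "'c measure" and H F :: "('t::countable \<Rightarrow> real) \<Rightarrow> real"
  assumes Q: "prob_space Q" and W: "\<And>t. t \<in> I \<Longrightarrow> square_integrable Q (W t)"
    and WC: "\<And>t. t \<in> I \<Longrightarrow> (\<integral>x. (W t x)\<^sup>2 \<partial>Q) \<le> C"
    and lip: "\<And>x y. \<bar>H x - H y\<bar> \<le> L * (\<Sum>t\<in>I. \<bar>x t - y t\<bar>)" and bdd: "\<And>x. \<bar>H x\<bar> \<le> B"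
    and F: "trig_poly I F" "\<And>x. \<bar>F x\<bar> \<le> B'"
    and pt: "\<And>x. \<bar>H x - F x\<bar> \<le> \<epsilon> + \<eta> * (\<Sum>t\<in>I. (x t)\<^sup>2)" and \<eta>: "0 \<le> \<eta>" "\<eta> * (real (card I) * max C 0) \<le> \<epsilon>"
  shows "\<bar>(\<integral>x. H (\<lambda>t. W t x) \<partial>Q) - (\<integral>x. F (\<lambda>t. W t x) \<partial>Q)\<bar> \<le> 2 * \<epsilon>"
proof -
  have Wm: "\<And>t. t \<in> I \<Longrightarrow> W t \<in> borel_measurable Q" using W by (simp add: square_integrable_def)
  have iH: "integrable Q (\<lambda>x. H (\<lambda>t. W t x))"
    by (rule finite_measure.integrable_const_bound[OF prob_space.axioms(1)[OF Q], where B = B])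
      (auto intro!: borel_measurable_lipschitz_coordinates[OF lip] Wm bdd)
  have iF: "integrable Q (\<lambda>x. F (\<lambda>t. W t x))"
    by (rule finite_measure.integrable_const_bound[OF prob_space.axioms(1)[OF Q], where B = B'])
      (auto intro!: trig_poly_measurable[OF F(1)] Wm F(2))
  have iW: "integrable Q (\<lambda>x. (W t x)\<^sup>2)" if "t \<in> I" for t using W[OF that] by (simp add: square_integrable_def)
  have ic: "integrable Q (\<lambda>x. c :: real)" for c
    by (rule finite_measure.integrable_const[OF prob_space.axioms(1)[OF Q]])
  have "\<bar>(\<integral>x. H (\<lambda>t. W t x) \<partial>Q) - (\<integral>x. F (\<lambda>t. W t x) \<partial>Q)\<bar> = \<bar>\<integral>x. H (\<lambda>t. W t x) - F (\<lambda>t. W t x) \<partial>Q\<bar>"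
    using iH iF by simp
  also have "\<dots> \<le> (\<integral>x. \<bar>H (\<lambda>t. W t x) - F (\<lambda>t. W t x)\<bar> \<partial>Q)" by (rule integral_abs_bound)
  also have "\<dots> \<le> (\<integral>x. \<epsilon> + \<eta> * (\<Sum>t\<in>I. (W t x)\<^sup>2) \<partial>Q)"
    using iH iF iW ic pt
    by (intro integral_mono Bochner_Integration.integrable_add integrable_mult_right Bochner_Integration.integrable_sum) auto
  also have "\<dots> = \<epsilon> + \<eta> * (\<Sum>t\<in>I. \<integral>x. (W t x)\<^sup>2 \<partial>Q)"
    using iW ic prob_space.prob_space[OF Q] by simp
  also have "\<dots> \<le> \<epsilon> + \<eta> * (real (card I) * max C 0)"
  proof -
    have "(\<Sum>t\<in>I. \<integral>x. (W t x)\<^sup>2 \<partial>Q) \<le> real (card I) * max C 0"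
      using WC by (intro sum_bounded_above) (simp add: le_max_iff_disj)
    then show ?thesis using \<eta>(1) by (intro add_left_mono mult_left_mono) auto
  qed
  also have "\<dots> \<le> 2 * \<epsilon>" using \<eta>(2) by simp
  finally show ?thesis .
qed

text \<open>As the second moments are bounded uniformly in \<open>n\<close>, one trigonometric
  polynomial approximates \<open>H\<close> in mean with an error independent of \<open>n\<close>,
  and its means converge.\<close>

lemma cramer_wold:
  fixes M :: "'a measure" and N :: "'b measure" and H :: "('t::countable \<Rightarrow> real) \<Rightarrow> real"
  assumes I: "finite I" and M: "prob_space M" and N: "prob_space N"
    and Z: "\<And>n t. t \<in> I \<Longrightarrow> square_integrable M (Z n t)" and Y: "\<And>t. t \<in> I \<Longrightarrow> square_integrable N (Y t)"
    and ZC: "\<And>n t. t \<in> I \<Longrightarrow> (\<integral>x. (Z n t x)\<^sup>2 \<partial>M) \<le> C" and YC: "\<And>t. t \<in> I \<Longrightarrow> (\<integral>x. (Y t x)\<^sup>2 \<partial>N) \<le> C"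
    and char: "\<And>\<theta> s. ((\<lambda>n. \<integral>x. cos ((\<Sum>t\<in>I. \<theta> t * Z n t x) + s) \<partial>M) \<longlongrightarrow> (\<integral>x. cos ((\<Sum>t\<in>I. \<theta> t * Y t x) + s) \<partial>N)) \<F>"
    and lip: "\<And>x y. \<bar>H x - H y\<bar> \<le> L * (\<Sum>t\<in>I. \<bar>x t - y t\<bar>)" and bdd: "\<And>x. \<bar>H x\<bar> \<le> B"
  shows "((\<lambda>n. \<integral>x. H (\<lambda>t. Z n t x) \<partial>M) \<longlongrightarrow> (\<integral>x. H (\<lambda>t. Y t x) \<partial>N)) \<F>"
proof (rule tendstoI)
  fix e :: real assume e: "0 < e"
  \<comment> \<open>Two shares for each of the two approximations and one for the limit of the
    trigonometric polynomial.\<close>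
  define \<epsilon> where "\<epsilon> = e / 5"
  have \<epsilon>: "0 < \<epsilon>" using e by (simp add: \<epsilon>_def)
  have B: "0 \<le> B" using bdd[of undefined] by linarith
  have BD: "0 < 2 * B + \<epsilon>" using B \<epsilon> by linarith
  \<comment> \<open>With \<open>K = sqrt D\<close>, a point outside the cube has sum of squares at
    least \<open>D\<close>; there the error is at most \<open>2 * B + \<epsilon>\<close>. This
    \<open>D\<close> makes the mean of the resulting quadratic term at most
    \<open>\<epsilon>\<close>.\<close>
  define D where "D = (2 * B + \<epsilon>) * (real (card I) * max C 0) / \<epsilon> + 1"
  have D: "0 < D"
    unfolding D_def using BD \<epsilon> by (intro add_nonneg_pos divide_nonneg_pos mult_nonneg_nonneg) auto
  define K where "K = sqrt D"
  have K: "0 < K" "K\<^sup>2 = D" using D by (auto simp: K_def)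
  obtain F where F: "trig_poly I F" "\<And>x. \<bar>F x\<bar> \<le> B + \<epsilon>"
    "\<And>x. (\<And>t. t \<in> I \<Longrightarrow> \<bar>x t\<bar> \<le> K) \<Longrightarrow> \<bar>F x - H x\<bar> \<le> \<epsilon>"
    using trig_poly_approximation[OF I lip bdd K(1) \<epsilon>] by (elim exE conjE) blast
  have pt: "\<bar>H x - F x\<bar> \<le> \<epsilon> + (2 * B + \<epsilon>) / D * (\<Sum>t\<in>I. (x t)\<^sup>2)" for x
  proof (cases "\<forall>t\<in>I. \<bar>x t\<bar> \<le> K")
    case True
    have "0 \<le> (2 * B + \<epsilon>) / D * (\<Sum>t\<in>I. (x t)\<^sup>2)" using BD D by (intro mult_nonneg_nonneg sum_nonneg) auto
    then show ?thesis using F(3)[of x] True by (simp add: abs_minus_commute)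
  next
    case False
    then obtain t where t: "t \<in> I" "K < \<bar>x t\<bar>" by auto
    have "D \<le> (x t)\<^sup>2" using power_mono[of K "\<bar>x t\<bar>" 2] t K by simp
    also have "\<dots> \<le> (\<Sum>t\<in>I. (x t)\<^sup>2)" using I t by (intro member_le_sum) auto
    finally have "(2 * B + \<epsilon>) / D * D \<le> (2 * B + \<epsilon>) / D * (\<Sum>t\<in>I. (x t)\<^sup>2)"
      using BD D by (intro mult_left_mono) auto
    then have "2 * B + \<epsilon> \<le> (2 * B + \<epsilon>) / D * (\<Sum>t\<in>I. (x t)\<^sup>2)" using D by simp
    then show ?thesis using F(2)[of x] bdd[of x] \<epsilon> by linarith
  qed
  have \<eta>: "0 \<le> (2 * B + \<epsilon>) / D" "(2 * B + \<epsilon>) / D * (real (card I) * max C 0) \<le> \<epsilon>"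
  proof -
    have "(2 * B + \<epsilon>) * (real (card I) * max C 0) \<le> \<epsilon> * D"
      unfolding D_def using \<epsilon> by (simp add: field_simps)
    then show "(2 * B + \<epsilon>) / D * (real (card I) * max C 0) \<le> \<epsilon>" using D by (simp add: field_simps)
    show "0 \<le> (2 * B + \<epsilon>) / D" using BD D by simp
  qed
  have cY: "\<bar>(\<integral>x. H (\<lambda>t. Y t x) \<partial>N) - (\<integral>x. F (\<lambda>t. Y t x) \<partial>N)\<bar> \<le> 2 * \<epsilon>"
    by (rule integral_close[OF N Y YC lip bdd F(1,2) pt \<eta>])
  have cZ: "\<bar>(\<integral>x. H (\<lambda>t. Z n t x) \<partial>M) - (\<integral>x. F (\<lambda>t. Z n t x) \<partial>M)\<bar> \<le> 2 * \<epsilon>" for n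
    by (rule integral_close[OF M Z ZC lip bdd F(1,2) pt \<eta>])
  have "((\<lambda>n. \<integral>x. F (\<lambda>t. Z n t x) \<partial>M) \<longlongrightarrow> (\<integral>x. F (\<lambda>t. Y t x) \<partial>N)) \<F>"
    by (rule trig_poly_tendsto[OF F(1) M N _ _ char]) (use Z Y in \<open>auto simp: square_integrable_def\<close>)
  from tendstoD[OF this \<epsilon>]
  show "\<forall>\<^sub>F n in \<F>. dist (\<integral>x. H (\<lambda>t. Z n t x) \<partial>M) (\<integral>x. H (\<lambda>t. Y t x) \<partial>N) < e"
  proof eventually_elim
    case (elim n)
    then show ?case using cY cZ[of n] unfolding dist_real_def \<epsilon>_def by linarith
  qed
qed

section \<open>The uniform distance and the Skorohod space\<close>

text \<open>The uniform distance is truncated because arbitrary functions on the cube need not be bounded.\<close>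

definition udist :: "(real ^ 'd::finite \<Rightarrow> real) \<Rightarrow> (real ^ 'd \<Rightarrow> real) \<Rightarrow> real" where
  "udist x y = (SUP t\<in>unit_cube. min 1 \<bar>x t - y t\<bar>)"

lemma zero_in_unit_cube: "0 \<in> (unit_cube :: (real ^ 'd::finite) set)"
  by (simp add: unit_cube_def less_eq_vec_def)

lemma mem_unit_cube: "t \<in> unit_cube \<longleftrightarrow> (\<forall>q. 0 \<le> t $ q \<and> t $ q \<le> 1)"
  by (auto simp: unit_cube_def less_eq_vec_def)

lemma udist_upper: "t \<in> unit_cube \<Longrightarrow> min 1 \<bar>x t - y t\<bar> \<le> udist x y"
  unfolding udist_def by (rule cSUP_upper) (auto intro!: bdd_aboveI2[where M = 1])

lemma udist_least: "(\<And>t. t \<in> unit_cube \<Longrightarrow> min 1 \<bar>x t - y t\<bar> \<le> c) \<Longrightarrow> udist x y \<le> c"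
  unfolding udist_def using zero_in_unit_cube by (intro cSUP_least) auto

lemma udist_le: "(\<And>t. t \<in> unit_cube \<Longrightarrow> \<bar>x t - y t\<bar> \<le> c) \<Longrightarrow> udist x y \<le> c"
  by (rule udist_least) (meson min.cobounded2 order_trans)

lemma udist_nonneg: "0 \<le> udist x y"
  using udist_upper[OF zero_in_unit_cube, of x y] by (meson abs_ge_zero min.boundedI order_trans zero_le_one)

lemma udist_le_one: "udist x y \<le> 1"
  by (rule udist_least) simp

lemma udist_refl: "udist x x = 0"
  using udist_le[of x x 0] udist_nonneg[of x x] by simp

lemma udist_commute: "udist x y = udist y x"
  unfolding udist_def by (simp add: abs_minus_commute)

lemma udist_triangle: "udist x z \<le> udist x y + udist y z"
proof (rule udist_least)
  fix t :: "real ^ 'a" assume t: "t \<in> unit_cube"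
  show "min 1 \<bar>x t - z t\<bar> \<le> udist x y + udist y z"
    using udist_upper[OF t, of x y] udist_upper[OF t, of y z] udist_nonneg[of x y] udist_nonneg[of y z]
    by (auto simp: min_def split: if_splits)
qed

lemma abs_diff_le_udist:
  assumes "t \<in> unit_cube" "udist x y < 1"
  shows "\<bar>x t - y t\<bar> \<le> udist x y"
  using udist_upper[OF assms(1), of x y] assms(2) by (simp add: min_def split: if_splits)

text \<open>The identity is an admissible time change.\<close>

lemma skorohod_dist_le:
  fixes x y :: "real ^ 'd::finite \<Rightarrow> real"
  assumes "\<And>t. t \<in> unit_cube \<Longrightarrow> \<bar>x t - y t\<bar> \<le> c"
  shows "skorohod_dist x y \<le> c"
  unfolding skorohod_dist_def
proof (rule cInf_lower)
  have c: "0 \<le> c" using assms[OF zero_in_unit_cube] by linarith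
  have "(\<lambda>_ s. s) \<in> time_changes" by (simp add: time_changes_def strict_mono_on_def)
  moreover have "\<forall>t\<in>unit_cube. (\<forall>q. \<bar>t $ q - t $ q\<bar> \<le> c) \<and> \<bar>x t - y (\<chi> q. t $ q)\<bar> \<le> c"
    using assms c by (simp add: vec_nth_inverse)
  ultimately show "c \<in> {e. 0 \<le> e \<and> (\<exists>\<tau>\<in>time_changes. \<forall>t\<in>unit_cube.
     (\<forall>q. \<bar>\<tau> q (t $ q) - t $ q\<bar> \<le> e) \<and> \<bar>x t - y (\<chi> q. \<tau> q (t $ q))\<bar> \<le> e)}"
    using c by (intro CollectI conjI bexI[of _ "\<lambda>_ s. s"]) auto
qed (auto intro!: bdd_belowI[where m = 0])

lemma openin_skorohod_udist:
  fixes x :: "real ^ 'd::finite \<Rightarrow> real"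
  assumes U: "openin skorohod_topology U" and x: "x \<in> U"
  obtains r where "0 < r" "\<And>y. y \<in> skorohod_space \<Longrightarrow> udist x y < r \<Longrightarrow> y \<in> U"
proof -
  obtain r where r: "0 < r" "\<And>y. y \<in> skorohod_space \<Longrightarrow> skorohod_dist x y < r \<Longrightarrow> y \<in> U"
    using U x unfolding openin_skorohod_topology by (elim conjE) (drule (1) bspec, blast)
  show ?thesis
  \<comment> \<open>Below 1 the truncation in \<open>udist\<close> is inactive, so
    \<open>udist\<close> bounds the Skorohod distance.\<close>
  proof (rule that[of "min r 1"])
    fix y assume y: "y \<in> skorohod_space" "udist x y < min r 1"
    have "skorohod_dist x y \<le> udist x y"
      by (rule skorohod_dist_le) (rule abs_diff_le_udist, use y(2) in auto)
    then show "y \<in> U" using r(2)[OF y(1)] y(2) by linarith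
  qed (use r(1) in simp)
qed

section \<open>Lipschitz functionals and envelopes\<close>

text \<open>As \<open>udist\<close> never exceeds 1, such a functional is automatically
  bounded.\<close>

definition uniformly_lipschitz :: "((real ^ 'd::finite \<Rightarrow> real) \<Rightarrow> real) \<Rightarrow> bool" where
  "uniformly_lipschitz H \<longleftrightarrow> (\<exists>L\<ge>0. \<forall>x y. \<bar>H x - H y\<bar> \<le> L * udist x y)"

lemma uniformly_lipschitz_bounded:
  assumes "uniformly_lipschitz H"
  shows "\<exists>B. \<forall>x. \<bar>H x\<bar> \<le> B"
proof -
  obtain L where L: "0 \<le> L" "\<forall>x y. \<bar>H x - H y\<bar> \<le> L * udist x y"
    using assms unfolding uniformly_lipschitz_def by blast
  have "\<bar>H x\<bar> \<le> \<bar>H (\<lambda>_. 0)\<bar> + L" for x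
    using L(2)[rule_format, of x "\<lambda>_. 0"] mult_left_mono[OF udist_le_one[of x "\<lambda>_. 0"] L(1)] by linarith
  then show ?thesis by blast
qed

text \<open>The Pasch-Hausdorff envelope: for \<open>h\<close> bounded below on \<open>A\<close>,
  the largest function that is \<open>k\<close>-Lipschitz for \<open>udist\<close> and at most
  \<open>h\<close> on \<open>A\<close>. For \<open>h = 0\<close> and \<open>k = 1\<close> it is the
  distance to \<open>A\<close>.\<close>

definition lip_minorant :: "(real ^ 'd::finite \<Rightarrow> real) set \<Rightarrow> real \<Rightarrow> ((real ^ 'd \<Rightarrow> real) \<Rightarrow> real) \<Rightarrow> (real ^ 'd \<Rightarrow> real) \<Rightarrow> real" where
  "lip_minorant A k h x = (INF y\<in>A. h y + k * udist x y)"

lemma lip_minorant_lower: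
  assumes "y \<in> A" "\<And>y. y \<in> A \<Longrightarrow> c \<le> h y" "0 \<le> k"
  shows "lip_minorant A k h x \<le> h y + k * udist x y"
  unfolding lip_minorant_def
proof (rule cINF_lower)
  show "bdd_below ((\<lambda>y. h y + k * udist x y) ` A)"
  proof (rule bdd_belowI2)
    fix y assume "y \<in> A"
    from assms(2)[OF this] mult_nonneg_nonneg[OF assms(3) udist_nonneg[of x y]] show "c \<le> h y + k * udist x y" by linarith
  qed
qed (rule assms(1))

lemma lip_minorant_greatest:
  assumes "A \<noteq> {}" "\<And>y. y \<in> A \<Longrightarrow> c \<le> h y + k * udist x y"
  shows "c \<le> lip_minorant A k h x"
  unfolding lip_minorant_def by (rule cINF_greatest[OF assms])

lemma uniformly_lipschitz_lip_minorant:
  assumes A: "A \<noteq> {}" and c: "\<And>y. y \<in> A \<Longrightarrow> c \<le> h y" and k: "0 \<le> k"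
  shows "uniformly_lipschitz (lip_minorant A k h)"
proof -
  have le: "lip_minorant A k h x - k * udist x x' \<le> lip_minorant A k h x'" for x x'
  proof (rule lip_minorant_greatest[OF A])
    fix y assume y: "y \<in> A"
    have "lip_minorant A k h x \<le> h y + k * udist x y" by (rule lip_minorant_lower[OF y c k])
    also have "\<dots> \<le> h y + k * (udist x x' + udist x' y)"
      by (intro add_left_mono mult_left_mono udist_triangle k)
    finally show "lip_minorant A k h x - k * udist x x' \<le> h y + k * udist x' y" by (simp add: distrib_left)
  qed
  have "\<bar>lip_minorant A k h x - lip_minorant A k h x'\<bar> \<le> k * udist x x'" for x x'
    using le[of x x'] le[of x' x, unfolded udist_commute[of x' x]] by (auto simp: abs_le_iff)
  then show ?thesis unfolding uniformly_lipschitz_def using k by blast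
qed

text \<open>A Skorohod open set is open for the uniform distance, hence the set where the uniform distance to its
  complement is positive.\<close>

lemma measurable_skorohod:
  fixes X :: "'a \<Rightarrow> real ^ 'd::finite \<Rightarrow> real"
  assumes X: "\<And>\<omega>. \<omega> \<in> space M \<Longrightarrow> X \<omega> \<in> skorohod_space"
    and m: "\<And>H. uniformly_lipschitz H \<Longrightarrow> (\<lambda>\<omega>. H (X \<omega>)) \<in> borel_measurable M"
  shows "X \<in> M \<rightarrow>\<^sub>M borel_of_topology skorohod_topology"
  unfolding borel_of_topology_def
proof (rule measurable_sigma_sets)
  show "sets (sigma (topspace skorohod_topology) {U. openin skorohod_topology U})
      = sigma_sets (topspace skorohod_topology) {U :: (real ^ 'd \<Rightarrow> real) set. openin skorohod_topology U}"
    by (rule sets_measure_of) (auto dest: openin_subset)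
  show "{U :: (real ^ 'd \<Rightarrow> real) set. openin skorohod_topology U} \<subseteq> Pow (topspace skorohod_topology)"
    by (auto dest: openin_subset)
  show "X \<in> space M \<rightarrow> topspace skorohod_topology" using X by (simp add: topspace_skorohod_topology)
  fix U :: "(real ^ 'd \<Rightarrow> real) set" assume "U \<in> {U. openin skorohod_topology U}"
  then have U: "openin skorohod_topology U" by simp
  show "X -` U \<inter> space M \<in> sets M"
  \<comment> \<open>The distance to an empty complement would be an infimum over the empty
    set.\<close>
  proof (cases "skorohod_space - U = {}")
    case True
    then have "X -` U \<inter> space M = space M" using X by auto
    then show ?thesis by simp
  next
    case False
    define g where "g = lip_minorant (skorohod_space - U) 1 (\<lambda>_. 0)"
    have g: "uniformly_lipschitz g" unfolding g_def by (rule uniformly_lipschitz_lip_minorant[OF False, of 0]) auto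
    have "x \<in> U \<longleftrightarrow> 0 < g x" if x: "x \<in> skorohod_space" for x
    proof
      assume "x \<in> U"
      from openin_skorohod_udist[OF U this] obtain r where
        r: "0 < r" "\<And>y. y \<in> skorohod_space \<Longrightarrow> udist x y < r \<Longrightarrow> y \<in> U" by blast
      have "r \<le> g x" unfolding g_def
        by (rule lip_minorant_greatest[OF False]) (use r(2) in \<open>auto simp: not_less[symmetric]\<close>)
      then show "0 < g x" using r(1) by linarith
    next
      assume g0: "0 < g x"
      show "x \<in> U"
      proof (rule ccontr)
        assume "x \<notin> U"
        then have "g x \<le> 0 + 1 * udist x x" unfolding g_def using x by (intro lip_minorant_lower[of _ _ 0]) auto
        with g0 show False by (simp add: udist_refl)
      qed
    qed
    then have "X -` U \<inter> space M = {\<omega> \<in> space M. 0 < g (X \<omega>)}" using X by auto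
    also have "\<dots> \<in> sets M" using m[OF g] by (intro borel_measurable_less) auto
    finally show ?thesis .
  qed
qed

lemma continuous_map_borel_measurable:
  assumes "continuous_map T euclideanreal h"
  shows "h \<in> borel_measurable (borel_of_topology T)"
proof (rule borel_measurableI)
  fix S :: "real set" assume "open S"
  then have "openin T {x \<in> topspace T. h x \<in> S}" using assms by (simp add: continuous_map_def)
  moreover have "{U. openin T U} \<subseteq> Pow (topspace T)" by (auto dest: openin_subset)
  moreover have "h -` S \<inter> space (borel_of_topology T) = {x \<in> topspace T. h x \<in> S}"
    using calculation(2) by (auto simp: borel_of_topology_def space_measure_of)
  ultimately show "h -` S \<inter> space (borel_of_topology T) \<in> sets (borel_of_topology T)"
    by (simp add: borel_of_topology_def sets_measure_of sigma_sets.Basic)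
qed

text \<open>Near \<open>x\<close> continuity bounds \<open>h\<close> from below; at uniform distance
  at least \<open>r\<close> the penalty \<open>k * r\<close> outweighs the oscillation
  \<open>2 * B\<close>.\<close>

lemma lip_minorant_tendsto:
  fixes x :: "real ^ 'd::finite \<Rightarrow> real"
  assumes h: "continuous_map skorohod_topology euclideanreal h"
    and B: "\<And>y. y \<in> skorohod_space \<Longrightarrow> \<bar>h y\<bar> \<le> B" and x: "x \<in> skorohod_space"
  shows "(\<lambda>k. lip_minorant skorohod_space (real k) h x) \<longlonglongrightarrow> h x"
proof (rule LIMSEQ_I)
  fix \<epsilon> :: real assume \<epsilon>: "0 < \<epsilon>"
  have lo: "- B \<le> h y" if "y \<in> skorohod_space" for y using B[OF that] by linarith
  have "openin skorohod_topology {y \<in> topspace skorohod_topology. h y \<in> {h x - \<epsilon> / 2<..}}"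
    by (rule openin_continuous_map_preimage[OF h]) simp
  then have U: "openin skorohod_topology {y \<in> skorohod_space. h x - \<epsilon> / 2 < h y}"
    by (simp add: topspace_skorohod_topology)
  have xU: "x \<in> {y \<in> skorohod_space. h x - \<epsilon> / 2 < h y}" using x \<epsilon> by simp
  from openin_skorohod_udist[OF U xU] obtain r where
    r: "0 < r" "\<And>y. y \<in> skorohod_space \<Longrightarrow> udist x y < r \<Longrightarrow> y \<in> {y \<in> skorohod_space. h x - \<epsilon> / 2 < h y}" by blast
  obtain k0 :: nat where k0: "2 * B / r < real k0" using reals_Archimedean2 by blast
  show "\<exists>no. \<forall>n\<ge>no. norm (lip_minorant skorohod_space (real n) h x - h x) < \<epsilon>"
  proof (intro exI[of _ k0] allI impI)
    fix k assume k: "k0 \<le> k"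
    have "2 * B < real k0 * r" using k0 r(1) by (simp add: pos_divide_less_eq)
    also have "\<dots> \<le> real k * r" using k r(1) by (intro mult_right_mono) auto
    finally have kr: "2 * B < real k * r" .
    have "h x - \<epsilon> / 2 \<le> lip_minorant skorohod_space (real k) h x"
    proof (rule lip_minorant_greatest)
      show "skorohod_space \<noteq> ({} :: (real ^ 'd \<Rightarrow> real) set)" using x by blast
      fix y :: "real ^ 'd \<Rightarrow> real" assume y: "y \<in> skorohod_space"
      show "h x - \<epsilon> / 2 \<le> h y + real k * udist x y"
      proof (cases "udist x y < r")
        case True
        then have "h x - \<epsilon> / 2 < h y" using r(2)[OF y True] by simp
        moreover have "0 \<le> real k * udist x y" by (intro mult_nonneg_nonneg udist_nonneg) simp
        ultimately show ?thesis by linarith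
      next
        case False
        then have "real k * r \<le> real k * udist x y" by (intro mult_left_mono) auto
        then show ?thesis using kr B[OF x] lo[OF y] \<epsilon> by linarith
      qed
    qed
    moreover have "lip_minorant skorohod_space (real k) h x \<le> h x + real k * udist x x"
      by (rule lip_minorant_lower[OF x lo]) auto
    ultimately show "norm (lip_minorant skorohod_space (real k) h x - h x) < \<epsilon>"
      using \<epsilon> by (simp add: udist_refl)
  qed
qed

section \<open>Weak convergence from Lipschitz functionals\<close>

lemma integrable_lipschitz:
  assumes M: "prob_space M" and H: "uniformly_lipschitz H" and m: "(\<lambda>\<omega>. H (X \<omega>)) \<in> borel_measurable M"
  shows "integrable M (\<lambda>\<omega>. H (X \<omega>))"
proof -
  obtain B where "\<forall>x. \<bar>H x\<bar> \<le> B" using uniformly_lipschitz_bounded[OF H] by blast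
  then show ?thesis
    by (intro finite_measure.integrable_const_bound[OF prob_space.axioms(1)[OF M], where B = B] m) auto
qed

text \<open>The level \<open>k\<close> of the envelope is chosen on the limit law alone, by
  dominated convergence. For this fixed Lipschitz minorant of \<open>h\<close> the means converge,
  which bounds the means of \<open>h\<close> from below along any filter.\<close>

lemma skorohod_lower_bound:
  fixes X :: "'i \<Rightarrow> 'a \<Rightarrow> real ^ 'd::finite \<Rightarrow> real" and Y :: "'b \<Rightarrow> real ^ 'd \<Rightarrow> real"
  assumes M: "prob_space M" and N: "prob_space N"
    and X: "\<And>n \<omega>. \<omega> \<in> space M \<Longrightarrow> X n \<omega> \<in> skorohod_space"
    and Y: "\<And>\<omega>. \<omega> \<in> space N \<Longrightarrow> Y \<omega> \<in> skorohod_space"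
    and mX: "\<And>n H. uniformly_lipschitz H \<Longrightarrow> (\<lambda>\<omega>. H (X n \<omega>)) \<in> borel_measurable M"
    and mY: "\<And>H. uniformly_lipschitz H \<Longrightarrow> (\<lambda>\<omega>. H (Y \<omega>)) \<in> borel_measurable N"
    and conv: "\<And>H. uniformly_lipschitz H \<Longrightarrow> ((\<lambda>n. \<integral>\<omega>. H (X n \<omega>) \<partial>M) \<longlongrightarrow> (\<integral>\<omega>. H (Y \<omega>) \<partial>N)) \<F>"
    and h: "continuous_map skorohod_topology euclideanreal h"
    and B: "\<And>y. y \<in> skorohod_space \<Longrightarrow> \<bar>h y\<bar> \<le> B"
    and \<epsilon>: "0 < \<epsilon>"
  shows "\<forall>\<^sub>F n in \<F>. (\<integral>\<omega>. h (Y \<omega>) \<partial>N) - \<epsilon> < (\<integral>\<omega>. h (X n \<omega>) \<partial>M)"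
proof -
  have ne: "skorohod_space \<noteq> ({} :: (real ^ 'd \<Rightarrow> real) set)"
    using Y prob_space.not_empty[OF N] by blast
  have lo: "- B \<le> h y" if "y \<in> skorohod_space" for y using B[OF that] by linarith
  let ?g = "\<lambda>k. lip_minorant skorohod_space (real k) h"
  have g: "uniformly_lipschitz (?g k)" for k
    by (rule uniformly_lipschitz_lip_minorant[OF ne lo]) auto
  have g_le: "?g k y \<le> h y" if "y \<in> skorohod_space" for k y
    using lip_minorant_lower[of y skorohod_space "- B" h "real k" y, OF that lo] by (simp add: udist_refl)
  have g_ge: "- B \<le> ?g k y" for k y
  proof (rule lip_minorant_greatest[OF ne])
    fix z :: "real ^ 'd \<Rightarrow> real" assume z: "z \<in> skorohod_space"
    show "- B \<le> h z + real k * udist y z"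
      using lo[OF z] mult_nonneg_nonneg[OF of_nat_0_le_iff[of k] udist_nonneg[of y z]] by linarith
  qed
  have "X n \<in> M \<rightarrow>\<^sub>M borel_of_topology skorohod_topology" for n
    by (rule measurable_skorohod) (use X mX in auto)
  from measurable_compose[OF this continuous_map_borel_measurable[OF h]]
  have hX: "(\<lambda>\<omega>. h (X n \<omega>)) \<in> borel_measurable M" for n .
  have "Y \<in> N \<rightarrow>\<^sub>M borel_of_topology skorohod_topology"
    by (rule measurable_skorohod) (use Y mY in auto)
  from measurable_compose[OF this continuous_map_borel_measurable[OF h]]
  have hY: "(\<lambda>\<omega>. h (Y \<omega>)) \<in> borel_measurable N" .
  have iX: "integrable M (\<lambda>\<omega>. h (X n \<omega>))" for n
    by (rule finite_measure.integrable_const_bound[OF prob_space.axioms(1)[OF M], where B = B]) (auto intro!: AE_I2 B X hX)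
  have "(\<lambda>k. \<integral>\<omega>. ?g k (Y \<omega>) \<partial>N) \<longlonglongrightarrow> (\<integral>\<omega>. h (Y \<omega>) \<partial>N)"
  proof (rule integral_dominated_convergence[where w = "\<lambda>_. B"])
    show "integrable N (\<lambda>_. B)" by (rule finite_measure.integrable_const[OF prob_space.axioms(1)[OF N]])
    show "AE \<omega> in N. (\<lambda>k. ?g k (Y \<omega>)) \<longlonglongrightarrow> h (Y \<omega>)" by (intro AE_I2 lip_minorant_tendsto[OF h B] Y)
    show "AE \<omega> in N. norm (?g k (Y \<omega>)) \<le> B" for k
    proof (rule AE_I2)
      fix \<omega> assume "\<omega> \<in> space N"
      from g_le[OF Y[OF this], of k] B[OF Y[OF this]] g_ge[of k "Y \<omega>"] show "norm (?g k (Y \<omega>)) \<le> B" by simp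
    qed
  qed (use hY mY[OF g] in auto)
  from LIMSEQ_D[OF this, of "\<epsilon> / 2"] \<epsilon> obtain k where
    k: "norm ((\<integral>\<omega>. ?g k (Y \<omega>) \<partial>N) - (\<integral>\<omega>. h (Y \<omega>) \<partial>N)) < \<epsilon> / 2" by auto
  have "0 < \<epsilon> / 2" using \<epsilon> by simp
  from tendstoD[OF conv[OF g[of k]] this] show ?thesis
  proof eventually_elim
    case (elim n)
    have "(\<integral>\<omega>. ?g k (X n \<omega>) \<partial>M) \<le> (\<integral>\<omega>. h (X n \<omega>) \<partial>M)"
      by (intro integral_mono integrable_lipschitz[OF M g] mX[OF g] iX g_le X)
    then show ?case using k elim unfolding dist_real_def real_norm_def by linarith
  qed
qed

lemma converges_in_distribution_skorohodI:
  fixes X :: "'i \<Rightarrow> 'a \<Rightarrow> real ^ 'd::finite \<Rightarrow> real" and Y :: "'b \<Rightarrow> real ^ 'd \<Rightarrow> real"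
  assumes M: "prob_space M" and N: "prob_space N"
    and X: "\<And>n \<omega>. \<omega> \<in> space M \<Longrightarrow> X n \<omega> \<in> skorohod_space"
    and Y: "\<And>\<omega>. \<omega> \<in> space N \<Longrightarrow> Y \<omega> \<in> skorohod_space"
    and mX: "\<And>n H. uniformly_lipschitz H \<Longrightarrow> (\<lambda>\<omega>. H (X n \<omega>)) \<in> borel_measurable M"
    and mY: "\<And>H. uniformly_lipschitz H \<Longrightarrow> (\<lambda>\<omega>. H (Y \<omega>)) \<in> borel_measurable N"
    and conv: "\<And>H. uniformly_lipschitz H \<Longrightarrow> ((\<lambda>n. \<integral>\<omega>. H (X n \<omega>) \<partial>M) \<longlongrightarrow> (\<integral>\<omega>. H (Y \<omega>) \<partial>N)) \<F>"
  shows "converges_in_distribution skorohod_topology M X N Y \<F>"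
  unfolding converges_in_distribution_def weakly_converges_def
proof (intro conjI allI impI)
  show mX': "X n \<in> M \<rightarrow>\<^sub>M borel_of_topology skorohod_topology" for n by (rule measurable_skorohod) (use X mX in auto)
  show mY': "Y \<in> N \<rightarrow>\<^sub>M borel_of_topology skorohod_topology" by (rule measurable_skorohod) (use Y mY in auto)
  fix h :: "(real ^ 'd \<Rightarrow> real) \<Rightarrow> real"
  assume "continuous_map skorohod_topology euclideanreal h \<and> bounded (h ` topspace skorohod_topology)"
  then have h: "continuous_map skorohod_topology euclideanreal h" and "bounded (h ` skorohod_space)"
    by (auto simp: topspace_skorohod_topology)
  then obtain B where B: "\<And>y. y \<in> skorohod_space \<Longrightarrow> \<bar>h y\<bar> \<le> B" by (auto simp: bounded_iff)
  \<comment> \<open>The lower bound for \<open>- h\<close> is the missing upper bound for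
    \<open>h\<close>.\<close>
  have h': "continuous_map skorohod_topology euclideanreal (\<lambda>x. - h x)"
    using h by (rule continuous_map_minus)
  have eq: "(\<integral>x. h x \<partial>distr M (borel_of_topology skorohod_topology) (X n)) = (\<integral>\<omega>. h (X n \<omega>) \<partial>M)" for n
    by (rule integral_distr[OF mX' continuous_map_borel_measurable[OF h]])
  have eq': "(\<integral>x. h x \<partial>distr N (borel_of_topology skorohod_topology) Y) = (\<integral>\<omega>. h (Y \<omega>) \<partial>N)"
    by (rule integral_distr[OF mY' continuous_map_borel_measurable[OF h]])
  show "((\<lambda>n. \<integral>x. h x \<partial>distr M (borel_of_topology skorohod_topology) (X n)) \<longlongrightarrow> (\<integral>x. h x \<partial>distr N (borel_of_topology skorohod_topology) Y)) \<F>"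
    unfolding eq eq'
  proof (rule tendstoI)
    fix \<epsilon> :: real assume \<epsilon>: "0 < \<epsilon>"
    have B': "\<bar>- h y\<bar> \<le> B" if "y \<in> skorohod_space" for y using B[OF that] by simp
    have "\<forall>\<^sub>F n in \<F>. (\<integral>\<omega>. h (Y \<omega>) \<partial>N) - \<epsilon> < (\<integral>\<omega>. h (X n \<omega>) \<partial>M)"
      by (rule skorohod_lower_bound[OF M N X Y mX mY conv h B \<epsilon>])
    moreover have "\<forall>\<^sub>F n in \<F>. (\<integral>\<omega>. - h (Y \<omega>) \<partial>N) - \<epsilon> < (\<integral>\<omega>. - h (X n \<omega>) \<partial>M)"
      by (rule skorohod_lower_bound[OF M N X Y mX mY conv h' B' \<epsilon>])
    ultimately show "\<forall>\<^sub>F n in \<F>. dist (\<integral>\<omega>. h (X n \<omega>) \<partial>M) (\<integral>\<omega>. h (Y \<omega>) \<partial>N) < \<epsilon>"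
    proof eventually_elim
      case (elim n)
      then show ?case by (simp add: dist_real_def abs_less_iff)
    qed
  qed
qed

section \<open>Step functions on a grid and continuous functions\<close>

definition step :: "nat ^ 'd::finite \<Rightarrow> (int ^ 'd \<Rightarrow> real) \<Rightarrow> real ^ 'd \<Rightarrow> real" where
  "step n a = (\<lambda>t\<in>unit_cube. a (scaled_floor n t))"

lemma scaled_floor_mem:
  fixes t :: "real ^ 'd::finite"
  assumes "t \<in> unit_cube"
  shows "scaled_floor n t \<in> {0..\<chi> q. int (n $ q)}"
proof -
  have "0 \<le> \<lfloor>real (n $ q) * t $ q\<rfloor> \<and> \<lfloor>real (n $ q) * t $ q\<rfloor> \<le> int (n $ q)" for q
  proof
    have t: "0 \<le> t $ q" "t $ q \<le> 1" using assms by (auto simp: mem_unit_cube)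
    show "0 \<le> \<lfloor>real (n $ q) * t $ q\<rfloor>" using t(1) by simp
    have "real (n $ q) * t $ q \<le> real (n $ q)" using t(2) by (intro mult_left_le) auto
    then have "\<lfloor>real (n $ q) * t $ q\<rfloor> \<le> \<lfloor>real (n $ q)\<rfloor>" by (rule floor_mono)
    then show "\<lfloor>real (n $ q) * t $ q\<rfloor> \<le> int (n $ q)" by simp
  qed
  then show ?thesis by (simp add: scaled_floor_def less_eq_vec_def)
qed

lemma floor_eventually_right:
  fixes y :: real
  assumes c: "0 \<le> c"
  obtains \<delta> where "0 < \<delta>" "\<And>z. y \<le> z \<Longrightarrow> z < y + \<delta> \<Longrightarrow> \<lfloor>c * z\<rfloor> = \<lfloor>c * y\<rfloor>"
proof -
  \<comment> \<open>The gap to the next integer is divided by \<open>c + 1\<close> instead of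
    \<open>c\<close>, which includes the case \<open>c = 0\<close>.\<close>
  define \<delta> where "\<delta> = (of_int \<lfloor>c * y\<rfloor> + 1 - c * y) / (c + 1)"
  have "0 < of_int \<lfloor>c * y\<rfloor> + 1 - c * y" by linarith
  then have pos: "0 < \<delta>" using c by (simp add: \<delta>_def)
  have c\<delta>: "(c + 1) * \<delta> = of_int \<lfloor>c * y\<rfloor> + 1 - c * y" using c by (simp add: \<delta>_def)
  have "\<lfloor>c * z\<rfloor> = \<lfloor>c * y\<rfloor>" if z: "y \<le> z" "z < y + \<delta>" for z
  proof (rule floor_unique)
    have "c * y \<le> c * z" using z(1) c by (rule mult_left_mono)
    then show "of_int \<lfloor>c * y\<rfloor> \<le> c * z" by linarith
    have "c * z \<le> c * (y + \<delta>)" using z(2) c by (intro mult_left_mono) auto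
    also have "\<dots> < c * y + (c + 1) * \<delta>"
      using pos by (simp add: distrib_left distrib_right)
    finally show "c * z < of_int \<lfloor>c * y\<rfloor> + 1" unfolding c\<delta> by simp
  qed
  then show ?thesis by (rule that[OF pos])
qed

lemma floor_eventually_left:
  fixes y :: real
  assumes c: "0 \<le> c"
  obtains \<delta> b where "0 < \<delta>" "\<And>z. z < y \<Longrightarrow> y - \<delta> < z \<Longrightarrow> \<lfloor>c * z\<rfloor> = b"
proof (cases "c = 0")
  case True
  then show ?thesis by (intro that[of 1 0]) auto
next
  case False
  with c have c: "0 < c" by simp
  define \<delta> where "\<delta> = (c * y - (of_int \<lceil>c * y\<rceil> - 1)) / c"
  have "0 < c * y - (of_int \<lceil>c * y\<rceil> - 1)" by linarith
  then have pos: "0 < \<delta>" using c by (simp add: \<delta>_def)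
  have c\<delta>: "c * \<delta> = c * y - (of_int \<lceil>c * y\<rceil> - 1)" using c by (simp add: \<delta>_def)
  \<comment> \<open>Just below \<open>y\<close> the floor is the largest integer strictly less than
    \<open>c * y\<close>.\<close>
  have "\<lfloor>c * z\<rfloor> = \<lceil>c * y\<rceil> - 1" if z: "z < y" "y - \<delta> < z" for z
  proof (rule floor_unique)
    have "c * (y - \<delta>) < c * z" using z(2) c by simp
    moreover have "c * (y - \<delta>) = of_int \<lceil>c * y\<rceil> - 1" using c\<delta> by (simp add: right_diff_distrib)
    ultimately show "of_int (\<lceil>c * y\<rceil> - 1) \<le> c * z" by simp
    have "c * z < c * y" using z(1) c by simp
    then show "c * z < of_int (\<lceil>c * y\<rceil> - 1) + 1" by (simp, linarith)
  qed
  then show ?thesis by (rule that[OF pos])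
qed

text \<open>A quadrant approaches \<open>t\<close> from one fixed side in each coordinate, and on
  either side the floor is eventually constant; from above its value is the one at
  \<open>t\<close>.\<close>

lemma scaled_floor_eventually_const:
  fixes t :: "real ^ 'd::finite"
  shows "\<exists>c. (R = UNIV \<longrightarrow> c = scaled_floor n t) \<and> (\<forall>\<^sub>F s in at t within quadrant R t. scaled_floor n s = c)"
proof -
  have "\<exists>c. (q \<in> R \<longrightarrow> c = \<lfloor>real (n $ q) * t $ q\<rfloor>) \<and>
      (\<forall>\<^sub>F s in at t within quadrant R t. \<lfloor>real (n $ q) * s $ q\<rfloor> = c)" for q
  proof (cases "q \<in> R")
    case True
    obtain \<delta> where \<delta>: "0 < \<delta>" "\<And>z. t $ q \<le> z \<Longrightarrow> z < t $ q + \<delta> \<Longrightarrow> \<lfloor>real (n $ q) * z\<rfloor> = \<lfloor>real (n $ q) * t $ q\<rfloor>"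
      by (rule floor_eventually_right[OF of_nat_0_le_iff[of "n $ q"], where y = "t $ q"]) blast
    have "\<forall>\<^sub>F s in at t within quadrant R t. \<lfloor>real (n $ q) * s $ q\<rfloor> = \<lfloor>real (n $ q) * t $ q\<rfloor>"
      unfolding eventually_at
    proof (intro exI[of _ \<delta>] conjI ballI impI \<delta>)
      fix s assume s: "s \<in> quadrant R t" "s \<noteq> t \<and> dist s t < \<delta>"
      show "t $ q \<le> s $ q" using s(1) True by (auto simp: quadrant_def split: if_splits)
      show "s $ q < t $ q + \<delta>" using dist_vec_nth_le[of s q t] s(2) unfolding dist_real_def by linarith
    qed
    then show ?thesis using True by blast
  next
    case False
    obtain \<delta> b where \<delta>: "0 < \<delta>" "\<And>z. z < t $ q \<Longrightarrow> t $ q - \<delta> < z \<Longrightarrow> \<lfloor>real (n $ q) * z\<rfloor> = b"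
      by (rule floor_eventually_left[OF of_nat_0_le_iff[of "n $ q"], where y = "t $ q"]) blast
    have "\<forall>\<^sub>F s in at t within quadrant R t. \<lfloor>real (n $ q) * s $ q\<rfloor> = b"
      unfolding eventually_at
    proof (intro exI[of _ \<delta>] conjI ballI impI \<delta>)
      fix s assume s: "s \<in> quadrant R t" "s \<noteq> t \<and> dist s t < \<delta>"
      show "s $ q < t $ q" using s(1) False by (auto simp: quadrant_def)
      show "t $ q - \<delta> < s $ q" using dist_vec_nth_le[of s q t] s(2) unfolding dist_real_def by linarith
    qed
    then show ?thesis using False by blast
  qed
  then have "\<forall>q. \<exists>c. (q \<in> R \<longrightarrow> c = \<lfloor>real (n $ q) * t $ q\<rfloor>) \<and>
      (\<forall>\<^sub>F s in at t within quadrant R t. \<lfloor>real (n $ q) * s $ q\<rfloor> = c)" by blast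
  from choice[OF this] obtain c where c: "\<And>q. q \<in> R \<Longrightarrow> c q = \<lfloor>real (n $ q) * t $ q\<rfloor>"
    "\<And>q. \<forall>\<^sub>F s in at t within quadrant R t. \<lfloor>real (n $ q) * s $ q\<rfloor> = c q" by blast
  show ?thesis
  proof (intro exI[of _ "\<chi> q. c q"] conjI impI)
    show "(\<chi> q. c q) = scaled_floor n t" if "R = UNIV" using c(1) that by (simp add: scaled_floor_def)
    have "\<forall>\<^sub>F s in at t within quadrant R t. \<forall>q. \<lfloor>real (n $ q) * s $ q\<rfloor> = c q"
      by (rule eventually_all_finite) (rule c(2))
    then show "\<forall>\<^sub>F s in at t within quadrant R t. scaled_floor n s = (\<chi> q. c q)"
      by eventually_elim (simp add: scaled_floor_def)
  qed
qed

lemma eventually_quadrant: "\<forall>\<^sub>F s in at t within quadrant R t. s \<in> unit_cube"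
  unfolding eventually_at by (intro exI[of _ 1]) (auto simp: quadrant_def)

lemma step_in_skorohod_space: "step n a \<in> skorohod_space"
  unfolding skorohod_space_def
proof (intro CollectI conjI ballI allI)
  show "step n a \<in> extensional unit_cube" by (simp add: step_def)
  fix t :: "real ^ 'a" assume t: "t \<in> unit_cube"
  have *: "\<exists>l. (R = UNIV \<longrightarrow> l = step n a t) \<and> (step n a \<longlongrightarrow> l) (at t within quadrant R t)" for R
  proof -
    from scaled_floor_eventually_const[of R n t] obtain c where
      c: "R = UNIV \<longrightarrow> c = scaled_floor n t" "\<forall>\<^sub>F s in at t within quadrant R t. scaled_floor n s = c" by blast
    have "\<forall>\<^sub>F s in at t within quadrant R t. step n a s = a c"
      using c(2) eventually_quadrant by eventually_elim (simp add: step_def)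
    then have "(step n a \<longlongrightarrow> a c) (at t within quadrant R t)" by (rule tendsto_eventually)
    then show ?thesis using c(1) t by (intro exI[of _ "a c"]) (simp add: step_def)
  qed
  show "\<exists>l. (step n a \<longlongrightarrow> l) (at t within quadrant R t)" for R using *[of R] by blast
  show "(step n a \<longlongrightarrow> step n a t) (at t within quadrant UNIV t)" using *[of UNIV] by blast
qed

lemma continuous_in_skorohod_space:
  assumes "continuous_on unit_cube x"
  shows "restrict x unit_cube \<in> skorohod_space"
proof -
  have "(restrict x unit_cube \<longlongrightarrow> x t) (at t within quadrant R t)" if t: "t \<in> unit_cube" for t R
  proof -
    have "(x \<longlongrightarrow> x t) (at t within unit_cube)" using assms t by (simp add: continuous_on_def)
    then have "(x \<longlongrightarrow> x t) (at t within quadrant R t)"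
      by (rule tendsto_within_subset) (auto simp: quadrant_def)
    moreover have "\<forall>\<^sub>F s in at t within quadrant R t. x s = restrict x unit_cube s"
      using eventually_quadrant by eventually_elim simp
    ultimately show ?thesis by (rule Lim_transform_eventually)
  qed
  then show ?thesis unfolding skorohod_space_def by (auto simp: restrict_def extensional_def)
qed

text \<open>Bounding the supremum by a sum turns \<open>H\<close> of a step function into a
  Lipschitz function of finitely many coordinates.\<close>

lemma step_lipschitz:
  assumes H: "\<And>x y. \<bar>H x - H y\<bar> \<le> L * udist x y" and L: "0 \<le> L"
  shows "\<bar>H (step n a) - H (step n b)\<bar> \<le> L * (\<Sum>k\<in>{0..\<chi> q. int (n $ q)}. \<bar>a k - b k\<bar>)"
proof -
  have "udist (step n a) (step n b) \<le> (\<Sum>k\<in>{0..\<chi> q. int (n $ q)}. \<bar>a k - b k\<bar>)"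
  proof (rule udist_le)
    fix t :: "real ^ 'a" assume t: "t \<in> unit_cube"
    have "\<bar>a (scaled_floor n t) - b (scaled_floor n t)\<bar> \<le> (\<Sum>k\<in>{0..\<chi> q. int (n $ q)}. \<bar>a k - b k\<bar>)"
      by (rule member_le_sum[OF scaled_floor_mem[OF t]]) auto
    then show "\<bar>step n a t - step n b t\<bar> \<le> (\<Sum>k\<in>{0..\<chi> q. int (n $ q)}. \<bar>a k - b k\<bar>)"
      using t by (simp add: step_def)
  qed
  with H[of "step n a" "step n b"] mult_left_mono[OF this L] show ?thesis by linarith
qed

section \<open>Discretization on a grid\<close>

definition grid_point :: "nat \<Rightarrow> int ^ 'd::finite \<Rightarrow> real ^ 'd" where
  "grid_point m k = (\<chi> q. of_int (k $ q) / real m)"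

lemma grid_point_mem:
  assumes "0 < m" "k \<in> {0..\<chi> q. int m}"
  shows "grid_point m k \<in> unit_cube"
proof -
  have "0 \<le> k $ q \<and> k $ q \<le> int m" for q using assms(2) by (auto simp: less_eq_vec_def)
  then have "0 \<le> real_of_int (k $ q) \<and> real_of_int (k $ q) \<le> real m" for q
    by (metis of_int_0_le_iff of_int_le_iff of_int_of_nat_eq)
  then show ?thesis using assms(1) by (simp add: grid_point_def mem_unit_cube)
qed

lemma inj_on_grid_point: "0 < m \<Longrightarrow> inj_on (grid_point m) A"
  by (rule inj_onI) (auto simp: grid_point_def vec_eq_iff)

text \<open>\<open>scaled_floor\<close> with all sides equal to \<open>m\<close>, followed by
  \<open>grid_point\<close>, rounds \<open>t\<close> down to the grid of mesh
  \<open>1 / m\<close>.\<close>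

lemma grid_point_scaled_floor:
  fixes t :: "real ^ 'd::finite"
  assumes m: "0 < m"
  shows "grid_point m (scaled_floor (\<chi> q. m) t) $ q \<le> t $ q"
    "t $ q < grid_point m (scaled_floor (\<chi> q. m) t) $ q + 1 / real m"
proof -
  have "of_int \<lfloor>real m * t $ q\<rfloor> \<le> real m * t $ q" "real m * t $ q < of_int \<lfloor>real m * t $ q\<rfloor> + 1" by linarith+
  then show "grid_point m (scaled_floor (\<chi> q. m) t) $ q \<le> t $ q"
    "t $ q < grid_point m (scaled_floor (\<chi> q. m) t) $ q + 1 / real m"
    using m by (simp_all add: grid_point_def scaled_floor_def field_simps)
qed

text \<open>The grid point below \<open>t\<close> is close to \<open>t\<close> in every coordinate,
  so uniform continuity on the compact cube applies; \<open>Suc m\<close> keeps the mesh well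
  defined.\<close>

lemma udist_grid_tendsto:
  fixes x :: "real ^ 'd::finite \<Rightarrow> real"
  assumes x: "continuous_on unit_cube x"
  shows "(\<lambda>m. udist (restrict x unit_cube) (step (\<chi> q. Suc m) (\<lambda>k. x (grid_point (Suc m) k)))) \<longlonglongrightarrow> 0"
proof (rule LIMSEQ_I)
  fix \<epsilon> :: real assume \<epsilon>: "0 < \<epsilon>"
  have "compact (unit_cube :: (real ^ 'd) set)"
    unfolding unit_cube_def by (simp add: interval_cbox)
  from compact_uniformly_continuous[OF x this]
  obtain \<delta> where \<delta>: "0 < \<delta>" "\<And>s t. s \<in> unit_cube \<Longrightarrow> t \<in> unit_cube \<Longrightarrow> dist t s < \<delta> \<Longrightarrow> dist (x t) (x s) < \<epsilon> / 2"
    unfolding uniformly_continuous_on_def using \<epsilon> by (meson half_gt_zero)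
  obtain m0 where m0: "real CARD('d) / \<delta> < real m0" using reals_Archimedean2 by blast
  show "\<exists>no. \<forall>m\<ge>no. norm (udist (restrict x unit_cube) (step (\<chi> q. Suc m) (\<lambda>k. x (grid_point (Suc m) k))) - 0) < \<epsilon>"
  proof (intro exI[of _ m0] allI impI)
    fix m assume m: "m0 \<le> m"
    have "udist (restrict x unit_cube) (step (\<chi> q. Suc m) (\<lambda>k. x (grid_point (Suc m) k))) \<le> \<epsilon> / 2"
    proof (rule udist_le)
      fix t :: "real ^ 'd" assume t: "t \<in> unit_cube"
      let ?p = "grid_point (Suc m) (scaled_floor (\<chi> q. Suc m) t)"
      have p: "?p \<in> unit_cube" using scaled_floor_mem[OF t, of "\<chi> q. Suc m"]
        by (intro grid_point_mem) (simp_all del: of_nat_Suc atLeastAtMost_iff)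
      have "norm (t - ?p) \<le> (\<Sum>q\<in>UNIV. \<bar>(t - ?p) $ q\<bar>)" by (rule norm_le_l1_cart)
      also have "\<dots> \<le> (\<Sum>q\<in>(UNIV :: 'd set). 1 / real (Suc m))"
      proof (rule sum_mono)
        fix q show "\<bar>(t - ?p) $ q\<bar> \<le> 1 / real (Suc m)"
          using grid_point_scaled_floor[of "Suc m" t q] by (simp del: of_nat_Suc)
      qed
      also have "\<dots> = real CARD('d) / real (Suc m)" by simp
      also have "\<dots> < \<delta>"
      proof -
        have "real CARD('d) / \<delta> < real (Suc m)" using m0 m by linarith
        then show ?thesis using \<delta>(1) by (simp add: field_simps del: of_nat_Suc)
      qed
      finally have "dist t ?p < \<delta>" by (simp add: dist_norm)
      from \<delta>(2)[OF p t this] show "\<bar>restrict x unit_cube t - step (\<chi> q. Suc m) (\<lambda>k. x (grid_point (Suc m) k)) t\<bar> \<le> \<epsilon> / 2"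
        using t by (simp add: step_def dist_real_def del: of_nat_Suc)
    qed
    then show "norm (udist (restrict x unit_cube) (step (\<chi> q. Suc m) (\<lambda>k. x (grid_point (Suc m) k))) - 0) < \<epsilon>"
      using \<epsilon> udist_nonneg[of "restrict x unit_cube"] by simp
  qed
qed

section \<open>Gaussian variables and the Brownian sheet\<close>

text \<open>Real and imaginary part of the characteristic function, combined by the addition formula
  for the cosine.\<close>

lemma integral_cos_std_normal: "(\<integral>z. cos (c * z + s) \<partial>std_normal_distribution) = cos s * exp (- (c\<^sup>2) / 2)"
proof -
  interpret real_distribution std_normal_distribution by (rule real_dist_normal_dist)
  have i: "integrable std_normal_distribution (\<lambda>z. iexp (c * z))"
    by (rule integrable_iexp) auto
  have eq: "complex_of_real (exp (- (c\<^sup>2) / 2)) = (\<integral>z. iexp (c * z) \<partial>std_normal_distribution)"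
    using fun_cong[OF char_std_normal_distribution, of c] by (simp add: char_def)
  have Re: "(\<integral>z. cos (c * z) \<partial>std_normal_distribution) = exp (- (c\<^sup>2) / 2)"
    using integral_Re[OF i] unfolding eq[symmetric] by (simp add: Re_exp)
  have Im: "(\<integral>z. sin (c * z) \<partial>std_normal_distribution) = 0"
    using integral_Im[OF i] unfolding eq[symmetric] by (simp add: Im_exp)
  have "integrable std_normal_distribution (\<lambda>z. cos (c * z))" "integrable std_normal_distribution (\<lambda>z. sin (c * z))"
    by (rule integrable_const_bound[where B = 1]; simp)+
  then show ?thesis by (simp add: cos_add Re Im)
qed

lemma gaussian_rv_cos:
  assumes N: "prob_space N" and g: "gaussian_rv N Y" and mean: "(\<integral>\<omega>. Y \<omega> \<partial>N) = 0"
  shows "square_integrable N Y" "(\<integral>\<omega>. cos (Y \<omega> + s) \<partial>N) = cos s * exp (- (\<integral>\<omega>. (Y \<omega>)\<^sup>2 \<partial>N) / 2)"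
proof -
  interpret prob_space N by (rule N)
  have Ym[measurable]: "Y \<in> borel_measurable N" using g by (simp add: gaussian_rv_def)
  have "square_integrable N Y \<and> (\<integral>\<omega>. cos (Y \<omega> + s) \<partial>N) = cos s * exp (- (\<integral>\<omega>. (Y \<omega>)\<^sup>2 \<partial>N) / 2)"
  proof (cases "\<exists>m. AE \<omega> in N. Y \<omega> = m")
    case True
    then obtain m where m: "AE \<omega> in N. Y \<omega> = m" by blast
    have "(\<integral>\<omega>. Y \<omega> \<partial>N) = (\<integral>\<omega>. m \<partial>N)" by (rule integral_cong_AE) (use m in auto)
    with mean have m0: "m = 0" by (simp add: prob_space)
    have "(\<integral>\<omega>. cos (Y \<omega> + s) \<partial>N) = (\<integral>\<omega>. cos s \<partial>N)" by (rule integral_cong_AE) (use m m0 in auto)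
    moreover have "(\<integral>\<omega>. (Y \<omega>)\<^sup>2 \<partial>N) = (\<integral>\<omega>. 0 \<partial>N)" by (rule integral_cong_AE) (use m m0 in auto)
    moreover have "integrable N (\<lambda>\<omega>. (Y \<omega>)\<^sup>2) = integrable N (\<lambda>\<omega>. 0 :: real)"
      by (rule integrable_cong_AE) (use m m0 in auto)
    ultimately show ?thesis by (simp add: prob_space square_integrable_def)
  next
    case False
    then obtain m \<sigma> where \<sigma>: "0 < \<sigma>" and D: "distributed N lborel Y (normal_density m \<sigma>)"
      using g unfolding gaussian_rv_def by blast
    have m0: "m = 0" using normal_distributed_expectation[OF \<sigma> D] mean by simp
    have v: "(\<integral>\<omega>. (Y \<omega>)\<^sup>2 \<partial>N) = \<sigma>\<^sup>2" using normal_distributed_variance[OF \<sigma> D] mean by simp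
    \<comment> \<open>A square that is not integrable would have integral 0, but the variance is
      positive.\<close>
    then have int2: "integrable N (\<lambda>\<omega>. (Y \<omega>)\<^sup>2)" using \<sigma> not_integrable_integral_eq[of N "\<lambda>\<omega>. (Y \<omega>)\<^sup>2"] by fastforce
    have "distributed N lborel (\<lambda>\<omega>. (Y \<omega> - m) / \<sigma>) std_normal_density"
      using normal_standard_normal_convert[OF \<sigma>] D by blast
    then have Z: "distributed N lborel (\<lambda>\<omega>. Y \<omega> / \<sigma>) std_normal_density" by (simp add: m0)
    have "(\<integral>\<omega>. cos (Y \<omega> + s) \<partial>N) = (\<integral>\<omega>. cos (\<sigma> * (Y \<omega> / \<sigma>) + s) \<partial>N)" using \<sigma> by simp
    also have "\<dots> = (\<integral>z. cos (\<sigma> * z + s) \<partial>distr N lborel (\<lambda>\<omega>. Y \<omega> / \<sigma>))"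
      by (rule integral_distr[symmetric]) auto
    also have "distr N lborel (\<lambda>\<omega>. Y \<omega> / \<sigma>) = std_normal_distribution"
      using distributed_distr_eq_density[OF Z] .
    also have "(\<integral>z. cos (\<sigma> * z + s) \<partial>std_normal_distribution) = cos s * exp (- (\<sigma>\<^sup>2) / 2)"
      by (rule integral_cos_std_normal)
    finally have "(\<integral>\<omega>. cos (Y \<omega> + s) \<partial>N) = cos s * exp (- (\<integral>\<omega>. (Y \<omega>)\<^sup>2 \<partial>N) / 2)" by (simp add: v)
    then show ?thesis using int2 by (simp add: square_integrable_def)
  qed
  then show "square_integrable N Y" "(\<integral>\<omega>. cos (Y \<omega> + s) \<partial>N) = cos s * exp (- (\<integral>\<omega>. (Y \<omega>)\<^sup>2 \<partial>N) / 2)" by auto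
qed

lemma brownian_sheet_gaussian:
  assumes "standard_brownian_sheet N B" "finite I" "I \<subseteq> unit_cube"
  shows "gaussian_rv N (\<lambda>\<omega>. \<Sum>t\<in>I. c t * B t \<omega>)"
proof -
  have "gaussian_process N unit_cube B" using assms(1) by (simp add: standard_brownian_sheet_def)
  then have "\<forall>I c. finite I \<and> I \<subseteq> unit_cube \<longrightarrow> gaussian_rv N (\<lambda>\<omega>. \<Sum>t\<in>I. c t * B t \<omega>)"
    unfolding gaussian_process_def by (rule conjunct2)
  from this[THEN spec, of I, THEN spec, of c] assms(2,3) show ?thesis by simp
qed

lemma brownian_sheet_square_integrable:
  assumes B: "standard_brownian_sheet N B" and t: "t \<in> unit_cube"
  shows "square_integrable N (B t)"
proof (rule gaussian_rv_cos(1))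
  show "prob_space N" "(\<integral>\<omega>. B t \<omega> \<partial>N) = 0" using B t by (auto simp: standard_brownian_sheet_def)
  have "gaussian_rv N (\<lambda>\<omega>. \<Sum>s\<in>{t}. 1 * B s \<omega>)"
    by (rule brownian_sheet_gaussian[OF B, where I = "{t}"]) (use t in auto)
  then show "gaussian_rv N (B t)" by simp
qed

lemma brownian_sheet_cos:
  fixes B :: "real ^ 'd::finite \<Rightarrow> 'b \<Rightarrow> real"
  assumes B: "standard_brownian_sheet N B" and I: "finite I" "inj_on p I" "\<And>k. k \<in> I \<Longrightarrow> p k \<in> unit_cube"
  shows "(\<integral>\<omega>. cos ((\<Sum>k\<in>I. \<theta> k * B (p k) \<omega>) + s) \<partial>N) =
    cos s * exp (- (\<Sum>k\<in>I. \<Sum>l\<in>I. \<theta> k * \<theta> l * (\<Prod>q\<in>UNIV. min (p k $ q) (p l $ q))) / 2)"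
proof -
  have N: "prob_space N" using B by (simp add: standard_brownian_sheet_def)
  have sq: "square_integrable N (B (p k))" if "k \<in> I" for k
    by (rule brownian_sheet_square_integrable[OF B I(3)[OF that]])
  \<comment> \<open>Gaussianity is stated for sums over sets of points, so the weights are carried
    from indices to points along the injection \<open>p\<close>.\<close>
  define c where "c t = \<theta> (the_inv_into I p t)" for t
  have g: "gaussian_rv N (\<lambda>\<omega>. \<Sum>t\<in>p ` I. c t * B t \<omega>)"
    by (rule brownian_sheet_gaussian[OF B, where I = "p ` I"]) (use I in auto)
  have eq: "(\<Sum>t\<in>p ` I. c t * B t \<omega>) = (\<Sum>k\<in>I. \<theta> k * B (p k) \<omega>)" for \<omega>
    unfolding sum.reindex[OF I(2)] comp_def by (rule sum.cong) (simp_all add: c_def the_inv_into_f_f[OF I(2)])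
  have int: "integrable N (B (p k))" if "k \<in> I" for k
    by (rule finite_measure.square_integrable_imp_integrable[OF prob_space.axioms(1)[OF N]])
      (use sq[OF that] in \<open>auto simp: square_integrable_def\<close>)
  have "(\<integral>\<omega>. (\<Sum>k\<in>I. \<theta> k * B (p k) \<omega>) \<partial>N) = (\<Sum>k\<in>I. \<theta> k * (\<integral>\<omega>. B (p k) \<omega> \<partial>N))"
    using int by (subst Bochner_Integration.integral_sum) auto
  also have "\<dots> = 0" using B I(3) by (intro sum.neutral) (auto simp: standard_brownian_sheet_def)
  finally have mean: "(\<integral>\<omega>. (\<Sum>k\<in>I. \<theta> k * B (p k) \<omega>) \<partial>N) = 0" .
  have sqm: "integrable N (\<lambda>\<omega>. B (p k) \<omega> * B (p l) \<omega>)" if "k \<in> I" "l \<in> I" for k l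
    by (rule square_integrable_mult[OF sq[OF that(1)] sq[OF that(2)]])
  have "(\<integral>\<omega>. (\<Sum>k\<in>I. \<theta> k * B (p k) \<omega>)\<^sup>2 \<partial>N)
      = (\<integral>\<omega>. (\<Sum>k\<in>I. \<Sum>l\<in>I. \<theta> k * \<theta> l * (B (p k) \<omega> * B (p l) \<omega>)) \<partial>N)"
    by (simp add: power2_eq_square sum_product mult_ac)
  also have "\<dots> = (\<Sum>k\<in>I. \<Sum>l\<in>I. \<integral>\<omega>. \<theta> k * \<theta> l * (B (p k) \<omega> * B (p l) \<omega>) \<partial>N)"
    using sqm by (subst Bochner_Integration.integral_sum, intro Bochner_Integration.integrable_sum integrable_mult_right)
      (auto intro!: sum.cong Bochner_Integration.integral_sum integrable_mult_right)
  also have "\<dots> = (\<Sum>k\<in>I. \<Sum>l\<in>I. \<theta> k * \<theta> l * (\<Prod>q\<in>UNIV. min (p k $ q) (p l $ q)))"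
    using B I(3) by (intro sum.cong) (auto simp: standard_brownian_sheet_def)
  finally have var: "(\<integral>\<omega>. (\<Sum>k\<in>I. \<theta> k * B (p k) \<omega>)\<^sup>2 \<partial>N) = (\<Sum>k\<in>I. \<Sum>l\<in>I. \<theta> k * \<theta> l * (\<Prod>q\<in>UNIV. min (p k $ q) (p l $ q)))" .
  show ?thesis using gaussian_rv_cos(2)[OF N g, unfolded eq, OF mean, of s] unfolding var .
qed

section \<open>A convergence criterion\<close>

text \<open>The process is compared with its discretization on a grid, this with the discretized
  limit, and the latter with the limit; the mesh is fixed before \<open>n\<close>. The supremum over
  \<open>t\<close> enters through an integrable majorant \<open>W\<close>.\<close>

lemma skorohod_convergence_criterion:
  fixes a :: "nat ^ 'd::finite \<Rightarrow> int ^ 'd \<Rightarrow> 'a \<Rightarrow> real" and y :: "real ^ 'd \<Rightarrow> 'b \<Rightarrow> real"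
  assumes M: "prob_space M" and N: "prob_space N"
    and a: "\<And>n k. square_integrable M (a n k)"
    and aC: "\<And>n k. k \<in> {0..\<chi> q. int (n $ q)} \<Longrightarrow> (\<integral>\<omega>. (a n k \<omega>)\<^sup>2 \<partial>M) \<le> C"
    and y: "\<And>t. t \<in> unit_cube \<Longrightarrow> square_integrable N (y t)"
    and yC: "\<And>t. t \<in> unit_cube \<Longrightarrow> (\<integral>\<omega>. (y t \<omega>)\<^sup>2 \<partial>N) \<le> C"
    and cont: "\<And>\<omega>. \<omega> \<in> space N \<Longrightarrow> continuous_on unit_cube (\<lambda>t. y t \<omega>)"
    and fdd: "\<And>m \<theta> s. 0 < m \<Longrightarrow>
      ((\<lambda>n. \<integral>\<omega>. cos ((\<Sum>k\<in>{0..\<chi> q. int m}. \<theta> k * a n (scaled_floor n (grid_point m k)) \<omega>) + s) \<partial>M)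
        \<longlongrightarrow> (\<integral>\<omega>. cos ((\<Sum>k\<in>{0..\<chi> q. int m}. \<theta> k * y (grid_point m k) \<omega>) + s) \<partial>N)) \<F>"
    and tight: "\<And>\<epsilon>. 0 < \<epsilon> \<Longrightarrow> \<forall>\<^sub>F m in sequentially. \<forall>\<^sub>F n in \<F>. \<exists>W. integrable M W \<and> (\<integral>\<omega>. W \<omega> \<partial>M) \<le> \<epsilon> \<and>
      (\<forall>\<omega>\<in>space M. \<forall>t\<in>unit_cube.
        \<bar>a n (scaled_floor n t) \<omega> - a n (scaled_floor n (grid_point (Suc m) (scaled_floor (\<chi> q. Suc m) t))) \<omega>\<bar> \<le> W \<omega>)"
  shows "converges_in_distribution skorohod_topology M (\<lambda>n \<omega>. step n (\<lambda>k. a n k \<omega>))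
    N (\<lambda>\<omega>. restrict (\<lambda>t. y t \<omega>) unit_cube) \<F>"
proof (rule converges_in_distribution_skorohodI[OF M N])
  show "step n (\<lambda>k. a n k \<omega>) \<in> skorohod_space" for n \<omega> by (rule step_in_skorohod_space)
  show "restrict (\<lambda>t. y t \<omega>) unit_cube \<in> skorohod_space" if "\<omega> \<in> space N" for \<omega>
    by (rule continuous_in_skorohod_space[OF cont[OF that]])
  let ?X = "\<lambda>n \<omega>. step n (\<lambda>k. a n k \<omega>)"
  let ?Y = "\<lambda>\<omega>. restrict (\<lambda>t. y t \<omega>) unit_cube"
  let ?Xm = "\<lambda>m n \<omega>. step (\<chi> q. Suc m) (\<lambda>k. a n (scaled_floor n (grid_point (Suc m) k)) \<omega>)"
  let ?Ym = "\<lambda>m \<omega>. step (\<chi> q. Suc m) (\<lambda>k. y (grid_point (Suc m) k) \<omega>)"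
  have am: "a n k \<in> borel_measurable M" for n k using a by (simp add: square_integrable_def)
  have ym: "y t \<in> borel_measurable N" if "t \<in> unit_cube" for t using y[OF that] by (simp add: square_integrable_def)
  have gm: "grid_point (Suc m) k \<in> unit_cube" if "k \<in> {0..\<chi> q. int (Suc m)}" for m and k :: "int ^ 'd"
    by (rule grid_point_mem[OF zero_less_Suc that])
  fix H :: "(real ^ 'd \<Rightarrow> real) \<Rightarrow> real" assume H: "uniformly_lipschitz H"
  then obtain L where L: "0 \<le> L" "\<And>x y. \<bar>H x - H y\<bar> \<le> L * udist x y"
    unfolding uniformly_lipschitz_def by blast
  obtain B where B: "\<And>x. \<bar>H x\<bar> \<le> B" using uniformly_lipschitz_bounded[OF H] by blast
  have lip: "\<bar>H (step n b) - H (step n c)\<bar> \<le> L * (\<Sum>k\<in>{0..\<chi> q. int (n $ q)}. \<bar>b k - c k\<bar>)" for n and b c :: "int ^ 'd \<Rightarrow> real"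
    by (rule step_lipschitz[OF L(2,1)])
  have lipm: "\<bar>H (step (\<chi> q. Suc m) b) - H (step (\<chi> q. Suc m) c)\<bar> \<le> L * (\<Sum>k\<in>{0..\<chi> q. int (Suc m)}. \<bar>b k - c k\<bar>)" for m and b c :: "int ^ 'd \<Rightarrow> real"
    using lip[of "\<chi> q. Suc m" b c] by (simp del: of_nat_Suc)
  show mX: "(\<lambda>\<omega>. H (?X n \<omega>)) \<in> borel_measurable M" for n
    using borel_measurable_lipschitz_coordinates[of "\<lambda>b. H (step n b)" L "{0..\<chi> q. int (n $ q)}" "a n" M, OF lip am] .
  have mXm: "(\<lambda>\<omega>. H (?Xm m n \<omega>)) \<in> borel_measurable M" for m n
    using borel_measurable_lipschitz_coordinates[of "\<lambda>b. H (step (\<chi> q. Suc m) b)" L "{0..\<chi> q. int (Suc m)}" "\<lambda>k. a n (scaled_floor n (grid_point (Suc m) k))" M, OF lipm am] .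
  have mYm: "(\<lambda>\<omega>. H (?Ym m \<omega>)) \<in> borel_measurable N" for m
    using borel_measurable_lipschitz_coordinates[of "\<lambda>b. H (step (\<chi> q. Suc m) b)" L "{0..\<chi> q. int (Suc m)}" "\<lambda>k. y (grid_point (Suc m) k)" N, OF lipm ym[OF gm]] .
  have limY: "(\<lambda>m. H (?Ym m \<omega>)) \<longlonglongrightarrow> H (?Y \<omega>)" if \<omega>: "\<omega> \<in> space N" for \<omega>
  proof (rule LIM_zero_cancel, rule Lim_null_comparison)
    show "\<forall>\<^sub>F m in sequentially. norm (H (?Ym m \<omega>) - H (?Y \<omega>)) \<le> L * udist (?Y \<omega>) (?Ym m \<omega>)"
      by (rule always_eventually, rule allI, subst udist_commute) (simp only: real_norm_def L(2))
    show "(\<lambda>m. L * udist (?Y \<omega>) (?Ym m \<omega>)) \<longlonglongrightarrow> 0"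
      using tendsto_mult_left[OF udist_grid_tendsto[OF cont[OF \<omega>]], of L] by simp
  qed
  \<comment> \<open>By continuity of the paths, \<open>H\<close> is a pointwise limit of its values
    on grid discretizations, which are functions of finitely many values of the process.\<close>
  show mY: "(\<lambda>\<omega>. H (?Y \<omega>)) \<in> borel_measurable N"
    by (rule borel_measurable_LIMSEQ_real[OF limY mYm])
  have "(\<lambda>m. \<integral>\<omega>. H (?Ym m \<omega>) \<partial>N) \<longlonglongrightarrow> (\<integral>\<omega>. H (?Y \<omega>) \<partial>N)"
    by (rule integral_dominated_convergence[where w = "\<lambda>_. B"])
      (auto intro!: AE_I2 limY mY mYm B finite_measure.integrable_const[OF prob_space.axioms(1)[OF N]])
  note YmY = this
  show "((\<lambda>n. \<integral>\<omega>. H (?X n \<omega>) \<partial>M) \<longlongrightarrow> (\<integral>\<omega>. H (?Y \<omega>) \<partial>N)) \<F>"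
  proof (rule tendstoI)
    fix e :: real assume e: "0 < e"
    \<comment> \<open>The denominator \<open>L + 1\<close> covers \<open>L = 0\<close> too.\<close>
    define \<epsilon> where "\<epsilon> = e / 3 / (L + 1)"
    have \<epsilon>: "0 < \<epsilon>" using e L(1) by (simp add: \<epsilon>_def)
    have L\<epsilon>: "L * \<epsilon> < e / 3"
    proof -
      have "L * \<epsilon> < (L + 1) * \<epsilon>" using \<epsilon> by simp
      also have "\<dots> = e / 3" using \<epsilon>_def L(1) nonzero_divide_eq_eq[of "L + 1" "e / 3" \<epsilon>]
        by (simp add: mult.commute)
      finally show ?thesis .
    qed
    have e3: "0 < e / 3" using e by simp
    have "\<forall>\<^sub>F m in sequentially. dist (\<integral>\<omega>. H (?Ym m \<omega>) \<partial>N) (\<integral>\<omega>. H (?Y \<omega>) \<partial>N) < e / 3"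
      by (rule tendstoD[OF YmY e3])
    from eventually_happens[OF eventually_conj[OF this tight[OF \<epsilon>]]] obtain m where
      m1: "dist (\<integral>\<omega>. H (?Ym m \<omega>) \<partial>N) (\<integral>\<omega>. H (?Y \<omega>) \<partial>N) < e / 3" and
      m2: "\<forall>\<^sub>F n in \<F>. \<exists>W. integrable M W \<and> (\<integral>\<omega>. W \<omega> \<partial>M) \<le> \<epsilon> \<and> (\<forall>\<omega>\<in>space M. \<forall>t\<in>unit_cube.
        \<bar>a n (scaled_floor n t) \<omega> - a n (scaled_floor n (grid_point (Suc m) (scaled_floor (\<chi> q. Suc m) t))) \<omega>\<bar> \<le> W \<omega>)"
      by auto
    have "((\<lambda>n. \<integral>\<omega>. H (?Xm m n \<omega>) \<partial>M) \<longlongrightarrow> (\<integral>\<omega>. H (?Ym m \<omega>) \<partial>N)) \<F>"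
    proof (rule cramer_wold[where I = "{0..\<chi> q. int (Suc m)}" and H = "\<lambda>b. H (step (\<chi> q. Suc m) b)"
          and Z = "\<lambda>n k. a n (scaled_floor n (grid_point (Suc m) k))" and Y = "\<lambda>k. y (grid_point (Suc m) k)" and C = C and L = L and B = B, OF _ M N])
      show "finite {0..\<chi> q. int (Suc m) :: int ^ 'd}" by simp
      show "square_integrable M (a n (scaled_floor n (grid_point (Suc m) k)))" for n k by (rule a)
      show "square_integrable N (y (grid_point (Suc m) k))" if "k \<in> {0..\<chi> q. int (Suc m)}" for k by (rule y[OF gm[OF that]])
      show "(\<integral>\<omega>. (y (grid_point (Suc m) k) \<omega>)\<^sup>2 \<partial>N) \<le> C" if "k \<in> {0..\<chi> q. int (Suc m)}" for k by (rule yC[OF gm[OF that]])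
      show "(\<integral>\<omega>. (a n (scaled_floor n (grid_point (Suc m) k)) \<omega>)\<^sup>2 \<partial>M) \<le> C" if "k \<in> {0..\<chi> q. int (Suc m)}" for n k
        by (rule aC[OF scaled_floor_mem[OF gm[OF that]]])
    qed (fact fdd[OF zero_less_Suc] lipm B)+
    from tendstoD[OF this e3] m2 show "\<forall>\<^sub>F n in \<F>. dist (\<integral>\<omega>. H (?X n \<omega>) \<partial>M) (\<integral>\<omega>. H (?Y \<omega>) \<partial>N) < e"
    proof eventually_elim
      case (elim n)
      then obtain W where W: "integrable M W" "(\<integral>\<omega>. W \<omega> \<partial>M) \<le> \<epsilon>"
        "\<And>\<omega> t. \<omega> \<in> space M \<Longrightarrow> t \<in> unit_cube \<Longrightarrow>
          \<bar>a n (scaled_floor n t) \<omega> - a n (scaled_floor n (grid_point (Suc m) (scaled_floor (\<chi> q. Suc m) t))) \<omega>\<bar> \<le> W \<omega>"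
        by blast
      have d: "udist (?X n \<omega>) (?Xm m n \<omega>) \<le> W \<omega>" if "\<omega> \<in> space M" for \<omega>
        by (rule udist_le) (use W(3)[OF that] in \<open>simp add: step_def\<close>)
      have iX: "integrable M (\<lambda>\<omega>. H (?X n \<omega>))" by (rule integrable_lipschitz[OF M H mX])
      have iXm: "integrable M (\<lambda>\<omega>. H (?Xm m n \<omega>))" by (rule integrable_lipschitz[OF M H mXm])
      have "\<bar>(\<integral>\<omega>. H (?X n \<omega>) \<partial>M) - (\<integral>\<omega>. H (?Xm m n \<omega>) \<partial>M)\<bar> = \<bar>\<integral>\<omega>. H (?X n \<omega>) - H (?Xm m n \<omega>) \<partial>M\<bar>"
        using iX iXm by simp
      also have "\<dots> \<le> (\<integral>\<omega>. \<bar>H (?X n \<omega>) - H (?Xm m n \<omega>)\<bar> \<partial>M)" by (rule integral_abs_bound)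
      also have "\<dots> \<le> (\<integral>\<omega>. L * W \<omega> \<partial>M)"
      proof (rule integral_mono)
        fix \<omega> assume "\<omega> \<in> space M"
        from mult_left_mono[OF d[OF this] L(1)] L(2)[of "?X n \<omega>" "?Xm m n \<omega>"]
        show "\<bar>H (?X n \<omega>) - H (?Xm m n \<omega>)\<bar> \<le> L * W \<omega>" by linarith
      qed (use iX iXm W(1) in auto)
      also have "\<dots> \<le> L * \<epsilon>" using mult_left_mono[OF W(2) L(1)] by simp
      finally show ?case using m1 elim(1) L\<epsilon> unfolding dist_real_def by linarith
    qed
  qed
qed

section \<open>Limits along increasing boxes\<close>

abbreviation corner :: "nat ^ 'd::finite \<Rightarrow> int ^ 'd" where
  "corner n \<equiv> \<chi> q. int (n $ q)"

lemma filterlim_coordinate: "filterlim (\<lambda>n. n $ q) at_top all_coords_at_top"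
  unfolding filterlim_def all_coords_at_top_def
  by (rule order_trans[OF filtermap_mono[OF INF_lower[of q]] filtermap_filtercomap]) simp

lemma eventually_coordinates_ge: "\<forall>\<^sub>F n in all_coords_at_top. \<forall>q. m \<le> n $ q"
  by (rule eventually_all_finite) (rule filterlim_coordinate[unfolded filterlim_at_top, rule_format])

lemma corner_nonneg: "0 \<le> corner n"
  by (simp add: less_eq_vec_def)

lemma box_volume_corner: "box_volume (corner n) = (\<Prod>q\<in>UNIV. real (n $ q))"
  by (simp add: box_volume_def)

lemma eventually_box_volume_pos: "\<forall>\<^sub>F n in all_coords_at_top. 0 < box_volume (corner n)"
  using eventually_coordinates_ge[of 1] by eventually_elim (auto simp: box_volume_corner intro!: prod_pos simp: Suc_le_eq)

lemma box_volume_tendsto: "filterlim (\<lambda>n :: nat ^ 'd::finite. box_volume (corner n)) at_top all_coords_at_top"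
  unfolding filterlim_at_top
proof
  fix Z :: real
  obtain m where m: "Z < real m" using reals_Archimedean2 by blast
  show "\<forall>\<^sub>F n :: nat ^ 'd in all_coords_at_top. Z \<le> box_volume (corner n)"
    using eventually_coordinates_ge[of "Suc m"]
  proof eventually_elim
    case (elim n)
    obtain q :: 'd where "q \<in> UNIV" by blast
    have "real m * 1 \<le> real (n $ q) * (\<Prod>r\<in>UNIV - {q}. real (n $ r))"
    proof (rule mult_mono)
      show "real m \<le> real (n $ q)" using elim[rule_format, of q] by simp
      show "1 \<le> (\<Prod>r\<in>UNIV - {q}. real (n $ r))"
      proof (rule prod_ge_1)
        fix r show "1 \<le> real (n $ r)" using elim[rule_format, of r] by simp
      qed
    qed auto
    also have "\<dots> = box_volume (corner n)"
      unfolding box_volume_corner by (subst prod.remove[of UNIV q]) auto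
    finally show ?case using m by simp
  qed
qed

text \<open>The fixed lower corner and the bounded rounding error change each side by a bounded
  amount, which is negligible against \<open>n $ q\<close>.\<close>

lemma card_ratio_tendsto:
  fixes \<beta> :: "nat ^ 'd::finite \<Rightarrow> int ^ 'd"
  assumes t: "\<And>q. 0 \<le> t q" and \<beta>: "\<And>n q. \<bar>real_of_int (\<beta> n $ q) - real (n $ q) * t q\<bar> \<le> c q"
  shows "((\<lambda>n. real (card {\<alpha>..\<beta> n}) / box_volume (corner n)) \<longlongrightarrow> (\<Prod>q\<in>UNIV. t q)) all_coords_at_top"
proof -
  have "((\<lambda>n :: nat ^ 'd. \<Prod>q\<in>UNIV. real (nat (\<beta> n $ q - \<alpha> $ q + 1)) / real (n $ q)) \<longlongrightarrow> (\<Prod>q\<in>UNIV. t q)) all_coords_at_top"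
  proof (rule tendsto_prod)
    fix q :: 'd
    define C where "C = c q + \<bar>real_of_int (\<alpha> $ q)\<bar> + 1"
    have "((\<lambda>n. real (nat (\<beta> n $ q - \<alpha> $ q + 1)) / real (n $ q) - t q) \<longlongrightarrow> 0) all_coords_at_top"
    proof (rule Lim_null_comparison)
      show "\<forall>\<^sub>F n in all_coords_at_top. norm (real (nat (\<beta> n $ q - \<alpha> $ q + 1)) / real (n $ q) - t q) \<le> C / real (n $ q)"
        using eventually_coordinates_ge[of 1]
      proof eventually_elim
        case (elim n)
        have n: "0 < real (n $ q)" using elim[rule_format, of q] by simp
        have "\<bar>real (nat (\<beta> n $ q - \<alpha> $ q + 1)) - real (n $ q) * t q\<bar> \<le> C"
          using \<beta>[of n q] mult_nonneg_nonneg[OF of_nat_0_le_iff[of "n $ q"] t[of q]] unfolding C_def by linarith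
        moreover have "real (nat (\<beta> n $ q - \<alpha> $ q + 1)) / real (n $ q) - t q
            = (real (nat (\<beta> n $ q - \<alpha> $ q + 1)) - real (n $ q) * t q) / real (n $ q)"
          using n by (simp add: field_simps)
        ultimately show ?case using n by (simp add: divide_right_mono)
      qed
      show "((\<lambda>n. C / real (n $ q)) \<longlongrightarrow> 0) all_coords_at_top"
        by (rule tendsto_divide_0[OF tendsto_const filterlim_at_top_imp_at_infinity])
          (rule filterlim_compose[OF filterlim_real_sequentially filterlim_coordinate])
    qed
    then show "((\<lambda>n. real (nat (\<beta> n $ q - \<alpha> $ q + 1)) / real (n $ q)) \<longlongrightarrow> t q) all_coords_at_top"
      by (rule LIM_zero_cancel)
  qed
  then show ?thesis
    by (simp add: card_vec_interval box_volume_corner prod_dividef)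
qed

section \<open>Absolutely convergent series in the square mean\<close>

lemma summable_on_tail:
  fixes a :: "'i \<Rightarrow> real"
  assumes nn: "\<And>i. 0 \<le> a i" and s: "a summable_on UNIV" and \<epsilon>: "0 < \<epsilon>"
  obtains J where "finite J" "\<And>K. finite K \<Longrightarrow> K \<inter> J = {} \<Longrightarrow> sum a K \<le> \<epsilon>"
proof -
  have "(sum a \<longlongrightarrow> infsum a UNIV) (finite_subsets_at_top UNIV)"
    using has_sum_infsum[OF s] by (simp add: has_sum_def)
  from tendstoD[OF this \<epsilon>] obtain J where
    J: "finite J" "\<And>Y. finite Y \<Longrightarrow> J \<subseteq> Y \<Longrightarrow> dist (sum a Y) (infsum a UNIV) < \<epsilon>"
    unfolding eventually_finite_subsets_at_top by auto
  show ?thesis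
  proof (rule that[OF J(1)])
    fix K assume K: "finite K" "K \<inter> J = {}"
    have "sum a (J \<union> K) \<le> infsum a UNIV"
      by (rule finite_sum_le_infsum[OF s]) (use J K nn in auto)
    moreover have "sum a (J \<union> K) = sum a J + sum a K"
      using J K by (intro sum.union_disjoint) auto
    ultimately show "sum a K \<le> \<epsilon>" using J(2)[OF J(1) subset_refl] unfolding dist_real_def by linarith
  qed
qed

text \<open>The index set is carried to the natural numbers by \<open>to_nat\<close>, with the zero
  function at numbers that encode no index; finite index sets then correspond to their
  images.\<close>

lemma has_L2_sum_summable:
  fixes u :: "'i::countable \<Rightarrow> 'a \<Rightarrow> real"
  assumes sq: "\<And>i. square_integrable M (u i)" and s: "(\<lambda>i. L2_norm M (u i)) summable_on UNIV"
  shows "\<exists>D. has_L2_sum M u D"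
proof -
  let ?u = "\<lambda>n. if n \<in> range (to_nat :: 'i \<Rightarrow> nat) then u (from_nat n) else (\<lambda>_. 0)"
  have fin: "finite {i :: 'i. to_nat i \<in> K}" if "finite K" for K
    using finite_vimageI[OF that inj_to_nat] by (simp add: vimage_def)
  have sum_eq: "(\<Sum>n\<in>K. L2_norm M (?u n)) = (\<Sum>i\<in>{i. to_nat i \<in> K}. L2_norm M (u i))" if K: "finite K" for K
  proof -
    have "(\<Sum>n\<in>K. L2_norm M (?u n)) = (\<Sum>n\<in>to_nat ` {i :: 'i. to_nat i \<in> K}. L2_norm M (?u n))"
      using K by (intro sum.mono_neutral_right) auto
    also have "\<dots> = (\<Sum>i\<in>{i. to_nat i \<in> K}. L2_norm M (u i))"
      by (subst sum.reindex) (auto simp: inj_on_def)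
    finally show ?thesis .
  qed
  have squ: "square_integrable M (?u n)" for n
    using sq square_integrable_zero[of M] by auto
  have sm: "summable (\<lambda>n. L2_norm M (?u n))"
  proof (rule summableI_nonneg_bounded)
    show "(\<Sum>i<n. L2_norm M (?u i)) \<le> infsum (\<lambda>i. L2_norm M (u i)) UNIV" for n
    proof -
      have "(\<Sum>i<n. L2_norm M (?u i)) = (\<Sum>i\<in>{i. to_nat i \<in> {..<n}}. L2_norm M (u i))" by (rule sum_eq) simp
      also have "\<dots> \<le> infsum (\<lambda>i. L2_norm M (u i)) UNIV"
        by (rule finite_sum_le_infsum[OF s fin[OF finite_lessThan]]) simp_all
      finally show ?thesis .
    qed
  qed simp
  define D where "D = (\<lambda>x. \<Sum>n. ?u n x)"
  have D: "square_integrable M D"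
    unfolding D_def by (rule has_L2_sum_nat(1)[of M ?u, OF squ sm])
  have tail: "L2_norm M (\<lambda>x. (\<Sum>i\<in>I. ?u i x) - D x) \<le> (\<Sum>n. if n \<in> I then 0 else L2_norm M (?u n))" if "finite I" for I
    unfolding D_def by (rule has_L2_sum_nat(2)[of M ?u, OF squ sm that])
  have "((\<lambda>I. L2_norm M (\<lambda>x. (\<Sum>i\<in>I. u i x) - D x)) \<longlongrightarrow> 0) (finite_subsets_at_top UNIV)"
  proof (rule tendstoI)
    fix e :: real assume e: "0 < e"
    obtain J where J: "finite J" "\<And>K. finite K \<Longrightarrow> K \<inter> J = {} \<Longrightarrow> (\<Sum>i\<in>K. L2_norm M (u i)) \<le> e / 2"
      by (rule summable_on_tail[OF _ s, of "e / 2"]) (use e in auto)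
    show "\<forall>\<^sub>F I in finite_subsets_at_top UNIV. dist (L2_norm M (\<lambda>x. (\<Sum>i\<in>I. u i x) - D x)) 0 < e"
      unfolding eventually_finite_subsets_at_top
    proof (intro exI[of _ J] conjI allI impI)
      fix I assume I: "finite I \<and> J \<subseteq> I \<and> I \<subseteq> UNIV"
      have "(\<Sum>n\<in>to_nat ` I. ?u n x) = (\<Sum>i\<in>I. u i x)" for x
        by (subst sum.reindex) (auto simp: inj_on_def)
      moreover have "(\<Sum>n. if n \<in> to_nat ` I then 0 else L2_norm M (?u n)) \<le> e / 2"
      proof (rule suminf_le_const)
        show "summable (\<lambda>n. if n \<in> to_nat ` I then 0 else L2_norm M (?u n))"
          by (rule summable_comparison_test'[OF sm, of 0]) auto
        fix n
        have "(\<Sum>k<n. if k \<in> to_nat ` I then 0 else L2_norm M (?u k)) = (\<Sum>k\<in>{..<n} - to_nat ` I. L2_norm M (?u k))"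
          by (rule sum.mono_neutral_cong_right) auto
        also have "\<dots> = (\<Sum>i\<in>{i. to_nat i \<in> {..<n} - to_nat ` I}. L2_norm M (u i))"
          by (rule sum_eq) simp
        also have "\<dots> \<le> e / 2"
          by (rule J(2)[OF fin]) (use I in auto)
        finally show "(\<Sum>k<n. if k \<in> to_nat ` I then 0 else L2_norm M (?u k)) \<le> e / 2" .
      qed
      ultimately show "dist (L2_norm M (\<lambda>x. (\<Sum>i\<in>I. u i x) - D x)) 0 < e"
        using tail[of "to_nat ` I"] I e by simp
    qed (use J in auto)
  qed
  then show ?thesis using sq D unfolding has_L2_sum_def by blast
qed

lemma (in prob_space) integral_cos_diff_le:
  assumes V: "square_integrable M V" and W: "square_integrable M W"
  shows "\<bar>(\<integral>x. cos (V x + s) \<partial>M) - (\<integral>x. cos (W x + s) \<partial>M)\<bar> \<le> L2_norm M (\<lambda>x. V x - W x)"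
proof -
  have i: "integrable M (\<lambda>x. cos (U x + s))" if "square_integrable M U" for U
  proof (rule integrable_const_bound[where B = 1])
    show "(\<lambda>x. cos (U x + s)) \<in> borel_measurable M"
      using square_integrable_measurable[OF that] by measurable
  qed simp
  have d: "square_integrable M (\<lambda>x. V x - W x)" by (rule square_integrable_diff[OF V W])
  have "\<bar>(\<integral>x. cos (V x + s) \<partial>M) - (\<integral>x. cos (W x + s) \<partial>M)\<bar> = \<bar>\<integral>x. cos (V x + s) - cos (W x + s) \<partial>M\<bar>"
    using i[OF V] i[OF W] by simp
  also have "\<dots> \<le> (\<integral>x. \<bar>cos (V x + s) - cos (W x + s)\<bar> \<partial>M)" by (rule integral_abs_bound)
  also have "\<dots> \<le> (\<integral>x. \<bar>V x - W x\<bar> \<partial>M)"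
  proof (rule integral_mono)
    show "integrable M (\<lambda>x. \<bar>V x - W x\<bar>)"
      using square_integrable_integrable[OF d] by (rule integrable_abs)
    show "\<bar>cos (V x + s) - cos (W x + s)\<bar> \<le> \<bar>V x - W x\<bar>" for x
      using abs_cos_diff_le[of "V x + s" "W x + s"] by simp
  qed (use i[OF V] i[OF W] in auto)
  also have "\<dots> \<le> L2_norm M (\<lambda>x. V x - W x)" by (rule L1_le_L2[OF d])
  finally show ?thesis .
qed

context real_iid
begin

section \<open>Reduction to differences\<close>

lemma proj_shift_AE:
  assumes f: "square_integrable P f"
  shows "AE \<omega> in P. proj \<mu> 0 (f \<circ> shift i) \<omega> = hannan_diff f (- i) \<omega>"
    and "proj \<mu> 0 (f \<circ> shift i) \<in> borel_measurable P"
proof -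
  have g: "square_integrable P (\<lambda>\<omega>. f (shift i \<omega>))" by (rule square_integrable_shift[OF f])
  have "($) (0 :: int ^ 'a) = (\<lambda>_. 0)" by (simp add: fun_eq_iff)
  then show "AE \<omega> in P. proj \<mu> 0 (f \<circ> shift i) \<omega> = hannan_diff f (- i) \<omega>"
    using proj_AE(1)[OF g, of 0] by (simp add: hannan_diff_def comp_def)
  show "proj \<mu> 0 (f \<circ> shift i) \<in> borel_measurable P" using proj_AE(2)[OF g, of 0] by (simp add: comp_def)
qed

lemma square_integrable_hannan_diff: "square_integrable P f \<Longrightarrow> square_integrable P (hannan_diff f j)"
  by (rule orthodiff_square_integrable[OF orthodiff_hannan_diff])

lemma square_integrable_proj_shift:
  assumes f: "square_integrable P f"
  shows "square_integrable P (proj \<mu> 0 (f \<circ> shift i))"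
  by (rule square_integrable_cong_AE[OF square_integrable_hannan_diff[OF f] proj_shift_AE(2)[OF f] proj_shift_AE(1)[OF f]])

lemma L2_norm_proj_shift:
  assumes f: "square_integrable P f"
  shows "L2_norm P (proj \<mu> 0 (f \<circ> shift i)) = L2_norm P (hannan_diff f (- i))"
  by (rule L2_norm_cong_AE[OF proj_shift_AE[OF f] square_integrable_measurable[OF square_integrable_hannan_diff[OF f]]])

text \<open>The change of sign between \<open>P\<^sub>0 X\<close> at \<open>i\<close> and
  \<open>hannan_diff\<close> at \<open>- i\<close> is absorbed by reindexing.\<close>

lemma hannan_summable:
  fixes f :: "(int ^ 'd::finite \<Rightarrow> real) \<Rightarrow> real"
  assumes f: "square_integrable P f"
    and s: "(\<lambda>i. L2_norm P (proj \<mu> 0 (f \<circ> shift i))) summable_on UNIV"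
  shows "(\<lambda>j. L2_norm P (hannan_diff f j)) summable_on UNIV"
proof -
  have "((\<lambda>j. L2_norm P (hannan_diff f j)) \<circ> uminus) summable_on UNIV"
    using s unfolding L2_norm_proj_shift[OF f] by (simp add: comp_def)
  then have "(\<lambda>j. L2_norm P (hannan_diff f j)) summable_on (range (uminus :: int ^ 'd \<Rightarrow> _))"
    by (subst summable_on_reindex) auto
  then show ?thesis by simp
qed

lemma orthodiff_zero: "orthodiff (\<lambda>_. 0)"
  by (simp add: orthodiff_def square_integrable_zero depends_on_const)

lemma orthodiff_add:
  assumes "orthodiff u" "orthodiff v"
  shows "orthodiff (\<lambda>\<omega>. u \<omega> + v \<omega>)"
  using orthodiff_diff[OF assms(1) orthodiff_diff[OF orthodiff_zero assms(2)]] by simp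

lemma orthodiff_sum: "(\<And>j. j \<in> J \<Longrightarrow> orthodiff (v j)) \<Longrightarrow> orthodiff (\<lambda>\<omega>. \<Sum>j\<in>J. v j \<omega>)"
  by (induction J rule: infinite_finite_induct) (auto simp: orthodiff_zero orthodiff_add)

text \<open>One finite set serves two purposes: it leaves a small tail of norms, and the sum over it
  is close to \<open>D\<close>. Both properties persist when a set is enlarged, so a union of two
  sets suffices.\<close>

lemma hannan_truncation:
  fixes f :: "(int ^ 'd::finite \<Rightarrow> real) \<Rightarrow> real"
  assumes f: "square_integrable P f"
    and s: "(\<lambda>i. L2_norm P (proj \<mu> 0 (f \<circ> shift i))) summable_on UNIV"
    and D: "has_L2_sum P (\<lambda>i. proj \<mu> 0 (f \<circ> shift i)) D" and \<epsilon>: "0 < \<epsilon>"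
  obtains J where "finite J" "\<And>K. finite K \<Longrightarrow> K \<inter> J = {} \<Longrightarrow> (\<Sum>j\<in>K. L2_norm P (hannan_diff f j)) \<le> \<epsilon>"
    "L2_norm P (\<lambda>\<omega>. (\<Sum>j\<in>J. hannan_diff f j \<omega>) - D \<omega>) \<le> \<epsilon>"
proof -
  obtain J1 where J1: "finite J1" "\<And>K. finite K \<Longrightarrow> K \<inter> J1 = {} \<Longrightarrow> (\<Sum>j\<in>K. L2_norm P (hannan_diff f j)) \<le> \<epsilon>"
    by (rule summable_on_tail[OF _ hannan_summable[OF f s] \<epsilon>]) auto
  have "((\<lambda>I. L2_norm P (\<lambda>\<omega>. (\<Sum>i\<in>I. proj \<mu> 0 (f \<circ> shift i) \<omega>) - D \<omega>)) \<longlongrightarrow> 0) (finite_subsets_at_top UNIV)"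
    using D by (simp add: has_L2_sum_def)
  from tendstoD[OF this \<epsilon>] obtain J2 where
    J2: "finite J2" "\<And>I. finite I \<Longrightarrow> J2 \<subseteq> I \<Longrightarrow> L2_norm P (\<lambda>\<omega>. (\<Sum>i\<in>I. proj \<mu> 0 (f \<circ> shift i) \<omega>) - D \<omega>) < \<epsilon>"
    unfolding eventually_finite_subsets_at_top by auto
  define I where "I = uminus ` J1 \<union> J2"
  have I: "finite I" "J2 \<subseteq> I" using J1 J2 by (auto simp: I_def)
  have Dm: "D \<in> borel_measurable P" using D by (simp add: has_L2_sum_def square_integrable_def)
  have "L2_norm P (\<lambda>\<omega>. (\<Sum>j\<in>uminus ` I. hannan_diff f j \<omega>) - D \<omega>)
      = L2_norm P (\<lambda>\<omega>. (\<Sum>i\<in>I. proj \<mu> 0 (f \<circ> shift i) \<omega>) - D \<omega>)"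
  proof (rule L2_norm_cong_AE)
    have "AE \<omega> in P. \<forall>i\<in>I. proj \<mu> 0 (f \<circ> shift i) \<omega> = hannan_diff f (- i) \<omega>"
      using I(1) proj_shift_AE(1)[OF f] by (simp add: AE_finite_all)
    then show "AE \<omega> in P. (\<Sum>j\<in>uminus ` I. hannan_diff f j \<omega>) - D \<omega> = (\<Sum>i\<in>I. proj \<mu> 0 (f \<circ> shift i) \<omega>) - D \<omega>"
      by eventually_elim (simp add: sum.reindex)
  qed (use Dm proj_shift_AE(2)[OF f] square_integrable_measurable[OF square_integrable_hannan_diff[OF f]] in
      \<open>auto intro!: borel_measurable_diff borel_measurable_sum\<close>)
  then have "L2_norm P (\<lambda>\<omega>. (\<Sum>j\<in>uminus ` I. hannan_diff f j \<omega>) - D \<omega>) \<le> \<epsilon>"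
    using J2(2)[OF I] by simp
  moreover have "(\<Sum>j\<in>K. L2_norm P (hannan_diff f j)) \<le> \<epsilon>" if "finite K" "K \<inter> uminus ` I = {}" for K
  proof (rule J1(2)[OF that(1)])
    have "J1 \<subseteq> uminus ` I" by (force simp: I_def image_iff)
    then show "K \<inter> J1 = {}" using that(2) by blast
  qed
  ultimately show ?thesis using I(1) by (intro that[of "uminus ` I"]) auto
qed

text \<open>The series inequality with the terms in \<open>J\<close> set to zero; the remaining
  norms add up to at most \<open>\<epsilon>\<close>.\<close>

lemma hannan_remainder:
  fixes f :: "(int ^ 'd::finite \<Rightarrow> real) \<Rightarrow> real"
  assumes f: "square_integrable P f" and mean: "(\<integral>\<omega>. f \<omega> \<partial>P) = 0"
    and J: "finite J" "\<And>K. finite K \<Longrightarrow> K \<inter> J = {} \<Longrightarrow> (\<Sum>j\<in>K. L2_norm P (hannan_diff f j)) \<le> \<epsilon>" and n: "0 \<le> n"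
  shows "L2_norm P (max_field_sum (\<lambda>\<omega>. f \<omega> - (\<Sum>j\<in>J. hannan_diff f j (shift j \<omega>))) {0..n})
    \<le> 2 ^ CARD('d) * sqrt (box_volume n) * \<epsilon>"
proof (rule maximal_inequality_series[where v = "\<lambda>j. if j \<in> J then (\<lambda>_. 0) else hannan_diff f j", OF _ _ _ _ n])
  show "square_integrable P (\<lambda>\<omega>. f \<omega> - (\<Sum>j\<in>J. hannan_diff f j (shift j \<omega>)))"
    by (intro square_integrable_diff f square_integrable_sum square_integrable_shift square_integrable_hannan_diff)
  show "orthodiff (if j \<in> J then (\<lambda>_. 0) else hannan_diff f j)" for j
    by (simp add: orthodiff_zero orthodiff_hannan_diff[OF f])
  show "(\<Sum>j\<in>cube N. L2_norm P (if j \<in> J then (\<lambda>_. 0) else hannan_diff f j)) \<le> \<epsilon>" for N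
  proof -
    have "(\<Sum>j\<in>cube N. L2_norm P (if j \<in> J then (\<lambda>_. 0) else hannan_diff f j)) = (\<Sum>j\<in>cube N - J. L2_norm P (hannan_diff f j))"
      by (rule sum.mono_neutral_cong_right) auto
    also have "\<dots> \<le> \<epsilon>" by (rule J(2)) auto
    finally show ?thesis .
  qed
  \<comment> \<open>Once the cube contains \<open>J\<close>, the sum over it splits into the part
    over \<open>J\<close> and the series with these terms removed.\<close>
  obtain N0 where N0: "J \<subseteq> cube N0" using finite_subset_cube[OF J(1)] by blast
  have "\<forall>\<^sub>F N in sequentially. L2_norm P (\<lambda>\<omega>. f \<omega> - (\<Sum>j\<in>cube N. hannan_diff f j (shift j \<omega>)))
    = L2_norm P (\<lambda>\<omega>. f \<omega> - (\<Sum>j\<in>J. hannan_diff f j (shift j \<omega>)) - (\<Sum>j\<in>cube N. (if j \<in> J then (\<lambda>_. 0) else hannan_diff f j) (shift j \<omega>)))"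
    using eventually_ge_at_top[of N0]
  proof eventually_elim
    case (elim N)
    have JN: "J \<subseteq> cube N" 
    proof
      fix j assume "j \<in> J"
      then have "\<bar>j $ q\<bar> \<le> int N0" for q using N0 by (auto simp: mem_cube)
      from order_trans[OF this] elim show "j \<in> cube N" by (simp add: mem_cube)
    qed
    have "(\<Sum>j\<in>cube N. hannan_diff f j (shift j \<omega>))
        = (\<Sum>j\<in>J. hannan_diff f j (shift j \<omega>)) + (\<Sum>j\<in>cube N. (if j \<in> J then (\<lambda>_. 0) else hannan_diff f j) (shift j \<omega>))" for \<omega>
    proof -
      have "(\<Sum>j\<in>cube N. (if j \<in> J then (\<lambda>_. 0) else hannan_diff f j) (shift j \<omega>)) = (\<Sum>j\<in>cube N - J. hannan_diff f j (shift j \<omega>))"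
        by (rule sum.mono_neutral_cong_right) auto
      then show ?thesis using sum.subset_diff[OF JN finite_cube, of "\<lambda>j. hannan_diff f j (shift j \<omega>)"] by simp
    qed
    then show ?case by (simp add: diff_diff_eq)
  qed
  from Lim_transform_eventually[OF hannan_decomposition[OF f mean] this]
  show "(\<lambda>N. L2_norm P (\<lambda>\<omega>. f \<omega> - (\<Sum>j\<in>J. hannan_diff f j (shift j \<omega>)) - (\<Sum>j\<in>cube N. (if j \<in> J then (\<lambda>_. 0) else hannan_diff f j) (shift j \<omega>)))) \<longlonglongrightarrow> 0" .
qed

end

section \<open>Finite-dimensional distributions\<close>

context real_iid
begin

lemma field_sum_shift_box: "field_sum v {1..r} (shift j \<omega>) = field_sum v {1 + j..r + j} \<omega>"
  unfolding field_sum_def shift_shift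
  by (rule sum.reindex_bij_witness[of _ "\<lambda>i. i - j" "\<lambda>i. i + j"])
    (auto simp: less_eq_vec_def add.commute le_diff_eq diff_le_eq)

text \<open>A box and its translate differ by a boundary of lower order: the three counts in the
  symmetric difference have the same limiting ratio to the volume.\<close>

lemma field_sum_shift_diff_tendsto:
  fixes r :: "nat ^ 'd::finite \<Rightarrow> int ^ 'd"
  assumes v: "orthodiff v" and t: "\<And>q. 0 \<le> t q"
    and r: "\<And>n q. \<bar>real_of_int (r n $ q) - real (n $ q) * t q\<bar> \<le> c"
  shows "((\<lambda>n. L2_norm P (\<lambda>\<omega>. field_sum v {1..r n} (shift j \<omega>) - field_sum v {1..r n} \<omega>) / sqrt (box_volume (corner n))) \<longlongrightarrow> 0) all_coords_at_top"
proof -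
  let ?A = "\<lambda>n. {1..r n}" and ?B = "\<lambda>n. {1 + j..r n + j}"
  let ?v = "\<lambda>n :: nat ^ 'd. box_volume (corner n)"
  define T where "T = (\<Prod>q\<in>UNIV. t q)"
  have int: "?B n \<inter> ?A n = {\<chi> q. max 1 (1 + j $ q)..\<chi> q. min (r n $ q) (r n $ q + j $ q)}" for n
    by (auto simp: less_eq_vec_def)
  have A: "((\<lambda>n. real (card (?A n)) / ?v n) \<longlongrightarrow> T) all_coords_at_top"
    unfolding T_def by (rule card_ratio_tendsto[OF t, where c = "\<lambda>_. c"]) (rule r)
  have B: "((\<lambda>n. real (card (?B n)) / ?v n) \<longlongrightarrow> T) all_coords_at_top"
    unfolding T_def
  proof (rule card_ratio_tendsto[OF t, where c = "\<lambda>q. c + \<bar>real_of_int (j $ q)\<bar>"])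
    show "\<bar>real_of_int ((r n + j) $ q) - real (n $ q) * t q\<bar> \<le> c + \<bar>real_of_int (j $ q)\<bar>" for n q
      using r[of n q] unfolding vector_add_component of_int_add by linarith
  qed
  have C: "((\<lambda>n. real (card (?B n \<inter> ?A n)) / ?v n) \<longlongrightarrow> T) all_coords_at_top"
    unfolding T_def int
  proof (rule card_ratio_tendsto[OF t, where c = "\<lambda>q. c + \<bar>real_of_int (j $ q)\<bar>"])
    show "\<bar>real_of_int ((\<chi> q. min (r n $ q) (r n $ q + j $ q)) $ q) - real (n $ q) * t q\<bar> \<le> c + \<bar>real_of_int (j $ q)\<bar>" for n q
      using r[of n q] by (simp add: abs_le_iff min_def)
  qed
  have "((\<lambda>n. sqrt ((real (card (?B n)) / ?v n + real (card (?A n)) / ?v n - 2 * (real (card (?B n \<inter> ?A n)) / ?v n)) * (L2_norm P v)\<^sup>2))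
      \<longlongrightarrow> sqrt ((T + T - 2 * T) * (L2_norm P v)\<^sup>2)) all_coords_at_top"
    by (intro tendsto_intros A B C)
  moreover have "sqrt ((real (card (?B n)) / ?v n + real (card (?A n)) / ?v n - 2 * (real (card (?B n \<inter> ?A n)) / ?v n)) * (L2_norm P v)\<^sup>2)
      = L2_norm P (\<lambda>\<omega>. field_sum v {1..r n} (shift j \<omega>) - field_sum v {1..r n} \<omega>) / sqrt (?v n)" for n
  proof -
    have ratio: "(a / v + b / v - 2 * (c / v)) * x = (a + b - 2 * c) * x / v" for a b c v x :: real
      by (simp add: divide_inverse algebra_simps)
    have "(real (card (?B n)) / ?v n + real (card (?A n)) / ?v n - 2 * (real (card (?B n \<inter> ?A n)) / ?v n)) * (L2_norm P v)\<^sup>2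
        = (L2_norm P (\<lambda>\<omega>. field_sum v {1..r n} (shift j \<omega>) - field_sum v {1..r n} \<omega>))\<^sup>2 / ?v n"
      unfolding field_sum_shift_box L2_norm_field_sum_diff[OF v finite_vec_interval finite_vec_interval]
      by (rule ratio)
    then show ?thesis by (simp add: real_sqrt_divide)
  qed
  ultimately show ?thesis by simp
qed

text \<open>The remainder costs \<open>2 ^ CARD('d) * \<epsilon>\<close> by its maximal inequality,
  and undoing the finitely many shifts eventually costs at most \<open>\<eta>\<close>.\<close>

lemma field_sum_approx:
  fixes f :: "(int ^ 'd::finite \<Rightarrow> real) \<Rightarrow> real" and r :: "nat ^ 'd \<Rightarrow> int ^ 'd"
  assumes f: "square_integrable P f" and mean: "(\<integral>\<omega>. f \<omega> \<partial>P) = 0"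
    and J: "finite J" "\<And>K. finite K \<Longrightarrow> K \<inter> J = {} \<Longrightarrow> (\<Sum>j\<in>K. L2_norm P (hannan_diff f j)) \<le> \<epsilon>"
    and t: "\<And>q. 0 \<le> t q" and r: "\<And>n q. \<bar>real_of_int (r n $ q) - real (n $ q) * t q\<bar> \<le> c"
    and rn: "\<And>n. r n \<in> {0..corner n}" and \<eta>: "0 < \<eta>"
  shows "\<forall>\<^sub>F n in all_coords_at_top. L2_norm P (\<lambda>\<omega>. field_sum f {1..r n} \<omega> - field_sum (\<lambda>\<omega>. \<Sum>j\<in>J. hannan_diff f j \<omega>) {1..r n} \<omega>)
    \<le> sqrt (box_volume (corner n)) * (2 ^ CARD('d) * \<epsilon> + \<eta>)"
proof -
  let ?h = "\<lambda>\<omega>. f \<omega> - (\<Sum>j\<in>J. hannan_diff f j (shift j \<omega>))"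
  let ?d = "\<lambda>n j \<omega>. field_sum (hannan_diff f j) {1..r n} (shift j \<omega>) - field_sum (hannan_diff f j) {1..r n} \<omega>"
  have sv: "square_integrable P (hannan_diff f j)" for j by (rule square_integrable_hannan_diff[OF f])
  have sh: "square_integrable P ?h"
    by (intro square_integrable_diff f square_integrable_sum square_integrable_shift sv)
  have sd: "square_integrable P (?d n j)" for n j
    by (intro square_integrable_diff square_integrable_shift square_integrable_field_sum sv)
  have eq: "field_sum f {1..r n} \<omega> - field_sum (\<lambda>\<omega>. \<Sum>j\<in>J. hannan_diff f j \<omega>) {1..r n} \<omega>
      = field_sum ?h {1..r n} \<omega> + (\<Sum>j\<in>J. ?d n j \<omega>)" for n \<omega>
  proof -
    have "field_sum ?h {1..r n} \<omega> = field_sum f {1..r n} \<omega> - (\<Sum>j\<in>J. field_sum (hannan_diff f j) {1..r n} (shift j \<omega>))"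
      unfolding field_sum_shift[symmetric] unfolding field_sum_def sum_subtractf by (subst sum.swap) simp
    moreover have "field_sum (\<lambda>\<omega>. \<Sum>j\<in>J. hannan_diff f j \<omega>) {1..r n} \<omega> = (\<Sum>j\<in>J. field_sum (hannan_diff f j) {1..r n} \<omega>)"
      unfolding field_sum_def by (rule sum.swap)
    ultimately show ?thesis by (simp add: sum_subtractf)
  qed
  \<comment> \<open>The maximum over all corners up to \<open>corner n\<close> bounds the sum at
    \<open>r n\<close>, so the normalization by the full volume fits every choice of
    \<open>r\<close>.\<close>
  have hb: "L2_norm P (field_sum ?h {1..r n}) \<le> 2 ^ CARD('d) * sqrt (box_volume (corner n)) * \<epsilon>" for n
  proof -
    have ne: "finite {0..corner n}" "{0..corner n} \<noteq> {}" using corner_nonneg[of n] by auto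
    have "L2_norm P (field_sum ?h {1..r n}) \<le> L2_norm P (max_field_sum ?h {0..corner n})"
    proof (rule L2_norm_mono[OF square_integrable_max_field_sum[OF sh ne]], rule AE_I2)
      fix \<omega> show "\<bar>field_sum ?h {1..r n} \<omega>\<bar> \<le> \<bar>max_field_sum ?h {0..corner n} \<omega>\<bar>"
        using max_field_sum_ge[OF ne(1) rn[of n], of ?h \<omega>] by linarith
    qed
    also have "\<dots> \<le> 2 ^ CARD('d) * sqrt (box_volume (corner n)) * \<epsilon>"
      by (rule hannan_remainder[OF f mean J corner_nonneg])
    finally show ?thesis .
  qed
  have "((\<lambda>n. \<Sum>j\<in>J. L2_norm P (?d n j) / sqrt (box_volume (corner n))) \<longlongrightarrow> (\<Sum>j\<in>J. 0)) all_coords_at_top"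
    by (intro tendsto_sum field_sum_shift_diff_tendsto[where t = t and c = c] orthodiff_hannan_diff[OF f] t r)
  then have "\<forall>\<^sub>F n in all_coords_at_top. (\<Sum>j\<in>J. L2_norm P (?d n j) / sqrt (box_volume (corner n))) < \<eta>"
    by (rule order_tendstoD(2)) (use \<eta> in simp)
  with eventually_box_volume_pos show ?thesis
  proof eventually_elim
    case (elim n)
    have "(\<Sum>j\<in>J. L2_norm P (?d n j)) = sqrt (box_volume (corner n)) * (\<Sum>j\<in>J. L2_norm P (?d n j) / sqrt (box_volume (corner n)))"
      unfolding sum_distrib_left using elim(1) by simp
    also have "\<dots> \<le> sqrt (box_volume (corner n)) * \<eta>"
      using elim by (intro mult_left_mono) auto
    finally have d: "(\<Sum>j\<in>J. L2_norm P (?d n j)) \<le> sqrt (box_volume (corner n)) * \<eta>" .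
    have "L2_norm P (\<lambda>\<omega>. field_sum ?h {1..r n} \<omega> + (\<Sum>j\<in>J. ?d n j \<omega>)) \<le> L2_norm P (field_sum ?h {1..r n}) + L2_norm P (\<lambda>\<omega>. \<Sum>j\<in>J. ?d n j \<omega>)"
      by (rule L2_norm_triangle[OF square_integrable_field_sum[OF sh] square_integrable_sum[OF sd]])
    also have "L2_norm P (\<lambda>\<omega>. \<Sum>j\<in>J. ?d n j \<omega>) \<le> (\<Sum>j\<in>J. L2_norm P (?d n j))"
      by (rule L2_norm_sum[OF sd])
    finally show ?case unfolding eq using hb[of n] d by (simp add: distrib_left mult_ac)
  qed
qed

text \<open>A combination of box sums is one sum over the full box with weights of order
  \<open>1 / sqrt (box_volume (corner n))\<close>; the error in the central limit theorem, volume
  times the cube of the weights, is of that order too. Orthogonality reduces the variance to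
  counting intersections of boxes.\<close>

lemma cylindrical_fdd:
  fixes u :: "(int ^ 'd::finite \<Rightarrow> real) \<Rightarrow> real" and r :: "'k \<Rightarrow> nat ^ 'd \<Rightarrow> int ^ 'd"
  assumes u: "orthodiff u" "cylindrical u" and I: "finite I"
    and t: "\<And>k q. 0 \<le> t k q" and r: "\<And>k n q. \<bar>real_of_int (r k n $ q) - real (n $ q) * t k q\<bar> \<le> c"
    and rn: "\<And>k n. r k n \<in> {0..corner n}"
  shows "((\<lambda>n. \<integral>\<omega>. cos ((\<Sum>k\<in>I. \<theta> k * (field_sum u {1..r k n} \<omega> / sqrt (box_volume (corner n)))) + s) \<partial>P)
    \<longlongrightarrow> cos s * exp (- ((L2_norm P u)\<^sup>2 * (\<Sum>k\<in>I. \<Sum>l\<in>I. \<theta> k * \<theta> l * (\<Prod>q\<in>UNIV. min (t k q) (t l q)))) / 2)) all_coords_at_top"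
proof -
  let ?v = "\<lambda>n :: nat ^ 'd. box_volume (corner n)"
  let ?W = "\<lambda>n \<omega>. \<Sum>k\<in>I. \<theta> k * (field_sum u {1..r k n} \<omega> / sqrt (?v n))"
  define V where "V = (\<Sum>k\<in>I. \<Sum>l\<in>I. \<theta> k * \<theta> l * (\<Prod>q\<in>UNIV. min (t k q) (t l q)))"
  define \<Theta> where "\<Theta> = (\<Sum>k\<in>I. \<bar>\<theta> k\<bar>)"
  have \<Theta>: "0 \<le> \<Theta>" by (simp add: \<Theta>_def sum_nonneg)
  have su: "square_integrable P u" by (rule orthodiff_square_integrable[OF u(1)])
  obtain C where C: "0 \<le> C" "\<And>I w wm \<theta>. finite I \<Longrightarrow> (\<And>i. \<bar>w i\<bar> \<le> wm) \<Longrightarrow>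
    \<bar>(\<integral>\<omega>. cos ((\<Sum>i\<in>I. w i * u (shift i \<omega>)) + \<theta>) \<partial>P) - cos \<theta> * exp (- (\<integral>\<omega>. (\<Sum>i\<in>I. w i * u (shift i \<omega>))\<^sup>2 \<partial>P) / 2)\<bar>
      \<le> C * real (card I) * wm ^ 3"
    by (rule clt_cylindrical[OF u]) blast
  have Weq: "?W n \<omega> = (\<Sum>i\<in>{1..corner n}. (\<Sum>k\<in>I. \<theta> k * (if i \<in> {1..r k n} then 1 / sqrt (?v n) else 0)) * u (shift i \<omega>))" for n \<omega>
  proof -
    have "(\<Sum>i\<in>{1..corner n}. (\<Sum>k\<in>I. \<theta> k * (if i \<in> {1..r k n} then 1 / sqrt (?v n) else 0)) * u (shift i \<omega>))
        = (\<Sum>k\<in>I. \<Sum>i\<in>{1..corner n}. \<theta> k * (if i \<in> {1..r k n} then 1 / sqrt (?v n) else 0) * u (shift i \<omega>))"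
      unfolding sum_distrib_right by (rule sum.swap)
    also have "\<dots> = ?W n \<omega>"
    proof (rule sum.cong[OF refl])
      fix k
      have sub: "{1..r k n} \<subseteq> {1..corner n}" using rn[of k n] by (meson atLeastAtMost_iff atLeastatMost_subset_iff order_refl)
      have "(\<Sum>i\<in>{1..corner n}. \<theta> k * (if i \<in> {1..r k n} then 1 / sqrt (?v n) else 0) * u (shift i \<omega>))
          = (\<Sum>i\<in>{1..r k n}. \<theta> k / sqrt (?v n) * u (shift i \<omega>))"
        by (rule sum.mono_neutral_cong_right[OF finite_vec_interval sub]) auto
      also have "\<dots> = \<theta> k * (field_sum u {1..r k n} \<omega> / sqrt (?v n))"
        unfolding field_sum_def sum_distrib_left[symmetric] by simp
      finally show "(\<Sum>i\<in>{1..corner n}. \<theta> k * (if i \<in> {1..r k n} then 1 / sqrt (?v n) else 0) * u (shift i \<omega>))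
          = \<theta> k * (field_sum u {1..r k n} \<omega> / sqrt (?v n))" .
    qed
    finally show ?thesis by simp
  qed
  have wm: "\<bar>\<Sum>k\<in>I. \<theta> k * (if i \<in> {1..r k n} then 1 / sqrt (?v n) else 0)\<bar> \<le> \<Theta> / sqrt (?v n)" for n i
  proof -
    have vn: "0 \<le> ?v n" by (rule box_volume_nonneg[OF corner_nonneg])
    have "\<bar>\<Sum>k\<in>I. \<theta> k * (if i \<in> {1..r k n} then 1 / sqrt (?v n) else 0)\<bar> \<le> (\<Sum>k\<in>I. \<bar>\<theta> k\<bar> * (1 / sqrt (?v n)))"
      by (rule order_trans[OF sum_abs]) (intro sum_mono, use vn in \<open>auto simp: abs_mult\<close>)
    also have "\<dots> = \<Theta> / sqrt (?v n)" unfolding \<Theta>_def sum_distrib_right[symmetric] by simp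
    finally show ?thesis .
  qed
  have clt: "\<bar>(\<integral>\<omega>. cos (?W n \<omega> + s) \<partial>P) - cos s * exp (- (\<integral>\<omega>. (?W n \<omega>)\<^sup>2 \<partial>P) / 2)\<bar> \<le> C * ?v n * (\<Theta> / sqrt (?v n)) ^ 3" for n
  proof -
    have "\<bar>(\<integral>\<omega>. cos (?W n \<omega> + s) \<partial>P) - cos s * exp (- (\<integral>\<omega>. (?W n \<omega>)\<^sup>2 \<partial>P) / 2)\<bar>
        \<le> C * real (card {1..corner n}) * (\<Theta> / sqrt (?v n)) ^ 3"
      unfolding Weq by (rule C(2)[OF finite_vec_interval wm])
    then show ?thesis by (simp only: card_box[OF corner_nonneg])
  qed
  have var: "(\<integral>\<omega>. (?W n \<omega>)\<^sup>2 \<partial>P) = (L2_norm P u)\<^sup>2 * (\<Sum>k\<in>I. \<Sum>l\<in>I. \<theta> k * \<theta> l * (real (card ({1..r k n} \<inter> {1..r l n})) / ?v n))" for n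
  proof -
    have vn: "0 \<le> ?v n" by (rule box_volume_nonneg[OF corner_nonneg])
    have int: "integrable P (\<lambda>\<omega>. field_sum u {1..r k n} \<omega> * field_sum u {1..r l n} \<omega>)" for k l
      by (intro square_integrable_mult square_integrable_field_sum su)
    have "(\<integral>\<omega>. (?W n \<omega>)\<^sup>2 \<partial>P) = (\<integral>\<omega>. (\<Sum>k\<in>I. \<Sum>l\<in>I. \<theta> k * \<theta> l / ?v n * (field_sum u {1..r k n} \<omega> * field_sum u {1..r l n} \<omega>)) \<partial>P)"
    proof (rule Bochner_Integration.integral_cong[OF refl])
      fix \<omega>
      have "\<theta> k * (field_sum u {1..r k n} \<omega> / sqrt (?v n)) * (\<theta> l * (field_sum u {1..r l n} \<omega> / sqrt (?v n)))
          = \<theta> k * \<theta> l / ?v n * (field_sum u {1..r k n} \<omega> * field_sum u {1..r l n} \<omega>)" for k l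
      proof -
        have "sqrt (?v n) * sqrt (?v n) = ?v n" using vn by simp
        then show ?thesis by (simp add: times_divide_times_eq mult_ac)
      qed
      then show "(?W n \<omega>)\<^sup>2 = (\<Sum>k\<in>I. \<Sum>l\<in>I. \<theta> k * \<theta> l / ?v n * (field_sum u {1..r k n} \<omega> * field_sum u {1..r l n} \<omega>))"
        unfolding power2_eq_square sum_product by simp
    qed
    also have "\<dots> = (\<Sum>k\<in>I. \<Sum>l\<in>I. \<theta> k * \<theta> l / ?v n * (\<integral>\<omega>. field_sum u {1..r k n} \<omega> * field_sum u {1..r l n} \<omega> \<partial>P))"
      using int by simp
    also have "\<dots> = (\<Sum>k\<in>I. \<Sum>l\<in>I. \<theta> k * \<theta> l / ?v n * (real (card ({1..r k n} \<inter> {1..r l n})) * (L2_norm P u)\<^sup>2))"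
      unfolding integral_field_sum_mult[OF u(1) u(1) finite_vec_interval finite_vec_interval] L2_norm_power2
      by (simp add: power2_eq_square)
    also have "\<dots> = (L2_norm P u)\<^sup>2 * (\<Sum>k\<in>I. \<Sum>l\<in>I. \<theta> k * \<theta> l * (real (card ({1..r k n} \<inter> {1..r l n})) / ?v n))"
      unfolding sum_distrib_left by (intro sum.cong refl) simp
    finally show ?thesis .
  qed
  have ratio: "((\<lambda>n. real (card ({1..r k n} \<inter> {1..r l n})) / ?v n) \<longlongrightarrow> (\<Prod>q\<in>UNIV. min (t k q) (t l q))) all_coords_at_top" for k l
  proof -
    \<comment> \<open>Intersections of such boxes are again boxes, with the coordinatewise minimum
      as corner; this produces the covariance of the sheet.\<close>
    have "{1..r k n} \<inter> {1..r l n} = {1..\<chi> q. min (r k n $ q) (r l n $ q)}" for n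
      by (auto simp: less_eq_vec_def)
    moreover have "((\<lambda>n. real (card {1..\<chi> q. min (r k n $ q) (r l n $ q)}) / ?v n) \<longlongrightarrow> (\<Prod>q\<in>UNIV. min (t k q) (t l q))) all_coords_at_top"
    proof (rule card_ratio_tendsto[where c = "\<lambda>_. c"])
      show "0 \<le> min (t k q) (t l q)" for q using t by simp
      show "\<bar>real_of_int ((\<chi> q. min (r k n $ q) (r l n $ q)) $ q) - real (n $ q) * min (t k q) (t l q)\<bar> \<le> c" for n q
      proof -
        have "real (n $ q) * min (t k q) (t l q) = min (real (n $ q) * t k q) (real (n $ q) * t l q)"
          by (auto simp: min_def mult_le_cancel_left)
        then show ?thesis using r[of k n q] r[of l n q] by (simp add: of_int_min min_def abs_le_iff)
      qed
    qed
    ultimately show ?thesis by simp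
  qed
  have "((\<lambda>n. cos s * exp (- (\<integral>\<omega>. (?W n \<omega>)\<^sup>2 \<partial>P) / 2)) \<longlongrightarrow> cos s * exp (- ((L2_norm P u)\<^sup>2 * V) / 2)) all_coords_at_top"
    unfolding var V_def by (intro tendsto_intros ratio) simp
  note limV = this
  have "((\<lambda>n. (\<integral>\<omega>. cos (?W n \<omega> + s) \<partial>P) - cos s * exp (- (\<integral>\<omega>. (?W n \<omega>)\<^sup>2 \<partial>P) / 2)) \<longlongrightarrow> 0) all_coords_at_top"
  proof (rule Lim_null_comparison)
    show "\<forall>\<^sub>F n in all_coords_at_top. norm ((\<integral>\<omega>. cos (?W n \<omega> + s) \<partial>P) - cos s * exp (- (\<integral>\<omega>. (?W n \<omega>)\<^sup>2 \<partial>P) / 2)) \<le> C * \<Theta> ^ 3 / sqrt (?v n)"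
      using eventually_box_volume_pos
    proof eventually_elim
      case (elim n)
      have "?v n = sqrt (?v n) * sqrt (?v n)" using elim by simp
      then have "C * ?v n * (\<Theta> / sqrt (?v n)) ^ 3 = C * \<Theta> ^ 3 / sqrt (?v n)"
        using elim by (simp add: power3_eq_cube field_simps)
      then show ?case using clt[of n] by simp
    qed
    show "((\<lambda>n. C * \<Theta> ^ 3 / sqrt (?v n)) \<longlongrightarrow> 0) all_coords_at_top"
      by (rule tendsto_divide_0[OF tendsto_const filterlim_at_top_imp_at_infinity])
        (rule filterlim_compose[OF sqrt_at_top box_volume_tendsto])
  qed
  from tendsto_add[OF this limV] show ?thesis unfolding V_def[symmetric] by simp
qed

text \<open>\<open>f\<close> is replaced by the finite sum over \<open>J\<close>, and this by a
  bounded difference \<open>u\<close>. The limit for \<open>u\<close> is close to the one for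
  \<open>D\<close> because it depends continuously on the norm.\<close>

lemma field_fdd:
  fixes f :: "(int ^ 'd::finite \<Rightarrow> real) \<Rightarrow> real" and r :: "'k \<Rightarrow> nat ^ 'd \<Rightarrow> int ^ 'd"
  assumes f: "square_integrable P f" and mean: "(\<integral>\<omega>. f \<omega> \<partial>P) = 0"
    and sm: "(\<lambda>i. L2_norm P (proj \<mu> 0 (f \<circ> shift i))) summable_on UNIV"
    and D: "has_L2_sum P (\<lambda>i. proj \<mu> 0 (f \<circ> shift i)) D" and I: "finite I"
    and t: "\<And>k q. 0 \<le> t k q" and r: "\<And>k n q. \<bar>real_of_int (r k n $ q) - real (n $ q) * t k q\<bar> \<le> c"
    and rn: "\<And>k n. r k n \<in> {0..corner n}"
  shows "((\<lambda>n. \<integral>\<omega>. cos ((\<Sum>k\<in>I. \<theta> k * (field_sum f {1..r k n} \<omega> / sqrt (box_volume (corner n)))) + s) \<partial>P)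
    \<longlongrightarrow> cos s * exp (- ((L2_norm P D)\<^sup>2 * (\<Sum>k\<in>I. \<Sum>l\<in>I. \<theta> k * \<theta> l * (\<Prod>q\<in>UNIV. min (t k q) (t l q)))) / 2)) all_coords_at_top"
proof (rule tendstoI)
  fix e :: real assume e: "0 < e"
  let ?v = "\<lambda>n :: nat ^ 'd. box_volume (corner n)"
  let ?W = "\<lambda>g n \<omega>. \<Sum>k\<in>I. \<theta> k * (field_sum g {1..r k n} \<omega> / sqrt (?v n))"
  define V where "V = (\<Sum>k\<in>I. \<Sum>l\<in>I. \<theta> k * \<theta> l * (\<Prod>q\<in>UNIV. min (t k q) (t l q)))"
  define G where "G x = cos s * exp (- (x\<^sup>2 * V) / 2)" for x
  define \<Theta> where "\<Theta> = (\<Sum>k\<in>I. \<bar>\<theta> k\<bar>)"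
  have \<Theta>: "0 \<le> \<Theta>" by (simp add: \<Theta>_def sum_nonneg)
  have sD: "square_integrable P D" using D by (simp add: has_L2_sum_def)
  have "isCont G (L2_norm P D)" unfolding G_def by (intro continuous_intros) simp
  then obtain \<delta> where \<delta>: "0 < \<delta>" "\<And>x. \<bar>x - L2_norm P D\<bar> < \<delta> \<Longrightarrow> \<bar>G x - G (L2_norm P D)\<bar> < e / 4"
    using e unfolding continuous_at_eps_delta by (metis dist_real_def divide_pos_pos zero_less_numeral)
  \<comment> \<open>Passing from \<open>f\<close> to the finite sum takes
    \<open>2 ^ CARD('d) + 1\<close> shares of \<open>\<epsilon>\<close> and passing on to
    \<open>u\<close> one more; the weights contribute \<open>\<Theta>\<close>, and the 4 confines
    this comparison to \<open>e / 4\<close>.\<close>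
  define \<kappa> where "\<kappa> = 4 * (\<Theta> + 1) * (2 ^ CARD('d) + 2)"
  have \<kappa>: "0 < \<kappa>" unfolding \<kappa>_def using \<Theta> by (intro mult_pos_pos add_nonneg_pos) auto
  define \<epsilon> where "\<epsilon> = min (\<delta> / 3) (e / \<kappa>)"
  have "0 < \<epsilon>" using \<delta>(1) e \<kappa> by (simp add: \<epsilon>_def)
  moreover have "\<epsilon> \<le> \<delta> / 3" "\<epsilon> \<le> e / \<kappa>" unfolding \<epsilon>_def by (rule min.cobounded1, rule min.cobounded2)
  ultimately have \<epsilon>: "0 < \<epsilon>" "\<epsilon> \<le> \<delta> / 3" "\<epsilon> \<le> e / \<kappa>" by auto
  obtain J where J: "finite J" "\<And>K. finite K \<Longrightarrow> K \<inter> J = {} \<Longrightarrow> (\<Sum>j\<in>K. L2_norm P (hannan_diff f j)) \<le> \<epsilon>"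
    "L2_norm P (\<lambda>\<omega>. (\<Sum>j\<in>J. hannan_diff f j \<omega>) - D \<omega>) \<le> \<epsilon>"
    by (rule hannan_truncation[OF f sm D \<epsilon>(1)]) blast
  let ?e = "\<lambda>\<omega>. \<Sum>j\<in>J. hannan_diff f j \<omega>"
  have oe: "orthodiff ?e" by (rule orthodiff_sum[OF orthodiff_hannan_diff[OF f]])
  obtain u where u: "orthodiff u" "cylindrical u" "L2_norm P (\<lambda>\<omega>. ?e \<omega> - u \<omega>) < \<epsilon>"
    by (rule orthodiff_approx[OF oe \<epsilon>(1)]) blast
  have se: "square_integrable P ?e" and su: "square_integrable P u"
    by (rule orthodiff_square_integrable[OF oe], rule orthodiff_square_integrable[OF u(1)])
  have "\<bar>L2_norm P u - L2_norm P D\<bar> < \<delta>"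
    using L2_norm_diff_abs[OF se su] L2_norm_diff_abs[OF se sD] J(3) u(3) \<epsilon>(1,2) by linarith
  from \<delta>(2)[OF this] have Gu: "\<bar>G (L2_norm P u) - G (L2_norm P D)\<bar> < e / 4" .
  have "((\<lambda>n. \<integral>\<omega>. cos (?W u n \<omega> + s) \<partial>P) \<longlongrightarrow> G (L2_norm P u)) all_coords_at_top"
    unfolding G_def V_def by (rule cylindrical_fdd[OF u(1,2) I t r rn])
  then have ev1: "\<forall>\<^sub>F n in all_coords_at_top. dist (\<integral>\<omega>. cos (?W u n \<omega> + s) \<partial>P) (G (L2_norm P u)) < e / 4"
    by (rule tendstoD) (use e in simp)
  have ev2: "\<forall>\<^sub>F n in all_coords_at_top. \<forall>k\<in>I. L2_norm P (\<lambda>\<omega>. field_sum f {1..r k n} \<omega> - field_sum ?e {1..r k n} \<omega>)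
    \<le> sqrt (?v n) * (2 ^ CARD('d) * \<epsilon> + \<epsilon>)"
    by (intro eventually_ball_finite I ballI field_sum_approx[OF f mean J(1,2) t r rn \<epsilon>(1)])
  show "\<forall>\<^sub>F n in all_coords_at_top. dist (\<integral>\<omega>. cos (?W f n \<omega> + s) \<partial>P)
      (cos s * exp (- ((L2_norm P D)\<^sup>2 * (\<Sum>k\<in>I. \<Sum>l\<in>I. \<theta> k * \<theta> l * (\<Prod>q\<in>UNIV. min (t k q) (t l q)))) / 2)) < e"
    unfolding V_def[symmetric] G_def[symmetric] using ev1 ev2 eventually_box_volume_pos
  proof eventually_elim
    case (elim n)
    let ?s = "sqrt (?v n)"
    have s: "0 < ?s" using elim(3) by simp
    have sW: "square_integrable P (?W g n)" if "square_integrable P g" for g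
    proof -
      have "square_integrable P (\<lambda>\<omega>. \<Sum>k\<in>I. (\<theta> k / ?s) * field_sum g {1..r k n} \<omega>)"
        by (intro square_integrable_sum square_integrable_cmult square_integrable_field_sum that)
      then show ?thesis by simp
    qed
    have d: "L2_norm P (\<lambda>\<omega>. field_sum f {1..r k n} \<omega> - field_sum u {1..r k n} \<omega>) \<le> ?s * ((2 ^ CARD('d) + 2) * \<epsilon>)" if k: "k \<in> I" for k
    proof -
      have "L2_norm P (\<lambda>\<omega>. (field_sum f {1..r k n} \<omega> - field_sum ?e {1..r k n} \<omega>) + field_sum (\<lambda>\<omega>. ?e \<omega> - u \<omega>) {1..r k n} \<omega>)
          \<le> L2_norm P (\<lambda>\<omega>. field_sum f {1..r k n} \<omega> - field_sum ?e {1..r k n} \<omega>) + L2_norm P (field_sum (\<lambda>\<omega>. ?e \<omega> - u \<omega>) {1..r k n})"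
        by (intro L2_norm_triangle square_integrable_diff square_integrable_field_sum f se su)
      also have "L2_norm P (field_sum (\<lambda>\<omega>. ?e \<omega> - u \<omega>) {1..r k n}) = sqrt (card {1..r k n}) * L2_norm P (\<lambda>\<omega>. ?e \<omega> - u \<omega>)"
        by (rule L2_norm_field_sum[OF orthodiff_diff[OF oe u(1)] finite_vec_interval])
      also have "\<dots> \<le> ?s * \<epsilon>"
      proof (rule mult_mono)
        have "card {1..r k n} \<le> card {1..corner n}"
          using rn[of k n] by (intro card_mono finite_vec_interval) (meson atLeastAtMost_iff atLeastatMost_subset_iff order_refl)
        then show "sqrt (card {1..r k n}) \<le> ?s" unfolding card_box[OF corner_nonneg, symmetric] by simp
      qed (use u(3) s in auto)
      also have "L2_norm P (\<lambda>\<omega>. field_sum f {1..r k n} \<omega> - field_sum ?e {1..r k n} \<omega>) \<le> ?s * (2 ^ CARD('d) * \<epsilon> + \<epsilon>)"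
        using elim(2) k by blast
      finally show ?thesis by (simp add: field_sum_def sum_subtractf algebra_simps)
    qed
    have "L2_norm P (\<lambda>\<omega>. ?W f n \<omega> - ?W u n \<omega>) = L2_norm P (\<lambda>\<omega>. \<Sum>k\<in>I. (\<theta> k / ?s) * (field_sum f {1..r k n} \<omega> - field_sum u {1..r k n} \<omega>))"
      by (simp add: sum_subtractf right_diff_distrib)
    also have "\<dots> \<le> (\<Sum>k\<in>I. L2_norm P (\<lambda>\<omega>. (\<theta> k / ?s) * (field_sum f {1..r k n} \<omega> - field_sum u {1..r k n} \<omega>)))"
      by (intro L2_norm_sum square_integrable_cmult square_integrable_diff square_integrable_field_sum f su)
    also have "\<dots> \<le> (\<Sum>k\<in>I. \<bar>\<theta> k\<bar> * ((2 ^ CARD('d) + 2) * \<epsilon>))"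
    proof (rule sum_mono)
      fix k assume k: "k \<in> I"
      have "\<bar>\<theta> k / ?s\<bar> * L2_norm P (\<lambda>\<omega>. field_sum f {1..r k n} \<omega> - field_sum u {1..r k n} \<omega>) \<le> \<bar>\<theta> k / ?s\<bar> * (?s * ((2 ^ CARD('d) + 2) * \<epsilon>))"
        by (rule mult_left_mono[OF d[OF k]]) simp
      also have "\<dots> = \<bar>\<theta> k\<bar> * ((2 ^ CARD('d) + 2) * \<epsilon>)" using elim(3) by (simp add: abs_divide)
      finally show "L2_norm P (\<lambda>\<omega>. (\<theta> k / ?s) * (field_sum f {1..r k n} \<omega> - field_sum u {1..r k n} \<omega>)) \<le> \<bar>\<theta> k\<bar> * ((2 ^ CARD('d) + 2) * \<epsilon>)"
        unfolding L2_norm_cmult .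
    qed
    also have "\<dots> = \<Theta> * ((2 ^ CARD('d) + 2) * \<epsilon>)" by (simp add: \<Theta>_def sum_distrib_right)
    also have "\<dots> \<le> e / 4"
    proof -
      have "\<Theta> * ((2 ^ CARD('d) + 2) * \<epsilon>) \<le> (\<Theta> + 1) * ((2 ^ CARD('d) + 2) * \<epsilon>)"
        using \<epsilon>(1) by (intro mult_right_mono) auto
      also have "\<dots> = \<kappa> * \<epsilon> / 4" by (simp add: \<kappa>_def)
      also have "\<dots> \<le> e / 4" using \<epsilon>(3) \<kappa> by (simp add: field_simps)
      finally show ?thesis .
    qed
    finally have "\<bar>(\<integral>\<omega>. cos (?W f n \<omega> + s) \<partial>P) - (\<integral>\<omega>. cos (?W u n \<omega> + s) \<partial>P)\<bar> \<le> e / 4"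
      using prob_space.integral_cos_diff_le[OF prob_space_P sW[OF f] sW[OF su], of s] by linarith
    then show ?case using elim(1) Gu unfolding dist_real_def by linarith
  qed
qed

end

section \<open>Tightness\<close>

text \<open>Above the threshold \<open>\<delta>\<close> the fourth power takes over; thus a quantity
  at an unknown position can be bounded by a sum of fourth powers over all positions.\<close>

lemma young_fourth_power:
  fixes x \<delta> :: real
  assumes "0 \<le> x" "0 < \<delta>"
  shows "x \<le> \<delta> + x ^ 4 / \<delta> ^ 3"
proof (cases "x \<le> \<delta>")
  case True
  have "0 \<le> x ^ 4 / \<delta> ^ 3" using assms by simp
  then show ?thesis using True by linarith
next
  case False
  then have "\<delta> ^ 3 \<le> x ^ 3" using assms by (intro power_mono) auto
  then have "x * \<delta> ^ 3 \<le> x * x ^ 3" using assms by (intro mult_left_mono) auto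
  then have "x \<le> x ^ 4 / \<delta> ^ 3" using assms by (simp add: pos_le_divide_eq power4_eq_xxxx power3_eq_cube)
  then show ?thesis using assms by linarith
qed

text \<open>The index is changed from \<open>p\<close> to \<open>r\<close> one coordinate at a time.
  The intermediate indices mix coordinates of both, hence the bound \<open>G q\<close> has to be
  uniform in \<open>k\<close>.\<close>

lemma vec_telescope:
  fixes S :: "int ^ 'd::finite \<Rightarrow> real"
  assumes G: "\<And>q k. k \<in> {0..N} \<Longrightarrow> \<bar>S (vec_upd k q (p $ q)) - S (vec_upd k q (r $ q))\<bar> \<le> G q"
    and p: "p \<in> {0..N}" and r: "r \<in> {0..N}"
  shows "\<bar>S p - S r\<bar> \<le> (\<Sum>q\<in>UNIV. G q)"
proof -
  define z where "z A = (\<chi> q. if q \<in> A then r $ q else p $ q)" for A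
  have "\<bar>S p - S (z A)\<bar> \<le> (\<Sum>q\<in>A. G q)" if "finite A" for A
    using that
  proof induction
    case empty
    have "z {} = p" by (simp add: z_def vec_eq_iff)
    then show ?case by simp
  next
    case (insert a A)
    have "z A \<in> {0..N}" using p r by (auto simp: z_def less_eq_vec_def)
    from G[OF this, of a] have "\<bar>S (vec_upd (z A) a (p $ a)) - S (vec_upd (z A) a (r $ a))\<bar> \<le> G a" .
    moreover have "vec_upd (z A) a (p $ a) = z A" "vec_upd (z A) a (r $ a) = z (insert a A)"
      using insert.hyps(2) by (auto simp: z_def vec_eq_iff)
    ultimately show ?case using insert by simp
  qed
  from this[of UNIV] show ?thesis by (simp add: z_def vec_lambda_eta)
qed

context real_iid
begin

text \<open>The difference of the two boxes is a translate of a thinner box that starts at 1, so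
  after a shift the maximal inequalities for boxes at the origin apply.\<close>

lemma field_sum_slab:
  assumes "0 \<le> b" "b \<le> a"
  shows "field_sum u {1..vec_upd k q a} \<omega> - field_sum u {1..vec_upd k q b} \<omega> = field_sum u {1..vec_upd k q (a - b)} (shift (vec_upd 0 q b) \<omega>)"
proof -
  have sub: "{1..vec_upd k q b} \<subseteq> {1..vec_upd k q a}" using assms by (auto simp: less_eq_vec_def)
  have "field_sum u {1..vec_upd k q a} \<omega> - field_sum u {1..vec_upd k q b} \<omega> = field_sum u ({1..vec_upd k q a} - {1..vec_upd k q b}) \<omega>"
    unfolding field_sum_def using sum.subset_diff[OF sub finite_vec_interval, of "\<lambda>i. u (shift i \<omega>)"] by simp
  also have "{1..vec_upd k q a} - {1..vec_upd k q b} = {1 + vec_upd 0 q b..vec_upd k q (a - b) + vec_upd 0 q b}"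
  proof (intro set_eqI iffI)
    fix i assume i: "i \<in> {1..vec_upd k q a} - {1..vec_upd k q b}"
    then have ge: "1 \<le> i $ p" and le: "i $ p \<le> vec_upd k q a $ p" for p by (auto simp: less_eq_vec_def)
    have "b < i $ q"
    proof (rule ccontr)
      assume "\<not> b < i $ q"
      then have "i $ p \<le> vec_upd k q b $ p" for p using le[of p] by (cases "p = q") auto
      then have "i \<in> {1..vec_upd k q b}" using ge by (simp add: less_eq_vec_def)
      then show False using i by simp
    qed
    then have "1 + vec_upd 0 q b $ p \<le> i $ p \<and> i $ p \<le> vec_upd k q (a - b) $ p + vec_upd 0 q b $ p" for p
      using ge[of p] le[of p] by (cases "p = q") auto
    then show "i \<in> {1 + vec_upd 0 q b..vec_upd k q (a - b) + vec_upd 0 q b}" by (simp add: less_eq_vec_def)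
  next
    fix i assume "i \<in> {1 + vec_upd 0 q b..vec_upd k q (a - b) + vec_upd 0 q b}"
    then have i: "1 + vec_upd 0 q b $ p \<le> i $ p \<and> i $ p \<le> vec_upd k q (a - b) $ p + vec_upd 0 q b $ p" for p
      by (auto simp: less_eq_vec_def)
    have "1 \<le> i $ p \<and> i $ p \<le> vec_upd k q a $ p" for p using i[of p] assms by (cases "p = q") auto
    moreover have "\<not> i $ q \<le> vec_upd k q b $ q" using i[of q] by simp
    ultimately show "i \<in> {1..vec_upd k q a} - {1..vec_upd k q b}" by (auto simp: less_eq_vec_def)
  qed
  finally show ?thesis unfolding field_sum_shift_box .
qed

lemma abs_field_sum_le:
  assumes "\<And>\<omega>. \<bar>u \<omega>\<bar> \<le> b"
  shows "\<bar>field_sum u A \<omega>\<bar> \<le> real (card A) * b"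
  unfolding field_sum_def by (rule order_trans[OF sum_abs], rule sum_bounded_above) (rule assms)

lemma max_field_sum_le_bound:
  assumes b: "\<And>\<omega>. \<bar>u \<omega>\<bar> \<le> b" and n: "0 \<le> n"
  shows "max_field_sum u {0..n} \<omega> \<le> real (card {1..n}) * b"
proof (rule max_field_sum_le)
  fix k assume k: "k \<in> {0..n}"
  have "card {1..k} \<le> card {1..n}" using k by (intro card_mono) auto
  moreover have "0 \<le> b" using b by (meson abs_ge_zero order_trans)
  ultimately show "\<bar>field_sum u {1..k} \<omega>\<bar> \<le> real (card {1..n}) * b"
    by (intro order_trans[OF abs_field_sum_le[OF b]] mult_right_mono) auto
qed (use n in auto)

text \<open>The index is moved to the one of the grid point below in one coordinate after the other. Each move adds a
  sum over a slab of relative thickness at most \<open>2 / M\<close>, which starts at one of \<open>M + 1\<close> positions; as the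
  fourth moment of its maximum is of order \<open>1 / M\<^sup>2\<close>, the sum over all positions is small.\<close>

lemma slab_modulus:
  fixes u :: "(int ^ 'd::finite \<Rightarrow> real) \<Rightarrow> real"
  assumes u: "orthodiff u" and b: "\<And>\<omega>. \<bar>u \<omega>\<bar> \<le> b" and \<delta>: "0 < \<delta>" and M: "0 < M" and n: "\<And>q. M \<le> n $ q"
  shows "\<exists>W. integrable P W \<and> (\<integral>\<omega>. W \<omega> \<partial>P) \<le> real CARD('d) * (\<delta> + 8 * 64 ^ CARD('d) * b ^ 4 / \<delta> ^ 3 / real M) \<and>
    (\<forall>\<omega>. \<forall>t\<in>unit_cube. \<bar>field_sum u {1..scaled_floor n t} \<omega> / sqrt (box_volume (corner n))
      - field_sum u {1..scaled_floor n (grid_point M (scaled_floor (\<chi> q. M) t))} \<omega> / sqrt (box_volume (corner n))\<bar> \<le> W \<omega>)"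
proof -
  interpret prob_space "P :: (int ^ 'd \<Rightarrow> real) measure" by (rule prob_space_P)
  let ?s = "sqrt (box_volume (corner n))"
  have nq: "0 < n $ q" for q using n[of q] M by linarith
  have v: "0 < box_volume (corner n)" unfolding box_volume_corner using nq by (intro prod_pos) simp
  have s: "0 < ?s" using v by simp
  have um: "u \<in> borel_measurable P" by (rule square_integrable_measurable[OF orthodiff_square_integrable[OF u]])
  \<comment> \<open>From the grid point to \<open>t\<close> the scaled index advances by at most
    \<open>n $ q / M + 1\<close>, and \<open>M \<le> n $ q\<close> absorbs the rounding into a
    second \<open>n $ q / M\<close>.\<close>
  define l where "l q = \<lfloor>2 * real (n $ q) / real M\<rfloor>" for q
  have l0: "0 \<le> l q" for q by (simp add: l_def)
  define L where "L q = vec_upd (corner n) q (l q)" for q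
  have L0: "0 \<le> L q" for q using l0 by (auto simp: L_def less_eq_vec_def)
  \<comment> \<open>The level at which the slab starts when the grid coordinate is
    \<open>i / M\<close>.\<close>
  define \<rho> where "\<rho> q i = \<lfloor>real (n $ q) * (of_int i / real M)\<rfloor>" for q and i :: int
  define G where "G q i \<omega> = max_field_sum u {0..L q} (shift (vec_upd 0 q (\<rho> q i)) \<omega>)" for q i \<omega>
  have G0: "0 \<le> G q i \<omega>" for q i \<omega>
    unfolding G_def using L0 by (intro max_field_sum_nonneg) auto
  have Gm: "G q i \<in> borel_measurable P" for q i
    unfolding G_def[abs_def] by (rule borel_measurable_shift[OF borel_measurable_max_field_sum[OF um finite_vec_interval]])
  have iG: "integrable P (\<lambda>\<omega>. G q i \<omega> ^ 4)" for q i
  proof (rule integrable_const_bound[where B = "(real (card {1..L q}) * b) ^ 4"])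
    show "AE \<omega> in P. norm (G q i \<omega> ^ 4) \<le> (real (card {1..L q}) * b) ^ 4"
      using G0 max_field_sum_le_bound[OF b L0] by (intro AE_I2) (simp add: G_def power_mono)
  qed (intro borel_measurable_power Gm)
  have EG: "(\<integral>\<omega>. G q i \<omega> ^ 4 \<partial>P) \<le> (8 ^ CARD('d) * (box_volume (corner n) * (2 / real M)) * b\<^sup>2)\<^sup>2" for q i
  proof -
    have "(\<integral>\<omega>. G q i \<omega> ^ 4 \<partial>P) = (\<integral>\<omega>. max_field_sum u {0..L q} \<omega> ^ 4 \<partial>P)"
      unfolding G_def by (rule integral_shift) (intro borel_measurable_power borel_measurable_max_field_sum um finite_vec_interval)
    also have "\<dots> \<le> (8 ^ CARD('d) * box_volume (L q) * b\<^sup>2)\<^sup>2" by (rule maximal_inequality_L4[OF u b L0])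
    also have "\<dots> \<le> (8 ^ CARD('d) * (box_volume (corner n) * (2 / real M)) * b\<^sup>2)\<^sup>2"
    proof -
      have "box_volume (L q) = of_int (l q) * (\<Prod>r\<in>UNIV - {q}. real (n $ r))"
        unfolding box_volume_def L_def by (subst prod.remove[of UNIV q]) (auto intro!: prod.cong)
      also have "\<dots> \<le> (real (n $ q) * (2 / real M)) * (\<Prod>r\<in>UNIV - {q}. real (n $ r))"
      proof (rule mult_right_mono)
        have "of_int (l q) \<le> 2 * real (n $ q) / real M" unfolding l_def by (rule of_int_floor_le)
        then show "of_int (l q) \<le> real (n $ q) * (2 / real M)" by (simp add: mult.commute)
      qed (auto intro!: prod_nonneg)
      also have "\<dots> = (real (n $ q) * (\<Prod>r\<in>UNIV - {q}. real (n $ r))) * (2 / real M)" by simp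
      also have "real (n $ q) * (\<Prod>r\<in>UNIV - {q}. real (n $ r)) = box_volume (corner n)"
        unfolding box_volume_corner by (subst prod.remove[of UNIV q]) auto
      finally have "box_volume (L q) \<le> box_volume (corner n) * (2 / real M)" .
      then show ?thesis using box_volume_nonneg[OF L0[of q]] by (intro power_mono mult_right_mono mult_left_mono) auto
    qed
    finally show ?thesis .
  qed
  \<comment> \<open>The starting level depends on \<open>t\<close>, so the bound by fourth powers is
    summed over all \<open>M + 1\<close> levels in each direction.\<close>
  define W where "W \<omega> = (\<Sum>q\<in>UNIV. \<delta> + (\<Sum>i\<in>{0..int M}. (G q i \<omega> / ?s) ^ 4 / \<delta> ^ 3))" for \<omega>
  have Weq: "W \<omega> = (\<Sum>q\<in>UNIV. \<delta> + (\<Sum>i\<in>{0..int M}. G q i \<omega> ^ 4 * (1 / (?s ^ 4 * \<delta> ^ 3))))" for \<omega>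
    by (simp add: W_def power_divide)
  have iW: "integrable P W"
    unfolding Weq[abs_def] by (intro Bochner_Integration.integrable_sum Bochner_Integration.integrable_add integrable_mult_left iG integrable_const)
  have "(\<integral>\<omega>. W \<omega> \<partial>P) = (\<Sum>q\<in>UNIV. \<delta> + (\<Sum>i\<in>{0..int M}. (\<integral>\<omega>. G q i \<omega> ^ 4 \<partial>P) * (1 / (?s ^ 4 * \<delta> ^ 3))))"
    unfolding Weq using iG by (simp add: prob_space[unfolded space_P])
  also have "\<dots> \<le> (\<Sum>q\<in>(UNIV :: 'd set). \<delta> + 8 * 64 ^ CARD('d) * b ^ 4 / \<delta> ^ 3 / real M)"
  proof (intro sum_mono add_left_mono)
    fix q :: 'd
    let ?c = "(8 ^ CARD('d) * (box_volume (corner n) * (2 / real M)) * b\<^sup>2)\<^sup>2 * (1 / (?s ^ 4 * \<delta> ^ 3))"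
    have "(\<Sum>i\<in>{0..int M}. (\<integral>\<omega>. G q i \<omega> ^ 4 \<partial>P) * (1 / (?s ^ 4 * \<delta> ^ 3))) \<le> (\<Sum>i\<in>{0..int M}. ?c)"
      using \<delta> s by (intro sum_mono mult_right_mono EG) auto
    also have "\<dots> = (real M + 1) * ?c" by simp
    \<comment> \<open>This 2 and the 4 from squaring the relative thickness \<open>2 / M\<close>
      make up the constant 8.\<close>
    also have "\<dots> \<le> (2 * real M) * ?c"
      using M \<delta> s by (intro mult_right_mono mult_nonneg_nonneg) auto
    also have "?c = 64 ^ CARD('d) * (4 / (real M)\<^sup>2) * b ^ 4 / \<delta> ^ 3"
    proof -
      have s4: "?s ^ 4 = (box_volume (corner n))\<^sup>2"
        using v by (simp add: power4_eq_xxxx power2_eq_square mult.assoc[symmetric])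
      have p: "(8 ^ CARD('d))\<^sup>2 = (64 ^ CARD('d) :: real)"
        by (simp add: power2_eq_square power_mult_distrib[symmetric])
      have "(8 ^ CARD('d) * (box_volume (corner n) * (2 / real M)) * b\<^sup>2)\<^sup>2
          = (8 ^ CARD('d))\<^sup>2 * ((box_volume (corner n))\<^sup>2 * (2 / real M)\<^sup>2) * (b\<^sup>2)\<^sup>2"
        by (simp only: power_mult_distrib)
      also have "\<dots> = 64 ^ CARD('d) * ((box_volume (corner n))\<^sup>2 * (4 / (real M)\<^sup>2)) * b ^ 4"
        unfolding p by (simp add: power_divide)
      finally show ?thesis unfolding s4 using v by simp
    qed
    also have "(2 * real M) * (64 ^ CARD('d) * (4 / (real M)\<^sup>2) * b ^ 4 / \<delta> ^ 3) = 8 * 64 ^ CARD('d) * b ^ 4 / \<delta> ^ 3 / real M"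
      using M by (simp add: power2_eq_square divide_simps)
    finally show "(\<Sum>i\<in>{0..int M}. (\<integral>\<omega>. G q i \<omega> ^ 4 \<partial>P) * (1 / (?s ^ 4 * \<delta> ^ 3))) \<le> 8 * 64 ^ CARD('d) * b ^ 4 / \<delta> ^ 3 / real M" .
  qed
  finally have EW: "(\<integral>\<omega>. W \<omega> \<partial>P) \<le> real CARD('d) * (\<delta> + 8 * 64 ^ CARD('d) * b ^ 4 / \<delta> ^ 3 / real M)" by simp
  have "\<bar>field_sum u {1..scaled_floor n t} \<omega> / ?s - field_sum u {1..scaled_floor n (grid_point M (scaled_floor (\<chi> q. M) t))} \<omega> / ?s\<bar> \<le> W \<omega>"
    if t: "t \<in> unit_cube" for \<omega> t
  proof -
    let ?g = "grid_point M (scaled_floor (\<chi> q. M) t)"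
    let ?p = "scaled_floor n t" and ?r = "scaled_floor n ?g"
    let ?i = "\<lambda>q. \<lfloor>real M * t $ q\<rfloor>"
    have kM: "scaled_floor (\<chi> q. M) t \<in> {0..\<chi> q. int M}" using scaled_floor_mem[OF t, of "\<chi> q. M"] by simp
    have g: "?g \<in> unit_cube" by (rule grid_point_mem[OF M kM])
    have iM: "?i q \<in> {0..int M}" for q using kM by (auto simp: scaled_floor_def less_eq_vec_def)
    have rq: "?r $ q = \<rho> q (?i q)" for q by (simp add: scaled_floor_def \<rho>_def grid_point_def)
    have le: "0 \<le> ?r $ q" "?r $ q \<le> ?p $ q" "?p $ q - ?r $ q \<le> l q" for q
    proof -
      show "0 \<le> ?r $ q" using scaled_floor_mem[OF g, of n] by (auto simp: less_eq_vec_def)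
      have "real (n $ q) * ?g $ q \<le> real (n $ q) * t $ q"
        using grid_point_scaled_floor(1)[OF M, of t q] by (intro mult_left_mono) auto
      then show "?r $ q \<le> ?p $ q" by (simp add: scaled_floor_def floor_mono)
      have "real (n $ q) * t $ q \<le> real (n $ q) * (?g $ q + 1 / real M)"
        using grid_point_scaled_floor(2)[OF M, of t q] by (intro mult_left_mono) auto
      also have "\<dots> = real (n $ q) * ?g $ q + real (n $ q) / real M" by (simp add: distrib_left)
      finally have "real (n $ q) * t $ q - real (n $ q) * ?g $ q \<le> real (n $ q) / real M" by simp
      moreover have "1 \<le> real (n $ q) / real M" using n[of q] M by simp
      moreover have "2 * real (n $ q) / real M = real (n $ q) / real M + real (n $ q) / real M" by simp
      ultimately have "of_int (?p $ q - ?r $ q) \<le> 2 * real (n $ q) / real M"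
        unfolding scaled_floor_def by (simp, linarith)
      then show "?p $ q - ?r $ q \<le> l q" unfolding l_def by (simp only: le_floor_iff)
    qed
    have "\<bar>field_sum u {1..?p} \<omega> - field_sum u {1..?r} \<omega>\<bar> \<le> (\<Sum>q\<in>UNIV. G q (?i q) \<omega>)"
    proof (rule vec_telescope[where N = "corner n", OF _ scaled_floor_mem[OF t] scaled_floor_mem[OF g]])
      fix q k assume k: "k \<in> {0..corner n}"
      have "vec_upd k q (?p $ q - ?r $ q) \<in> {0..L q}"
        using k le[of q] by (auto simp: L_def less_eq_vec_def)
      then show "\<bar>field_sum u {1..vec_upd k q (?p $ q)} \<omega> - field_sum u {1..vec_upd k q (?r $ q)} \<omega>\<bar> \<le> G q (?i q) \<omega>"
        unfolding field_sum_slab[OF le(1,2)] unfolding G_def rq[symmetric] by (rule max_field_sum_ge[OF finite_vec_interval])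
    qed
    then have "\<bar>field_sum u {1..?p} \<omega> - field_sum u {1..?r} \<omega>\<bar> / ?s \<le> (\<Sum>q\<in>UNIV. G q (?i q) \<omega>) / ?s"
      using s by (intro divide_right_mono) auto
    also have "\<dots> = (\<Sum>q\<in>UNIV. G q (?i q) \<omega> / ?s)" by (rule sum_divide_distrib)
    also have "\<dots> \<le> W \<omega>"
      unfolding W_def
    proof (rule sum_mono)
      fix q :: 'd
      have "G q (?i q) \<omega> / ?s \<le> \<delta> + (G q (?i q) \<omega> / ?s) ^ 4 / \<delta> ^ 3"
        using G0[of q "?i q" \<omega>] s \<delta> by (intro young_fourth_power) auto
      also have "(G q (?i q) \<omega> / ?s) ^ 4 / \<delta> ^ 3 \<le> (\<Sum>i\<in>{0..int M}. (G q i \<omega> / ?s) ^ 4 / \<delta> ^ 3)"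
        using G0 s \<delta> by (intro member_le_sum[OF iM]) auto
      finally show "G q (?i q) \<omega> / ?s \<le> \<delta> + (\<Sum>i\<in>{0..int M}. (G q i \<omega> / ?s) ^ 4 / \<delta> ^ 3)" by simp
    qed
    finally show ?thesis using s by (simp add: diff_divide_distrib[symmetric])
  qed
  then show ?thesis using iW EW by blast
qed

lemma max_field_sum_diff:
  assumes n: "0 \<le> n" and "p \<in> {0..n}" "r \<in> {0..n}"
  shows "\<bar>field_sum g {1..p} \<omega> - field_sum g {1..r} \<omega>\<bar> \<le> 2 * max_field_sum g {0..n} \<omega>"
  using max_field_sum_ge[OF finite_vec_interval assms(2), of g \<omega>] max_field_sum_ge[OF finite_vec_interval assms(3), of g \<omega>]
  by linarith

text \<open>\<open>f\<close> is split into a small remainder, finitely many small differences and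
  finitely many bounded ones. Slabs are used for the bounded ones; the other two kinds are bounded
  by twice their maxima over the whole box.\<close>

lemma field_tight:
  fixes f :: "(int ^ 'd::finite \<Rightarrow> real) \<Rightarrow> real"
  assumes f: "square_integrable P f" and mean: "(\<integral>\<omega>. f \<omega> \<partial>P) = 0"
    and sm: "(\<lambda>i. L2_norm P (proj \<mu> 0 (f \<circ> shift i))) summable_on UNIV" and \<epsilon>: "0 < \<epsilon>"
  shows "\<forall>\<^sub>F m in sequentially. \<forall>\<^sub>F n in all_coords_at_top. \<exists>W. integrable P W \<and> (\<integral>\<omega>. W \<omega> \<partial>P) \<le> \<epsilon> \<and>
    (\<forall>\<omega>. \<forall>t\<in>unit_cube. \<bar>field_sum f {1..scaled_floor n t} \<omega> / sqrt (box_volume (corner n))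
      - field_sum f {1..scaled_floor n (grid_point (Suc m) (scaled_floor (\<chi> q. Suc m) t))} \<omega> / sqrt (box_volume (corner n))\<bar> \<le> W \<omega>)"
proof -
  interpret prob_space "P :: (int ^ 'd \<Rightarrow> real) measure" by (rule prob_space_P)
  let ?k = "2 ^ CARD('d) :: real"
  \<comment> \<open>The remainder and the small differences cost
    \<open>2 * 2 ^ CARD('d) * \<epsilon>0\<close> each, which is
    \<open>\<epsilon> / 4\<close>.\<close>
  define \<epsilon>0 where "\<epsilon>0 = \<epsilon> / (8 * ?k)"
  have \<epsilon>0: "0 < \<epsilon>0" using \<epsilon> by (simp add: \<epsilon>0_def)
  obtain J where J: "finite J" "\<And>K. finite K \<Longrightarrow> K \<inter> J = {} \<Longrightarrow> (\<Sum>j\<in>K. L2_norm P (hannan_diff f j)) \<le> \<epsilon>0"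
    by (rule summable_on_tail[OF _ hannan_summable[OF f sm] \<epsilon>0]) auto
  define \<eta> where "\<eta> = \<epsilon>0 / (real (card J) + 1)"
  have \<eta>: "0 < \<eta>" "real (card J) * \<eta> \<le> \<epsilon>0" using \<epsilon>0 by (auto simp: \<eta>_def field_simps)
  have "\<forall>j. \<exists>u. orthodiff u \<and> (\<exists>b. \<forall>\<omega>. \<bar>u \<omega>\<bar> \<le> b) \<and> L2_norm P (\<lambda>\<omega>. hannan_diff f j \<omega> - u \<omega>) < \<eta>"
  proof
    fix j
    obtain u where u: "orthodiff u" "cylindrical u" "L2_norm P (\<lambda>\<omega>. hannan_diff f j \<omega> - u \<omega>) < \<eta>"
      by (rule orthodiff_approx[OF orthodiff_hannan_diff[OF f] \<eta>(1)]) blast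
    moreover obtain b where "\<forall>\<omega>. \<bar>u \<omega>\<bar> \<le> b" by (rule cylindricalE[OF u(2)]) blast
    ultimately show "\<exists>u. orthodiff u \<and> (\<exists>b. \<forall>\<omega>. \<bar>u \<omega>\<bar> \<le> b) \<and> L2_norm P (\<lambda>\<omega>. hannan_diff f j \<omega> - u \<omega>) < \<eta>"
      by (intro exI[of _ u] conjI exI[of _ b])
  qed
  from choice[OF this] obtain u where u: "\<forall>j. orthodiff (u j) \<and> (\<exists>b. \<forall>\<omega>. \<bar>u j \<omega>\<bar> \<le> b) \<and> L2_norm P (\<lambda>\<omega>. hannan_diff f j \<omega> - u j \<omega>) < \<eta>" ..
  have uo: "orthodiff (u j)" and ub: "\<exists>b. \<forall>\<omega>. \<bar>u j \<omega>\<bar> \<le> b" and un: "L2_norm P (\<lambda>\<omega>. hannan_diff f j \<omega> - u j \<omega>) < \<eta>" for j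
    using u[rule_format, of j] by auto
  from ub have "\<forall>j. \<exists>b. \<forall>\<omega>. \<bar>u j \<omega>\<bar> \<le> b" by blast
  from choice[OF this] obtain b where "\<forall>j \<omega>. \<bar>u j \<omega>\<bar> \<le> b j" ..
  then have b: "\<And>j \<omega>. \<bar>u j \<omega>\<bar> \<le> b j" by blast
  \<comment> \<open>Makes the part of the slab bound that does not vanish as \<open>m\<close> grows
    less than \<open>\<epsilon> / 2\<close> after summation over \<open>J\<close>.\<close>
  define \<delta> where "\<delta> = \<epsilon> / (4 * (real (card J) + 1) * real CARD('d))"
  have \<delta>: "0 < \<delta>" using \<epsilon> by (simp add: \<delta>_def)
  have d\<delta>: "real CARD('d) * \<delta> = \<epsilon> / (4 * (real (card J) + 1))" by (simp add: \<delta>_def)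
  have J\<delta>: "(\<Sum>j\<in>J. real CARD('d) * (\<delta> + 0)) < \<epsilon> / 2"
  proof -
    have "(\<Sum>j\<in>J. real CARD('d) * (\<delta> + 0)) = real (card J) * (\<epsilon> / (4 * (real (card J) + 1)))"
      using d\<delta> by simp
    also have "\<dots> < \<epsilon> / 2"
    proof -
      have "0 \<le> \<epsilon> * real (card J)" using \<epsilon> by simp
      then show ?thesis using \<epsilon> by (simp add: divide_simps)
    qed
    finally show ?thesis .
  qed
  let ?c = "\<lambda>j. 8 * 64 ^ CARD('d) * b j ^ 4 / \<delta> ^ 3"
  have "(\<lambda>m. ?c j / real (Suc m)) \<longlonglongrightarrow> 0" for j
    by (rule tendsto_divide_0[OF tendsto_const filterlim_at_top_imp_at_infinity])
      (rule filterlim_compose[OF filterlim_real_sequentially filterlim_Suc])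
  then have "(\<lambda>m. \<Sum>j\<in>J. real CARD('d) * (\<delta> + ?c j / real (Suc m))) \<longlonglongrightarrow> (\<Sum>j\<in>J. real CARD('d) * (\<delta> + 0))"
    by (intro tendsto_intros)
  from order_tendstoD(2)[OF this J\<delta>] show ?thesis
  proof eventually_elim
    case (elim m)
    show ?case using eventually_coordinates_ge[of "Suc m"] eventually_box_volume_pos
    proof eventually_elim
      case (elim n)
      let ?s = "sqrt (box_volume (corner n))"
      have s: "0 < ?s" using elim(2) by simp
      have n0: "(0 :: int ^ 'd) \<le> corner n" by (rule corner_nonneg)
      have ne: "finite {0..corner n}" "{0..corner n} \<noteq> {}" using n0 by auto
      have "\<forall>j. \<exists>W. integrable P W \<and> (\<integral>\<omega>. W \<omega> \<partial>P) \<le> real CARD('d) * (\<delta> + ?c j / real (Suc m)) \<and>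
        (\<forall>\<omega>. \<forall>t\<in>unit_cube. \<bar>field_sum (u j) {1..scaled_floor n t} \<omega> / ?s
          - field_sum (u j) {1..scaled_floor n (grid_point (Suc m) (scaled_floor (\<chi> q. Suc m) t))} \<omega> / ?s\<bar> \<le> W \<omega>)"
        by (rule allI, rule slab_modulus[OF uo b \<delta> zero_less_Suc]) (rule elim(1)[rule_format])
      from choice[OF this] obtain W where "\<forall>j. integrable P (W j) \<and> (\<integral>\<omega>. W j \<omega> \<partial>P) \<le> real CARD('d) * (\<delta> + ?c j / real (Suc m)) \<and>
        (\<forall>\<omega>. \<forall>t\<in>unit_cube. \<bar>field_sum (u j) {1..scaled_floor n t} \<omega> / ?s
          - field_sum (u j) {1..scaled_floor n (grid_point (Suc m) (scaled_floor (\<chi> q. Suc m) t))} \<omega> / ?s\<bar> \<le> W j \<omega>)" ..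
      then have W: "\<And>j. integrable P (W j)" "\<And>j. (\<integral>\<omega>. W j \<omega> \<partial>P) \<le> real CARD('d) * (\<delta> + ?c j / real (Suc m))"
        "\<And>j \<omega> t. t \<in> unit_cube \<Longrightarrow> \<bar>field_sum (u j) {1..scaled_floor n t} \<omega> / ?s
          - field_sum (u j) {1..scaled_floor n (grid_point (Suc m) (scaled_floor (\<chi> q. Suc m) t))} \<omega> / ?s\<bar> \<le> W j \<omega>"
        by auto
      let ?h = "\<lambda>\<omega>. f \<omega> - (\<Sum>j\<in>J. hannan_diff f j (shift j \<omega>))"
      let ?w = "\<lambda>j \<omega>. hannan_diff f j \<omega> - u j \<omega>"
      let ?mh = "max_field_sum ?h {0..corner n}" and ?mw = "\<lambda>j. max_field_sum (?w j) {0..corner n}"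
      \<comment> \<open>The terms with index \<open>j\<close> are evaluated at the shifted
        configuration because \<open>hannan_diff f j\<close> enters the decomposition of
        \<open>f\<close> after the shift by \<open>j\<close>; the shift does not change
        means.\<close>
      define X where "X \<omega> = 2 / ?s * ?mh \<omega> + (\<Sum>j\<in>J. 2 / ?s * ?mw j (shift j \<omega>) + W j (shift j \<omega>))" for \<omega>
      have sh: "square_integrable P ?h"
        by (intro square_integrable_diff f square_integrable_sum square_integrable_shift square_integrable_hannan_diff)
      have ow: "orthodiff (?w j)" for j by (rule orthodiff_diff[OF orthodiff_hannan_diff[OF f] uo])
      have smh: "square_integrable P ?mh" by (rule square_integrable_max_field_sum[OF sh ne])
      have smw: "square_integrable P (?mw j)" for j
        by (rule square_integrable_max_field_sum[OF orthodiff_square_integrable[OF ow] ne])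
      have imh: "integrable P ?mh" by (rule square_integrable_imp_integrable_P[OF smh])
      have imw: "integrable P (\<lambda>\<omega>. ?mw j (shift j \<omega>))" for j
        by (rule square_integrable_imp_integrable_P[OF square_integrable_shift[OF smw]])
      have iWs: "integrable P (\<lambda>\<omega>. W j (shift j \<omega>))" for j
      proof -
        have "integrable (distr P P (shift j)) (W j)" unfolding distr_shift by (rule W(1))
        then show ?thesis by (rule integrable_distr[OF measurable_shift])
      qed
      have Emh: "(\<integral>\<omega>. ?mh \<omega> \<partial>P) \<le> ?k * ?s * \<epsilon>0"
        using expectation_le_L2[OF smh] hannan_remainder[OF f mean J n0] by linarith
      have Emw: "(\<integral>\<omega>. ?mw j (shift j \<omega>) \<partial>P) \<le> ?k * ?s * \<eta>" for j
      proof -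
        have "(\<integral>\<omega>. ?mw j (shift j \<omega>) \<partial>P) = (\<integral>\<omega>. ?mw j \<omega> \<partial>P)"
          by (rule integral_shift[OF square_integrable_measurable[OF smw]])
        also have "\<dots> \<le> L2_norm P (?mw j)" using expectation_le_L2[OF smw[of j]] by linarith
        also have "\<dots> \<le> ?k * ?s * L2_norm P (?w j)" by (rule maximal_inequality_L2[OF ow n0])
        also have "\<dots> \<le> ?k * ?s * \<eta>" using un[of j] s by (intro mult_left_mono) auto
        finally show ?thesis .
      qed
      have EWs: "(\<integral>\<omega>. W j (shift j \<omega>) \<partial>P) \<le> real CARD('d) * (\<delta> + ?c j / real (Suc m))" for j
        using integral_shift[of "W j" j] borel_measurable_integrable[OF W(1)[of j]] W(2)[of j] by simp
      have "integrable P X"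
        unfolding X_def[abs_def]
        by (intro Bochner_Integration.integrable_add Bochner_Integration.integrable_sum integrable_mult_right imh imw iWs)
      moreover have "(\<integral>\<omega>. X \<omega> \<partial>P) \<le> \<epsilon>"
      proof -
        have "(\<integral>\<omega>. X \<omega> \<partial>P) = 2 / ?s * (\<integral>\<omega>. ?mh \<omega> \<partial>P) + (\<Sum>j\<in>J. 2 / ?s * (\<integral>\<omega>. ?mw j (shift j \<omega>) \<partial>P) + (\<integral>\<omega>. W j (shift j \<omega>) \<partial>P))"
          unfolding X_def using imh imw iWs by simp
        also have "\<dots> \<le> 2 / ?s * (?k * ?s * \<epsilon>0) + (\<Sum>j\<in>J. 2 / ?s * (?k * ?s * \<eta>) + real CARD('d) * (\<delta> + ?c j / real (Suc m)))"
          using s by (intro add_mono sum_mono mult_left_mono Emh Emw EWs) auto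
        also have "\<dots> = 2 * ?k * \<epsilon>0 + 2 * ?k * (real (card J) * \<eta>) + (\<Sum>j\<in>J. real CARD('d) * (\<delta> + ?c j / real (Suc m)))"
          using s by (simp add: sum.distrib)
        also have "\<dots> \<le> 2 * ?k * \<epsilon>0 + 2 * ?k * \<epsilon>0 + \<epsilon> / 2"
          using \<eta>(2) \<open>(\<Sum>j\<in>J. real CARD('d) * (\<delta> + ?c j / real (Suc m))) < \<epsilon> / 2\<close>
          by (intro add_mono mult_left_mono) auto
        also have "\<dots> = \<epsilon>" by (simp add: \<epsilon>0_def)
        finally show ?thesis .
      qed
      moreover have "\<bar>field_sum f {1..scaled_floor n t} \<omega> / ?s
          - field_sum f {1..scaled_floor n (grid_point (Suc m) (scaled_floor (\<chi> q. Suc m) t))} \<omega> / ?s\<bar> \<le> X \<omega>" if t: "t \<in> unit_cube" for \<omega> t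
      proof -
        let ?p = "scaled_floor n t" and ?r = "scaled_floor n (grid_point (Suc m) (scaled_floor (\<chi> q. Suc m) t))"
        let ?D = "\<lambda>g \<omega>. field_sum g {1..?p} \<omega> / ?s - field_sum g {1..?r} \<omega> / ?s"
        have p: "?p \<in> {0..corner n}" by (rule scaled_floor_mem[OF t])
        have "scaled_floor (\<chi> q. Suc m) t \<in> {0..\<chi> q. int (Suc m)}"
          using scaled_floor_mem[OF t, of "\<chi> q. Suc m"] by (simp del: of_nat_Suc)
        then have r: "?r \<in> {0..corner n}" by (intro scaled_floor_mem grid_point_mem) auto
        have dec: "field_sum f A \<omega> = field_sum ?h A \<omega> + (\<Sum>j\<in>J. field_sum (?w j) A (shift j \<omega>) + field_sum (u j) A (shift j \<omega>))" for A
        proof -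
          have "field_sum ?h A \<omega> = field_sum f A \<omega> - (\<Sum>j\<in>J. field_sum (hannan_diff f j) A (shift j \<omega>))"
            unfolding field_sum_shift[symmetric] unfolding field_sum_def sum_subtractf by (subst sum.swap) simp
          moreover have "field_sum (?w j) A \<omega>' + field_sum (u j) A \<omega>' = field_sum (hannan_diff f j) A \<omega>'" for j \<omega>'
            by (simp add: field_sum_def sum_subtractf)
          ultimately show ?thesis by simp
        qed
        have alg: "(H + (\<Sum>j\<in>J. w j + v j)) / c - (H' + (\<Sum>j\<in>J. w' j + v' j)) / c
            = (H / c - H' / c) + (\<Sum>j\<in>J. (w j / c - w' j / c) + (v j / c - v' j / c))" for H H' c :: real and w w' v v'
          by (simp add: add_divide_distrib sum_divide_distrib sum.distrib sum_subtractf)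
        have eq: "?D f \<omega> = ?D ?h \<omega> + (\<Sum>j\<in>J. ?D (?w j) (shift j \<omega>) + ?D (u j) (shift j \<omega>))"
          unfolding dec by (rule alg)
        have tri: "\<bar>H + (\<Sum>j\<in>J. w j + v j)\<bar> \<le> \<bar>H\<bar> + (\<Sum>j\<in>J. \<bar>w j\<bar> + \<bar>v j\<bar>)" for H :: real and w v
          by (rule order_trans[OF abs_triangle_ineq], rule add_left_mono, rule order_trans[OF sum_abs], rule sum_mono, rule abs_triangle_ineq)
        have D: "\<bar>?D g \<omega>'\<bar> \<le> 2 / ?s * max_field_sum g {0..corner n} \<omega>'" for g \<omega>'
        proof -
          have "\<bar>?D g \<omega>'\<bar> = \<bar>field_sum g {1..?p} \<omega>' - field_sum g {1..?r} \<omega>'\<bar> / ?s"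
            using s by (simp add: diff_divide_distrib[symmetric])
          also have "\<dots> \<le> (2 * max_field_sum g {0..corner n} \<omega>') / ?s"
            using s by (intro divide_right_mono max_field_sum_diff[OF n0 p r]) auto
          finally show ?thesis by simp
        qed
        show ?thesis unfolding eq X_def
          by (rule order_trans[OF tri], intro add_mono sum_mono D W(3)[OF t])
      qed
      ultimately show ?case by blast
    qed
  qed
qed

end

context real_iid
begin

section \<open>Uniform second moments and assembly of the invariance principle\<close>

text \<open>\<open>hannan_remainder\<close> with the empty set \<open>J\<close> bounds the maximum
  by the whole Hannan sum.\<close>

lemma field_sum_second_moment:
  fixes f :: "(int ^ 'd::finite \<Rightarrow> real) \<Rightarrow> real"
  assumes f: "square_integrable P f" and mean: "(\<integral>\<omega>. f \<omega> \<partial>P) = 0"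
    and sm: "(\<lambda>i. L2_norm P (proj \<mu> 0 (f \<circ> shift i))) summable_on UNIV"
  obtains C where "0 \<le> C" "\<And>n k. k \<in> {0..corner n} \<Longrightarrow> (\<integral>\<omega>. (field_sum f {1..k} \<omega> / sqrt (box_volume (corner n)))\<^sup>2 \<partial>P) \<le> C"
proof -
  define C where "C = infsum (\<lambda>j. L2_norm P (hannan_diff f j)) UNIV"
  have C: "(\<Sum>j\<in>K. L2_norm P (hannan_diff f j)) \<le> C" if "finite K" for K
    unfolding C_def by (rule finite_sum_le_infsum[OF hannan_summable[OF f sm] that]) auto
  have "(\<integral>\<omega>. (field_sum f {1..k} \<omega> / sqrt (box_volume (corner n)))\<^sup>2 \<partial>P) \<le> (2 ^ CARD('d) * C)\<^sup>2"
    if k: "k \<in> {0..corner n}" for n k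
  proof -
    let ?v = "box_volume (corner n)"
    have v: "0 \<le> ?v" by (rule box_volume_nonneg[OF corner_nonneg])
    have ne: "finite {0..corner n}" "{0..corner n} \<noteq> {}" using corner_nonneg[of n] by auto
    have "L2_norm P (field_sum f {1..k}) \<le> L2_norm P (max_field_sum f {0..corner n})"
    proof (rule L2_norm_mono[OF square_integrable_max_field_sum[OF f ne]], rule AE_I2)
      fix \<omega> show "\<bar>field_sum f {1..k} \<omega>\<bar> \<le> \<bar>max_field_sum f {0..corner n} \<omega>\<bar>"
        using max_field_sum_ge[OF ne(1) k, of f \<omega>] by linarith
    qed
    also have "\<dots> \<le> 2 ^ CARD('d) * sqrt ?v * C"
      using hannan_remainder[OF f mean finite.emptyI _ corner_nonneg, of C n] C by simp
    finally have "(L2_norm P (field_sum f {1..k}))\<^sup>2 \<le> (2 ^ CARD('d) * sqrt ?v * C)\<^sup>2"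
      by (rule power_mono) simp
    also have "\<dots> = (2 ^ CARD('d) * C)\<^sup>2 * ?v"
      using v by (simp add: power_mult_distrib)
    finally have le: "(L2_norm P (field_sum f {1..k}))\<^sup>2 \<le> (2 ^ CARD('d) * C)\<^sup>2 * ?v" .
    have "(\<integral>\<omega>. (field_sum f {1..k} \<omega> / sqrt ?v)\<^sup>2 \<partial>P) = (L2_norm P (field_sum f {1..k}))\<^sup>2 / ?v"
      using v by (simp add: L2_norm_power2 power_divide)
    also have "\<dots> \<le> (2 ^ CARD('d) * C)\<^sup>2"
    \<comment> \<open>If some side of the box is 0, the normalized sum is 0 by the convention for
      division by zero.\<close>
    proof (cases "?v = 0")
      case False
      then have "0 < ?v" using v by linarith
      then show ?thesis using le by (simp add: pos_divide_le_eq)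
    qed simp
    finally show ?thesis .
  qed
  then show ?thesis by (intro that[of "(2 ^ CARD('d) * C)\<^sup>2"]) auto
qed

lemma invariance_principle:
  fixes f :: "(int ^ 'd::finite \<Rightarrow> real) \<Rightarrow> real" and B :: "real ^ 'd \<Rightarrow> 'b \<Rightarrow> real"
  assumes f: "square_integrable P f" and mean: "(\<integral>\<omega>. f \<omega> \<partial>P) = 0"
    and sm: "(\<lambda>i. L2_norm P (proj \<mu> 0 (f \<circ> shift i))) summable_on UNIV"
    and D: "has_L2_sum P (\<lambda>i. proj \<mu> 0 (f \<circ> shift i)) D"
    and \<sigma>: "\<sigma>\<^sup>2 = (\<integral>\<omega>. (D \<omega>)\<^sup>2 \<partial>P)" and B: "standard_brownian_sheet N B"
  shows "converges_in_distribution skorohod_topology P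
    (\<lambda>n \<omega>. step n (\<lambda>k. field_sum f {1..k} \<omega> / sqrt (box_volume (corner n))))
    N (\<lambda>\<omega>. \<lambda>t\<in>unit_cube. \<sigma> * B t \<omega>) all_coords_at_top"
proof -
  obtain C where C: "0 \<le> C" "\<And>n k. k \<in> {0..corner n} \<Longrightarrow> (\<integral>\<omega>. (field_sum f {1..k} \<omega> / sqrt (box_volume (corner n)))\<^sup>2 \<partial>P) \<le> C"
    by (rule field_sum_second_moment[OF f mean sm]) blast
  show ?thesis
  proof (rule skorohod_convergence_criterion[where C = "C + \<sigma>\<^sup>2"])
    show "prob_space (P :: (int ^ 'd \<Rightarrow> real) measure)" by (rule prob_space_P)
    show "prob_space N" using B by (simp add: standard_brownian_sheet_def)
    show "square_integrable P (\<lambda>\<omega>. field_sum f {1..k} \<omega> / sqrt (box_volume (corner n)))" for n k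
      using square_integrable_cmult[OF square_integrable_field_sum[OF f, of "{1..k}"], of "1 / sqrt (box_volume (corner n))"] by simp
    show "(\<integral>\<omega>. (field_sum f {1..k} \<omega> / sqrt (box_volume (corner n)))\<^sup>2 \<partial>P) \<le> C + \<sigma>\<^sup>2" if "k \<in> {0..corner n}" for n k
      using C(2)[OF that] by (simp add: add_increasing2)
    show "square_integrable N (\<lambda>\<omega>. \<sigma> * B t \<omega>)" if "t \<in> unit_cube" for t
      by (rule square_integrable_cmult[OF brownian_sheet_square_integrable[OF B that]])
    show "(\<integral>\<omega>. (\<sigma> * B t \<omega>)\<^sup>2 \<partial>N) \<le> C + \<sigma>\<^sup>2" if t: "t \<in> unit_cube" for t
    proof -
      have "\<forall>s\<in>unit_cube. \<forall>t\<in>unit_cube. (\<integral>\<omega>. B s \<omega> * B t \<omega> \<partial>N) = (\<Prod>q\<in>UNIV. min (s $ q) (t $ q))"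
        using B by (simp add: standard_brownian_sheet_def)
      then have "(\<integral>\<omega>. B t \<omega> * B t \<omega> \<partial>N) = (\<Prod>q\<in>UNIV. t $ q)" using t by simp
      also have "\<dots> \<le> 1" using t by (intro prod_le_1) (auto simp: mem_unit_cube)
      finally have "\<sigma>\<^sup>2 * (\<integral>\<omega>. B t \<omega> * B t \<omega> \<partial>N) \<le> \<sigma>\<^sup>2" by (rule mult_left_le) simp
      moreover have "(\<integral>\<omega>. (\<sigma> * B t \<omega>)\<^sup>2 \<partial>N) = \<sigma>\<^sup>2 * (\<integral>\<omega>. B t \<omega> * B t \<omega> \<partial>N)"
        by (simp add: power_mult_distrib power2_eq_square[of "B t _"])
      ultimately show ?thesis using C(1) by linarith
    qed
    show "continuous_on unit_cube (\<lambda>t. \<sigma> * B t \<omega>)" if "\<omega> \<in> space N" for \<omega>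
      using B that by (intro continuous_on_mult_left) (simp add: standard_brownian_sheet_def)
    show "\<forall>\<^sub>F m in sequentially. \<forall>\<^sub>F n in all_coords_at_top. \<exists>W. integrable P W \<and> (\<integral>\<omega>. W \<omega> \<partial>P) \<le> \<epsilon> \<and>
      (\<forall>\<omega>\<in>space P. \<forall>t\<in>unit_cube.
        \<bar>field_sum f {1..scaled_floor n t} \<omega> / sqrt (box_volume (corner n))
        - field_sum f {1..scaled_floor n (grid_point (Suc m) (scaled_floor (\<chi> q. Suc m) t))} \<omega> / sqrt (box_volume (corner n))\<bar> \<le> W \<omega>)"
      if "0 < \<epsilon>" for \<epsilon>
      using field_tight[OF f mean sm that] by simp
    show "((\<lambda>n. \<integral>\<omega>. cos ((\<Sum>k\<in>{0..\<chi> q. int m}. \<theta> k *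
          (field_sum f {1..scaled_floor n (grid_point m k)} \<omega> / sqrt (box_volume (corner n)))) + s) \<partial>P)
        \<longlongrightarrow> (\<integral>\<omega>. cos ((\<Sum>k\<in>{0..\<chi> q. int m}. \<theta> k * (\<sigma> * B (grid_point m k) \<omega>)) + s) \<partial>N)) all_coords_at_top"
      if m: "0 < m" for m s and \<theta> :: "int ^ 'd \<Rightarrow> real"
    proof -
      let ?I = "{0..\<chi> q. int m} :: (int ^ 'd) set"
      \<comment> \<open>\<open>field_fdd\<close> states its conditions for every index, so indices
        off the grid are sent to the point 0 of the cube.\<close>
      define p where "p k = (if k \<in> ?I then grid_point m k else 0)" for k
      have p: "p k \<in> unit_cube" for k
        unfolding p_def by (cases "k \<in> ?I") (simp_all add: grid_point_mem[OF m] zero_in_unit_cube del: atLeastAtMost_iff)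
      have r: "\<bar>real_of_int (scaled_floor n (p k) $ q) - real (n $ q) * p k $ q\<bar> \<le> 1" for k n q
        unfolding scaled_floor_def by (simp, linarith)
      have p0: "0 \<le> p k $ q" for k q using p[of k] by (simp add: mem_unit_cube)
      have lim: "((\<lambda>n. \<integral>\<omega>. cos ((\<Sum>k\<in>?I. \<theta> k * (field_sum f {1..scaled_floor n (p k)} \<omega> / sqrt (box_volume (corner n)))) + s) \<partial>P)
        \<longlongrightarrow> cos s * exp (- ((L2_norm P D)\<^sup>2 * (\<Sum>k\<in>?I. \<Sum>l\<in>?I. \<theta> k * \<theta> l * (\<Prod>q\<in>UNIV. min (p k $ q) (p l $ q)))) / 2)) all_coords_at_top"
        by (rule field_fdd[OF f mean sm D finite_vec_interval p0 r scaled_floor_mem[OF p]])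
      have "(\<integral>\<omega>. cos ((\<Sum>k\<in>?I. (\<theta> k * \<sigma>) * B (grid_point m k) \<omega>) + s) \<partial>N) =
          cos s * exp (- (\<Sum>k\<in>?I. \<Sum>l\<in>?I. (\<theta> k * \<sigma>) * (\<theta> l * \<sigma>) * (\<Prod>q\<in>UNIV. min (grid_point m k $ q) (grid_point m l $ q))) / 2)"
        by (rule brownian_sheet_cos[OF B finite_vec_interval inj_on_grid_point[OF m] grid_point_mem[OF m]])
      also have "(\<Sum>k\<in>?I. \<Sum>l\<in>?I. (\<theta> k * \<sigma>) * (\<theta> l * \<sigma>) * (\<Prod>q\<in>UNIV. min (grid_point m k $ q) (grid_point m l $ q)))
          = (L2_norm P D)\<^sup>2 * (\<Sum>k\<in>?I. \<Sum>l\<in>?I. \<theta> k * \<theta> l * (\<Prod>q\<in>UNIV. min (p k $ q) (p l $ q)))"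
        unfolding L2_norm_power2 \<sigma>[symmetric] sum_distrib_left
        by (intro sum.cong refl) (simp add: p_def power2_eq_square mult_ac del: atLeastAtMost_iff)
      finally have "(\<integral>\<omega>. cos ((\<Sum>k\<in>?I. \<theta> k * (\<sigma> * B (grid_point m k) \<omega>)) + s) \<partial>N)
          = cos s * exp (- ((L2_norm P D)\<^sup>2 * (\<Sum>k\<in>?I. \<Sum>l\<in>?I. \<theta> k * \<theta> l * (\<Prod>q\<in>UNIV. min (p k $ q) (p l $ q)))) / 2)"
        by (simp only: mult.assoc)
      moreover have "(\<Sum>k\<in>?I. \<theta> k * (field_sum f {1..scaled_floor n (p k)} \<omega> / sqrt (box_volume (corner n))))
          = (\<Sum>k\<in>?I. \<theta> k * (field_sum f {1..scaled_floor n (grid_point m k)} \<omega> / sqrt (box_volume (corner n))))" for n \<omega>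
        by (rule sum.cong[OF refl]) (simp add: p_def del: atLeastAtMost_iff)
      ultimately show ?thesis using lim by simp
    qed
  qed
qed

end

theorem theorem5p1:
  fixes \<mu> :: "real measure"
    and f :: "(int ^ 'd::finite \<Rightarrow> real) \<Rightarrow> real"
  assumes "real_distribution \<mu>"
    and "square_integrable (field_measure \<mu>) f"
    and "(\<integral>\<omega>. f \<omega> \<partial>field_measure \<mu>) = 0"
    and Hannan: "(\<lambda>i. L2_norm (field_measure \<mu>) (proj \<mu> 0 (f \<circ> shift i))) summable_on UNIV"
  shows "(\<exists>D0. has_L2_sum (field_measure \<mu>) (\<lambda>i. proj \<mu> 0 (f \<circ> shift i)) D0) \<and>
    (\<forall>D0 \<sigma> N (B :: real ^ 'd \<Rightarrow> 'b \<Rightarrow> real).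
       has_L2_sum (field_measure \<mu>) (\<lambda>i. proj \<mu> 0 (f \<circ> shift i)) D0 \<and>
       \<sigma>\<^sup>2 = (\<integral>\<omega>. (D0 \<omega>)\<^sup>2 \<partial>field_measure \<mu>) \<and>
       standard_brownian_sheet N B \<longrightarrow>
       converges_in_distribution skorohod_topology
         (field_measure \<mu>)
         (\<lambda>n \<omega>. \<lambda>t\<in>unit_cube.
            partial_sum f (scaled_floor n t) \<omega> / sqrt (real (\<Prod>q\<in>UNIV. n $ q)))
         N (\<lambda>\<omega>. \<lambda>t\<in>unit_cube. \<sigma> * B t \<omega>)
         all_coords_at_top)"
proof -
  interpret real_iid \<mu> by (rule real_iid.intro) fact
  have fm: "(field_measure \<mu> :: (int ^ 'd \<Rightarrow> real) measure) = P" by (rule field_measure_def)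
  note hyp = assms(2-4)[unfolded fm]
  have eq: "(\<lambda>t\<in>unit_cube. partial_sum f (scaled_floor n t) \<omega> / sqrt (real (\<Prod>q\<in>UNIV. n $ q)))
      = step n (\<lambda>k. field_sum f {1..k} \<omega> / sqrt (box_volume (corner n)))" for n \<omega>
    by (simp add: step_def partial_sum_def field_sum_def box_volume_corner)
  show ?thesis
    unfolding fm eq
  proof (intro conjI allI impI)
    show "\<exists>D0. has_L2_sum P (\<lambda>i. proj \<mu> 0 (f \<circ> shift i)) D0"
      by (rule has_L2_sum_summable[OF square_integrable_proj_shift[OF hyp(1)] hyp(3)])
    fix D0 \<sigma> and N :: "'b measure" and B :: "real ^ 'd \<Rightarrow> 'b \<Rightarrow> real"
    assume a: "has_L2_sum P (\<lambda>i. proj \<mu> 0 (f \<circ> shift i)) D0 \<and> \<sigma>\<^sup>2 = (\<integral>\<omega>. (D0 \<omega>)\<^sup>2 \<partial>P) \<and> standard_brownian_sheet N B"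
    show "converges_in_distribution skorohod_topology P
        (\<lambda>n \<omega>. step n (\<lambda>k. field_sum f {1..k} \<omega> / sqrt (box_volume (corner n))))
        N (\<lambda>\<omega>. \<lambda>t\<in>unit_cube. \<sigma> * B t \<omega>) all_coords_at_top"
      by (rule invariance_principle[OF hyp(1,2,3)]) (use a in auto)
  qed
qed

end
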